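(* Let $n\ge 1$ and let $k\ge 0$ be a fixed integer. In degrees $j=0,\dots,2n-1$ the boundary complex $\Gamma(U,\mathcal V_j)/\mathcal J_j(U)$ of the $k$-Cauchy-Fueter complex is the differential complex $$0\to\Gamma(bD,\mathscr V_0)\xrightarrow{\mathscr D_0}\cdots\to\Gamma(bD,\mathscr V_j)\xrightarrow{\mathscr D_j}\Gamma(bD,\mathscr V_{j+1})\to\cdots\xrightarrow{\mathscr D_{2n-2}}\Gamma(bD,\mathscr V_{2n-1})\to 0 .$$ That is, there are linear isomorphisms $\Gamma(U,\mathcal V_j)/\mathcal J_j(U)\cong\Gamma(bD\cap U,\mathscr V_j)$ ($0\le j\le 2n-1$) under which the maps induced by $\mathcal D_j$ ($0\le j\le 2n-2$) become differential operators $\mathscr D_j$. Here $\mathscr V_j=\mathscr V_j^{(1)}\oplus\mathscr V_j^{(2)}$ with $$\mathscr V_j^{(1)}=\odot^{\sigma_j}\mathbb C^2\otimes\wedge^{\tau_j}\mathbb C^{2n},\quad \mathscr V_j^{(2)}=\odot^{\sigma_{j+1}}\mathbb C^2\otimes\wedge^{\tau_j-1}\mathbb C^{2n}\quad (j\ne k),\qquad \mathscr V_k^{(1)}=\mathscr V_k^{(2)}=\wedge^{k}\mathbb C^{2n},$$ (so $\mathscr V_0^{(2)}=0$ if $k\ge1$). For $\mathbb F=(\mathbb F_1,\mathbb F_2)\in\Gamma(bD,\mathscr V_j^{(1)})\oplus\Gamma(bD,\mathscr V_j^{(2)})$ one has $\mathscr D_j\mathbb F=(\mathscr D_j^{(1)}\mathbb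 F,\mathscr D_j^{(2)}\mathbb F)$ with $$\mathscr D_j^{(1)}\mathbb F=\begin{cases}\partial_{A'}\mathfrak d^{A'}\mathbb F_1+\mathcal E_0\wedge\mathbb F_2, & j=0,\dots,k-1,\\ \mathfrak d^{0'}\mathfrak d^{1'}\mathbb F_1-\mathcal E_0\wedge(\mathbf T^{1'0'}\mathbb F_1+\mathbb F_2), & j=k,\\ s_{A'}\mathfrak d^{A'}\mathbb F_1+\mathcal E_0\wedge\mathbb F_2, & j=k+1,\dots,2n-2.\end{cases}$$
   Context: Indices: $\dot A\in\{0,\dots,2n+1\}$, $A,B\in\{0,\dots,2n-1\}$, $A',B',\dots\in\{0',1'\}$; $o(0')=0$, $o(1')=1$; repeated indices are summed. Primed indices are raised by $f^{0'}=f_{1'}$, $f^{1'}=-f_{0'}$ (and lowered by the inverse rule); $\varepsilon_{0'1'}=1=-\varepsilon_{1'0'}$, $\varepsilon_{0'0'}=\varepsilon_{1'1'}=0$. $\wedge^\tau=0$ for $\tau<0$. $k$-Cauchy-Fueter complex. Identify $\mathbb H^{n+1}$ with $\mathbb R^{4n+4}$ by $q_{l+1}=x_{4l+1}+x_{4l+2}\mathbf i+x_{4l+3}\mathbf j+x_{4l+4}\mathbf k$, $l=0,\dots,n$; $\partial_m=\partial/\partial x_m$. Put $\nabla_{(2l)0'}=\partial_{4l+1}+\mathbf i\partial_{4l+2}$, $\nabla_{(2l)1'}=-\partial_{4l+3}-\mathbf i\partial_{4l+4}$, $\nabla_{(2l+1)0'}=\partial_{4l+3}-\mathbf i\partial_{4l+4}$,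 $\nabla_{(2l+1)1'}=\partial_{4l+1}-\mathbf i\partial_{4l+2}$ ($l=0,\dots,n$), so $\nabla_{\dot A}^{0'}=\nabla_{\dot A1'}$, $\nabla_{\dot A}^{1'}=-\nabla_{\dot A0'}$. Let $\omega^0,\dots,\omega^{2n+1}$ be a basis of $\mathbb C^{2n+2}$, with $\mathbb C^{2n}=\mathrm{span}(\omega^0,\dots,\omega^{2n-1})$, and for $f=f_{\mathbf{\dot A}}\omega^{\mathbf{\dot A}}$ let $d^{A'}f=\nabla_{\dot A}^{A'}f_{\mathbf{\dot A}}\,\omega^{\dot A}\wedge\omega^{\mathbf{\dot A}}$. Let $\sigma_j=k-j,\ \tau_j=j$ for $j\le k$ and $\sigma_j=j-k-1,\ \tau_j=j+1$ for $j\ge k+1$; $\mathcal V_j=\odot^{\sigma_j}\mathbb C^2\otimes\wedge^{\tau_j}\mathbb C^{2n+2}$, where $\odot^\sigma\mathbb C^2$ is identified with homogeneous polynomials of degree $\sigma$ in $(s^{0'},s^{1'})$; $\partial_{A'}=\partial/\partial s^{A'}$, $s_{0'}=-s^{1'}$, $s_{1'}=s^{0'}$. The operators $\mathcal D_j:\Gamma(\cdot,\mathcal V_j)\to\Gamma(\cdot,\mathcal V_{j+1})$ (on smooth sections) are $\mathcal D_j=\partial_{A'}d^{A'}$ for $j<k$, $\mathcal D_k=d^{0'}d^{1'}$, $\mathcal D_j=s_{A'}d^{A'}$ for $k<j\le 2n$. Boundary. $D=\{\varrho>0\}$, where near the origin $\varrho(\mathbf q)=\operatorname{Re}q_{n+1}-\phi(\mathbf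 q',\operatorname{Im}q_{n+1})$, $\mathbf q=(\mathbf q',q_{n+1})\in\mathbb H^n\times\mathbb H$, $\phi$ smooth real, $\phi=O(|(\mathbf q',\operatorname{Im}q_{n+1})|^2)$. Everything is local: $U$ is an open neighborhood of the origin on which $\varrho$ has this form, and $bD$ in the claim stands for $bD\cap U$. Put $\mathbf N_{B'C'}=\nabla_{(2n+o(B'))C'}$ and let $\mathbf N\varrho$ be the invertible matrix $(\mathbf N_{B'C'}\varrho)$. Define $n_{AB'}=\nabla_{AD'}\varrho\,(\mathbf N\varrho)^{-1}_{D'B'}$, $Z_A^{A'}=\nabla_A^{A'}-n_{AB'}\mathbf N_{B'}^{A'}$ (tangential to $bD$), $\mathfrak d^{A'}f=Z_A^{A'}f_{\mathbf A}\,\omega^A\wedge\omega^{\mathbf A}$ for $f=f_{\mathbf A}\omega^{\mathbf A}$. Define $R_{B'C'}=\varepsilon_{B'D'}(\mathbf N\varrho)^{-1}_{D'C'}$, the tangential fields $\mathbf T_{B'}^{A'}=R_{B'C'}\mathbf N_{C'}^{A'}-\delta_{B'}^{A'}\partial_{4n+1}$, and $\mathbf T^{1'0'}:=\mathbf T_{1'}^{1'}$. Let $\Omega^{A'}=d^{A'}\varrho$; then $\Omega^{0'},\Omega^{1'},\omega^0,\dots,\omega^{2n-1}$ is a pointwise basis of $\mathbb C^{2n+2}$. With $\mathcal E=-d^{0'}d^{1'}\varrho$, write uniquely $\mathcal E=\mathcal E_0+\Omega^{A'}\wedge\mathcal E_{A'}+\mathcal E_{0'1'}\Omega^{0'}\wedge\Omega^{1'}$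 with $\mathcal E_0,\mathcal E_{A'},\mathcal E_{0'1'}$ involving only $\omega^0,\dots,\omega^{2n-1}$. Boundary complex. $u\in\Gamma(U,\mathcal V_j)$ has zero Cauchy data on $bD$ for $\mathcal D_j$ if $\int_D\langle\mathcal D_ju,\psi\rangle dV=\int_D\langle u,\mathcal D_j^*\psi\rangle dV$ for every smooth $\mathcal V_{j+1}$-valued $\psi$ compactly supported in $U$ ($\mathcal D_j^*$ the formal adjoint for fixed constant Hermitian inner products). $\mathcal J_j(U)$ is the space of such $u$. One has $\mathcal D_j\mathcal J_j(U)\subset\mathcal J_{j+1}(U)$, and the boundary complex is the quotient complex $\Gamma(U,\mathcal V_j)/\mathcal J_j(U)$ with the maps induced by $\mathcal D_j$. *)

theory Defs
  imports
    "HOL-Analysis.Analysis"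
    "HOL-Library.Function_Algebras"
    "HOL-Library.Landau_Symbols"
begin

text \<open>
  Conventions.  The space \<open>\<real>\<^bsup>4n+4\<^esup>\<close> is a Euclidean space \<open>'a\<close> together with an enumeration
  \<open>b\<close> of its orthonormal basis by \<open>{1..4n+4}\<close>; so \<open>x\<^sub>m = x \<bullet> b m\<close> and \<open>dV\<close> is \<^term>\<open>lborel\<close>.
  Primed indices \<open>0', 1'\<close> are the elements \<open>0, 1\<close> of the two-element type \<^typ>\<open>2\<close>;
  unprimed indices are natural numbers.
  Functions on a subset of \<open>'a\<close> are total functions, sections being extended by zero.
  Vector operations on functions are pointwise (\<^theory>\<open>HOL-Library.Function_Algebras\<close>).
\<close>

fun differentiable_times_on :: "nat \<Rightarrow> 'a::real_normed_vector set \<Rightarrow> ('a \<Rightarrow> 'b::real_normed_vector) \<Rightarrow> bool" where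
  "differentiable_times_on 0 W f \<longleftrightarrow> continuous_on W f"
| "differentiable_times_on (Suc r) W f \<longleftrightarrow> (\<forall>x\<in>W. f differentiable (at x)) \<and>
     (\<forall>v. differentiable_times_on r W (\<lambda>x. frechet_derivative f (at x) v))"

text \<open>\<open>C\<^sup>\<infinity>\<close> on an open set.\<close>

definition smooth_on :: "'a::real_normed_vector set \<Rightarrow> ('a \<Rightarrow> 'b::real_normed_vector) \<Rightarrow> bool" where
  "smooth_on W f \<longleftrightarrow> (\<forall>r. differentiable_times_on r W f)"

definition local_extension ::
    "'a::real_normed_vector set \<Rightarrow> 'a \<Rightarrow> ('a \<Rightarrow> 'b::real_normed_vector) \<Rightarrow> ('a \<Rightarrow> 'b) \<Rightarrow> bool" where
  "local_extension S p f g \<longleftrightarrow>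
     (\<exists>W. open W \<and> p \<in> W \<and> smooth_on W g \<and> (\<forall>y\<in>W \<inter> S. g y = f y))"

text \<open>Smoothness of a function on an embedded submanifold \<open>S\<close>.\<close>

definition smooth_along :: "'a::real_normed_vector set \<Rightarrow> ('a \<Rightarrow> 'b::real_normed_vector) \<Rightarrow> bool" where
  "smooth_along S f \<longleftrightarrow> (\<forall>p\<in>S. \<exists>g. local_extension S p f g)"

text \<open>
  Action on functions on \<open>S\<close> of an operator \<open>X\<close> that is a vector field tangential to \<open>S\<close>:
  apply \<open>X\<close> to a smooth local extension.  For tangential \<open>X\<close> the value at a point of \<open>S\<close> does not
  depend on the extension.
\<close>

definition along ::
    "'a::real_normed_vector set \<Rightarrow> (('a \<Rightarrow> complex) \<Rightarrow> 'a \<Rightarrow> complex) \<Rightarrow> ('a \<Rightarrow> complex) \<Rightarrow> 'a \<Rightarrow> complex" where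
  "along S X f p = X (SOME g. local_extension S p f g) p"

text \<open>
  A form is given by its coefficients: \<open>\<alpha> {a\<^sub>1 < \<dots> < a\<^sub>t}\<close> is the coefficient of
  \<open>\<omega>\<^bsup>a\<^sub>1\<^esup> \<and> \<dots> \<and> \<omega>\<^bsup>a\<^sub>t\<^esup>\<close>.
  In a \<open>pform\<close>, \<open>v a b\<close> is the form that multiplies the monomial
  \<open>(s\<^bsup>0'\<^esup>)\<^bsup>a\<^esup> (s\<^bsup>1'\<^esup>)\<^bsup>b\<^esup>\<close>.
\<close>

type_synonym form = "nat set \<Rightarrow> complex"
type_synonym pform = "nat \<Rightarrow> nat \<Rightarrow> form"

definition form_sign :: "nat set \<Rightarrow> nat set \<Rightarrow> complex" where
  "form_sign P Q = (- 1) ^ card {(p, q). p \<in> P \<and> q \<in> Q \<and> q < p}"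

definition wedge :: "form \<Rightarrow> form \<Rightarrow> form" where
  "wedge \<alpha> \<beta> = (\<lambda>T. \<Sum>P\<in>Pow T. form_sign P (T - P) * \<alpha> P * \<beta> (T - P))"

definition omega :: "nat \<Rightarrow> form" where
  "omega A = (\<lambda>T. if T = {A} then 1 else 0)"

definition pwedge :: "form \<Rightarrow> pform \<Rightarrow> pform" where
  "pwedge \<alpha> v = (\<lambda>a b. wedge \<alpha> (v a b))"

text \<open>\<open>\<wedge>\<^sup>\<tau> \<complex>\<^sup>N\<close> and \<open>\<odot>\<^sup>\<sigma> \<complex>\<^sup>2 \<otimes> \<wedge>\<^sup>\<tau> \<complex>\<^sup>N\<close>; both vanish if \<open>\<tau> < 0\<close>.\<close>

definition forms :: "nat \<Rightarrow> int \<Rightarrow> form set" where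
  "forms N t = {\<alpha>. \<forall>T. \<alpha> T \<noteq> 0 \<longrightarrow> T \<subseteq> {..<N} \<and> int (card T) = t}"

definition pform_index :: "nat \<Rightarrow> nat \<Rightarrow> int \<Rightarrow> (nat \<times> nat \<times> nat set) set" where
  "pform_index N s t = {(a, b, T). a + b = s \<and> T \<subseteq> {..<N} \<and> int (card T) = t}"

definition pforms :: "nat \<Rightarrow> nat \<Rightarrow> int \<Rightarrow> pform set" where
  "pforms N s t = {v. \<forall>a b T. v a b T \<noteq> 0 \<longrightarrow> (a, b, T) \<in> pform_index N s t}"

definition pscale :: "complex \<Rightarrow> pform \<Rightarrow> pform" where
  "pscale c v = (\<lambda>a b T. c * v a b T)"

text \<open>\<open>\<partial>\<^bsub>A'\<^esub> = \<partial>/\<partial>s\<^bsup>A'\<^esup>\<close>, and multiplication by \<open>s\<^bsub>0'\<^esub> = - s\<^bsup>1'\<^esup>\<close>, \<open>s\<^bsub>1'\<^esub> = s\<^bsup>0'\<^esup>\<close>.\<close>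

definition ds :: "2 \<Rightarrow> pform \<Rightarrow> pform" where
  "ds A' v = (\<lambda>a b T. if A' = 0 then of_nat (a + 1) * v (a + 1) b T
                                 else of_nat (b + 1) * v a (b + 1) T)"

definition slow :: "2 \<Rightarrow> pform \<Rightarrow> pform" where
  "slow A' v = (\<lambda>a b T. if A' = 0 then (if b = 0 then 0 else - v a (b - 1) T)
                                   else (if a = 0 then 0 else v (a - 1) b T))"

definition pd :: "(nat \<Rightarrow> 'a::euclidean_space) \<Rightarrow> nat \<Rightarrow> ('a \<Rightarrow> complex) \<Rightarrow> 'a \<Rightarrow> complex" where
  "pd b m f x = frechet_derivative f (at x) (b m)"

text \<open>\<open>nabla b A A'\<close> is \<open>\<nabla>\<^bsub>AA'\<^esub>\<close> and \<open>nabla_up b A A'\<close> is \<open>\<nabla>\<^bsub>A\<^esub>\<^bsup>A'\<^esup>\<close>.\<close>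

definition nabla :: "(nat \<Rightarrow> 'a::euclidean_space) \<Rightarrow> nat \<Rightarrow> 2 \<Rightarrow> ('a \<Rightarrow> complex) \<Rightarrow> 'a \<Rightarrow> complex" where
  "nabla b A A' f x = (let l = A div 2 in
     if even A
     then (if A' = 0 then pd b (4*l+1) f x + \<i> * pd b (4*l+2) f x
                     else - pd b (4*l+3) f x - \<i> * pd b (4*l+4) f x)
     else (if A' = 0 then pd b (4*l+3) f x - \<i> * pd b (4*l+4) f x
                     else pd b (4*l+1) f x - \<i> * pd b (4*l+2) f x))"

definition nabla_up :: "(nat \<Rightarrow> 'a::euclidean_space) \<Rightarrow> nat \<Rightarrow> 2 \<Rightarrow> ('a \<Rightarrow> complex) \<Rightarrow> 'a \<Rightarrow> complex" where
  "nabla_up b A A' f x = (if A' = 0 then nabla b A 1 f x else - nabla b A 0 f x)"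

definition dform :: "(nat \<Rightarrow> 'a::euclidean_space) \<Rightarrow> nat \<Rightarrow> 2 \<Rightarrow> ('a \<Rightarrow> form) \<Rightarrow> 'a \<Rightarrow> form" where
  "dform b n A' f x = (\<Sum>A<2*n+2. wedge (omega A) (\<lambda>T. nabla_up b A A' (\<lambda>y. f y T) x))"

type_synonym 'a psection = "'a \<Rightarrow> pform"

text \<open>Coefficientwise extension to \<open>pform\<close>-valued functions of an operator on form-valued functions.\<close>

definition plift :: "(('a \<Rightarrow> form) \<Rightarrow> 'a \<Rightarrow> form) \<Rightarrow> 'a psection \<Rightarrow> 'a psection" where
  "plift L u x = (\<lambda>a b. L (\<lambda>y. u y a b) x)"

definition sig :: "nat \<Rightarrow> nat \<Rightarrow> nat" where
  "sig k j = (if j \<le> k then k - j else j - k - 1)"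

definition tau :: "nat \<Rightarrow> nat \<Rightarrow> nat" where
  "tau k j = (if j \<le> k then j else j + 1)"

definition CFspace :: "nat \<Rightarrow> nat \<Rightarrow> nat \<Rightarrow> pform set" where
  "CFspace n k j = pforms (2*n+2) (sig k j) (int (tau k j))"

definition CFop :: "(nat \<Rightarrow> 'a::euclidean_space) \<Rightarrow> nat \<Rightarrow> nat \<Rightarrow> 'a set \<Rightarrow> nat \<Rightarrow> 'a psection \<Rightarrow> 'a psection" where
  "CFop b n k U j u = (\<lambda>x. if x \<notin> U then 0
     else if j < k then (\<Sum>A'\<in>UNIV. ds A' (plift (dform b n A') u x))
     else if j = k then plift (dform b n 0) (plift (dform b n 1) u) x
     else (\<Sum>A'\<in>UNIV. slow A' (plift (dform b n A') u x)))"

definition sscale :: "complex \<Rightarrow> 'a psection \<Rightarrow> 'a psection" where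
  "sscale c u = (\<lambda>x. pscale c (u x))"

definition sections :: "'a::euclidean_space set \<Rightarrow> pform set \<Rightarrow> 'a psection set" where
  "sections U V = {u. (\<forall>x\<in>U. u x \<in> V) \<and> (\<forall>x. x \<notin> U \<longrightarrow> u x = 0) \<and>
                      (\<forall>a b T. smooth_on U (\<lambda>x. u x a b T))}"

definition bsections :: "'a::euclidean_space set \<Rightarrow> pform set \<Rightarrow> 'a psection set" where
  "bsections S V = {u. (\<forall>x\<in>S. u x \<in> V) \<and> (\<forall>x. x \<notin> S \<longrightarrow> u x = 0) \<and>
                       (\<forall>a b T. smooth_along S (\<lambda>x. u x a b T))}"

definition csections :: "'a::euclidean_space set \<Rightarrow> pform set \<Rightarrow> 'a psection set" where
  "csections U V = {u \<in> sections UNIV V. \<exists>K. compact K \<and> K \<subseteq> U \<and> (\<forall>x. x \<notin> K \<longrightarrow> u x = 0)}"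

definition hermitian_inner :: "pform set \<Rightarrow> (pform \<Rightarrow> pform \<Rightarrow> complex) \<Rightarrow> bool" where
  "hermitian_inner V h \<longleftrightarrow>
     (\<forall>u\<in>V. \<forall>v\<in>V. \<forall>w\<in>V. h (u + v) w = h u w + h v w) \<and>
     (\<forall>c. \<forall>u\<in>V. \<forall>w\<in>V. h (pscale c u) w = c * h u w) \<and>
     (\<forall>u\<in>V. \<forall>w\<in>V. h w u = cnj (h u w)) \<and>
     (\<forall>u\<in>V. u \<noteq> 0 \<longrightarrow> 0 < Re (h u u))"

text \<open>
  \<open>\<D>\<^sub>j\<^sup>*\<psi>\<close> for \<open>\<psi>\<close> with compact support: the section paired with which every compactly supported \<open>u\<close>
  gives \<open>\<integral>\<langle>\<D>\<^sub>ju, \<psi>\<rangle>dV\<close>; it is unique, and it exists as \<open>\<D>\<^sub>j\<close> has constant coefficients.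
\<close>

definition CFadjoint :: "(nat \<Rightarrow> 'a::euclidean_space) \<Rightarrow> nat \<Rightarrow> nat \<Rightarrow> (nat \<Rightarrow> pform \<Rightarrow> pform \<Rightarrow> complex) \<Rightarrow>
    nat \<Rightarrow> 'a psection \<Rightarrow> 'a psection" where
  "CFadjoint b n k h j \<psi> = (THE v. v \<in> csections UNIV (CFspace n k j) \<and>
     (\<forall>u\<in>csections UNIV (CFspace n k j).
        (LINT x|lborel. h (Suc j) (CFop b n k UNIV j u x) (\<psi> x)) = (LINT x|lborel. h j (u x) (v x))))"

text \<open>\<open>\<J>\<^sub>j(U)\<close>: sections over \<open>U\<close> with zero Cauchy data on \<open>bD\<close>.\<close>

definition zero_Cauchy :: "(nat \<Rightarrow> 'a::euclidean_space) \<Rightarrow> nat \<Rightarrow> nat \<Rightarrow> (nat \<Rightarrow> pform \<Rightarrow> pform \<Rightarrow> complex) \<Rightarrow>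
    'a set \<Rightarrow> 'a set \<Rightarrow> nat \<Rightarrow> 'a psection set" where
  "zero_Cauchy b n k h U D j = {u \<in> sections U (CFspace n k j).
     \<forall>\<psi>\<in>csections U (CFspace n k (Suc j)).
       (LINT x:D|lborel. h (Suc j) (CFop b n k U j u x) (\<psi> x)) =
       (LINT x:D|lborel. h j (u x) (CFadjoint b n k h j \<psi> x))}"

text \<open>Congruence modulo a subspace \<open>J\<close> of \<open>G\<close>; the quotient space is \<open>G // modrel G J\<close>.\<close>

definition modrel :: "'a psection set \<Rightarrow> 'a psection set \<Rightarrow> 'a psection rel" where
  "modrel G J = {(u, v). u \<in> G \<and> v \<in> G \<and> u - v \<in> J}"

definition quotient_linear_iso :: "'a psection set \<Rightarrow> 'a psection set \<Rightarrow> ('a psection \<times> 'a psection) set \<Rightarrow>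
    ('a psection set \<Rightarrow> 'a psection \<times> 'a psection) \<Rightarrow> bool" where
  "quotient_linear_iso G J H \<Psi> \<longleftrightarrow>
     bij_betw \<Psi> (G // modrel G J) H \<and>
     (\<forall>u\<in>G. \<forall>v\<in>G. \<Psi> (modrel G J `` {u + v}) = \<Psi> (modrel G J `` {u}) + \<Psi> (modrel G J `` {v})) \<and>
     (\<forall>c. \<forall>u\<in>G. \<Psi> (modrel G J `` {sscale c u}) =
        map_prod (sscale c) (sscale c) (\<Psi> (modrel G J `` {u})))"

definition oidx :: "2 \<Rightarrow> nat" where
  "oidx A' = (if A' = 0 then 0 else 1)"

definition eps :: "2 \<Rightarrow> 2 \<Rightarrow> complex" where
  "eps A' B' = (if A' = 0 \<and> B' = 1 then 1 else if A' = 1 \<and> B' = 0 then - 1 else 0)"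

abbreviation cfun :: "('a \<Rightarrow> real) \<Rightarrow> 'a \<Rightarrow> complex" where
  "cfun \<rho> \<equiv> (\<lambda>x. complex_of_real (\<rho> x))"

text \<open>\<open>N\<^bsub>B'C'\<^esub>\<close>, \<open>N\<^bsub>B'\<^esub>\<^bsup>A'\<^esup>\<close>, and the inverse of the matrix with \<open>(B', C')\<close> entry \<open>N\<^bsub>B'C'\<^esub>\<rho>\<close>.\<close>

definition Nlow :: "(nat \<Rightarrow> 'a::euclidean_space) \<Rightarrow> nat \<Rightarrow> 2 \<Rightarrow> 2 \<Rightarrow> ('a \<Rightarrow> complex) \<Rightarrow> 'a \<Rightarrow> complex" where
  "Nlow b n B' C' = nabla b (2*n + oidx B') C'"

definition Nup :: "(nat \<Rightarrow> 'a::euclidean_space) \<Rightarrow> nat \<Rightarrow> 2 \<Rightarrow> 2 \<Rightarrow> ('a \<Rightarrow> complex) \<Rightarrow> 'a \<Rightarrow> complex" where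
  "Nup b n B' A' = nabla_up b (2*n + oidx B') A'"

definition Ninv :: "(nat \<Rightarrow> 'a::euclidean_space) \<Rightarrow> nat \<Rightarrow> ('a \<Rightarrow> real) \<Rightarrow> 'a \<Rightarrow> complex^2^2" where
  "Ninv b n \<rho> x = matrix_inv (\<chi> B' C'. Nlow b n B' C' (cfun \<rho>) x)"

definition ncoef :: "(nat \<Rightarrow> 'a::euclidean_space) \<Rightarrow> nat \<Rightarrow> ('a \<Rightarrow> real) \<Rightarrow> nat \<Rightarrow> 2 \<Rightarrow> 'a \<Rightarrow> complex" where
  "ncoef b n \<rho> A B' x = (\<Sum>D'\<in>UNIV. nabla b A D' (cfun \<rho>) x * Ninv b n \<rho> x $ D' $ B')"

definition Zfield :: "(nat \<Rightarrow> 'a::euclidean_space) \<Rightarrow> nat \<Rightarrow> ('a \<Rightarrow> real) \<Rightarrow> nat \<Rightarrow> 2 \<Rightarrow>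
    ('a \<Rightarrow> complex) \<Rightarrow> 'a \<Rightarrow> complex" where
  "Zfield b n \<rho> A A' f x = nabla_up b A A' f x - (\<Sum>B'\<in>UNIV. ncoef b n \<rho> A B' x * Nup b n B' A' f x)"

definition Rcoef :: "(nat \<Rightarrow> 'a::euclidean_space) \<Rightarrow> nat \<Rightarrow> ('a \<Rightarrow> real) \<Rightarrow> 2 \<Rightarrow> 2 \<Rightarrow> 'a \<Rightarrow> complex" where
  "Rcoef b n \<rho> B' C' x = (\<Sum>D'\<in>UNIV. eps B' D' * Ninv b n \<rho> x $ D' $ C')"

text \<open>\<open>Tfield b n \<rho> B' A'\<close> is \<open>T\<^bsub>B'\<^esub>\<^bsup>A'\<^esup>\<close>; in particular \<open>T\<^bsup>1'0'\<^esup>\<close> is \<open>Tfield b n \<rho> 1 1\<close>.\<close>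

definition Tfield :: "(nat \<Rightarrow> 'a::euclidean_space) \<Rightarrow> nat \<Rightarrow> ('a \<Rightarrow> real) \<Rightarrow> 2 \<Rightarrow> 2 \<Rightarrow>
    ('a \<Rightarrow> complex) \<Rightarrow> 'a \<Rightarrow> complex" where
  "Tfield b n \<rho> B' A' f x = (\<Sum>C'\<in>UNIV. Rcoef b n \<rho> B' C' x * Nup b n C' A' f x)
     - (if A' = B' then pd b (4*n+1) f x else 0)"

text \<open>\<open>\<dd>\<^bsup>A'\<^esup>\<close> on form-valued functions on the boundary \<open>S\<close>.\<close>

definition bdform :: "(nat \<Rightarrow> 'a::euclidean_space) \<Rightarrow> nat \<Rightarrow> ('a \<Rightarrow> real) \<Rightarrow> 'a set \<Rightarrow> 2 \<Rightarrow>
    ('a \<Rightarrow> form) \<Rightarrow> 'a \<Rightarrow> form" where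
  "bdform b n \<rho> S A' f x = (\<Sum>A<2*n. wedge (omega A) (\<lambda>T. along S (Zfield b n \<rho> A A') (\<lambda>y. f y T) x))"

definition zero_form :: "('a \<Rightarrow> real) \<Rightarrow> 'a \<Rightarrow> form" where
  "zero_form \<rho> x = (\<lambda>T. if T = {} then complex_of_real (\<rho> x) else 0)"

definition Omega :: "(nat \<Rightarrow> 'a::euclidean_space) \<Rightarrow> nat \<Rightarrow> ('a \<Rightarrow> real) \<Rightarrow> 2 \<Rightarrow> 'a \<Rightarrow> form" where
  "Omega b n \<rho> A' = dform b n A' (zero_form \<rho>)"

definition Eform :: "(nat \<Rightarrow> 'a::euclidean_space) \<Rightarrow> nat \<Rightarrow> ('a \<Rightarrow> real) \<Rightarrow> 'a \<Rightarrow> form" where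
  "Eform b n \<rho> x = - dform b n 0 (dform b n 1 (zero_form \<rho>)) x"

text \<open>The component \<open>\<E>\<^sub>0\<close> of \<open>\<E> = \<E>\<^sub>0 + \<Omega>\<^bsup>A'\<^esup> \<and> \<E>\<^bsub>A'\<^esub> + \<E>\<^bsub>0'1'\<^esub> \<Omega>\<^bsup>0'\<^esup> \<and> \<Omega>\<^bsup>1'\<^esup>\<close>.\<close>

definition Ezero :: "(nat \<Rightarrow> 'a::euclidean_space) \<Rightarrow> nat \<Rightarrow> ('a \<Rightarrow> real) \<Rightarrow> 'a \<Rightarrow> form" where
  "Ezero b n \<rho> x = (THE e. e \<in> forms (2*n) 2 \<and>
     (\<exists>e' :: 2 \<Rightarrow> form. \<exists>c. (\<forall>A'. e' A' \<in> forms (2*n) 1) \<and>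
        Eform b n \<rho> x = e + (\<Sum>A'\<in>UNIV. wedge (Omega b n \<rho> A' x) (e' A'))
          + (\<lambda>T. c * wedge (Omega b n \<rho> 0 x) (Omega b n \<rho> 1 x) T)))"

definition Bspace1 :: "nat \<Rightarrow> nat \<Rightarrow> nat \<Rightarrow> pform set" where
  "Bspace1 n k j = pforms (2*n) (sig k j) (int (tau k j))"

definition Bspace2 :: "nat \<Rightarrow> nat \<Rightarrow> nat \<Rightarrow> pform set" where
  "Bspace2 n k j = (if j = k then pforms (2*n) 0 (int k)
                    else pforms (2*n) (sig k (j + 1)) (int (tau k j) - 1))"

definition bspace_sections :: "nat \<Rightarrow> nat \<Rightarrow> 'a::euclidean_space set \<Rightarrow> nat \<Rightarrow> ('a psection \<times> 'a psection) set" where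
  "bspace_sections n k S j = bsections S (Bspace1 n k j) \<times> bsections S (Bspace2 n k j)"

text \<open>
  Scalar linear differential operators (of finite order) on the hypersurface \<open>S = {\<rho> = 0}\<close>: the algebra
  generated by multiplications by smooth functions and by smooth tangential vector fields.
\<close>

inductive_set scalar_diffops :: "('a::euclidean_space \<Rightarrow> real) \<Rightarrow> 'a set \<Rightarrow> (('a \<Rightarrow> complex) \<Rightarrow> 'a \<Rightarrow> complex) set"
  for \<rho> S where
  mult: "smooth_along S c \<Longrightarrow> (\<lambda>f x. c x * f x) \<in> scalar_diffops \<rho> S"
| field: "smooth_along S X \<Longrightarrow> (\<And>p. p \<in> S \<Longrightarrow> frechet_derivative \<rho> (at p) (X p) = 0) \<Longrightarrow>
    along S (\<lambda>f x. frechet_derivative f (at x) (X x)) \<in> scalar_diffops \<rho> S"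
| add: "P \<in> scalar_diffops \<rho> S \<Longrightarrow> Q \<in> scalar_diffops \<rho> S \<Longrightarrow> (\<lambda>f x. P f x + Q f x) \<in> scalar_diffops \<rho> S"
| comp: "P \<in> scalar_diffops \<rho> S \<Longrightarrow> Q \<in> scalar_diffops \<rho> S \<Longrightarrow> P \<circ> Q \<in> scalar_diffops \<rho> S"

text \<open>
  Scalar-valued differential operators on \<open>G\<close>, a space of pairs of sections; only indices in the
  finite sets \<open>I\<^sub>1\<close>, \<open>I\<^sub>2\<close> carry nonzero coefficients of the two entries.
\<close>

definition diffop_component :: "('a::euclidean_space \<Rightarrow> real) \<Rightarrow> 'a set \<Rightarrow>
    (nat \<times> nat \<times> nat set) set \<Rightarrow> (nat \<times> nat \<times> nat set) set \<Rightarrow> ('a psection \<times> 'a psection) set \<Rightarrow>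
    ('a psection \<times> 'a psection \<Rightarrow> 'a \<Rightarrow> complex) \<Rightarrow> bool" where
  "diffop_component \<rho> S I\<^sub>1 I\<^sub>2 G L \<longleftrightarrow>
     (\<exists>M\<^sub>1 M\<^sub>2. range M\<^sub>1 \<subseteq> scalar_diffops \<rho> S \<and> range M\<^sub>2 \<subseteq> scalar_diffops \<rho> S \<and>
       (\<forall>F\<^sub>1 F\<^sub>2. (F\<^sub>1, F\<^sub>2) \<in> G \<longrightarrow> (\<forall>x\<in>S. L (F\<^sub>1, F\<^sub>2) x =
          (\<Sum>(a, b, T)\<in>I\<^sub>1. M\<^sub>1 (a, b, T) (\<lambda>y. F\<^sub>1 y a b T) x) +
          (\<Sum>(a, b, T)\<in>I\<^sub>2. M\<^sub>2 (a, b, T) (\<lambda>y. F\<^sub>2 y a b T) x))))"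

definition boundary_diffop :: "nat \<Rightarrow> nat \<Rightarrow> ('a::euclidean_space \<Rightarrow> real) \<Rightarrow> 'a set \<Rightarrow> nat \<Rightarrow>
    ('a psection \<times> 'a psection \<Rightarrow> 'a psection \<times> 'a psection) \<Rightarrow> bool" where
  "boundary_diffop n k \<rho> S j P \<longleftrightarrow>
     P ` bspace_sections n k S j \<subseteq> bspace_sections n k S (Suc j) \<and>
     (let I\<^sub>1 = pform_index (2*n) (sig k j) (int (tau k j));
          I\<^sub>2 = (if j = k then pform_index (2*n) 0 (int k)
                else pform_index (2*n) (sig k (j + 1)) (int (tau k j) - 1))
      in \<forall>a b T. diffop_component \<rho> S I\<^sub>1 I\<^sub>2 (bspace_sections n k S j) (\<lambda>F x. fst (P F) x a b T) \<and>
                 diffop_component \<rho> S I\<^sub>1 I\<^sub>2 (bspace_sections n k S j) (\<lambda>F x. snd (P F) x a b T))"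

definition boundary_T10 :: "(nat \<Rightarrow> 'a::euclidean_space) \<Rightarrow> nat \<Rightarrow> ('a \<Rightarrow> real) \<Rightarrow> 'a set \<Rightarrow>
    'a psection \<Rightarrow> 'a psection" where
  "boundary_T10 b n \<rho> S F x = (\<lambda>a c T. along S (Tfield b n \<rho> 1 1) (\<lambda>y. F y a c T) x)"

text \<open>\<open>(q', Im q\<^bsub>n+1\<^esub>)\<close>, as the point with \<open>Re q\<^bsub>n+1\<^esub> = x\<^bsub>4n+1\<^esub>\<close> set to \<open>0\<close>.\<close>

definition drop_re :: "(nat \<Rightarrow> 'a::euclidean_space) \<Rightarrow> nat \<Rightarrow> 'a \<Rightarrow> 'a" where
  "drop_re b n x = x - (x \<bullet> b (4*n+1)) *\<^sub>R b (4*n+1)"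

end

theory Submission
  imports Defs
begin

text \<open>
  Exterior multiplication by \<open>\<Omega>\<^sup>0\<^sup>'\<close>, \<open>\<Omega>\<^sup>1\<^sup>'\<close> and the contractions dual to them satisfy the canonical anticommutation
  relations, so every form splits into a tangential part \<open>p u\<close>, annihilated by the contractions \<open>J\<^sub>0\<close>, \<open>J\<^sub>1\<close>, and
  multiples of \<open>\<Omega>\<^sup>0\<^sup>'\<close> and \<open>\<Omega>\<^sup>1\<^sup>'\<close>.  Integrating by parts, \<open>u\<close> has zero Cauchy data for \<open>\<D>\<^sub>j\<close>, \<open>j \<noteq> k\<close>, iff the symbol of
  \<open>\<D>\<^sub>j\<close> in the direction \<open>d\<rho>\<close> annihilates \<open>u\<close> on \<open>bD\<close>; for the second order operator \<open>\<D>\<^sub>k\<close> the condition is that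
  \<open>\<Omega>\<^sup>0\<^sup>' \<and> \<Omega>\<^sup>1\<^sup>' \<and> u\<close> and one first order expression in \<open>u\<close> vanish on \<open>bD\<close>.  By the splitting this means that \<open>p u\<close> and
  a second component vanish on \<open>bD\<close>, namely \<open>J\<^sub>1 J\<^sub>0\<close> of the symbol applied to \<open>u\<close> or, for \<open>j = k\<close>, \<open>J\<^sub>1 J\<^sub>0\<close> of the first
  order expression in \<open>u - p u\<close> plus the normal derivative of \<open>p u\<close>.  This pair of traces identifies \<open>\<Gamma>(U, \<V>\<^sub>j) / \<J>\<^sub>j(U)\<close> with the boundary sections: boundary data are
  extended to be constant along \<open>\<partial>\<^bsub>4n+1\<^esub>\<close> and cut off away from \<open>bD\<close>.

  The boundary operator is the trace of \<open>\<D>\<^sub>j\<close> applied to the extension.  On functions constant along \<open>\<partial>\<^bsub>4n+1\<^esub>\<close>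
  every derivative is tangential.  Its first component follows from \<open>p d\<^sup>A = \<dd>\<^sup>A\<close> on tangential forms,
  \<open>d\<^sup>A (\<Omega>\<^sup>B \<and> v) = d\<^sup>A \<Omega>\<^sup>B \<and> v - \<Omega>\<^sup>B \<and> d\<^sup>A v\<close>, \<open>p (\<Omega>\<^sup>B \<and> v) = 0\<close> and \<open>p \<E> = \<E>\<^sub>0\<close>.
\<close>

section \<open>Smooth functions\<close>

text \<open>No surface measure on bD occurs. Its place is taken by the functional sending F to the
  integral over D of the derivative of F along e, the direction of Re q_{n+1}. For test functions on
  U it is minus an integral over the graph; all that is used is that it sees only the values of F on
  bD, and that it is nondegenerate there. As \<rho> is x_{4n+1} minus a function independent of
  x_{4n+1}, d\<rho>(e) = 1 and d\<rho> is constant along e. Hence under the integral every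
  derivative can be traded for the one along e, at the price of a factor d\<rho>, and multiplication
  by \<Omega> commutes with that derivative. The second order operator is the main obstacle: its
  Green formula brings derivatives of the test function f in all directions to the boundary, but
  only f and its derivative along e are independent data there, so Stokes has to be applied twice. A
  further obstacle is that U is arbitrary: translation along e may leave it and a collar of fixed
  width need not exist, so the projection to bD lives on a smaller open set and the cutoff has
  variable width.\<close>

lemma differentiable_cong_open:
  assumes "open W" "x \<in> W" "\<And>y. y \<in> W \<Longrightarrow> f y = g y" "f differentiable (at x)"
  shows "g differentiable (at x)" "frechet_derivative g (at x) = frechet_derivative f (at x)"
proof -
  have "(f has_derivative frechet_derivative f (at x)) (at x)"
    using assms(4) by (simp only: frechet_derivative_works)
  then have "(g has_derivative frechet_derivative f (at x)) (at x)"
    using has_derivative_transform_within_open assms by metis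
  then show "g differentiable (at x)" "frechet_derivative g (at x) = frechet_derivative f (at x)"
    using frechet_derivative_at[of g] by (auto simp: differentiable_def)
qed

text \<open>Which linear maps are derivatives at a point depends only on the germ, and
  \<open>frechet_derivative\<close> is a choice among them; so the equality holds also where f has
  no derivative.\<close>

lemma frechet_derivative_cong_open:
  assumes "open W" "x \<in> W" "\<And>y. y \<in> W \<Longrightarrow> f y = g y"
  shows "frechet_derivative f (at x) = frechet_derivative g (at x)"
proof -
  have "(f has_derivative D) (at x) \<longleftrightarrow> (g has_derivative D) (at x)" for D
    using assms has_derivative_transform_within_open by metis
  then show ?thesis by (simp add: frechet_derivative_def)
qed

lemma differentiable_times_on_cong:
  assumes "open W" "\<And>x. x \<in> W \<Longrightarrow> f x = g x" "differentiable_times_on r W f"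
  shows "differentiable_times_on r W g"
  using assms
proof (induction r arbitrary: f g)
  case 0
  then show ?case using continuous_on_cong[of W W f g] by simp
next
  case (Suc r)
  show ?case unfolding differentiable_times_on.simps
  proof (intro conjI ballI allI)
    fix x assume "x \<in> W"
    with Suc.prems show "g differentiable at x"
      using differentiable_cong_open(1)[of W x f g] by auto
  next
    fix v
    show "differentiable_times_on r W (\<lambda>x. frechet_derivative g (at x) v)"
    proof (rule Suc.IH)
      show "frechet_derivative f (at x) v = frechet_derivative g (at x) v" if "x \<in> W" for x
        using frechet_derivative_cong_open[of W x f g] that Suc.prems by simp
    qed (use Suc.prems in auto)
  qed
qed

text \<open>The definition asks for continuity only at order 0, so the inclusion between consecutive
  orders rests on differentiable functions being continuous.\<close>

lemma differentiable_times_on_Suc_D: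
  "differentiable_times_on (Suc r) W f \<Longrightarrow> differentiable_times_on r W f"
proof (induction r arbitrary: f)
  case 0
  then have "f differentiable_on W"
    by (auto simp: differentiable_on_def intro: differentiable_at_withinI)
  then show ?case by (simp add: differentiable_imp_continuous_on)
next
  case (Suc r)
  have "differentiable_times_on r W (\<lambda>x. frechet_derivative f (at x) v)" for v
    using Suc.prems by (intro Suc.IH) (simp del: differentiable_times_on.simps(1))
  then show ?case using Suc.prems by auto
qed

lemma differentiable_times_on_subset:
  "V \<subseteq> W \<Longrightarrow> differentiable_times_on r W f \<Longrightarrow> differentiable_times_on r V f"
  by (induction r arbitrary: f) (auto intro: continuous_on_subset)

lemma differentiable_times_on_local:
  assumes "\<And>x. x \<in> W \<Longrightarrow> \<exists>V. open V \<and> x \<in> V \<and> differentiable_times_on r V f"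
  shows "differentiable_times_on r W f"
  using assms
proof (induction r arbitrary: f)
  case 0
  have "continuous (at x) f" if "x \<in> W" for x
    using 0[OF that] continuous_on_eq_continuous_at by auto
  then show ?case by (simp add: continuous_at_imp_continuous_on)
next
  case (Suc r)
  have "differentiable_times_on r W (\<lambda>x. frechet_derivative f (at x) v)" for v
  proof (rule Suc.IH)
    fix x assume "x \<in> W"
    from Suc.prems[OF this] show "\<exists>V. open V \<and> x \<in> V \<and> differentiable_times_on r V (\<lambda>x. frechet_derivative f (at x) v)"
      by auto
  qed
  moreover have "f differentiable at x" if "x \<in> W" for x
    using Suc.prems[OF that] by auto
  ultimately show ?case by auto
qed

lemma frechet_derivative_eqI:
  "(f has_derivative D) (at x) \<Longrightarrow> frechet_derivative f (at x) v = D v"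
  by (simp add: frechet_derivative_at[symmetric])

lemma differentiable_times_on_const: "differentiable_times_on r W (\<lambda>x. c)"
  by (induction r arbitrary: c) auto

lemma differentiable_times_on_bounded_linear:
  assumes "bounded_linear L" "open W" "differentiable_times_on r W f"
  shows "differentiable_times_on r W (\<lambda>x. L (f x))"
  using assms(3)
proof (induction r arbitrary: f)
  case 0
  then show ?case using assms(1) by (simp add: bounded_linear.continuous_on)
next
  case (Suc r)
  have d: "((\<lambda>x. L (f x)) has_derivative (\<lambda>v. L (frechet_derivative f (at x) v))) (at x)" if "x \<in> W" for x
    using Suc.prems that
    by (auto intro!: bounded_linear.has_derivative[OF assms(1)] frechet_derivative_works[THEN iffD1])
  have "differentiable_times_on r W (\<lambda>x. frechet_derivative (\<lambda>x. L (f x)) (at x) v)" for v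
    by (rule differentiable_times_on_cong[OF assms(2) _ Suc.IH[of "\<lambda>x. frechet_derivative f (at x) v"]])
      (use Suc.prems frechet_derivative_eqI[OF d] in auto)
  then show ?case using d by (auto simp: differentiable_def)
qed

lemma differentiable_times_on_add:
  assumes "open W" "differentiable_times_on r W f" "differentiable_times_on r W g"
  shows "differentiable_times_on r W (\<lambda>x. f x + g x)"
  using assms(2,3)
proof (induction r arbitrary: f g)
  case 0
  then show ?case by (simp add: continuous_on_add)
next
  case (Suc r)
  have d: "((\<lambda>x. f x + g x) has_derivative
      (\<lambda>v. frechet_derivative f (at x) v + frechet_derivative g (at x) v)) (at x)" if "x \<in> W" for x
    using Suc.prems that by (auto intro!: has_derivative_add frechet_derivative_works[THEN iffD1])
  have "differentiable_times_on r W (\<lambda>x. frechet_derivative (\<lambda>x. f x + g x) (at x) v)" for v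
    by (rule differentiable_times_on_cong[OF assms(1) _ Suc.IH[of
        "\<lambda>x. frechet_derivative f (at x) v" "\<lambda>x. frechet_derivative g (at x) v"]])
      (use Suc.prems frechet_derivative_eqI[OF d] in auto)
  then show ?case using d by (auto simp: differentiable_def)
qed

lemma differentiable_times_on_bilinear:
  assumes "bounded_bilinear P" "open W" "differentiable_times_on r W f" "differentiable_times_on r W g"
  shows "differentiable_times_on r W (\<lambda>x. P (f x) (g x))"
  using assms(3,4)
proof (induction r arbitrary: f g)
  case 0
  then show ?case by (simp add: bounded_bilinear.continuous_on[OF assms(1)])
next
  case (Suc r)
  have d: "((\<lambda>x. P (f x) (g x)) has_derivative
      (\<lambda>v. P (f x) (frechet_derivative g (at x) v) + P (frechet_derivative f (at x) v) (g x))) (at x)"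
    if "x \<in> W" for x
    using Suc.prems that
    by (auto intro!: bounded_bilinear.FDERIV[OF assms(1)] frechet_derivative_works[THEN iffD1])
  have fg: "differentiable_times_on r W f" "differentiable_times_on r W g"
    using Suc.prems by (blast intro: differentiable_times_on_Suc_D)+
  have "differentiable_times_on r W (\<lambda>x. frechet_derivative (\<lambda>x. P (f x) (g x)) (at x) v)" for v
    by (rule differentiable_times_on_cong[OF assms(2) _
          differentiable_times_on_add[OF assms(2)
          Suc.IH[of f "\<lambda>x. frechet_derivative g (at x) v"]
          Suc.IH[of "\<lambda>x. frechet_derivative f (at x) v" g]]])
      (use Suc.prems fg frechet_derivative_eqI[OF d] in auto)
  then show ?case using d by (auto simp: differentiable_def)
qed

lemma differentiable_times_on_sum:
  assumes "open W" "\<And>i. i \<in> I \<Longrightarrow> differentiable_times_on r W (f i)"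
  shows "differentiable_times_on r W (\<lambda>x. \<Sum>i\<in>I. f i x)"
  using assms(2)
  by (induction I rule: infinite_finite_induct)
    (auto intro: differentiable_times_on_const differentiable_times_on_add[OF assms(1)])

lemma has_derivative_Basis_sum:
  fixes f :: "'a::euclidean_space \<Rightarrow> 'b::real_normed_vector"
  assumes "f differentiable (at x)"
  shows "frechet_derivative f (at x) v = (\<Sum>i\<in>Basis. (v \<bullet> i) *\<^sub>R frechet_derivative f (at x) i)"
proof -
  have l: "linear (frechet_derivative f (at x))" by (simp add: assms linear_frechet_derivative)
  have "frechet_derivative f (at x) v = frechet_derivative f (at x) (\<Sum>i\<in>Basis. (v \<bullet> i) *\<^sub>R i)"
    by (simp add: euclidean_representation)
  also have "\<dots> = (\<Sum>i\<in>Basis. (v \<bullet> i) *\<^sub>R frechet_derivative f (at x) i)"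
    using l by (simp add: linear_sum linear_scale)
  finally show ?thesis .
qed

text \<open>The definition uses derivatives in constant directions, whereas the chain rule yields
  the derivative of f in the moving direction dg(v). Expanding this direction in the basis gives a
  sum of products, to which the induction hypothesis applies.\<close>

lemma differentiable_times_on_compose:
  fixes f :: "'b::euclidean_space \<Rightarrow> 'c::real_normed_vector" and g :: "'a::real_normed_vector \<Rightarrow> 'b"
  assumes "open V" "open W" "\<And>x. x \<in> W \<Longrightarrow> g x \<in> V"
    "differentiable_times_on r V f" "differentiable_times_on r W g"
  shows "differentiable_times_on r W (\<lambda>x. f (g x))"
  using assms(4,5)
proof (induction r arbitrary: f)
  case 0
  then show ?case using assms(3)
    by (auto intro!: continuous_on_compose2[of V f W g])
next
  case (Suc r)
  have d: "((\<lambda>x. f (g x)) has_derivative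
      (\<lambda>v. \<Sum>i\<in>Basis. (frechet_derivative g (at x) v \<bullet> i) *\<^sub>R frechet_derivative f (at (g x)) i)) (at x)"
    if "x \<in> W" for x
  proof -
    have df: "f differentiable (at (g x))" and dg: "g differentiable (at x)"
      using Suc.prems that assms(3) by auto
    have "((f \<circ> g) has_derivative (frechet_derivative f (at (g x)) \<circ> frechet_derivative g (at x))) (at x)"
      using df dg unfolding frechet_derivative_works by (intro diff_chain_at)
    moreover have "frechet_derivative f (at (g x)) \<circ> frechet_derivative g (at x) =
        (\<lambda>v. \<Sum>i\<in>Basis. (frechet_derivative g (at x) v \<bullet> i) *\<^sub>R frechet_derivative f (at (g x)) i)"
      by (rule ext, subst comp_apply, rule has_derivative_Basis_sum[OF df])
    ultimately show ?thesis by (simp add: o_def)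
  qed
  have g: "differentiable_times_on r W g" by (rule differentiable_times_on_Suc_D[OF Suc.prems(2)])
  have "differentiable_times_on r W (\<lambda>x. frechet_derivative (\<lambda>x. f (g x)) (at x) v)" for v
  proof (rule differentiable_times_on_cong[OF assms(2)])
    show "(\<Sum>i\<in>Basis. (frechet_derivative g (at x) v \<bullet> i) *\<^sub>R frechet_derivative f (at (g x)) i) =
         frechet_derivative (\<lambda>x. f (g x)) (at x) v" if "x \<in> W" for x
      using frechet_derivative_eqI[OF d[OF that]] by simp
    show "differentiable_times_on r W (\<lambda>x. \<Sum>i\<in>Basis.
        (frechet_derivative g (at x) v \<bullet> i) *\<^sub>R frechet_derivative f (at (g x)) i)"
    proof (intro differentiable_times_on_sum[OF assms(2)]
        differentiable_times_on_bilinear[OF bounded_bilinear_scaleR assms(2)])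
      show "differentiable_times_on r W (\<lambda>x. frechet_derivative g (at x) v \<bullet> i)" for i
        using Suc.prems(2)
        by (auto intro!: differentiable_times_on_bounded_linear[OF bounded_linear_inner_left assms(2)])
      show "differentiable_times_on r W (\<lambda>x. frechet_derivative f (at (g x)) i)" for i
        using Suc.prems(1) g by (intro Suc.IH) auto
    qed
  qed
  then show ?case using d by (auto simp: differentiable_def)
qed

lemma smooth_on_cong:
  "open W \<Longrightarrow> (\<And>x. x \<in> W \<Longrightarrow> f x = g x) \<Longrightarrow> smooth_on W f \<Longrightarrow> smooth_on W g"
  unfolding smooth_on_def using differentiable_times_on_cong by blast

lemma smooth_on_subset: "V \<subseteq> W \<Longrightarrow> smooth_on W f \<Longrightarrow> smooth_on V f"
  unfolding smooth_on_def using differentiable_times_on_subset by blast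

lemma smooth_on_local:
  "(\<And>x. x \<in> W \<Longrightarrow> \<exists>V. open V \<and> x \<in> V \<and> smooth_on V f) \<Longrightarrow> smooth_on W f"
  unfolding smooth_on_def
  by (intro allI differentiable_times_on_local) blast

lemma smooth_on_continuous: "smooth_on W f \<Longrightarrow> continuous_on W f"
  unfolding smooth_on_def using differentiable_times_on.simps(1) by blast

lemma smooth_on_differentiable: "smooth_on W f \<Longrightarrow> x \<in> W \<Longrightarrow> f differentiable (at x)"
  unfolding smooth_on_def using differentiable_times_on.simps(2) by blast

lemma smooth_on_has_derivative:
  "smooth_on W f \<Longrightarrow> x \<in> W \<Longrightarrow> (f has_derivative frechet_derivative f (at x)) (at x)"
  by (blast intro: smooth_on_differentiable frechet_derivative_works[THEN iffD1])

lemma smooth_on_frechet_derivative: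
  "smooth_on W f \<Longrightarrow> smooth_on W (\<lambda>x. frechet_derivative f (at x) v)"
  unfolding smooth_on_def using differentiable_times_on.simps(2) by blast

lemma smooth_onI_frechet_derivative:
  assumes "\<And>x. x \<in> W \<Longrightarrow> f differentiable (at x)"
    and "\<And>v. smooth_on W (\<lambda>x. frechet_derivative f (at x) v)"
  shows "smooth_on W f"
  unfolding smooth_on_def
proof
  fix r
  have "differentiable_times_on (Suc r) W f"
    unfolding differentiable_times_on.simps(2)
  proof (intro conjI ballI allI)
    show "differentiable_times_on r W (\<lambda>x. frechet_derivative f (at x) v)" for v
      using assms(2)[of v] by (simp only: smooth_on_def)
  qed (rule assms(1))
  then show "differentiable_times_on r W f" by (rule differentiable_times_on_Suc_D)
qed

lemma smooth_on_const: "smooth_on W (\<lambda>x. c)"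
  by (simp add: smooth_on_def differentiable_times_on_const)

lemma smooth_on_bounded_linear:
  "bounded_linear L \<Longrightarrow> open W \<Longrightarrow> smooth_on W f \<Longrightarrow> smooth_on W (\<lambda>x. L (f x))"
  by (simp add: smooth_on_def differentiable_times_on_bounded_linear)

lemma smooth_on_id: "smooth_on W (\<lambda>x. x)"
  by (rule smooth_onI_frechet_derivative) (auto simp: smooth_on_const)

lemma smooth_on_linear: "bounded_linear L \<Longrightarrow> open W \<Longrightarrow> smooth_on W L"
  using smooth_on_bounded_linear[OF _ _ smooth_on_id] .

lemma smooth_on_add: "open W \<Longrightarrow> smooth_on W f \<Longrightarrow> smooth_on W g \<Longrightarrow> smooth_on W (\<lambda>x. f x + g x)"
  by (simp add: smooth_on_def differentiable_times_on_add)

lemma smooth_on_sum: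
  "open W \<Longrightarrow> (\<And>i. i \<in> I \<Longrightarrow> smooth_on W (f i)) \<Longrightarrow> smooth_on W (\<lambda>x. \<Sum>i\<in>I. f i x)"
  by (simp add: smooth_on_def differentiable_times_on_sum)

lemma smooth_on_bilinear:
  "bounded_bilinear P \<Longrightarrow> open W \<Longrightarrow> smooth_on W f \<Longrightarrow> smooth_on W g \<Longrightarrow>
    smooth_on W (\<lambda>x. P (f x) (g x))"
  by (simp add: smooth_on_def differentiable_times_on_bilinear)

lemma smooth_on_mult:
  fixes f g :: "'a::real_normed_vector \<Rightarrow> 'b::real_normed_algebra"
  shows "open W \<Longrightarrow> smooth_on W f \<Longrightarrow> smooth_on W g \<Longrightarrow> smooth_on W (\<lambda>x. f x * g x)"
  by (rule smooth_on_bilinear[OF bounded_bilinear_mult])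

lemmas smooth_on_scaleR = smooth_on_bilinear[OF bounded_bilinear_scaleR]

lemma smooth_on_uminus: "open W \<Longrightarrow> smooth_on W f \<Longrightarrow> smooth_on W (\<lambda>x. - f x)"
  using smooth_on_bounded_linear[OF bounded_linear_minus[OF bounded_linear_ident]] .

lemma smooth_on_diff: "open W \<Longrightarrow> smooth_on W f \<Longrightarrow> smooth_on W g \<Longrightarrow> smooth_on W (\<lambda>x. f x - g x)"
  using smooth_on_add[of W f "\<lambda>x. - g x"] smooth_on_uminus[of W g] by simp

lemmas smooth_on_of_real = smooth_on_bounded_linear[OF bounded_linear_of_real]
  and smooth_on_cnj = smooth_on_bounded_linear[OF bounded_linear_cnj]
  and smooth_on_Re = smooth_on_bounded_linear[OF bounded_linear_Re]
  and smooth_on_Im = smooth_on_bounded_linear[OF bounded_linear_Im]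

lemma smooth_on_compose:
  fixes f :: "'b::euclidean_space \<Rightarrow> 'c::real_normed_vector" and g :: "'a::real_normed_vector \<Rightarrow> 'b"
  shows "open V \<Longrightarrow> open W \<Longrightarrow> (\<And>x. x \<in> W \<Longrightarrow> g x \<in> V) \<Longrightarrow> smooth_on V f \<Longrightarrow> smooth_on W g \<Longrightarrow>
    smooth_on W (\<lambda>x. f (g x))"
  by (simp add: smooth_on_def differentiable_times_on_compose)

text \<open>The derivative of 1/f is a product of 1/f, f' and 1/f, so induction on the order with f
  fixed suffices.\<close>

lemma smooth_on_inverse:
  fixes f :: "'a::real_normed_vector \<Rightarrow> 'b::real_normed_field"
  assumes "open W" "smooth_on W f" "\<And>x. x \<in> W \<Longrightarrow> f x \<noteq> 0"
  shows "smooth_on W (\<lambda>x. inverse (f x))"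
  unfolding smooth_on_def
proof
  show "differentiable_times_on r W (\<lambda>x. inverse (f x))" for r
  proof (induction r)
    case 0
    then show ?case using assms smooth_on_continuous by (auto intro!: continuous_on_inverse)
  next
    case (Suc r)
    have d: "((\<lambda>x. inverse (f x)) has_derivative
        (\<lambda>v. - (inverse (f x) * frechet_derivative f (at x) v * inverse (f x)))) (at x)" if "x \<in> W" for x
      using Deriv.has_derivative_inverse[OF assms(3)[OF that] smooth_on_has_derivative[OF assms(2) that]] .
    have df: "differentiable_times_on r W (\<lambda>x. frechet_derivative f (at x) v)" for v
      using smooth_on_frechet_derivative[OF assms(2), of v] by (simp add: smooth_on_def)
    have "differentiable_times_on r W (\<lambda>x. frechet_derivative (\<lambda>x. inverse (f x)) (at x) v)" for v
      by (rule differentiable_times_on_cong[OF assms(1) _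
          differentiable_times_on_bounded_linear[OF bounded_linear_minus[OF bounded_linear_ident] assms(1)
          differentiable_times_on_bilinear[OF bounded_bilinear_mult assms(1)
          differentiable_times_on_bilinear[OF bounded_bilinear_mult assms(1) Suc.IH df[of v]] Suc.IH]]])
        (use frechet_derivative_eqI[OF d] in auto)
    then show ?case using d by (auto simp: differentiable_def)
  qed
qed

lemma smooth_on_extend_zero:
  assumes "open U" "closed K" "K \<subseteq> U" "smooth_on U f" "\<And>x. x \<notin> K \<Longrightarrow> f x = 0"
  shows "smooth_on UNIV f"
proof (rule smooth_on_local)
  fix x
  show "\<exists>V. open V \<and> x \<in> V \<and> smooth_on V f"
  proof (cases "x \<in> U")
    case False
    then have "open (- K)" "x \<in> - K" using assms by auto
    moreover have "smooth_on (- K) f"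
      by (rule smooth_on_cong[OF _ _ smooth_on_const[of "- K" 0]]) (use assms in auto)
    ultimately show ?thesis by blast
  qed (use assms in auto)
qed

text \<open>The second difference of f over a small parallelogram is r^2 times a mixed derivative at
  some interior point, for either order of the two directions. When the parallelogram shrinks to x,
  continuity of both mixed derivatives forces them to agree there.\<close>

lemma frechet_derivative_swap_real:
  fixes f :: "'a::real_normed_vector \<Rightarrow> real"
  assumes "open W" "smooth_on W f" "x \<in> W"
  shows "frechet_derivative (\<lambda>y. frechet_derivative f (at y) v) (at x) w =
         frechet_derivative (\<lambda>y. frechet_derivative f (at y) w) (at x) v"
proof -
  define H where "H v w y = frechet_derivative (\<lambda>y. frechet_derivative f (at y) v) (at y) w" for v w y
  have smH: "smooth_on W (H v w)" for v w
    unfolding H_def by (intro smooth_on_frechet_derivative assms(2))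
  have line: "((\<lambda>s. g (z + s *\<^sub>R u)) has_real_derivative frechet_derivative g (at (z + s *\<^sub>R u)) u) (at s)"
    if "smooth_on W g" "z + s *\<^sub>R u \<in> W" for g :: "'a \<Rightarrow> real" and z s u
  proof -
    have 1: "((\<lambda>s. z + s *\<^sub>R u) has_derivative (\<lambda>h. h *\<^sub>R u)) (at s)"
      by (auto intro!: derivative_eq_intros)
    have 2: "((g \<circ> (\<lambda>s. z + s *\<^sub>R u)) has_derivative
        (frechet_derivative g (at (z + s *\<^sub>R u)) \<circ> (\<lambda>h. h *\<^sub>R u))) (at s)"
      by (rule diff_chain_at[OF 1 smooth_on_has_derivative[OF that]])
    have "linear (frechet_derivative g (at (z + s *\<^sub>R u)))"
      by (rule linear_frechet_derivative[OF smooth_on_differentiable[OF that]])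
    then show ?thesis using 2 unfolding has_field_derivative_def
      by (simp add: o_def linear_scale mult_commute_abs)
  qed
  have ex: "\<exists>a c. 0 < a \<and> a < r \<and> 0 < c \<and> c < r \<and>
      f (x + r *\<^sub>R v + r *\<^sub>R w) - f (x + r *\<^sub>R v) - (f (x + r *\<^sub>R w) - f x) =
      r * r * H v w (x + a *\<^sub>R v + c *\<^sub>R w)"
    if r: "0 < r" and box: "\<And>a c. 0 \<le> a \<Longrightarrow> a \<le> r \<Longrightarrow> 0 \<le> c \<Longrightarrow> c \<le> r \<Longrightarrow> x + a *\<^sub>R v + c *\<^sub>R w \<in> W"
    for r v w
  proof -
    have "\<exists>a>0. a < r \<and> (f (x + r *\<^sub>R w + r *\<^sub>R v) - f (x + r *\<^sub>R v)) - (f (x + r *\<^sub>R w + 0 *\<^sub>R v) - f (x + 0 *\<^sub>R v)) = (r - 0) *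
       (frechet_derivative f (at (x + r *\<^sub>R w + a *\<^sub>R v)) v - frechet_derivative f (at (x + a *\<^sub>R v)) v)"
    proof (rule MVT2[OF r])
      fix s assume s: "0 \<le> s" "s \<le> r"
      have "x + r *\<^sub>R w + s *\<^sub>R v \<in> W" "x + s *\<^sub>R v \<in> W"
        using box[of s r] box[of s 0] s r by (auto simp: add.commute add.left_commute)
      then show "((\<lambda>s. f (x + r *\<^sub>R w + s *\<^sub>R v) - f (x + s *\<^sub>R v)) has_real_derivative
         frechet_derivative f (at (x + r *\<^sub>R w + s *\<^sub>R v)) v - frechet_derivative f (at (x + s *\<^sub>R v)) v) (at s)"
        by (intro DERIV_diff line assms(2))
    qed
    then obtain a where a: "0 < a" "a < r" and a_eq: "f (x + r *\<^sub>R w + r *\<^sub>R v) - f (x + r *\<^sub>R v) - (f (x + r *\<^sub>R w) - f x) = r *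
       (frechet_derivative f (at (x + r *\<^sub>R w + a *\<^sub>R v)) v - frechet_derivative f (at (x + a *\<^sub>R v)) v)"
      by auto
    have "\<exists>c>0. c < r \<and> frechet_derivative f (at (x + a *\<^sub>R v + r *\<^sub>R w)) v -
        frechet_derivative f (at (x + a *\<^sub>R v + 0 *\<^sub>R w)) v = (r - 0) * H v w (x + a *\<^sub>R v + c *\<^sub>R w)"
      unfolding H_def
    proof (rule MVT2[OF r])
      fix s assume s: "0 \<le> s" "s \<le> r"
      then have "x + a *\<^sub>R v + s *\<^sub>R w \<in> W" using box[of a s] a by auto
      then show "((\<lambda>s. frechet_derivative f (at (x + a *\<^sub>R v + s *\<^sub>R w)) v) has_real_derivative
          frechet_derivative (\<lambda>y. frechet_derivative f (at y) v) (at (x + a *\<^sub>R v + s *\<^sub>R w)) w) (at s)"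
        by (intro line smooth_on_frechet_derivative assms(2))
    qed
    then obtain c where "0 < c" "c < r" "frechet_derivative f (at (x + a *\<^sub>R v + r *\<^sub>R w)) v -
        frechet_derivative f (at (x + a *\<^sub>R v)) v = r * H v w (x + a *\<^sub>R v + c *\<^sub>R w)"
      by auto
    then show ?thesis using a a_eq
      by (intro exI[of _ a] exI[of _ c]) (simp add: algebra_simps)
  qed
  have "H v w x = H w v x"
  proof (rule ccontr)
    assume ne: "H v w x \<noteq> H w v x"
    define \<epsilon> where "\<epsilon> = \<bar>H v w x - H w v x\<bar> / 2"
    have \<epsilon>: "\<epsilon> > 0" using ne by (simp add: \<epsilon>_def)
    have "isCont (H v w) x" "isCont (H w v) x"
      using smooth_on_continuous[OF smH] assms continuous_on_eq_continuous_at by blast+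
    then obtain d1 d2 where d1: "d1 > 0" "\<And>y. dist y x < d1 \<Longrightarrow> dist (H v w y) (H v w x) < \<epsilon>"
      and d2: "d2 > 0" "\<And>y. dist y x < d2 \<Longrightarrow> dist (H w v y) (H w v x) < \<epsilon>"
      using \<epsilon> unfolding continuous_at_eps_delta by metis
    obtain d3 where d3: "d3 > 0" "ball x d3 \<subseteq> W" using assms open_contains_ball by blast
    define d where "d = min d1 (min d2 d3)"
    define r where "r = d / (norm v + norm w + 1)"
    have pos: "d > 0" "norm v + norm w + 1 > 0" using d1 d2 d3 by (auto simp: d_def add_nonneg_pos)
    then have r: "r > 0" by (simp add: r_def)
    have near: "dist (x + a *\<^sub>R v + c *\<^sub>R w) x < d" if "0 \<le> a" "a \<le> r" "0 \<le> c" "c \<le> r" for a c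
    proof -
      have "dist (x + a *\<^sub>R v + c *\<^sub>R w) x \<le> norm (a *\<^sub>R v) + norm (c *\<^sub>R w)"
        using norm_triangle_ineq[of "a *\<^sub>R v" "c *\<^sub>R w"] by (simp add: dist_norm add.assoc)
      also have "\<dots> \<le> r * norm v + r * norm w" using that by (auto intro!: add_mono mult_right_mono)
      also have "\<dots> < r * (norm v + norm w + 1)" using r by (simp add: algebra_simps)
      also have "\<dots> = d" using pos by (simp add: r_def)
      finally show ?thesis .
    qed
    have box: "x + a *\<^sub>R v + c *\<^sub>R w \<in> W" if "0 \<le> a" "a \<le> r" "0 \<le> c" "c \<le> r" for a c
      using near[OF that] d3 by (auto simp: d_def dist_commute subset_iff)
    then have box': "x + a *\<^sub>R w + c *\<^sub>R v \<in> W" if "0 \<le> a" "a \<le> r" "0 \<le> c" "c \<le> r" for a c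
      using that by (metis add.assoc add.commute)
    obtain a c where ac: "0 < a" "a < r" "0 < c" "c < r"
      "f (x + r *\<^sub>R v + r *\<^sub>R w) - f (x + r *\<^sub>R v) - (f (x + r *\<^sub>R w) - f x) =
      r * r * H v w (x + a *\<^sub>R v + c *\<^sub>R w)" using ex[OF r box] by blast
    obtain a' c' where ac': "0 < a'" "a' < r" "0 < c'" "c' < r"
      "f (x + r *\<^sub>R w + r *\<^sub>R v) - f (x + r *\<^sub>R w) - (f (x + r *\<^sub>R v) - f x) =
      r * r * H w v (x + a' *\<^sub>R w + c' *\<^sub>R v)" using ex[OF r box'] by blast
    have "r * r * H v w (x + a *\<^sub>R v + c *\<^sub>R w) = r * r * H w v (x + a' *\<^sub>R w + c' *\<^sub>R v)"
      using ac(5) ac'(5) by (simp add: algebra_simps)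
    then have "H v w (x + a *\<^sub>R v + c *\<^sub>R w) = H w v (x + c' *\<^sub>R v + a' *\<^sub>R w)"
      using r by (simp add: algebra_simps)
    moreover have "dist (H v w (x + a *\<^sub>R v + c *\<^sub>R w)) (H v w x) < \<epsilon>"
      using d1(2) near[of a c] ac by (auto simp: d_def)
    moreover have "dist (H w v (x + c' *\<^sub>R v + a' *\<^sub>R w)) (H w v x) < \<epsilon>"
      using d2(2) near[of c' a'] ac' by (auto simp: d_def)
    ultimately show False unfolding \<epsilon>_def dist_real_def by (simp add: abs_if field_simps split: if_splits)
  qed
  then show ?thesis by (simp add: H_def)
qed

lemma frechet_derivative_linear_compose:
  assumes "bounded_linear L" "f differentiable (at x)"
  shows "frechet_derivative (\<lambda>y. L (f y)) (at x) v = L (frechet_derivative f (at x) v)"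
  by (rule frechet_derivative_eqI, rule bounded_linear.has_derivative[OF assms(1)])
    (use assms(2) in \<open>simp only: frechet_derivative_works\<close>)

text \<open>The mean value theorem behind the real case is about real values, hence the passage
  through real and imaginary parts.\<close>

lemma frechet_derivative_swap:
  fixes f :: "'a::real_normed_vector \<Rightarrow> complex"
  assumes "open W" "smooth_on W f" "x \<in> W"
  shows "frechet_derivative (\<lambda>y. frechet_derivative f (at y) v) (at x) w =
         frechet_derivative (\<lambda>y. frechet_derivative f (at y) w) (at x) v"
proof -
  have *: "L (frechet_derivative (\<lambda>y. frechet_derivative f (at y) v) (at x) w) =
           frechet_derivative (\<lambda>y. frechet_derivative (\<lambda>z. L (f z)) (at y) v) (at x) w"
    if L: "bounded_linear L" for L :: "complex \<Rightarrow> real" and v w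
  proof -
    have "L (frechet_derivative (\<lambda>y. frechet_derivative f (at y) v) (at x) w) =
          frechet_derivative (\<lambda>y. L (frechet_derivative f (at y) v)) (at x) w"
      by (rule frechet_derivative_linear_compose[OF L, symmetric],
          rule smooth_on_differentiable[OF smooth_on_frechet_derivative[OF assms(2)] assms(3)])
    also have "\<dots> = frechet_derivative (\<lambda>y. frechet_derivative (\<lambda>z. L (f z)) (at y) v) (at x) w"
      by (rule arg_cong[where f = "\<lambda>D. D w"], rule frechet_derivative_cong_open[OF assms(1,3)],
          rule frechet_derivative_linear_compose[OF L, symmetric],
          rule smooth_on_differentiable[OF assms(2)])
    finally show ?thesis .
  qed
  have "Re (frechet_derivative (\<lambda>y. frechet_derivative f (at y) v) (at x) w) =
        Re (frechet_derivative (\<lambda>y. frechet_derivative f (at y) w) (at x) v)"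
    unfolding *[OF bounded_linear_Re]
    by (rule frechet_derivative_swap_real[OF assms(1) _ assms(3)]) (intro smooth_on_Re assms(1,2))
  moreover have "Im (frechet_derivative (\<lambda>y. frechet_derivative f (at y) v) (at x) w) =
        Im (frechet_derivative (\<lambda>y. frechet_derivative f (at y) w) (at x) v)"
    unfolding *[OF bounded_linear_Im]
    by (rule frechet_derivative_swap_real[OF assms(1) _ assms(3)]) (intro smooth_on_Im assms(1,2))
  ultimately show ?thesis by (rule complex_eqI)
qed

section \<open>Rules for derivatives in a fixed direction and along lines\<close>

lemma frechet_derivative_add:
  "f differentiable (at x) \<Longrightarrow> g differentiable (at x) \<Longrightarrow>
    frechet_derivative (\<lambda>y. f y + g y) (at x) v = frechet_derivative f (at x) v + frechet_derivative g (at x) v"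
  unfolding frechet_derivative_works by (rule frechet_derivative_eqI) (rule has_derivative_add)

lemma frechet_derivative_diff:
  "f differentiable (at x) \<Longrightarrow> g differentiable (at x) \<Longrightarrow>
    frechet_derivative (\<lambda>y. f y - g y) (at x) v = frechet_derivative f (at x) v - frechet_derivative g (at x) v"
  unfolding frechet_derivative_works by (rule frechet_derivative_eqI) (rule has_derivative_diff)

lemma frechet_derivative_mult:
  fixes f g :: "'a::real_normed_vector \<Rightarrow> 'b::{real_normed_algebra,comm_ring}"
  shows "f differentiable (at x) \<Longrightarrow> g differentiable (at x) \<Longrightarrow>
    frechet_derivative (\<lambda>y. f y * g y) (at x) v = frechet_derivative f (at x) v * g x + f x * frechet_derivative g (at x) v"
  unfolding frechet_derivative_works
  by (subst frechet_derivative_eqI, rule bounded_bilinear.FDERIV[OF bounded_bilinear_mult])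
    (auto simp: add.commute)

lemma frechet_derivative_sum:
  "(\<And>i. i \<in> I \<Longrightarrow> f i differentiable (at x)) \<Longrightarrow>
    frechet_derivative (\<lambda>y. \<Sum>i\<in>I. f i y) (at x) v = (\<Sum>i\<in>I. frechet_derivative (f i) (at x) v)"
  unfolding frechet_derivative_works by (rule frechet_derivative_eqI) (rule has_derivative_sum)

lemma frechet_derivative_compose:
  assumes "f differentiable (at (g x))" "g differentiable (at x)"
  shows "frechet_derivative (\<lambda>y. f (g y)) (at x) v =
    frechet_derivative f (at (g x)) (frechet_derivative g (at x) v)"
  using frechet_derivative_compose[OF assms(2,1)] by (simp add: o_def)

lemma frechet_derivative_of_real:
  "f differentiable (at x) \<Longrightarrow>
    frechet_derivative (\<lambda>y. of_real (f y)) (at x) v = of_real (frechet_derivative f (at x) v)"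
  by (rule frechet_derivative_linear_compose[OF bounded_linear_of_real])

lemma has_vector_derivative_along_line:
  assumes "f differentiable (at (z + s *\<^sub>R u))"
  shows "((\<lambda>s. f (z + s *\<^sub>R u)) has_vector_derivative frechet_derivative f (at (z + s *\<^sub>R u)) u) (at s)"
proof -
  have 1: "((\<lambda>s. z + s *\<^sub>R u) has_derivative (\<lambda>h. h *\<^sub>R u)) (at s)"
    by (auto intro!: derivative_eq_intros)
  have 2: "((f \<circ> (\<lambda>s. z + s *\<^sub>R u)) has_derivative
      (frechet_derivative f (at (z + s *\<^sub>R u)) \<circ> (\<lambda>h. h *\<^sub>R u))) (at s)"
    by (rule diff_chain_at[OF 1 frechet_derivative_works[THEN iffD1, OF assms]])
  show ?thesis using 2 linear_frechet_derivative[OF assms] unfolding has_vector_derivative_def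
    by (simp add: o_def linear_scale)
qed

lemma frechet_derivative_zero_along_line:
  assumes "f differentiable (at x)" "d > 0" "\<And>t. \<bar>t\<bar> < d \<Longrightarrow> f (x + t *\<^sub>R u) = f x"
  shows "frechet_derivative f (at x) u = 0"
proof -
  have "((\<lambda>s. f (x + s *\<^sub>R u)) has_vector_derivative frechet_derivative f (at x) u) (at 0)"
    using has_vector_derivative_along_line[of f x 0 u] assms(1) by simp
  moreover have "((\<lambda>s. f (x + s *\<^sub>R u)) has_vector_derivative 0) (at 0)"
    by (rule has_vector_derivative_transform_within_open[of "\<lambda>s. f x" _ _ "ball 0 d"])
      (use assms in \<open>auto simp: dist_norm\<close>)
  ultimately show ?thesis by (rule vector_derivative_unique_at)
qed

lemma norm_diff_along_line_le:
  assumes "t \<ge> 0"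
    and "\<And>s. 0 \<le> s \<Longrightarrow> s \<le> t \<Longrightarrow> f differentiable (at (z + s *\<^sub>R u))"
    and "\<And>s. 0 \<le> s \<Longrightarrow> s \<le> t \<Longrightarrow> norm (frechet_derivative f (at (z + s *\<^sub>R u)) u) \<le> B"
  shows "norm (f (z + t *\<^sub>R u) - f z) \<le> B * t"
proof -
  have "norm (f (z + t *\<^sub>R u) - f (z + 0 *\<^sub>R u)) \<le> B * norm (t - 0)"
  proof (rule differentiable_bound[of "{0..t}"])
    show "((\<lambda>s. f (z + s *\<^sub>R u)) has_derivative (\<lambda>h. h *\<^sub>R frechet_derivative f (at (z + s *\<^sub>R u)) u)) (at s within {0..t})"
      if "s \<in> {0..t}" for s
      using has_vector_derivative_along_line[OF assms(2)] that
      by (auto simp: has_vector_derivative_def intro: has_derivative_at_withinI)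
    show "onorm (\<lambda>h. h *\<^sub>R frechet_derivative f (at (z + s *\<^sub>R u)) u) \<le> B" if "s \<in> {0..t}" for s
    proof (rule onorm_le)
      show "norm (h *\<^sub>R frechet_derivative f (at (z + s *\<^sub>R u)) u) \<le> B * norm h" for h
        using mult_left_mono[OF assms(3)[of s], of "\<bar>h\<bar>"] that by (simp add: mult.commute)
    qed
  qed (use assms in auto)
  then show ?thesis using assms by simp
qed

section \<open>Cutoff functions\<close>

text \<open>A family closed under differentiation: the derivative of p(1/t) exp(-1/t) is q(1/t)
  exp(-1/t) with q(X) = X^2 (p(X) - p'(X)). Smoothness of exp(-1/t) follows by an induction over all
  p at once.\<close>

definition poly_bump :: "real poly \<Rightarrow> real \<Rightarrow> real" where
  "poly_bump p t = (if t > 0 then poly p (1 / t) * exp (- (1 / t)) else 0)"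

lemma poly_exp_tendsto_0: "((\<lambda>x::real. poly p x * exp (- x)) \<longlongrightarrow> 0) at_top"
proof -
  have "((\<lambda>x. \<Sum>i\<le>degree p. coeff p i * (x ^ i / exp x)) \<longlongrightarrow> (\<Sum>i\<le>degree p. coeff p i * 0)) at_top"
    by (intro tendsto_sum tendsto_mult tendsto_const tendsto_power_div_exp_0)
  then show ?thesis
    by (simp add: poly_altdef sum_divide_distrib exp_minus divide_inverse sum_distrib_right mult.assoc)
qed

lemma poly_bump_has_derivative:
  "(poly_bump p has_real_derivative poly_bump (pCons 0 (pCons 0 (p - pderiv p))) t) (at t)"
proof (cases "t = 0")
  case t: True
  have "((\<lambda>h. poly_bump p h / h) \<longlongrightarrow> 0) (at_left 0)"
    by (rule tendsto_eventually) (auto simp: poly_bump_def eventually_at_filter)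
  moreover have "((\<lambda>h. poly_bump p h / h) \<longlongrightarrow> 0) (at_right 0)"
  proof (rule Lim_transform_eventually)
    show "((\<lambda>h. poly (pCons 0 p) (inverse h) * exp (- inverse h)) \<longlongrightarrow> 0) (at_right (0::real))"
      by (rule filterlim_compose[OF poly_exp_tendsto_0 filterlim_inverse_at_top_right])
    show "\<forall>\<^sub>F h in at_right 0. poly (pCons 0 p) (inverse h) * exp (- inverse h) = poly_bump p h / h"
      by (auto simp: eventually_at_filter poly_bump_def field_simps)
  qed
  ultimately have "((\<lambda>h. poly_bump p h / h) \<longlongrightarrow> 0) (at 0)"
    by (simp add: filterlim_split_at_real filterlim_at_split)
  then show ?thesis unfolding t by (simp add: DERIV_def poly_bump_def)
next
  case False
  show ?thesis
  proof (cases "t > 0")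
    case True
    have "((\<lambda>t. poly p (1 / t) * exp (- (1 / t))) has_real_derivative
        poly_bump (pCons 0 (pCons 0 (p - pderiv p))) t) (at t)"
      using True by (auto intro!: derivative_eq_intros
          simp: poly_bump_def field_simps power2_eq_square)
    then show ?thesis
      by (rule has_field_derivative_transform_within_open[of _ _ _ "{0<..}"])
        (use True in \<open>auto simp: poly_bump_def\<close>)
  next
    case neg: False
    have "((\<lambda>t. 0) has_real_derivative poly_bump (pCons 0 (pCons 0 (p - pderiv p))) t) (at t)"
      using neg by (auto simp: poly_bump_def)
    then show ?thesis
      by (rule has_field_derivative_transform_within_open[of _ _ _ "{..<0}"])
        (use neg False in \<open>auto simp: poly_bump_def\<close>)
  qed
qed

lemma smooth_on_poly_bump: "smooth_on UNIV (poly_bump p)"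
proof -
  have d: "(poly_bump p has_derivative (\<lambda>h. poly_bump (pCons 0 (pCons 0 (p - pderiv p))) t * h)) (at t)" for p t
    using poly_bump_has_derivative[of p t] by (simp add: has_field_derivative_def)
  have "differentiable_times_on r UNIV (poly_bump p)" for r
  proof (induction r arbitrary: p)
    case 0
    show ?case using d has_derivative_continuous by (fastforce simp: continuous_on_eq_continuous_at)
  next
    case (Suc r)
    have "poly_bump p differentiable (at t)" for t using d by (auto simp: differentiable_def)
    moreover have "differentiable_times_on r UNIV (\<lambda>t. frechet_derivative (poly_bump p) (at t) v)" for v
      unfolding frechet_derivative_eqI[OF d]
      by (rule differentiable_times_on_bounded_linear[OF bounded_linear_mult_left]) (use Suc.IH in auto)
    ultimately show ?case by simp
  qed
  then show ?thesis by (simp add: smooth_on_def)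
qed

abbreviation "bump \<equiv> poly_bump 1"

lemma bump_pos: "t > 0 \<Longrightarrow> bump t > 0"
  and bump_nonneg: "bump t \<ge> 0"
  and bump_eq_0: "t \<le> 0 \<Longrightarrow> bump t = 0"
  by (auto simp: poly_bump_def)

lemma frechet_derivative_bump:
  "frechet_derivative bump (at t) v = (if t > 0 then exp (- (1 / t)) / t\<^sup>2 * v else 0)"
  using frechet_derivative_eqI[OF poly_bump_has_derivative[of 1 t, unfolded has_field_derivative_def]]
  by (auto simp: poly_bump_def power2_eq_square field_simps)

lemma smooth_on_bump_compose: "open W \<Longrightarrow> smooth_on W g \<Longrightarrow> smooth_on W (\<lambda>x. bump (g x))"
  by (rule smooth_on_compose[OF open_UNIV _ UNIV_I smooth_on_poly_bump])

definition step :: "real \<Rightarrow> real" where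
  "step t = bump t * inverse (bump t + bump (1 - t))"

lemma step_denominator_pos: "bump t + bump (1 - t) > 0"
  using bump_pos[of t] bump_pos[of "1 - t"] bump_nonneg[of t] bump_nonneg[of "1 - t"] by linarith

lemma step_eq_0: "t \<le> 0 \<Longrightarrow> step t = 0"
  and step_eq_1: "t \<ge> 1 \<Longrightarrow> step t = 1"
  and step_nonneg: "step t \<ge> 0"
  and step_le_1: "step t \<le> 1"
  using step_denominator_pos[of t] bump_nonneg[of "1 - t"] bump_nonneg[of t]
  by (auto simp: step_def bump_eq_0 field_simps)

lemma smooth_on_step: "smooth_on UNIV step"
proof -
  have "smooth_on UNIV (\<lambda>t. bump (1 - t))"
    by (intro smooth_on_bump_compose smooth_on_diff smooth_on_const smooth_on_id) auto
  then have "smooth_on UNIV (\<lambda>t. bump t * inverse (bump t + bump (1 - t)))"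
    using step_denominator_pos
    by (intro smooth_on_mult smooth_on_inverse smooth_on_add smooth_on_poly_bump) (auto simp: less_imp_neq[symmetric])
  then show ?thesis unfolding step_def[abs_def] .
qed

lemma smooth_on_step_compose: "open W \<Longrightarrow> smooth_on W g \<Longrightarrow> smooth_on W (\<lambda>x. step (g x))"
  by (rule smooth_on_compose[OF open_UNIV _ UNIV_I smooth_on_step])

lemma frechet_derivative_step_eq_0:
  assumes "t < 0 \<or> t > 1"
  shows "frechet_derivative step (at t) v = 0"
proof -
  have *: "frechet_derivative step (at t) v = frechet_derivative (\<lambda>_. c) (at t) v"
    if "open A" "t \<in> A" "\<And>s. s \<in> A \<Longrightarrow> step s = c" for A c
    by (rule arg_cong[where f = "\<lambda>D. D v"], rule frechet_derivative_cong_open[OF that])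
  show ?thesis
    using assms *[of "{..<0}" 0] *[of "{1<..}" 1] by (auto simp: step_eq_0 step_eq_1)
qed

text \<open>If F vanishes to first order in \<rho>, this bound controls (m + 1) step'((m + 1)
  \<rho>) F uniformly in m.\<close>

lemma step_derivative_bounded: "\<exists>C. \<forall>t. \<bar>frechet_derivative step (at t) 1 * t\<bar> \<le> C"
proof -
  have "continuous_on UNIV (\<lambda>t. frechet_derivative step (at t) 1)"
    using smooth_on_continuous[OF smooth_on_frechet_derivative[OF smooth_on_step]] .
  then have "continuous_on {0..1} (\<lambda>t. frechet_derivative step (at t) 1 * t)"
    by (auto intro!: continuous_intros intro: continuous_on_subset)
  then have "bounded ((\<lambda>t. frechet_derivative step (at t) 1 * t) ` {0..1})"
    by (intro compact_imp_bounded compact_continuous_image) auto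
  then obtain C where C: "\<forall>t\<in>{0..1}. \<bar>frechet_derivative step (at t) 1 * t\<bar> \<le> C"
    by (auto simp: bounded_iff)
  then have "0 \<le> C" by force
  then have "\<bar>frechet_derivative step (at t) 1 * t\<bar> \<le> C" for t
    using C frechet_derivative_step_eq_0[of t 1] by (cases "t \<in> {0..1}") auto
  then show ?thesis by blast
qed

text \<open>A sum of bumps over finitely many balls covering K is positive on K and vanishes off the
  balls; dividing by a positive lower bound on K before applying \<open>step\<close> makes it 1 on
  K.\<close>

lemma smooth_cutoff:
  fixes K V :: "'a::euclidean_space set"
  assumes "compact K" "open V" "K \<subseteq> V"
  shows "\<exists>\<eta>::'a \<Rightarrow> real. \<exists>C. smooth_on UNIV \<eta> \<and> (\<forall>x. 0 \<le> \<eta> x \<and> \<eta> x \<le> 1) \<and> (\<forall>x\<in>K. \<eta> x = 1) \<and>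
    compact C \<and> C \<subseteq> V \<and> (\<forall>x. x \<notin> C \<longrightarrow> \<eta> x = 0)"
proof -
  have "\<exists>r>0. cball x r \<subseteq> V" if "x \<in> K" for x
    using assms that open_contains_cball by blast
  then obtain r where r: "\<And>x. x \<in> K \<Longrightarrow> r x > 0 \<and> cball x (r x) \<subseteq> V" by metis
  have cover: "K \<subseteq> (\<Union>x\<in>K. ball x (r x))"
  proof
    fix x assume x: "x \<in> K"
    then have "x \<in> ball x (r x)" using r[OF x] by simp
    then show "x \<in> (\<Union>x\<in>K. ball x (r x))" using x by (rule UN_I[rotated])
  qed
  obtain F where F: "F \<subseteq> K" "finite F" "K \<subseteq> (\<Union>x\<in>F. ball x (r x))"
    using compactE_image[of K K "\<lambda>x. ball x (r x)"] assms(1) cover by auto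
  define s where "s x = (\<Sum>c\<in>F. bump ((r c)\<^sup>2 - (x - c) \<bullet> (x - c)))" for x
  have smooth_s: "smooth_on UNIV s"
    unfolding s_def
    by (intro smooth_on_sum smooth_on_bump_compose smooth_on_diff smooth_on_const smooth_on_bilinear[OF bounded_bilinear_inner] smooth_on_id) auto
  have s_nonneg: "s x \<ge> 0" for x unfolding s_def by (intro sum_nonneg bump_nonneg)
  have s_pos: "s x > 0" if x: "x \<in> K" for x
  proof -
    obtain c where c: "c \<in> F" "x \<in> ball c (r c)" using F x by blast
    then have "(norm (x - c))\<^sup>2 < (r c)\<^sup>2"
      by (intro power_strict_mono) (auto simp: dist_norm norm_minus_commute)
    then have "bump ((r c)\<^sup>2 - (x - c) \<bullet> (x - c)) > 0"
      by (intro bump_pos) (simp add: power2_norm_eq_inner)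
    then show ?thesis unfolding s_def using c F(2)
      by (intro sum_pos2) (auto simp: bump_nonneg)
  qed
  have s_0: "s x = 0" if "x \<notin> (\<Union>c\<in>F. cball c (r c))" for x
    unfolding s_def
  proof (intro sum.neutral ballI bump_eq_0)
    fix c assume c: "c \<in> F"
    then have "r c \<le> norm (x - c)" "0 \<le> r c" using that r F by (auto simp: dist_norm norm_minus_commute less_imp_le)
    then have "(r c)\<^sup>2 \<le> (norm (x - c))\<^sup>2" by (intro power_mono) auto
    then show "(r c)\<^sup>2 - (x - c) \<bullet> (x - c) \<le> 0" by (simp add: power2_norm_eq_inner)
  qed
  have "\<exists>m>0. \<forall>x\<in>K. m \<le> s x"
  proof (cases "K = {}")
    case False
    have "continuous_on K s" using smooth_on_continuous[OF smooth_s] continuous_on_subset by blast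
    then obtain x0 where "x0 \<in> K" "\<And>x. x \<in> K \<Longrightarrow> s x0 \<le> s x"
      using continuous_attains_inf[OF assms(1) False] by blast
    then show ?thesis using s_pos by blast
  qed (auto intro: exI[of _ 1])
  then obtain m where m: "m > 0" "\<And>x. x \<in> K \<Longrightarrow> m \<le> s x" by blast
  show ?thesis
  proof (intro exI conjI allI ballI impI)
    show "smooth_on UNIV (\<lambda>x. step (s x * (1 / m)))"
      by (intro smooth_on_step_compose smooth_on_mult smooth_on_const smooth_s) auto
    show "compact (\<Union>c\<in>F. cball c (r c))" using F by auto
    show "(\<Union>c\<in>F. cball c (r c)) \<subseteq> V" using r F by blast
  qed (use m s_0 in \<open>auto simp: step_nonneg step_le_1 step_eq_1 step_eq_0 field_simps\<close>)
qed

text \<open>The sum of \<open>1 - \<eta>\<^sub>m\<close> over cutoffs \<open>\<eta>\<^sub>m\<close> of a compact exhaustion is smooth and grows at least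
  like the inverse distance to the complement of \<open>U\<close>.\<close>

lemma smooth_radius:
  fixes U :: "'a::euclidean_space set"
  assumes U: "open U"
  shows "\<exists>g::'a \<Rightarrow> real. smooth_on U g \<and> (\<forall>x\<in>U. g x > 0 \<and> ball x (g x) \<subseteq> U)"
proof (cases "U = UNIV")
  case True
  then show ?thesis by (auto intro!: exI[of _ "\<lambda>x. 1"] smooth_on_const)
next
  case False
  then have ne: "- U \<noteq> {}" and cl: "closed (- U)" using U by auto
  define d where "d x = infdist x (- U)" for x
  have cont: "continuous_on UNIV d" unfolding d_def by (intro continuous_intros)
  define K where "K m = cball 0 (real m) \<inter> {x. d x \<ge> 1 / (real m + 1)}" for m
  define V where "V m = ball 0 (real m + 1) \<inter> {x. d x > 1 / (real m + 2)}" for m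
  have K: "compact (K m)" for m
    unfolding K_def by (intro compact_Int_closed closed_Collect_le cont continuous_on_const) auto
  have V: "open (V m)" for m
    unfolding V_def by (intro open_Int open_Collect_less cont continuous_on_const) auto
  have KV: "K m \<subseteq> V m" for m
  proof -
    have "1 / (real m + 2) < 1 / (real m + 1)" by (simp add: field_simps)
    then show ?thesis by (auto simp: K_def V_def)
  qed
  define P where "P m \<eta> \<longleftrightarrow> smooth_on UNIV \<eta> \<and> (\<forall>x. \<eta> x \<le> 1) \<and> (\<forall>x\<in>K m. \<eta> x = 1) \<and>
    (\<forall>x. x \<notin> V m \<longrightarrow> \<eta> x = 0)" for m and \<eta> :: "'a \<Rightarrow> real"
  have "\<exists>\<eta>. P m \<eta>" for m
    using smooth_cutoff[OF K V KV, of m] unfolding P_def by blast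
  then obtain \<eta> where "\<And>m. P m (\<eta> m)" by metis
  then have \<eta>: "smooth_on UNIV (\<eta> m)" "\<eta> m x \<le> 1" "x \<in> K m \<Longrightarrow> \<eta> m x = 1" "x \<notin> V m \<Longrightarrow> \<eta> m x = 0" for m x
    by (simp_all add: P_def)
  define G where "G x = (\<Sum>m. 1 - \<eta> m x)" for x
  have mono: "V m \<subseteq> K m'" if "m < m'" for m m'
  proof -
    have "real m + 1 \<le> real m'" using that by linarith
    moreover from this have "1 / (real m' + 1) \<le> 1 / (real m + 2)" by (simp add: field_simps)
    ultimately show ?thesis by (auto simp: K_def V_def)
  qed
  have G_fin: "G x = (\<Sum>m\<le>N. 1 - \<eta> m x)" if "x \<in> V N" for x N
    unfolding G_def by (rule suminf_finite) (use \<eta>(3) subsetD[OF mono that] in \<open>auto simp: not_le\<close>)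
  have exV: "\<exists>N. x \<in> V N" if "x \<in> U" for x
  proof -
    have "d x > 0" unfolding d_def using infdist_pos_not_in_closed[OF cl ne] that by auto
    then obtain N1 where N1: "1 / d x < real N1" using reals_Archimedean2 by blast
    obtain N2 where N2: "norm x < real N2" using reals_Archimedean2 by blast
    have "1 / d x < real (max N1 N2) + 2" using N1 by simp
    then have "1 / (real (max N1 N2) + 2) < d x" using \<open>d x > 0\<close> by (simp add: field_simps)
    moreover have "norm x < real (max N1 N2) + 1" using N2 by simp
    ultimately have "x \<in> V (max N1 N2)" by (simp add: V_def)
    then show ?thesis by blast
  qed
  have smG: "smooth_on U G"
  proof (rule smooth_on_local)
    fix x assume "x \<in> U"
    then obtain N where N: "x \<in> V N" using exV by blast
    have "smooth_on (V N) (\<lambda>x. \<Sum>m\<le>N. 1 - \<eta> m x)"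
      by (intro smooth_on_sum smooth_on_diff smooth_on_const V) (use \<eta>(1) smooth_on_subset in blast)
    then have "smooth_on (V N) G" by (rule smooth_on_cong[OF V, rotated]) (use G_fin in simp)
    then show "\<exists>V. open V \<and> x \<in> V \<and> smooth_on V G" using V N by blast
  qed
  have bnd: "G x \<ge> 0 \<and> 1 / d x \<le> G x + 2" if x: "x \<in> U" for x
  proof -
    have dx: "d x > 0" unfolding d_def using infdist_pos_not_in_closed[OF cl ne] x by auto
    obtain N where N: "x \<in> V N" using exV[OF x] by blast
    \<comment> \<open>For m in L the point x lies outside \<open>V m\<close>, so the m-th summand of
      G is exactly 1, and L has at least 1 / d x - 2 elements.\<close>
    define L where "L = {m. m \<le> N \<and> real m + 2 \<le> 1 / d x}"
    have "1 / d x < real N + 2" using N dx by (auto simp: V_def field_simps)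
    then have L: "L = {m. real m + 2 \<le> 1 / d x}" by (auto simp: L_def)
    have "1 - \<eta> m x = 1" if "m \<in> L" for m
    proof -
      have "d x \<le> 1 / (real m + 2)" using that dx unfolding L by (simp add: field_simps)
      then have "x \<notin> V m" by (simp add: V_def)
      then show ?thesis using \<eta>(4) by simp
    qed
    then have "real (card L) = (\<Sum>m\<in>L. 1 - \<eta> m x)" by simp
    also have "\<dots> \<le> (\<Sum>m\<le>N. 1 - \<eta> m x)"
      by (intro sum_mono2) (use \<eta>(2) in \<open>auto simp: L_def\<close>)
    finally have "real (card L) \<le> G x" using G_fin[OF N] by simp
    moreover have "1 / d x \<le> real (card L) + 2"
    proof (cases "1 / d x \<ge> 2")
      case True
      define q where "q = nat \<lfloor>1 / d x - 2\<rfloor>"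
      have "real q \<le> 1 / d x - 2" unfolding q_def using True by linarith
      then have "{..q} \<subseteq> L" unfolding L by auto
      moreover have "finite L" unfolding L_def by simp
      ultimately have "q + 1 \<le> card L" using card_mono[of L "{..q}"] by simp
      moreover have "1 / d x - 2 < real q + 1" unfolding q_def using True by linarith
      ultimately show ?thesis by linarith
    qed linarith
    ultimately show ?thesis by linarith
  qed
  show ?thesis
  proof (intro exI conjI ballI)
    \<comment> \<open>Since 1 / d x \<le> G x + 2, one more unit makes the radius strictly smaller
      than the distance d x to the complement.\<close>
    show "smooth_on U (\<lambda>x. inverse (G x + 3))"
      using bnd by (intro smooth_on_inverse smooth_on_add smG smooth_on_const U) force
    fix x assume x: "x \<in> U"
    show "inverse (G x + 3) > 0" using bnd[OF x] by simp
    have dx: "d x > 0" unfolding d_def using infdist_pos_not_in_closed[OF cl ne] x by auto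
    have "inverse (G x + 3) < d x" using bnd[OF x] dx by (simp add: field_simps)
    then have "y \<in> U" if "dist x y < inverse (G x + 3)" for y
      using that infdist_le[of y "- U" x] unfolding d_def by fastforce
    then show "ball x (inverse (G x + 3)) \<subseteq> U" by auto
  qed
qed

section \<open>Integration of compactly supported functions\<close>

definition test_on :: "'a::euclidean_space set \<Rightarrow> ('a \<Rightarrow> complex) \<Rightarrow> bool" where
  "test_on U F \<longleftrightarrow> smooth_on UNIV F \<and> (\<exists>K. compact K \<and> K \<subseteq> U \<and> (\<forall>x. x \<notin> K \<longrightarrow> F x = 0))"

lemma test_onI:
  "open U \<Longrightarrow> compact K \<Longrightarrow> K \<subseteq> U \<Longrightarrow> smooth_on U F \<Longrightarrow> (\<And>x. x \<notin> K \<Longrightarrow> F x = 0) \<Longrightarrow> test_on U F"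
  unfolding test_on_def using smooth_on_extend_zero[of U K F] compact_imp_closed by blast

lemma test_on_smooth: "test_on U F \<Longrightarrow> smooth_on W F"
  unfolding test_on_def using smooth_on_subset by blast

lemma test_on_subset: "test_on V F \<Longrightarrow> V \<subseteq> U \<Longrightarrow> test_on U F"
  unfolding test_on_def by blast

lemma test_on_eq_0: "test_on U F \<Longrightarrow> x \<notin> U \<Longrightarrow> F x = 0"
  unfolding test_on_def by blast

lemma test_on_mult:
  assumes "open U" "test_on U F" "smooth_on U G"
  shows "test_on U (\<lambda>x. G x * F x)"
proof -
  obtain K where "compact K" "K \<subseteq> U" "\<And>x. x \<notin> K \<Longrightarrow> F x = 0"
    using assms(2) by (auto simp: test_on_def)
  then show ?thesis
    by (intro test_onI[of U K] assms(1) smooth_on_mult assms(3) test_on_smooth[OF assms(2)]) auto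
qed

lemma test_on_zero: "test_on U (\<lambda>x. 0)"
  unfolding test_on_def by (auto simp: smooth_on_const intro: exI[of _ "{}"])

lemma test_on_add:
  assumes "test_on U F" "test_on U G"
  shows "test_on U (\<lambda>x. F x + G x)"
proof -
  obtain K L where "compact K" "K \<subseteq> U" "\<And>x. x \<notin> K \<Longrightarrow> F x = 0" "compact L" "L \<subseteq> U" "\<And>x. x \<notin> L \<Longrightarrow> G x = 0"
    using assms by (auto simp: test_on_def)
  then show ?thesis unfolding test_on_def
    by (intro conjI smooth_on_add exI[of _ "K \<union> L"] test_on_smooth[OF assms(1)] test_on_smooth[OF assms(2)]) auto
qed

lemma test_on_cmult: "test_on U F \<Longrightarrow> test_on U (\<lambda>x. c * F x)"
  unfolding test_on_def by (auto intro!: smooth_on_mult smooth_on_const)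

lemma test_on_diff: "test_on U F \<Longrightarrow> test_on U G \<Longrightarrow> test_on U (\<lambda>x. F x - G x)"
  using test_on_add[of U F "\<lambda>x. - 1 * G x"] test_on_cmult[of U G "- 1"] by simp

lemma test_on_sum: "(\<And>i. i \<in> I \<Longrightarrow> test_on U (F i)) \<Longrightarrow> test_on U (\<lambda>x. \<Sum>i\<in>I. F i x)"
  by (induction I rule: infinite_finite_induct) (auto simp: test_on_zero intro: test_on_add)

lemma test_on_frechet_derivative:
  assumes "test_on U F"
  shows "test_on U (\<lambda>x. frechet_derivative F (at x) v)"
proof -
  obtain K where K: "compact K" "K \<subseteq> U" "\<And>x. x \<notin> K \<Longrightarrow> F x = 0"
    using assms by (auto simp: test_on_def)
  have "frechet_derivative F (at x) v = 0" if "x \<notin> K" for x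
  proof -
    have "open (- K)" using compact_imp_closed[OF K(1)] by (simp add: open_Compl)
    then show ?thesis using frechet_derivative_cong_open[of "- K" x F "\<lambda>_. 0"] K(3) that by simp
  qed
  then show ?thesis using K unfolding test_on_def
    by (intro conjI smooth_on_frechet_derivative test_on_smooth[OF assms]) blast
qed

lemma test_on_bounded:
  assumes "test_on U F"
  shows "\<exists>B. \<forall>x. norm (F x) \<le> B"
proof -
  obtain K where K: "compact K" "\<And>x. x \<notin> K \<Longrightarrow> F x = 0"
    using assms by (auto simp: test_on_def)
  have "bounded (F ` K)"
    by (intro compact_imp_bounded compact_continuous_image K smooth_on_continuous test_on_smooth[OF assms])
  then obtain B where "\<forall>x\<in>K. norm (F x) \<le> B" by (auto simp: bounded_iff)
  then have "norm (F x) \<le> max B 0" for x using K(2)[of x] by (cases "x \<in> K") force+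
  then show ?thesis by blast
qed

lemma test_on_integrable:
  assumes "test_on U F"
  shows "integrable lborel F"
proof -
  obtain K where K: "compact K" "\<And>x. x \<notin> K \<Longrightarrow> F x = 0"
    using assms by (auto simp: test_on_def)
  have "integrable lborel (\<lambda>x. indicator K x *\<^sub>R F x)"
    by (intro borel_integrable_compact K smooth_on_continuous test_on_smooth[OF assms])
  moreover have "(\<lambda>x. indicator K x *\<^sub>R F x) = F"
    using K(2) by (auto simp: indicator_def)
  ultimately show ?thesis by simp
qed

text \<open>By translation invariance of Lebesgue measure every difference quotient of F has
  integral 0; dominated convergence carries this over to the derivative.\<close>

lemma integral_frechet_derivative_test:
  fixes F :: "'a::euclidean_space \<Rightarrow> complex"
  assumes F: "test_on UNIV F"
  shows "(LINT x|lborel. frechet_derivative F (at x) v) = 0"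
proof -
  obtain K where K: "compact K" "\<And>x. x \<notin> K \<Longrightarrow> F x = 0"
    using F by (auto simp: test_on_def)
  have Fd: "F differentiable (at x)" for x using smooth_on_differentiable[OF test_on_smooth[OF F]] by blast
  obtain B where B: "\<And>x. norm (frechet_derivative F (at x) v) \<le> B"
    using test_on_bounded[OF test_on_frechet_derivative[OF F]] by blast
  \<comment> \<open>The step sizes 1 / (m + 1) lie in [0, 1], so this one compact set contains the
    supports of all difference quotients and carries the dominating function.\<close>
  define K' where "K' = (\<lambda>(x, s). x - s *\<^sub>R v) ` (K \<times> {0..1::real})"
  have K': "compact K'" unfolding K'_def
    by (intro compact_continuous_image compact_Times K)
      (auto intro!: continuous_intros simp: split_beta)
  have Fm: "F \<in> borel_measurable lborel" by (rule borel_measurable_integrable[OF test_on_integrable[OF F]])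
  define s where "s m x = (real m + 1) *\<^sub>R (F (x + (1 / (real m + 1)) *\<^sub>R v) - F x)" for m x
  have tr_int: "integrable lborel (\<lambda>x. F (x + w))" and tr_eq: "(LINT x|lborel. F (x + w)) = (LINT x|lborel. F x)" for w
  proof -
    have *: "integrable (distr lborel borel ((+) w)) F"
      unfolding lborel_distr_plus by (rule test_on_integrable[OF F])
    show "integrable lborel (\<lambda>x. F (x + w))"
      using integrable_distr[OF _ *] by (simp add: add.commute)
    show "(LINT x|lborel. F (x + w)) = (LINT x|lborel. F x)"
      using integral_distr[of "(+) w" lborel borel F] Fm unfolding lborel_distr_plus by (simp add: add.commute)
  qed
  have "(\<lambda>m. LINT x|lborel. s m x) \<longlonglongrightarrow> (LINT x|lborel. frechet_derivative F (at x) v)"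
  proof (rule integral_dominated_convergence[where w = "\<lambda>x. indicator K' x *\<^sub>R B"])
    show "(\<lambda>x. frechet_derivative F (at x) v) \<in> borel_measurable lborel"
      by (rule borel_measurable_integrable[OF test_on_integrable[OF test_on_frechet_derivative[OF F]]])
    show "s m \<in> borel_measurable lborel" for m
      unfolding s_def[abs_def]
      by (intro borel_measurable_scaleR borel_measurable_const borel_measurable_diff Fm
          borel_measurable_integrable[OF tr_int])
    show "integrable lborel (\<lambda>x. indicator K' x *\<^sub>R B)"
      by (intro borel_integrable_compact K' continuous_on_const)
    show "AE x in lborel. (\<lambda>m. s m x) \<longlonglongrightarrow> frechet_derivative F (at x) v"
    proof (intro AE_I2)
      fix x
      have "((\<lambda>t. F (x + t *\<^sub>R v)) has_vector_derivative frechet_derivative F (at x) v) (at 0)"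
        using has_vector_derivative_along_line[of F x 0 v] Fd by simp
      then have "((\<lambda>t. (1 / t) *\<^sub>R (F (x + t *\<^sub>R v) - F x)) \<longlongrightarrow> frechet_derivative F (at x) v) (at 0)"
      proof -
        assume "((\<lambda>t. F (x + t *\<^sub>R v)) has_vector_derivative frechet_derivative F (at x) v) (at 0)"
        then have "((\<lambda>t. norm (F (x + t *\<^sub>R v) - F x - t *\<^sub>R frechet_derivative F (at x) v) / norm t) \<longlongrightarrow> 0) (at 0)"
          by (simp add: has_vector_derivative_def has_derivative_at)
        then have "((\<lambda>t. norm ((1 / t) *\<^sub>R (F (x + t *\<^sub>R v) - F x) - frechet_derivative F (at x) v)) \<longlongrightarrow> 0) (at 0)"
        proof (rule Lim_transform_eventually)
          show "\<forall>\<^sub>F t in at 0. norm (F (x + t *\<^sub>R v) - F x - t *\<^sub>R frechet_derivative F (at x) v) / norm t =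
              norm ((1 / t) *\<^sub>R (F (x + t *\<^sub>R v) - F x) - frechet_derivative F (at x) v)"
            unfolding eventually_at_filter
          proof (intro always_eventually allI impI)
            fix t :: real assume "t \<noteq> 0"
            then have "(1 / t) *\<^sub>R (F (x + t *\<^sub>R v) - F x) - frechet_derivative F (at x) v =
                (1 / t) *\<^sub>R (F (x + t *\<^sub>R v) - F x - t *\<^sub>R frechet_derivative F (at x) v)"
              by (simp add: scaleR_right_diff_distrib)
            then show "norm (F (x + t *\<^sub>R v) - F x - t *\<^sub>R frechet_derivative F (at x) v) / norm t =
              norm ((1 / t) *\<^sub>R (F (x + t *\<^sub>R v) - F x) - frechet_derivative F (at x) v)"
              by (simp only: norm_scaleR) simp
          qed
        qed
        then show ?thesis by (simp only: tendsto_norm_zero_iff LIM_zero_iff)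
      qed
      moreover have "(\<lambda>m. 1 / (real m + 1)) \<longlonglongrightarrow> 0"
        using LIMSEQ_inverse_real_of_nat by (simp add: inverse_eq_divide add.commute)
      then have "filterlim (\<lambda>m. 1 / (real m + 1)) (at 0) sequentially"
        unfolding filterlim_at by (auto intro!: always_eventually)
      ultimately show "(\<lambda>m. s m x) \<longlonglongrightarrow> frechet_derivative F (at x) v"
        unfolding s_def by (auto dest: filterlim_compose)
    qed
    show "AE x in lborel. norm (s m x) \<le> indicator K' x *\<^sub>R B" for m
    proof (intro AE_I2)
      fix x
      let ?t = "1 / (real m + 1)"
      show "norm (s m x) \<le> indicator K' x *\<^sub>R B"
      proof (cases "x \<in> K'")
        case True
        have "norm (F (x + ?t *\<^sub>R v) - F x) \<le> B * ?t"
          by (rule norm_diff_along_line_le) (use B Fd in auto)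
        then have "(real m + 1) * norm (F (x + ?t *\<^sub>R v) - F x) \<le> B" by (simp add: field_simps)
        then show ?thesis using True unfolding s_def norm_scaleR by simp
      next
        case False
        have "F x = 0"
          using False K(2)[of x] by (force simp: K'_def image_iff)
        moreover have "F (x + ?t *\<^sub>R v) = 0"
        proof (rule K(2), rule notI)
          assume "x + ?t *\<^sub>R v \<in> K"
          then have "x \<in> K'" unfolding K'_def
            by (intro image_eqI[of _ _ "(x + ?t *\<^sub>R v, ?t)"]) (auto simp: field_simps)
          then show False using False by simp
        qed
        ultimately show ?thesis using False by (simp add: s_def)
      qed
    qed
  qed
  moreover have "(LINT x|lborel. s m x) = 0" for m
    unfolding s_def using tr_int tr_eq test_on_integrable[OF F] by simp
  ultimately show ?thesis by (simp add: LIMSEQ_const_iff)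
qed

section \<open>Integration over the domain above a graph\<close>

text \<open>\<open>\<psi>\<close> is invariant under all translations along e, while the formula for
  \<rho> is known only in U. Thus \<rho> (x + t e) = \<rho> x + t whenever both end points lie in U,
  even if the segment between them leaves it.\<close>

locale graph_domain =
  fixes e :: "'a::euclidean_space" and U D :: "'a set" and \<rho> \<psi> :: "'a \<Rightarrow> real"
  assumes open_U: "open U"
    and e_unit: "e \<bullet> e = 1"
    and \<psi>_invariant: "\<And>x t. \<psi> (x + t *\<^sub>R e) = \<psi> x"
    and \<rho>_eq: "\<And>x. x \<in> U \<Longrightarrow> \<rho> x = x \<bullet> e - \<psi> x"
    and smooth_\<psi>: "smooth_on U \<psi>"
    and D_eq: "D = {x. \<rho> x > 0}"
begin

definition S :: "'a set" where "S = {x \<in> U. \<rho> x = 0}"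

definition proj :: "'a \<Rightarrow> 'a" where "proj x = x - \<rho> x *\<^sub>R e"

text \<open>Moving along e to the graph may leave U. This is the open set on which
  \<open>proj\<close> lands on S, hence the natural domain of functions that continue boundary
  values constantly along e.\<close>

definition U0 :: "'a set" where "U0 = {x \<in> U. proj x \<in> U}"

lemma smooth_\<rho>: "smooth_on U \<rho>"
proof -
  have "smooth_on U (\<lambda>x. x \<bullet> e - \<psi> x)"
    by (intro smooth_on_diff smooth_\<psi> smooth_on_linear[OF bounded_linear_inner_left] open_U)
  then show ?thesis by (rule smooth_on_cong[OF open_U, rotated]) (simp add: \<rho>_eq)
qed

lemma \<rho>_shift: "x \<in> U \<Longrightarrow> x + t *\<^sub>R e \<in> U \<Longrightarrow> \<rho> (x + t *\<^sub>R e) = \<rho> x + t"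
  by (simp add: \<rho>_eq \<psi>_invariant inner_add_left e_unit)

lemma proj_shift: "x \<in> U \<Longrightarrow> x + t *\<^sub>R e \<in> U \<Longrightarrow> proj (x + t *\<^sub>R e) = proj x"
  by (simp add: proj_def \<rho>_shift scaleR_add_left)

lemma proj_S: "x \<in> S \<Longrightarrow> proj x = x" by (simp add: S_def proj_def)

lemma proj_in_S: "x \<in> U0 \<Longrightarrow> proj x \<in> S"
  using \<rho>_shift[of x "- \<rho> x"] by (auto simp: U0_def S_def proj_def)

lemma S_subset_U0: "S \<subseteq> U0" using proj_S by (auto simp: U0_def S_def)

lemma S_subset_U: "S \<subseteq> U" by (auto simp: S_def)
lemma U0_subset_U: "U0 \<subseteq> U" by (auto simp: U0_def)

lemma smooth_proj: "smooth_on U proj"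
  unfolding proj_def by (intro smooth_on_diff smooth_on_id smooth_on_scaleR smooth_\<rho> smooth_on_const open_U)

lemma open_U0: "open U0"
proof -
  have "open (U \<inter> proj -` U)"
    using continuous_open_preimage[OF smooth_on_continuous[OF smooth_proj] open_U open_U] .
  moreover have "U0 = U \<inter> proj -` U" by (auto simp: U0_def)
  ultimately show ?thesis by simp
qed

lemma smooth_compose_proj: "smooth_on U G \<Longrightarrow> smooth_on U0 (\<lambda>x. G (proj x))"
  by (rule smooth_on_compose[OF open_U open_U0])
    (auto simp: U0_def intro: smooth_on_subset[OF _ smooth_proj])

lemma open_ball_shift:
  assumes "open W" "x \<in> W"
  shows "\<exists>d>0. \<forall>t. \<bar>t\<bar> < d \<longrightarrow> x + t *\<^sub>R e \<in> W"
proof -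
  have "norm e = 1" using e_unit by (simp add: norm_eq_sqrt_inner)
  then show ?thesis using assms by (force simp: open_dist dist_norm)
qed

lemma derivative_e_zero:
  assumes "open W" "x \<in> W" "f differentiable (at x)" "\<And>t. x + t *\<^sub>R e \<in> W \<Longrightarrow> f (x + t *\<^sub>R e) = f x"
  shows "frechet_derivative f (at x) e = 0"
  using open_ball_shift[OF assms(1,2)] frechet_derivative_zero_along_line[of f x _ e] assms(3,4) by blast

lemma \<rho>_e: 
  assumes "x \<in> U"
  shows "frechet_derivative \<rho> (at x) e = 1"
proof -
  have "frechet_derivative (\<lambda>y. \<rho> y - y \<bullet> e) (at x) e = 0"
    by (rule derivative_e_zero[OF open_U assms])
      (use smooth_on_differentiable[OF smooth_\<rho> assms] assms in
        \<open>auto simp: \<rho>_shift inner_add_left e_unit intro!: differentiable_diff bounded_linear_imp_differentiable bounded_linear_inner_left\<close>)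
  moreover have "frechet_derivative (\<lambda>y. y \<bullet> e) (at x) e = 1"
    by (subst frechet_derivative_eqI[OF bounded_linear_imp_has_derivative[OF bounded_linear_inner_left]]) (rule e_unit)
  ultimately show ?thesis
    by (subst (asm) frechet_derivative_diff)
      (use smooth_on_differentiable[OF smooth_\<rho> assms] in
        \<open>auto intro!: bounded_linear_imp_differentiable bounded_linear_inner_left\<close>)
qed

lemma \<rho>'_shift:
  assumes "x \<in> U" "x + t *\<^sub>R e \<in> U"
  shows "frechet_derivative \<rho> (at (x + t *\<^sub>R e)) v = frechet_derivative \<rho> (at x) v"
proof -
  have s: "((\<lambda>y. y - t *\<^sub>R e) has_derivative (\<lambda>h. h)) (at (x + t *\<^sub>R e))"
    by (auto intro!: derivative_eq_intros)
  have "(\<rho> has_derivative frechet_derivative \<rho> (at x)) (at (x + t *\<^sub>R e - t *\<^sub>R e))"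
    using smooth_on_has_derivative[OF smooth_\<rho> assms(1)] by simp
  from diff_chain_at[OF s this]
  have "((\<lambda>y. \<rho> (y - t *\<^sub>R e)) has_derivative frechet_derivative \<rho> (at x)) (at (x + t *\<^sub>R e))"
    by (simp add: o_def)
  then have "((\<lambda>y. \<rho> (y - t *\<^sub>R e) + t) has_derivative frechet_derivative \<rho> (at x)) (at (x + t *\<^sub>R e))"
    by (rule has_derivative_add_const)
  then have d: "((\<lambda>y. \<rho> (y - t *\<^sub>R e) + t) has_derivative frechet_derivative \<rho> (at x)) (at (x + t *\<^sub>R e))" .
  have "open {y. y - t *\<^sub>R e \<in> U}"
    using open_vimage[OF open_U, of "\<lambda>y. y - t *\<^sub>R e"] by (simp add: vimage_def continuous_on_diff continuous_on_const)
  then have op: "open (U \<inter> {y. y - t *\<^sub>R e \<in> U})" using open_U by (rule open_Int[rotated])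
  have "(\<rho> has_derivative frechet_derivative \<rho> (at x)) (at (x + t *\<^sub>R e))"
  proof (rule has_derivative_transform_within_open[OF d op])
    show "\<rho> (y - t *\<^sub>R e) + t = \<rho> y" if "y \<in> U \<inter> {y. y - t *\<^sub>R e \<in> U}" for y
      using \<rho>_shift[of "y - t *\<^sub>R e" t] that by simp
  qed (use assms in auto)
  then show ?thesis by (rule frechet_derivative_eqI)
qed

text \<open>The tangential field v - d\<rho>(v) e has divergence minus this derivative, hence is
  divergence free.\<close>

lemma \<rho>'_e:
  assumes "x \<in> U"
  shows "frechet_derivative (\<lambda>y. frechet_derivative \<rho> (at y) v) (at x) e = 0"
  by (rule derivative_e_zero[OF open_U assms smooth_on_differentiable[OF smooth_on_frechet_derivative[OF smooth_\<rho>] assms]])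
    (rule \<rho>'_shift[OF assms])

text \<open>Along e the function \<rho> has slope 1, so each of its zeros in U is a limit of points
  of D; where \<rho> is nonzero, its sign is locally constant by continuity.\<close>

lemma S_eq_frontier: "S = frontier D \<inter> U"
proof -
  have cont: "continuous_on U \<rho>" by (rule smooth_on_continuous[OF smooth_\<rho>])
  have opD: "open (D \<inter> U)"
  proof -
    have "open (U \<inter> \<rho> -` {0<..})" by (rule continuous_open_preimage[OF cont open_U]) simp
    then show ?thesis unfolding D_eq by (simp add: vimage_def Int_commute Collect_conj_eq[symmetric] Int_def)
  qed
  have opN: "open (U \<inter> \<rho> -` {..<0})" by (rule continuous_open_preimage[OF cont open_U]) simp
  have 1: "x \<in> frontier D" if x: "x \<in> S" for x
  proof -
    have xU: "x \<in> U" "\<rho> x = 0" using x by (auto simp: S_def)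
    have "x \<notin> interior D" using interior_subset xU(2) D_eq by force
    moreover have "x \<in> closure D"
      unfolding closure_approachable
    proof (intro allI impI)
      fix r :: real assume r: "r > 0"
      obtain d where d: "d > 0" "\<And>t. \<bar>t\<bar> < d \<Longrightarrow> x + t *\<^sub>R e \<in> ball x r \<inter> U"
        using open_ball_shift[of "ball x r \<inter> U" x] xU r open_U by auto
      have "x + (d/2) *\<^sub>R e \<in> ball x r \<inter> U" using d by auto
      moreover have "\<rho> (x + (d/2) *\<^sub>R e) > 0" using \<rho>_shift[of x "d/2"] xU calculation d by auto
      ultimately show "\<exists>y\<in>D. dist y x < r" by (auto simp: D_eq dist_commute intro!: bexI[of _ "x + (d/2) *\<^sub>R e"])
    qed
    ultimately show ?thesis by (simp add: frontier_def)
  qed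
  have 2: "\<rho> x = 0" if "x \<in> frontier D" "x \<in> U" for x
  proof (rule ccontr)
    assume "\<rho> x \<noteq> 0"
    then consider "\<rho> x > 0" | "\<rho> x < 0" by linarith
    then show False
    proof cases
      case 1
      then have "x \<in> D \<inter> U" using that by (simp add: D_eq)
      then have "x \<in> interior D" using opD interiorI by blast
      then show False using that by (simp add: frontier_def)
    next
      case 2
      then have "x \<in> U \<inter> \<rho> -` {..<0}" using that by simp
      moreover have "(U \<inter> \<rho> -` {..<0}) \<inter> D = {}" by (auto simp: D_eq)
      ultimately have "x \<notin> closure D" using opN by (meson disjoint_iff open_Int_closure_eq_empty)
      then show False using that by (simp add: frontier_def)
    qed
  qed
  show ?thesis using 1 2 S_subset_U by (auto simp: S_def)
qed

lemma open_D: "open (D \<inter> U)"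
proof -
  have "open (U \<inter> \<rho> -` {0<..})"
    by (rule continuous_open_preimage[OF smooth_on_continuous[OF smooth_\<rho>] open_U]) simp
  moreover have "U \<inter> \<rho> -` {0<..} = D \<inter> U" by (auto simp: D_eq)
  ultimately show ?thesis by simp
qed

lemma indicator_test: "test_on U F \<Longrightarrow> indicator D x *\<^sub>R F x = indicator (D \<inter> U) x *\<^sub>R F x"
  using test_on_eq_0[of U F x] by (auto simp: indicator_def)

lemma set_integrable_test:
  assumes "test_on U F"
  shows "set_integrable lborel D F"
proof -
  have "integrable lborel (\<lambda>x. indicator (D \<inter> U) x *\<^sub>R F x)"
    using test_on_integrable[OF assms] open_D by (intro integrable_mult_indicator) auto
  then show ?thesis by (simp add: set_integrable_def indicator_test[OF assms])
qed

lemma integral_D_add: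
  "test_on U F \<Longrightarrow> test_on U G \<Longrightarrow> (LINT x:D|lborel. F x + G x) = (LINT x:D|lborel. F x) + (LINT x:D|lborel. G x)"
  by (intro set_integral_add set_integrable_test)

lemma integral_D_diff:
  "test_on U F \<Longrightarrow> test_on U G \<Longrightarrow> (LINT x:D|lborel. F x - G x) = (LINT x:D|lborel. F x) - (LINT x:D|lborel. G x)"
  by (intro set_integral_diff set_integrable_test)

lemma integral_D_sum:
  assumes "\<And>i. i \<in> I \<Longrightarrow> test_on U (F i)"
  shows "(LINT x:D|lborel. (\<Sum>i\<in>I. F i x)) = (\<Sum>i\<in>I. LINT x:D|lborel. F i x)"
  using assms
proof (induction I rule: infinite_finite_induct)
  case (insert i I)
  then show ?case by (simp add: integral_D_add test_on_sum)
qed (auto simp: set_lebesgue_integral_def)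

lemma integral_D_cmult: "(LINT x:D|lborel. c * F x) = c * (LINT x:D|lborel. F x :: complex)"
  by (rule set_integral_mult_right)

definition Hstep :: "nat \<Rightarrow> 'a \<Rightarrow> complex" where
  "Hstep m x = of_real (step ((real m + 1) * \<rho> x))"

lemma smooth_Hstep: "smooth_on U (Hstep m)"
  unfolding Hstep_def[abs_def]
  by (intro smooth_on_of_real open_U smooth_on_step_compose smooth_on_mult smooth_on_const smooth_\<rho>)

lemma Hstep_derivative:
  assumes x: "x \<in> U"
  shows "frechet_derivative (Hstep m) (at x) v =
    of_real (frechet_derivative step (at ((real m + 1) * \<rho> x)) 1 * (real m + 1) * frechet_derivative \<rho> (at x) v)"
proof -
  have d1: "step differentiable (at s)" for s by (rule smooth_on_differentiable[OF smooth_on_step UNIV_I])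
  have d2: "(\<lambda>y. (real m + 1) * \<rho> y) differentiable (at x)"
    by (intro differentiable_mult differentiable_const smooth_on_differentiable[OF smooth_\<rho> x])
  have d3: "frechet_derivative (\<lambda>y. (real m + 1) * \<rho> y) (at x) v = (real m + 1) * frechet_derivative \<rho> (at x) v"
    by (subst frechet_derivative_mult) (auto intro: smooth_on_differentiable[OF smooth_\<rho> x])
  have lin: "frechet_derivative step (at s) w = frechet_derivative step (at s) 1 * w" for s w
    using linear_scale[OF linear_frechet_derivative[OF d1], of s w 1] by simp
  have "frechet_derivative (Hstep m) (at x) v = of_real (frechet_derivative (\<lambda>y. step ((real m + 1) * \<rho> y)) (at x) v)"
    unfolding Hstep_def[abs_def]
    by (rule frechet_derivative_of_real, rule smooth_on_differentiable[OF _ x])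
      (intro smooth_on_step_compose open_U smooth_on_mult smooth_on_const smooth_\<rho>)
  also have "\<dots> = of_real (frechet_derivative step (at ((real m + 1) * \<rho> x)) (frechet_derivative (\<lambda>y. (real m + 1) * \<rho> y) (at x) v))"
    by (subst frechet_derivative_compose[OF d1 d2]) (rule refl)
  also have "\<dots> = of_real (frechet_derivative step (at ((real m + 1) * \<rho> x)) 1 * (real m + 1) * frechet_derivative \<rho> (at x) v)"
    by (subst lin) (simp add: d3 mult.assoc)
  finally show ?thesis .
qed

lemma Hstep_tendsto: "(\<lambda>m. Hstep m x) \<longlonglongrightarrow> indicator D x"
proof (cases "\<rho> x > 0")
  case True
  obtain N where N: "1 / \<rho> x < real N" using reals_Archimedean2 by blast
  have "Hstep m x = 1" if "m \<ge> N" for m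
  proof -
    have "1 / \<rho> x \<le> real m + 1" using N that by linarith
    then have "1 \<le> (real m + 1) * \<rho> x" using True by (simp add: field_simps)
    then show ?thesis by (simp add: Hstep_def step_eq_1)
  qed
  then have "\<forall>\<^sub>F m in sequentially. Hstep m x = 1" by (auto simp: eventually_sequentially)
  then show ?thesis using True by (auto simp: D_eq intro: tendsto_eventually)
next
  case False
  then have "Hstep m x = 0" for m
    by (simp add: Hstep_def step_eq_0 mult_nonneg_nonpos)
  then show ?thesis using False by (simp add: D_eq)
qed

lemma norm_Hstep_le: "norm (Hstep m x) \<le> 1"
  unfolding Hstep_def norm_of_real using step_nonneg step_le_1 by (simp add: abs_of_nonneg)

lemma Hstep_integral_tendsto:
  assumes F: "test_on U F"
  shows "(\<lambda>m. LINT x|lborel. Hstep m x * F x) \<longlonglongrightarrow> (LINT x:D|lborel. F x)"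
  unfolding set_lebesgue_integral_def
proof (rule integral_dominated_convergence[where w = "\<lambda>x. norm (F x)"])
  show "(\<lambda>x. indicat_real D x *\<^sub>R F x) \<in> borel_measurable lborel"
    using set_integrable_test[OF F] unfolding set_integrable_def by (rule borel_measurable_integrable)
  show "(\<lambda>x. Hstep m x * F x) \<in> borel_measurable lborel" for m
    by (rule borel_measurable_integrable[OF test_on_integrable[OF test_on_mult[OF open_U F smooth_Hstep]]])
  show "integrable lborel (\<lambda>x. norm (F x))" by (intro integrable_norm test_on_integrable[OF F])
  show "AE x in lborel. (\<lambda>m. Hstep m x * F x) \<longlonglongrightarrow> indicat_real D x *\<^sub>R F x"
  proof (intro AE_I2)
    fix x
    have "(\<lambda>m. Hstep m x * F x) \<longlonglongrightarrow> indicator D x * F x" by (intro tendsto_mult Hstep_tendsto tendsto_const)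
    then show "(\<lambda>m. Hstep m x * F x) \<longlonglongrightarrow> indicat_real D x *\<^sub>R F x" by (cases "x \<in> D") simp_all
  qed
  show "AE x in lborel. norm (Hstep m x * F x) \<le> norm (F x)" for m
    using mult_right_mono[OF norm_Hstep_le, of "norm (F _)"] by (intro AE_I2) (simp add: norm_mult)
qed

lemma integral_frechet_derivative_U: "test_on U F \<Longrightarrow> (LINT x|lborel. frechet_derivative F (at x) v) = 0"
  by (rule integral_frechet_derivative_test[OF test_on_subset]) auto

lemma smooth_\<rho>': "smooth_on U (\<lambda>x. complex_of_real (frechet_derivative \<rho> (at x) v))"
  by (intro smooth_on_of_real open_U smooth_on_frechet_derivative smooth_\<rho>)

text \<open>The field \<open>v - d\<rho>(v) e\<close> is tangential and divergence free, so it commutes with the cutoffs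
  \<open>step ((m + 1) \<rho>)\<close> that approximate the indicator of \<open>D\<close>.\<close>

lemma integral_D_derivative:
  assumes F: "test_on U F"
  shows "(LINT x:D|lborel. frechet_derivative F (at x) v) =
    (LINT x:D|lborel. frechet_derivative (\<lambda>y. of_real (frechet_derivative \<rho> (at y) v) * F y) (at x) e)"
proof -
  let ?r = "\<lambda>y. complex_of_real (frechet_derivative \<rho> (at y) v)"
  have tr: "test_on U (\<lambda>y. ?r y * F y)" by (intro test_on_mult open_U F smooth_\<rho>')
  define Y where "Y x = frechet_derivative F (at x) v - frechet_derivative (\<lambda>y. ?r y * F y) (at x) e" for x
  have tY: "test_on U Y" unfolding Y_def
    by (intro test_on_diff test_on_frechet_derivative F tr)
  have "(LINT x|lborel. Hstep m x * Y x) = 0" for m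
  proof -
    define G where "G x = Hstep m x * F x" for x
    have tG: "test_on U G" unfolding G_def by (intro test_on_mult open_U F smooth_Hstep)
    have trG: "test_on U (\<lambda>y. ?r y * G y)" by (intro test_on_mult open_U tG smooth_\<rho>')
    have dH: "Hstep m differentiable (at x)" and dF: "F differentiable (at x)" and dG: "G differentiable (at x)" and
      dr: "?r differentiable (at x)" if "x \<in> U" for x
      using smooth_on_differentiable[OF smooth_Hstep that] smooth_on_differentiable[OF test_on_smooth[OF F] UNIV_I]
        smooth_on_differentiable[OF test_on_smooth[OF tG] UNIV_I] smooth_on_differentiable[OF smooth_\<rho>' that] .
    have r_e: "frechet_derivative ?r (at x) e = 0" if "x \<in> U" for x
      using frechet_derivative_of_real[OF smooth_on_differentiable[OF smooth_on_frechet_derivative[OF smooth_\<rho>] that], of v e]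
      by (simp add: \<rho>'_e[OF that])
    \<comment> \<open>When the product rule lets v or e act on the cutoff, both terms contribute
      step'((m + 1) \<rho>) (m + 1) d\<rho>(v) F and cancel. What remains is a difference of
      derivatives of compactly supported functions.\<close>
    have "Hstep m x * Y x = frechet_derivative G (at x) v - frechet_derivative (\<lambda>y. ?r y * G y) (at x) e" for x
    proof (cases "x \<in> U")
      case True
      note d = dH[OF True] dF[OF True] dG[OF True] dr[OF True]
      have G': "frechet_derivative G (at x) w = frechet_derivative (Hstep m) (at x) w * F x + Hstep m x * frechet_derivative F (at x) w" for w
        unfolding G_def by (rule frechet_derivative_mult[OF d(1,2)])
      show ?thesis
        unfolding Y_def frechet_derivative_mult[OF d(4,2)] frechet_derivative_mult[OF d(4,3)] r_e[OF True] G'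
          Hstep_derivative[OF True] \<rho>_e[OF True]
        by (simp add: algebra_simps)
    next
      case False
      then show ?thesis
        using test_on_eq_0[OF tY False] test_on_eq_0[OF test_on_frechet_derivative[OF tG] False]
          test_on_eq_0[OF test_on_frechet_derivative[OF trG] False] by simp
    qed
    then have "(LINT x|lborel. Hstep m x * Y x) =
        (LINT x|lborel. frechet_derivative G (at x) v - frechet_derivative (\<lambda>y. ?r y * G y) (at x) e)" by simp
    also have "\<dots> = (LINT x|lborel. frechet_derivative G (at x) v) - (LINT x|lborel. frechet_derivative (\<lambda>y. ?r y * G y) (at x) e)"
      by (rule Bochner_Integration.integral_diff) (rule test_on_integrable[OF test_on_frechet_derivative], rule tG trG)+
    also have "\<dots> = 0"
      by (simp add: integral_frechet_derivative_U[OF tG] integral_frechet_derivative_U[OF trG])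
    finally show ?thesis .
  qed
  then have "(LINT x:D|lborel. Y x) = 0"
    using Hstep_integral_tendsto[OF tY] by (simp add: LIMSEQ_const_iff)
  then show ?thesis
    unfolding Y_def by (simp add: integral_D_diff test_on_frechet_derivative F tr)
qed

text \<open>Let r be a radius with all balls around points of the support inside U. Where |\<rho>| <
  r, the mean value inequality along e from the zero \<open>proj x\<close> of F gives the constant
  B2; elsewhere on the support B1 \<le> (B1 / r) |\<rho>| is enough.\<close>

lemma norm_le_\<rho>:
  assumes F: "test_on U F" and zero: "\<And>x. x \<in> S \<Longrightarrow> F x = 0"
  shows "\<exists>C\<ge>0. \<forall>x\<in>U. norm (F x) \<le> C * \<bar>\<rho> x\<bar>"
proof -
  obtain K where K: "compact K" "K \<subseteq> U" "\<And>x. x \<notin> K \<Longrightarrow> F x = 0" using F by (auto simp: test_on_def)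
  obtain B1 where B1: "\<And>x. norm (F x) \<le> B1" using test_on_bounded[OF F] by blast
  obtain B2 where B2: "\<And>x. norm (frechet_derivative F (at x) e) \<le> B2"
    using test_on_bounded[OF test_on_frechet_derivative[OF F]] by blast
  obtain r where r: "r > 0" "\<And>x. x \<in> K \<Longrightarrow> ball x r \<subseteq> U"
    using Heine_Borel_lemma[of K "{U}"] K(1,2) open_U by auto
  have norm_e: "norm e = 1" using e_unit by (simp add: norm_eq_sqrt_inner)
  have B0: "B1 \<ge> 0" "B2 \<ge> 0" using order_trans[OF norm_ge_zero B1] order_trans[OF norm_ge_zero B2] by auto
  have Fd: "F differentiable (at x)" for x by (rule smooth_on_differentiable[OF test_on_smooth[OF F] UNIV_I])
  have lin: "frechet_derivative F (at x) (- e) = - frechet_derivative F (at x) e" for x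
    by (rule linear_neg[OF linear_frechet_derivative[OF Fd]])
  have "norm (F x) \<le> (B2 + B1 / r) * \<bar>\<rho> x\<bar>" if x: "x \<in> U" for x
  proof (cases "x \<in> K")
    case True
    show ?thesis
    proof (cases "\<bar>\<rho> x\<bar> < r")
      case small: True
      have "proj x \<in> ball x r" using small norm_e by (simp add: proj_def dist_norm)
      then have "x \<in> U0" using r(2)[OF True] x by (auto simp: U0_def)
      then have "F (proj x) = 0" using zero proj_in_S by simp
      moreover have "norm (F (x + \<bar>\<rho> x\<bar> *\<^sub>R (- sgn (\<rho> x) *\<^sub>R e)) - F x) \<le> B2 * \<bar>\<rho> x\<bar>"
      proof (rule norm_diff_along_line_le)
        fix s
        show "norm (frechet_derivative F (at (x + s *\<^sub>R (- sgn (\<rho> x) *\<^sub>R e))) (- sgn (\<rho> x) *\<^sub>R e)) \<le> B2"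
          using B2 B0 lin linear_0[OF linear_frechet_derivative[OF Fd]] by (cases "\<rho> x" "0::real" rule: linorder_cases) auto
      qed (use Fd in auto)
      moreover have "x + \<bar>\<rho> x\<bar> *\<^sub>R (- sgn (\<rho> x) *\<^sub>R e) = proj x"
        by (simp add: proj_def sgn_real_def)
      ultimately have "norm (F x) \<le> B2 * \<bar>\<rho> x\<bar>" by simp
      also have "\<dots> \<le> (B2 + B1 / r) * \<bar>\<rho> x\<bar>" using B0 r by (intro mult_right_mono) auto
      finally show ?thesis .
    next
      case False
      have "norm (F x) \<le> B1" by (rule B1)
      also have "\<dots> \<le> (B1 / r) * \<bar>\<rho> x\<bar>" using False r B0 mult_left_mono[of r "\<bar>\<rho> x\<bar>" B1] by (simp add: field_simps)
      also have "\<dots> \<le> (B2 + B1 / r) * \<bar>\<rho> x\<bar>" using B0 r by (intro mult_right_mono) auto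
      finally show ?thesis .
    qed
  next
    case False
    then show ?thesis using K(3) B0 r by simp
  qed
  moreover have "B2 + B1 / r \<ge> 0" using B0 r by simp
  ultimately show ?thesis by blast
qed

text \<open>Equivalently, the functional that integrates the derivative along e over D depends only
  on the values on S. It thereby stands in for minus the boundary integral.\<close>

lemma integral_D_derivative_vanishing:
  assumes F: "test_on U F" and zero: "\<And>x. x \<in> S \<Longrightarrow> F x = 0"
  shows "(LINT x:D|lborel. frechet_derivative F (at x) e) = 0"
proof -
  obtain C where C0: "C \<ge> 0" and C: "\<And>x. x \<in> U \<Longrightarrow> norm (F x) \<le> C * \<bar>\<rho> x\<bar>" using norm_le_\<rho>[OF assms] by blast
  obtain C' where C': "\<And>t. \<bar>frechet_derivative step (at t) 1 * t\<bar> \<le> C'" using step_derivative_bounded by blast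
  have C'0: "C' \<ge> 0" using C'[of 0] by simp
  obtain K where K: "compact K" "K \<subseteq> U" "\<And>x. x \<notin> K \<Longrightarrow> F x = 0" using F by (auto simp: test_on_def)
  define Q where "Q m x = frechet_derivative (Hstep m) (at x) e * F x" for m x
  have eq: "(LINT x|lborel. Hstep m x * frechet_derivative F (at x) e) = - (LINT x|lborel. Q m x)"
    and Qm: "Q m \<in> borel_measurable lborel" for m
  proof -
    have tG: "test_on U (\<lambda>x. Hstep m x * F x)" by (intro test_on_mult open_U F smooth_Hstep)
    have i1: "integrable lborel (Q m)" unfolding Q_def[abs_def]
      by (intro test_on_integrable[of U] test_on_mult open_U F smooth_on_frechet_derivative smooth_Hstep)
    have i2: "integrable lborel (\<lambda>x. Hstep m x * frechet_derivative F (at x) e)"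
      by (intro test_on_integrable[of U] test_on_mult open_U smooth_Hstep test_on_frechet_derivative F)
    have "frechet_derivative (\<lambda>x. Hstep m x * F x) (at x) e = Q m x + Hstep m x * frechet_derivative F (at x) e" for x
    proof (cases "x \<in> U")
      case True
      show ?thesis unfolding Q_def
        by (rule frechet_derivative_mult[OF smooth_on_differentiable[OF smooth_Hstep True]
              smooth_on_differentiable[OF test_on_smooth[OF F] UNIV_I]])
    next
      case False
      then show ?thesis unfolding Q_def
        using test_on_eq_0[OF F False] test_on_eq_0[OF test_on_frechet_derivative[OF F] False]
          test_on_eq_0[OF test_on_frechet_derivative[OF tG] False] by simp
    qed
    then have "0 = (LINT x|lborel. Q m x + Hstep m x * frechet_derivative F (at x) e)"
      using integral_frechet_derivative_U[OF tG, of e] by simp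
    also have "\<dots> = (LINT x|lborel. Q m x) + (LINT x|lborel. Hstep m x * frechet_derivative F (at x) e)"
      by (rule Bochner_Integration.integral_add[OF i1 i2])
    finally show "(LINT x|lborel. Hstep m x * frechet_derivative F (at x) e) = - (LINT x|lborel. Q m x)"
      by (simp add: eq_neg_iff_add_eq_0 add.commute)
    show "Q m \<in> borel_measurable lborel" by (rule borel_measurable_integrable[OF i1])
  qed
  \<comment> \<open>\<open>Q m\<close> lives where 0 \<le> (m + 1) \<rho> \<le> 1, a layer shrinking
    to S, and |F| \<le> C |\<rho>| compensates the factor m + 1 of the differentiated
    cutoff.\<close>
  have "(\<lambda>m. LINT x|lborel. Q m x) \<longlonglongrightarrow> (LINT x|(lborel::'a measure). (0::complex))"
  proof (rule integral_dominated_convergence[where w = "\<lambda>x. indicator K x *\<^sub>R (C * C')" and s = Q and f = "\<lambda>x. 0"])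
    show "integrable lborel (\<lambda>x. indicator K x *\<^sub>R (C * C'))"
      by (intro borel_integrable_compact K continuous_on_const)
    show "AE x in lborel. (\<lambda>m. Q m x) \<longlonglongrightarrow> 0"
    proof (intro AE_I2 tendsto_eventually)
      fix x
      show "\<forall>\<^sub>F m in sequentially. Q m x = 0"
      proof (cases "x \<in> U \<and> \<rho> x \<noteq> 0")
        case False
        then have "F x = 0" using zero K by (auto simp: S_def)
        then show ?thesis by (simp add: Q_def)
      next
        case True
        obtain N where N: "1 / \<bar>\<rho> x\<bar> < real N" using reals_Archimedean2 by blast
        have "Q m x = 0" if "m \<ge> N" for m
        proof -
          have "1 / \<bar>\<rho> x\<bar> < real m + 1" using N that by linarith
          then have "1 < (real m + 1) * \<bar>\<rho> x\<bar>" using True by (simp add: field_simps)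
          then have "(real m + 1) * \<rho> x < 0 \<or> (real m + 1) * \<rho> x > 1"
            by (cases "\<rho> x > 0") (auto simp: mult_pos_neg abs_if split: if_splits)
          then show ?thesis using True by (simp add: Q_def Hstep_derivative frechet_derivative_step_eq_0)
        qed
        then show ?thesis by (auto simp: eventually_sequentially)
      qed
    qed
    show "AE x in lborel. norm (Q m x) \<le> indicator K x *\<^sub>R (C * C')" for m
    proof (intro AE_I2)
      fix x
      show "norm (Q m x) \<le> indicator K x *\<^sub>R (C * C')"
      proof (cases "x \<in> K")
        case True
        then have xU: "x \<in> U" using K by blast
        have "norm (Q m x) \<le> \<bar>frechet_derivative step (at ((real m + 1) * \<rho> x)) 1 * (real m + 1)\<bar> * (C * \<bar>\<rho> x\<bar>)"
          unfolding Q_def norm_mult Hstep_derivative[OF xU] \<rho>_e[OF xU] norm_of_real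
          using C[OF xU] by (intro mult_mono) auto
        also have "\<dots> = C * \<bar>frechet_derivative step (at ((real m + 1) * \<rho> x)) 1 * ((real m + 1) * \<rho> x)\<bar>"
          by (simp add: abs_mult)
        also have "\<dots> \<le> C * C'"
          by (rule mult_left_mono[OF C' C0])
        finally show ?thesis using True by simp
      next
        case False
        then show ?thesis using K(3) by (simp add: Q_def)
      qed
    qed
  qed (use Qm in auto)
  then have "(\<lambda>m. LINT x|lborel. Hstep m x * frechet_derivative F (at x) e) \<longlonglongrightarrow> 0"
    unfolding eq using tendsto_minus by fastforce
  then show ?thesis
    using Hstep_integral_tendsto[OF test_on_frechet_derivative[OF F]] LIMSEQ_unique by blast
qed

lemma integral_D_nonneg_eq_0:
  fixes w :: "'a \<Rightarrow> real"
  assumes t: "test_on U (\<lambda>x. of_real (w x))" and nn: "\<And>x. x \<in> D \<inter> U \<Longrightarrow> 0 \<le> w x"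
    and int: "(LINT x:D|lborel. complex_of_real (w x)) = 0" and x: "x \<in> D \<inter> U"
  shows "w x = 0"
proof (rule ccontr)
  assume "w x \<noteq> 0"
  let ?f = "\<lambda>x. indicator (D \<inter> U) x * w x"
  have w0: "w x = 0" if "x \<notin> U" for x using test_on_eq_0[OF t that] by simp
  have f_eq: "complex_of_real (?f x) = indicator D x *\<^sub>R complex_of_real (w x)" for x
    using w0[of x] by (auto simp: indicator_def)
  have ic: "integrable lborel (\<lambda>x. complex_of_real (?f x))"
    using set_integrable_test[OF t] unfolding set_integrable_def f_eq .
  then have i: "integrable lborel ?f" by (simp only: complex_of_real_integrable_eq)
  have "complex_of_real (LINT x|lborel. ?f x) = (LINT x|lborel. complex_of_real (?f x))"
    by (rule integral_complex_of_real[symmetric])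
  also have "\<dots> = 0" using int unfolding set_lebesgue_integral_def f_eq .
  finally have "(LINT x|lborel. ?f x) = 0" by simp
  then have ae: "AE x in lborel. ?f x = 0"
    using integral_nonneg_eq_0_iff_AE[OF i] nn by (simp add: indicator_def)
  have "smooth_on UNIV (\<lambda>x. Re (complex_of_real (w x)))" by (intro smooth_on_Re test_on_smooth[OF t]) simp
  then have cw: "continuous_on UNIV w" using smooth_on_continuous by simp
  define V where "V = (D \<inter> U) \<inter> w -` (- {0})"
  have "open V" unfolding V_def
    by (rule continuous_open_preimage[OF continuous_on_subset[OF cw] open_D]) auto
  moreover have "x \<in> V" using x \<open>w x \<noteq> 0\<close> by (simp add: V_def)
  moreover have "negligible V"
  proof -
    have "AE x in lebesgue. x \<notin> V"
      using AE_completion[OF ae] by eventually_elim (auto simp: V_def indicator_def)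
    moreover have "V \<in> sets lebesgue" using \<open>open V\<close> by (simp add: borel_open)
    ultimately show ?thesis by (simp only: negligible_iff_null_sets AE_iff_null_sets)
  qed
  ultimately show False using open_not_negligible by blast
qed

text \<open>The test function is a product of bumps in \<open>\<rho>\<close> and in the coordinates transversal to \<open>e\<close>, so that
  its derivative along \<open>e\<close> has a sign on \<open>D\<close>.\<close>

lemma integral_D_derivative_nondegenerate:
  assumes G: "smooth_on U G"
    and int: "\<And>F. test_on U F \<Longrightarrow> (LINT x:D|lborel. frechet_derivative (\<lambda>x. F x * G x) (at x) e) = 0"
    and p: "p \<in> S"
  shows "G p = 0"
proof (rule ccontr)
  assume Gp: "G p \<noteq> 0"
  have pU: "p \<in> U0" "p \<in> U" "\<rho> p = 0" using p S_subset_U0 by (auto simp: S_def)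
  have norm_e: "norm e = 1" using e_unit by (simp add: norm_eq_sqrt_inner)
  obtain r where r: "r > 0" "cball p r \<subseteq> U0" using open_U0 pU open_contains_cball by blast
  have "isCont \<psi> p" using smooth_on_continuous[OF smooth_\<psi>] pU open_U continuous_on_eq_continuous_at by blast
  then obtain d1 where d1: "d1 > 0" "\<And>y. dist y p < d1 \<Longrightarrow> dist (\<psi> y) (\<psi> p) < r / 4"
    using r unfolding continuous_at_eps_delta by (metis zero_less_divide_iff zero_less_numeral)
  \<comment> \<open>With |\<rho> x| and the transversal displacement below \<delta>, the height of x
    over p along e is below \<delta> + r/4, since \<open>\<psi>\<close> varies by less than r/4. The
    total distance is then below 2 \<delta> + r/4 < r.\<close>
  define \<delta> where "\<delta> = min d1 (r / 4)"
  have \<delta>: "\<delta> > 0" "\<delta> \<le> d1" "\<delta> \<le> r / 4" using d1 r by (auto simp: \<delta>_def)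
  define tr where "tr x = (x - p) - ((x - p) \<bullet> e) *\<^sub>R e" for x
  define \<beta> where "\<beta> x = bump (\<delta>\<^sup>2 - \<rho> x * \<rho> x)" for x
  define \<alpha> where "\<alpha> x = bump (\<delta>\<^sup>2 - tr x \<bullet> tr x)" for x
  have tr_shift: "tr (x + t *\<^sub>R e) = tr x" for x t
    by (simp add: tr_def inner_diff_left inner_add_left e_unit algebra_simps)
  have near: "x \<in> cball p r" if x: "x \<in> U" "\<beta> x \<noteq> 0" "\<alpha> x \<noteq> 0" for x
  proof -
    have "(\<rho> x)\<^sup>2 < \<delta>\<^sup>2" using x(2) bump_eq_0[of "\<delta>\<^sup>2 - \<rho> x * \<rho> x"] unfolding \<beta>_def by (force simp: power2_eq_square)
    then have a: "\<bar>\<rho> x\<bar> < \<delta>" using \<delta>(1) power2_less_imp_less[of "\<bar>\<rho> x\<bar>" \<delta>] by simp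
    have "(norm (tr x))\<^sup>2 < \<delta>\<^sup>2" using x(3) bump_eq_0[of "\<delta>\<^sup>2 - tr x \<bullet> tr x"] unfolding \<alpha>_def
      by (force simp: power2_norm_eq_inner)
    then have b: "norm (tr x) < \<delta>" using \<delta>(1) by (simp add: power2_less_imp_less)
    define s where "s = (x - p) \<bullet> e"
    have xs: "x = p + tr x + s *\<^sub>R e" by (simp add: tr_def s_def)
    have "\<psi> x = \<psi> (p + tr x)" by (subst xs) (rule \<psi>_invariant)
    moreover have "dist (p + tr x) p < d1" using b \<delta> by (simp add: dist_norm)
    ultimately have "\<bar>\<psi> x - \<psi> p\<bar> < r / 4" using d1(2)[of "p + tr x"] by (simp add: dist_real_def)
    moreover have "s = \<rho> x + (\<psi> x - \<psi> p)" using \<rho>_eq[OF x(1)] \<rho>_eq[OF pU(2)] pU(3) by (simp add: s_def inner_diff_left)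
    ultimately have "\<bar>s\<bar> < \<delta> + r / 4" using a by linarith
    moreover have "dist x p \<le> norm (tr x) + \<bar>s\<bar>"
      using norm_triangle_ineq[of "tr x" "s *\<^sub>R e"] xs norm_e by (simp add: dist_norm add.assoc) (metis add_diff_cancel_left' add.assoc xs)
    ultimately show ?thesis using b \<delta> r by (simp add: dist_commute)
  qed
  \<comment> \<open>This factor is constant along e, so that differentiation along e meets only
    \<open>\<beta>\<close>; the conjugate makes it nonnegative.\<close>
  define c where "c x = of_real (\<alpha> x) * (cnj (G (proj x)) * G (proj x))" for x
  have smooth_\<alpha>: "smooth_on UNIV \<alpha>"
    unfolding \<alpha>_def tr_def
    by (intro smooth_on_bump_compose smooth_on_diff smooth_on_const smooth_on_bilinear[OF bounded_bilinear_inner]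
        smooth_on_scaleR smooth_on_id) auto
  have smooth_\<beta>: "smooth_on U \<beta>"
    unfolding \<beta>_def by (intro smooth_on_bump_compose smooth_on_diff smooth_on_const smooth_on_mult smooth_\<rho> open_U)
  have smooth_\<beta>0: "smooth_on U0 \<beta>" using smooth_\<beta> U0_subset_U smooth_on_subset by blast
  have smooth_\<alpha>0: "smooth_on U0 \<alpha>" using smooth_\<alpha> smooth_on_subset by blast
  have smooth_G: "smooth_on U0 (\<lambda>x. G (proj x))" by (rule smooth_compose_proj[OF G])
  have smooth_c: "smooth_on U0 c"
    unfolding c_def by (intro smooth_on_mult smooth_on_of_real smooth_on_cnj open_U0 smooth_\<alpha>0 smooth_G)
  define f1 where "f1 x = (if x \<in> U then of_real (\<beta> x) * of_real (\<alpha> x) * cnj (G (proj x)) else 0)" for x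
  have "smooth_on U0 (\<lambda>x. of_real (\<beta> x) * of_real (\<alpha> x) * cnj (G (proj x)))"
    by (intro smooth_on_mult smooth_on_of_real smooth_on_cnj open_U0 smooth_\<alpha>0 smooth_\<beta>0 smooth_G)
  then have "smooth_on U0 f1"
    by (rule smooth_on_cong[OF open_U0, rotated]) (use U0_subset_U in \<open>auto simp: f1_def\<close>)
  then have t1: "test_on U0 f1"
    by (intro test_onI[OF open_U0 compact_cball r(2)]) (use near in \<open>auto simp: f1_def\<close>)
  then have t1U: "test_on U f1" using U0_subset_U test_on_subset by blast
  have t2: "test_on U (\<lambda>x. f1 x * G x)" using test_on_mult[OF open_U t1U G] by (simp add: mult.commute)
  have t3: "test_on U (\<lambda>x. f1 x * G (proj x))"
    using test_on_subset[OF test_on_mult[OF open_U0 t1 smooth_G] U0_subset_U] by (simp add: mult.commute)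
  \<comment> \<open>G may be replaced by its trace continued constantly along e, because the
    functional sees only the values on S.\<close>
  have "(LINT x:D|lborel. frechet_derivative (\<lambda>x. f1 x * G x - f1 x * G (proj x)) (at x) e) = 0"
    by (rule integral_D_derivative_vanishing[OF test_on_diff[OF t2 t3]]) (simp add: proj_S)
  moreover have "frechet_derivative (\<lambda>x. f1 x * G x - f1 x * G (proj x)) (at x) e =
      frechet_derivative (\<lambda>x. f1 x * G x) (at x) e - frechet_derivative (\<lambda>x. f1 x * G (proj x)) (at x) e" for x
    by (rule frechet_derivative_diff) (rule smooth_on_differentiable[OF test_on_smooth UNIV_I], rule t2 t3)+
  ultimately have "(LINT x:D|lborel. frechet_derivative (\<lambda>x. f1 x * G x) (at x) e) -
      (LINT x:D|lborel. frechet_derivative (\<lambda>x. f1 x * G (proj x)) (at x) e) = 0"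
    by (simp add: integral_D_diff[OF test_on_frechet_derivative[OF t2] test_on_frechet_derivative[OF t3]])
  then have int3: "(LINT x:D|lborel. frechet_derivative (\<lambda>x. f1 x * G (proj x)) (at x) e) = 0"
    using int[OF t1U] by simp
  \<comment> \<open>Minus the derivative along e of the test product. It is nonnegative on D because
    \<delta>^2 - \<rho>^2 decreases in \<rho> for \<rho> > 0 and \<open>bump\<close> is
    increasing.\<close>
  define w where "w x = (if x \<in> U0 then frechet_derivative bump (at (\<delta>\<^sup>2 - \<rho> x * \<rho> x)) 1 * (2 * \<rho> x) *
      (\<alpha> x * (norm (G (proj x)))\<^sup>2) else 0)" for x
  have bump_d: "bump differentiable (at t)" for t by (rule smooth_on_differentiable[OF smooth_on_poly_bump UNIV_I])
  have D3: "frechet_derivative (\<lambda>x. f1 x * G (proj x)) (at x) e = - of_real (w x)" for x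
  proof (cases "x \<in> U0")
    case True
    then have xU: "x \<in> U" using U0_subset_U by blast
    have ev: "frechet_derivative (\<lambda>x. f1 x * G (proj x)) (at x) e = frechet_derivative (\<lambda>x. of_real (\<beta> x) * c x) (at x) e"
      by (rule arg_cong[where f = "\<lambda>D. D e"], rule frechet_derivative_cong_open[OF open_U xU])
        (simp add: f1_def c_def)
    have \<beta>d: "\<beta> differentiable (at x)" by (rule smooth_on_differentiable[OF smooth_\<beta> xU])
    have c0: "frechet_derivative c (at x) e = 0"
      by (rule derivative_e_zero[OF open_U0 True smooth_on_differentiable[OF smooth_c True]])
        (use proj_shift xU U0_subset_U in \<open>auto simp: c_def \<alpha>_def tr_shift\<close>)
    have \<rho>d: "\<rho> differentiable (at x)" by (rule smooth_on_differentiable[OF smooth_\<rho> xU])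
    have in': "frechet_derivative (\<lambda>y. \<delta>\<^sup>2 - \<rho> y * \<rho> y) (at x) e = - (2 * \<rho> x)"
      by (subst frechet_derivative_diff) (auto simp: frechet_derivative_mult[OF \<rho>d \<rho>d] \<rho>_e[OF xU] intro!: differentiable_mult \<rho>d)
    have \<beta>': "frechet_derivative \<beta> (at x) e = - (frechet_derivative bump (at (\<delta>\<^sup>2 - \<rho> x * \<rho> x)) 1 * (2 * \<rho> x))"
    proof -
      have "frechet_derivative \<beta> (at x) e = frechet_derivative bump (at (\<delta>\<^sup>2 - \<rho> x * \<rho> x))
          (frechet_derivative (\<lambda>y. \<delta>\<^sup>2 - \<rho> y * \<rho> y) (at x) e)"
        unfolding \<beta>_def[abs_def]
        by (rule frechet_derivative_compose[OF bump_d]) (intro differentiable_diff differentiable_mult \<rho>d differentiable_const)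
      then show ?thesis unfolding in'
        using linear_scale[OF linear_frechet_derivative[OF bump_d], of "\<delta>\<^sup>2 - \<rho> x * \<rho> x" "- (2 * \<rho> x)" 1] by simp
    qed
    have "frechet_derivative (\<lambda>x. of_real (\<beta> x) * c x) (at x) e = of_real (frechet_derivative \<beta> (at x) e) * c x"
      by (subst frechet_derivative_mult)
        (auto simp: c0 frechet_derivative_of_real[OF \<beta>d] intro!: smooth_on_differentiable[OF smooth_on_of_real[OF open_U smooth_\<beta>] xU]
          smooth_on_differentiable[OF smooth_c True])
    also have "\<dots> = - of_real (w x)"
    proof -
      have "cnj (G (proj x)) * G (proj x) = of_real ((norm (G (proj x)))\<^sup>2)"
        using complex_norm_square[of "G (proj x)"] by (simp only: mult.commute)
      then show ?thesis using True by (simp add: \<beta>' w_def c_def)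
    qed
    finally show ?thesis using ev by simp
  next
    case False
    then show ?thesis
      using test_on_eq_0[OF test_on_frechet_derivative[OF test_on_mult[OF open_U0 t1 smooth_G]] False, of e]
      by (simp add: w_def mult.commute)
  qed
  have bump'_nonneg: "frechet_derivative bump (at t) 1 \<ge> 0" for t by (simp add: frechet_derivative_bump)
  have tw: "test_on U (\<lambda>x. of_real (w x))"
    using test_on_cmult[OF test_on_frechet_derivative[OF t3], of "- 1" e] by (simp add: D3)
  have "(LINT x:D|lborel. - 1 * frechet_derivative (\<lambda>x. f1 x * G (proj x)) (at x) e) = 0"
    unfolding integral_D_cmult int3 by simp
  then have intw: "(LINT x:D|lborel. complex_of_real (w x)) = 0" by (simp add: D3)
  have w0: "w x = 0" if "x \<in> D \<inter> U" for x
    by (rule integral_D_nonneg_eq_0[OF tw _ intw that])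
      (auto simp: w_def D_eq \<alpha>_def intro!: mult_nonneg_nonneg bump'_nonneg bump_nonneg)
  obtain d where d: "d > 0" "\<And>t. \<bar>t\<bar> < d \<Longrightarrow> p + t *\<^sub>R e \<in> U0" using open_ball_shift[OF open_U0 pU(1)] by blast
  \<comment> \<open>A point slightly above p lies in D and projects to p; with t < \<delta> all
    factors of w are positive there.\<close>
  define t where "t = min (d / 2) (\<delta> / 2)"
  have t: "t > 0" "t < d" "t < \<delta>" using d \<delta> by (auto simp: t_def)
  define q where "q = p + t *\<^sub>R e"
  have q: "q \<in> U0" "q \<in> U" using d t U0_subset_U by (auto simp: q_def)
  have \<rho>q: "\<rho> q = t" using \<rho>_shift[OF pU(2)] q pU(3) by (simp add: q_def)
  have "tr q = 0" using tr_shift[of p t] by (simp add: q_def tr_def)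
  then have "\<alpha> q > 0" using \<delta> by (simp add: \<alpha>_def bump_pos)
  moreover have "proj q = p" using proj_shift[OF pU(2)] q proj_S[OF p] by (simp add: q_def)
  moreover have "t * t < \<delta>\<^sup>2" using t by (simp add: power2_eq_square mult_strict_mono)
  then have "frechet_derivative bump (at (\<delta>\<^sup>2 - t * t)) 1 > 0" by (simp add: frechet_derivative_bump)
  ultimately have "w q > 0" using t Gp q by (simp add: w_def \<rho>q)
  moreover have "w q = 0" by (rule w0) (use q t \<rho>q in \<open>auto simp: D_eq\<close>)
  ultimately show False by simp
qed

end

section \<open>Operators on forms\<close>

lemma sum_apply: "(\<Sum>i\<in>I. f i) x = (\<Sum>i\<in>I. f i x)"
  by (induction I rule: infinite_finite_induct) auto

lemma UNIV_01: "(UNIV :: 2 set) = {0, 1}"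
proof -
  have "x = 0 \<or> x = 1" for x :: 2 using exhaust_2[of x] by auto
  then show ?thesis by auto
qed

lemma sum_01: "(\<Sum>A'\<in>(UNIV :: 2 set). f A') = f 0 + f 1"
  by (simp add: UNIV_01)

lemma exhaust_01: "A' = (0::2) \<or> A' = 1" using exhaust_2[of A'] by auto

lemma pscale_simps:
  "pscale c (u + v) = pscale c u + pscale c v" "pscale c (u - v) = pscale c u - pscale c v"
  "pscale c (- u) = - pscale c u" "pscale c 0 = 0" "pscale 0 u = 0" "pscale 1 u = u"
  "pscale c (pscale d u) = pscale (c * d) u" "pscale (- c) u = - pscale c u"
  by (auto simp: pscale_def fun_eq_iff algebra_simps)

lemma pscale_add_left: "pscale (c + d) u = pscale c u + pscale d u"
  by (auto simp: pscale_def fun_eq_iff algebra_simps)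

lemma additive_simps:
  fixes K :: "'v::ab_group_add \<Rightarrow> 'w::ab_group_add"
  assumes "\<And>u v. K (u + v) = K u + K v"
  shows "K 0 = 0" "K (- u) = - K u" "K (u - v) = K u - K v" "K (\<Sum>i\<in>I. w i) = (\<Sum>i\<in>I. K (w i))"
proof -
  show z: "K 0 = 0" using assms[of 0 0] by simp
  show m: "K (- u) = - K u" for u using assms[of u "- u"] z by (simp add: eq_neg_iff_add_eq_0 add.commute)
  show "K (u - v) = K u - K v" using assms[of u "- v"] m by simp
  show "K (\<Sum>i\<in>I. w i) = (\<Sum>i\<in>I. K (w i))"
    by (induction I rule: infinite_finite_induct) (simp_all add: z assms)
qed

lemma pscale_sum: "pscale c (\<Sum>i\<in>I. u i) = (\<Sum>i\<in>I. pscale c (u i))"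
  by (rule additive_simps(4)[of "pscale c", OF pscale_simps(1)])

lemma pscale_sum_left: "pscale (\<Sum>i\<in>I. c i) u = (\<Sum>i\<in>I. pscale (c i) u)"
  by (rule additive_simps(4)[of "\<lambda>c. pscale c u", OF pscale_add_left])

lemma pscale_apply: "pscale c u i j T = c * u i j T" by (simp add: pscale_def)

text \<open>Each coefficient of the output is a fixed finite combination of coefficients of the
  input. This finiteness lets such maps commute with differentiation and integration coefficient by
  coefficient, although \<open>pform\<close> is infinite dimensional.\<close>

definition coeffop :: "(pform \<Rightarrow> pform) \<Rightarrow> bool" where
  "coeffop K \<longleftrightarrow> (\<forall>i j T. \<exists>I c. finite I \<and> (\<forall>v. K v i j T = (\<Sum>(i', j', T')\<in>I. c (i', j', T') * v i' j' T')))"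

lemma coeffop_single:
  assumes "\<And>i j T. \<exists>c i' j' T'. \<forall>v. K v i j T = c * v i' j' T'"
  shows "coeffop K"
  unfolding coeffop_def
proof (intro allI)
  fix i j T
  obtain c i' j' T' where "\<forall>v. K v i j T = c * v i' j' T'" using assms by blast
  then show "\<exists>I c. finite I \<and> (\<forall>v. K v i j T = (\<Sum>(i', j', T')\<in>I. c (i', j', T') * v i' j' T'))"
    by (intro exI[of _ "{(i', j', T')}"] exI[of _ "\<lambda>_. c"]) auto
qed

lemma coeffop_id: "coeffop (\<lambda>v. v)"
  by (rule coeffop_single) (metis mult_1)

lemma coeffop_zero: "coeffop (\<lambda>v. 0)"
  by (rule coeffop_single) (metis mult_zero_left zero_fun_apply)

lemma coeffop_pscale: "coeffop K \<Longrightarrow> coeffop (\<lambda>v. pscale c (K v))"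
  unfolding coeffop_def
proof (intro allI)
  fix i j T assume "\<forall>i j T. \<exists>I c. finite I \<and> (\<forall>v. K v i j T = (\<Sum>(i', j', T')\<in>I. c (i', j', T') * v i' j' T'))"
  then obtain I d where "finite I" "\<forall>v. K v i j T = (\<Sum>(i', j', T')\<in>I. d (i', j', T') * v i' j' T')" by meson
  then show "\<exists>I d. finite I \<and> (\<forall>v. pscale c (K v) i j T = (\<Sum>(i', j', T')\<in>I. d (i', j', T') * v i' j' T'))"
    by (intro exI[of _ I] exI[of _ "\<lambda>x. c * d x"]) (auto simp: pscale_def sum_distrib_left mult.assoc intro!: sum.cong)
qed

lemma coeffop_add:
  assumes "coeffop K" "coeffop L"
  shows "coeffop (\<lambda>v. K v + L v)"
  unfolding coeffop_def
proof (intro allI)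
  fix i j T
  obtain I c where I: "finite I" "\<forall>v. K v i j T = (\<Sum>(i', j', T')\<in>I. c (i', j', T') * v i' j' T')"
    using assms(1) unfolding coeffop_def by meson
  obtain I' c' where I': "finite I'" "\<forall>v. L v i j T = (\<Sum>(i', j', T')\<in>I'. c' (i', j', T') * v i' j' T')"
    using assms(2) unfolding coeffop_def by meson
  have ext: "(\<Sum>(i', j', T')\<in>A. c (i', j', T') * v i' j' T') =
      (\<Sum>(i', j', T')\<in>A \<union> B. (if (i', j', T') \<in> A then c (i', j', T') else 0) * v i' j' T')"
    if "finite A" "finite B" for A B c and v :: pform
    by (rule sum.mono_neutral_cong_left) (use that in auto)
  let ?d = "\<lambda>x. (if x \<in> I then c x else 0) + (if x \<in> I' then c' x else 0)"
  have "(K v + L v) i j T = (\<Sum>(i', j', T')\<in>I \<union> I'. ?d (i', j', T') * v i' j' T')" for v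
    using ext[OF I(1) I'(1), of c v] ext[OF I'(1) I(1), of c' v] I(2) I'(2)
    by (simp add: sum.distrib[symmetric] Un_commute[of I' I] split_def distrib_right)
  then show "\<exists>I c. finite I \<and> (\<forall>v. (K v + L v) i j T = (\<Sum>(i', j', T')\<in>I. c (i', j', T') * v i' j' T'))"
    using I(1) I'(1) by (intro exI[of _ "I \<union> I'"] exI[of _ ?d]) blast
qed

lemma coeffop_sum: "(\<And>i. i \<in> I \<Longrightarrow> coeffop (K i)) \<Longrightarrow> coeffop (\<lambda>v. \<Sum>i\<in>I. K i v)"
  by (induction I rule: infinite_finite_induct) (simp_all add: coeffop_zero coeffop_add)

lemma coeffop_uminus: "coeffop K \<Longrightarrow> coeffop (\<lambda>v. - K v)"
  using coeffop_pscale[of K "- 1"] by (simp add: pscale_simps)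

lemma coeffop_comp:
  assumes "coeffop K" "coeffop L"
  shows "coeffop (\<lambda>v. K (L v))"
  unfolding coeffop_def
proof (intro allI)
  fix i j T
  obtain I c where I: "\<And>v. K v i j T = (\<Sum>(i', j', T')\<in>I. c (i', j', T') * v i' j' T')"
    using assms(1) unfolding coeffop_def by meson
  define M where "M x v = (\<lambda>(_::nat) (_::nat) (_::nat set). c x * L v (fst x) (fst (snd x)) (snd (snd x)))" for x v
  have "coeffop (M x)" for x
    unfolding coeffop_def
  proof (intro allI)
    fix i0 j0 T0
    obtain I' c' where "finite I'" "\<forall>v. L v (fst x) (fst (snd x)) (snd (snd x)) = (\<Sum>(i', j', T')\<in>I'. c' (i', j', T') * v i' j' T')"
      using assms(2) unfolding coeffop_def by meson
    then show "\<exists>I d. finite I \<and> (\<forall>v. M x v i0 j0 T0 = (\<Sum>(i', j', T')\<in>I. d (i', j', T') * v i' j' T'))"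
      by (intro exI[of _ I'] exI[of _ "\<lambda>y. c x * c' y"]) (auto simp: M_def sum_distrib_left mult.assoc intro!: sum.cong)
  qed
  then have "coeffop (\<lambda>v. \<Sum>x\<in>I. M x v)" by (intro coeffop_sum)
  then obtain I' c' where I': "finite I'" "\<And>v. (\<Sum>x\<in>I. M x v) i j T = (\<Sum>(i', j', T')\<in>I'. c' (i', j', T') * v i' j' T')"
    unfolding coeffop_def by meson
  have "(\<Sum>x\<in>I. M x v) i j T = K (L v) i j T" for v
    by (simp add: sum_apply M_def split_def I)
  then show "\<exists>I' c'. finite I' \<and> (\<forall>v. K (L v) i j T = (\<Sum>(i', j', T')\<in>I'. c' (i', j', T') * v i' j' T'))"
    using I' by (intro exI[of _ I'] exI[of _ c']) simp
qed

lemma coeffop_linear: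
  assumes "coeffop K"
  shows "K (u + v) = K u + K v" "K (pscale c u) = pscale c (K u)"
proof -
  show "K (u + v) = K u + K v"
  proof (intro ext)
    fix i j T
    obtain I d where "\<forall>v. K v i j T = (\<Sum>(i', j', T')\<in>I. d (i', j', T') * v i' j' T')"
      using assms unfolding coeffop_def by meson
    then show "K (u + v) i j T = (K u + K v) i j T"
      by (simp add: sum.distrib[symmetric] split_def distrib_left)
  qed
  show "K (pscale c u) = pscale c (K u)"
  proof (intro ext)
    fix i j T
    obtain I d where "\<forall>v. K v i j T = (\<Sum>(i', j', T')\<in>I. d (i', j', T') * v i' j' T')"
      using assms unfolding coeffop_def by meson
    then show "K (pscale c u) i j T = pscale c (K u) i j T"
      by (simp add: pscale_def sum_distrib_left split_def algebra_simps)
  qed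
qed

lemma coeffop_additive:
  assumes "coeffop K"
  shows "K 0 = 0" "K (- u) = - K u" "K (u - v) = K u - K v" "K (\<Sum>i\<in>I. w i) = (\<Sum>i\<in>I. K (w i))"
  by (rule additive_simps[of K, OF coeffop_linear(1)[OF assms]])+

section \<open>Exterior multiplication, contraction and their anticommutation relations\<close>

definition osign :: "nat \<Rightarrow> nat set \<Rightarrow> complex" where
  "osign A T = (- 1) ^ card {q \<in> T. q < A}"

lemma osign_square: "osign A T * osign A T = 1" "osign A T * (osign A T * c) = c"
  by (simp_all add: osign_def power_add[symmetric] mult_2[symmetric] mult.assoc[symmetric])

lemma osign_insert: "osign A (insert B T) = (if B \<notin> T \<and> B < A then - osign A T else osign A T)"
proof (cases "B \<notin> T \<and> B < A")
  case True
  then have "{q \<in> insert B T. q < A} = insert B {q \<in> T. q < A}" by auto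
  moreover have "finite {q \<in> T. q < A}" by (rule finite_subset[of _ "{..<A}"]) auto
  ultimately show ?thesis using True by (simp add: osign_def)
next
  case False
  then have "{q \<in> insert B T. q < A} = {q \<in> T. q < A}" by auto
  then show ?thesis using False by (auto simp: osign_def)
qed

lemma osign_remove: "osign A (T - {B}) = (if B \<in> T \<and> B < A then - osign A T else osign A T)"
proof (cases "B \<in> T")
  case True
  then have "T = insert B (T - {B})" by auto
  then show ?thesis using osign_insert[of A B "T - {B}"] True by (auto split: if_splits)
qed auto

text \<open>Unlike \<open>wedge (omega A)\<close>, which is 0 at infinite index sets, this keeps all
  coefficients, so that the anticommutation relations hold for every \<open>pform\<close>. The
  exponent in \<open>osign\<close> counts elements of T below A and is finite in any case.\<close>

definition wedge1 :: "nat \<Rightarrow> pform \<Rightarrow> pform" where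
  "wedge1 A v = (\<lambda>i j T. if A \<in> T then osign A T * v i j (T - {A}) else 0)"

definition contr :: "nat \<Rightarrow> pform \<Rightarrow> pform" where
  "contr A v = (\<lambda>i j T. if A \<in> T then 0 else osign A T * v i j (insert A T))"

lemma coeffop_wedge1: "coeffop (wedge1 A)"
proof (rule coeffop_single)
  show "\<exists>c i' j' T'. \<forall>v. wedge1 A v i j T = c * v i' j' T'" for i j T
    by (rule exI[of _ "if A \<in> T then osign A T else 0"], intro exI[of _ i] exI[of _ j] exI[of _ "T - {A}"]) (auto simp: wedge1_def)
qed

lemma coeffop_contr: "coeffop (contr A)"
proof (rule coeffop_single)
  show "\<exists>c i' j' T'. \<forall>v. contr A v i j T = c * v i' j' T'" for i j T
    by (rule exI[of _ "if A \<in> T then 0 else osign A T"], intro exI[of _ i] exI[of _ j] exI[of _ "insert A T"]) (auto simp: contr_def)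
qed

lemma coeffop_ds: "coeffop (ds A')"
proof (rule coeffop_single)
  show "\<exists>c i' j' T'. \<forall>v. ds A' v i j T = c * v i' j' T'" for i j T
  proof (cases "A' = 0")
    case True
    show ?thesis unfolding ds_def True
      by (rule exI[of _ "of_nat (i + 1)"], intro exI[of _ "i + 1"] exI[of _ j] exI[of _ T]) auto
  next
    case False
    then show ?thesis unfolding ds_def
      by (intro exI[of _ "of_nat (j + 1)"] exI[of _ i] exI[of _ "j + 1"] exI[of _ T]) auto
  qed
qed

lemma coeffop_slow: "coeffop (slow A')"
proof (rule coeffop_single)
  show "\<exists>c i' j' T'. \<forall>v. slow A' v i j T = c * v i' j' T'" for i j T
  proof (cases "A' = 0")
    case True
    show ?thesis unfolding slow_def True
      by (rule exI[of _ "if j = 0 then 0 else - 1"], intro exI[of _ i] exI[of _ "j - 1"] exI[of _ T]) auto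
  next
    case False
    then show ?thesis unfolding slow_def
      by (intro exI[of _ "if i = 0 then 0 else 1"] exI[of _ "i - 1"] exI[of _ j] exI[of _ T]) auto
  qed
qed

lemma wedge1_wedge1: "wedge1 A (wedge1 B v) = - wedge1 B (wedge1 A v)"
proof (cases "A = B")
  case True
  then show ?thesis by (auto simp: wedge1_def fun_eq_iff)
next
  case False
  then show ?thesis
    by (auto simp: wedge1_def fun_eq_iff osign_remove Diff_insert2[symmetric] insert_commute Diff_insert[symmetric])
qed

lemma contr_contr: "contr A (contr B v) = - contr B (contr A v)"
proof (cases "A = B")
  case True
  then show ?thesis by (auto simp: contr_def fun_eq_iff)
next
  case False
  then show ?thesis
    by (auto simp: contr_def fun_eq_iff osign_insert insert_commute)
qed

lemma contr_wedge1: "contr A (wedge1 B v) + wedge1 B (contr A v) = (if A = B then v else 0)"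
proof (cases "A = B")
  case True
  then show ?thesis
    by (auto simp: contr_def wedge1_def fun_eq_iff osign_insert osign_remove osign_square insert_absorb)
next
  case False
  have "insert A (T - {B}) = insert A T - {B}" for T using False by auto
  then show ?thesis using False
    by (auto simp: contr_def wedge1_def fun_eq_iff osign_insert osign_remove)
qed

text \<open>Canonical anticommutation relations of two creation operators \<open>O\<^sub>0\<close>, \<open>O\<^sub>1\<close> and their annihilation operators;
  \<open>p\<close> is the projection onto the vacua along the sum of the ranges of \<open>O\<^sub>0\<close> and \<open>O\<^sub>1\<close>.\<close>

locale car =
  fixes O0 O1 J0 J1 :: "'v::ab_group_add \<Rightarrow> 'v"
  assumes add: "O0 (u + v) = O0 u + O0 v" "O1 (u + v) = O1 u + O1 v" "J0 (u + v) = J0 u + J0 v" "J1 (u + v) = J1 u + J1 v"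
    and OO: "O0 (O0 v) = 0" "O1 (O1 v) = 0" "O1 (O0 v) = - O0 (O1 v)"
    and JJ: "J0 (J0 v) = 0" "J1 (J1 v) = 0" "J0 (J1 v) = - J1 (J0 v)"
    and JO: "J0 (O0 v) = v - O0 (J0 v)" "J1 (O1 v) = v - O1 (J1 v)" "J0 (O1 v) = - O1 (J0 v)" "J1 (O0 v) = - O0 (J1 v)"
begin

lemmas additive = add additive_simps[of O0, OF add(1)] additive_simps[of O1, OF add(2)]
  additive_simps[of J0, OF add(3)] additive_simps[of J1, OF add(4)]

text \<open>\<open>O0 O1\<close> kills every multiple of \<open>O0\<close> or \<open>O1\<close>, and
  \<open>J1 J0\<close> inverts it on vacua.\<close>

definition p :: "'v \<Rightarrow> 'v" where "p v = J1 (J0 (O0 (O1 v)))"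

lemma p_eq: "p v = v - O0 (J0 v) - O1 (J1 v) + O0 (O1 (J1 (J0 v)))"
  by (simp add: p_def additive OO JJ JO)

lemma p_add: "p (u + v) = p u + p v" by (simp add: p_def additive)
lemmas p_additive = p_add additive_simps[of p, OF p_add]

lemma p_O: "p (O0 v) = 0" "p (O1 v) = 0"
  by (simp_all add: p_def additive OO JJ JO)

lemma J_p: "J0 (p v) = 0" "J1 (p v) = 0"
  by (simp_all add: p_eq additive OO JJ JO)

lemma p_vacuum: "J0 v = 0 \<Longrightarrow> J1 v = 0 \<Longrightarrow> p v = v"
  by (simp add: p_eq additive)

text \<open>Only the first three components have to be projected: \<open>J1 (J0 v)\<close> is
  already annihilated by both \<open>J0\<close> and \<open>J1\<close>.\<close>

lemma decomposition: "v = p v + O0 (p (J0 v)) + O1 (p (J1 v)) + O0 (O1 (J1 (J0 v)))"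
  by (simp add: p_eq additive OO JJ JO)

lemma O0_O1_eq_0_iff: "O0 (O1 v) = 0 \<longleftrightarrow> p v = 0"
proof
  assume "p v = 0"
  then have "v = O0 (p (J0 v)) + O1 (p (J1 v)) + O0 (O1 (J1 (J0 v)))" using decomposition[of v] by simp
  then have "O0 (O1 v) = O0 (O1 (O0 (p (J0 v)) + O1 (p (J1 v)) + O0 (O1 (J1 (J0 v)))))" by simp
  also have "\<dots> = 0" by (simp add: additive OO)
  finally show "O0 (O1 v) = 0" .
qed (simp add: p_def additive)

lemma eq_O0_O1: "O0 v = 0 \<Longrightarrow> O1 v = 0 \<Longrightarrow> v = O0 (O1 (J1 (J0 v)))"
proof -
  assume "O0 v = 0" "O1 v = 0"
  then have "v = O0 (J0 v)" "v = O1 (J1 v)" "O1 (J0 v) = 0" using JO[of v] by (simp_all add: additive)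
  then show ?thesis using JO(2)[of "J0 v"] by (simp add: additive)
qed

text \<open>\<open>S\<^sub>0\<close>, \<open>S\<^sub>1\<close> stand for either pair of operators acting on the polynomial factor.\<close>

lemma symbol_eq_0_iff:
  assumes S: "\<And>u v. S0 (u + v) = S0 u + S0 v" "\<And>u v. S1 (u + v) = S1 u + S1 v"
    "\<And>v. S0 (O0 v) = O0 (S0 v)" "\<And>v. S0 (O1 v) = O1 (S0 v)" "\<And>v. S1 (O0 v) = O0 (S1 v)" "\<And>v. S1 (O1 v) = O1 (S1 v)"
    "\<And>v. S0 (J0 v) = J0 (S0 v)" "\<And>v. S0 (J1 v) = J1 (S0 v)" "\<And>v. S1 (J0 v) = J0 (S1 v)" "\<And>v. S1 (J1 v) = J1 (S1 v)"
  shows "S0 (O0 v) + S1 (O1 v) = 0 \<longleftrightarrow> S0 (p v) = 0 \<and> S1 (p v) = 0 \<and> J1 (J0 (S0 (O0 v) + S1 (O1 v))) = 0"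
proof -
  note Sa = S(1) additive_simps[of S0, OF S(1)] S(2) additive_simps[of S1, OF S(2)]
  \<comment> \<open>By \<open>decomposition\<close>, ?X is determined by its vacuum part and its
    coefficients of \<open>O0\<close>, \<open>O1\<close> and \<open>O0 O1\<close>. The first is 0
    because \<open>p\<close> kills the ranges of \<open>O0\<close> and \<open>O1\<close>; the next
    two are S0 (p v) and S1 (p v).\<close>
  let ?X = "S0 (O0 v) + S1 (O1 v)"
  have 0: "p ?X = 0" by (simp add: S p_additive p_O)
  have 1: "p (J0 ?X) = S0 (p v)" "p (J1 ?X) = S1 (p v)"
    by (simp_all add: p_def S Sa additive OO JJ JO)
  show ?thesis
  proof
    assume "?X = 0"
    then show "S0 (p v) = 0 \<and> S1 (p v) = 0 \<and> J1 (J0 ?X) = 0"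
      using 1 by (simp add: additive p_additive)
  next
    assume "S0 (p v) = 0 \<and> S1 (p v) = 0 \<and> J1 (J0 ?X) = 0"
    then have "S0 (p v) = 0" "S1 (p v) = 0" "J1 (J0 ?X) = 0" by auto
    then have "p ?X + O0 (p (J0 ?X)) + O1 (p (J1 ?X)) + O0 (O1 (J1 (J0 ?X))) = 0"
      unfolding 0 1 by (simp only: additive add_0_left)
    then show "?X = 0" using decomposition[of ?X] by simp
  qed
qed

end

section \<open>Sections\<close>

definition pdp :: "(nat \<Rightarrow> 'a::euclidean_space) \<Rightarrow> nat \<Rightarrow> 'a psection \<Rightarrow> 'a psection" where
  "pdp b m u x = (\<lambda>i j T. pd b m (\<lambda>y. u y i j T) x)"

definition smooth_section :: "'a::euclidean_space set \<Rightarrow> 'a psection \<Rightarrow> bool" where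
  "smooth_section W u \<longleftrightarrow> (\<forall>i j T. smooth_on W (\<lambda>x. u x i j T))"

lemma smooth_sectionI: "(\<And>i j T. smooth_on W (\<lambda>x. u x i j T)) \<Longrightarrow> smooth_section W u"
  and smooth_sectionD: "smooth_section W u \<Longrightarrow> smooth_on W (\<lambda>x. u x i j T)"
  by (auto simp: smooth_section_def)

lemma smooth_section_cong:
  assumes "open W" "\<And>x. x \<in> W \<Longrightarrow> u x = v x" "smooth_section W u"
  shows "smooth_section W v"
proof (rule smooth_sectionI)
  show "smooth_on W (\<lambda>x. v x i j T)" for i j T
    by (rule smooth_on_cong[OF assms(1) _ smooth_sectionD[OF assms(3)]]) (simp add: assms(2))
qed

lemma smooth_section_add: "open W \<Longrightarrow> smooth_section W u \<Longrightarrow> smooth_section W v \<Longrightarrow> smooth_section W (\<lambda>x. u x + v x)"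
  by (simp add: smooth_section_def smooth_on_add)

lemma smooth_section_diff: "open W \<Longrightarrow> smooth_section W u \<Longrightarrow> smooth_section W v \<Longrightarrow> smooth_section W (\<lambda>x. u x - v x)"
  by (simp add: smooth_section_def smooth_on_diff)

lemma smooth_section_zero: "smooth_section W (\<lambda>x. 0)"
  by (simp add: smooth_section_def smooth_on_const)

lemma smooth_section_sum:
  "open W \<Longrightarrow> (\<And>i. i \<in> I \<Longrightarrow> smooth_section W (u i)) \<Longrightarrow> smooth_section W (\<lambda>x. \<Sum>i\<in>I. u i x)"
  by (simp add: smooth_section_def sum_apply smooth_on_sum)

lemma smooth_section_pscale:
  "open W \<Longrightarrow> smooth_on W c \<Longrightarrow> smooth_section W u \<Longrightarrow> smooth_section W (\<lambda>x. pscale (c x) (u x))"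
  by (simp add: smooth_section_def pscale_def smooth_on_mult)

lemma smooth_section_coeffop:
  assumes "open W" "coeffop K" "smooth_section W u"
  shows "smooth_section W (\<lambda>x. K (u x))"
proof (rule smooth_sectionI)
  fix i j T
  obtain I c where I: "\<forall>v. K v i j T = (\<Sum>(i', j', T')\<in>I. c (i', j', T') * v i' j' T')"
    using assms(2) unfolding coeffop_def by meson
  show "smooth_on W (\<lambda>x. K (u x) i j T)"
    unfolding I[rule_format] split_def
    by (intro smooth_on_sum smooth_on_mult smooth_on_const smooth_sectionD assms)
qed

lemma smooth_on_pd: "smooth_on W f \<Longrightarrow> smooth_on W (pd b m f)"
  unfolding pd_def[abs_def] by (rule smooth_on_frechet_derivative)

lemma smooth_section_pdp: "smooth_section W u \<Longrightarrow> smooth_section W (pdp b m u)"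
  using smooth_on_pd unfolding smooth_section_def pdp_def by fast

lemma pdp_cong:
  assumes "open W" "x \<in> W" "\<And>y. y \<in> W \<Longrightarrow> u y = v y"
  shows "pdp b m u x = pdp b m v x"
  unfolding pdp_def pd_def
  by (intro ext, rule arg_cong[where f = "\<lambda>D. D (b m)"], rule frechet_derivative_cong_open[OF assms(1,2)])
    (simp only: assms(3))

lemma pdp_add:
  assumes "smooth_section W u" "smooth_section W v" "x \<in> W"
  shows "pdp b m (\<lambda>y. u y + v y) x = pdp b m u x + pdp b m v x"
  unfolding pdp_def pd_def
  by (intro ext, simp only: plus_fun_apply, rule frechet_derivative_add)
    (rule smooth_on_differentiable[OF smooth_sectionD assms(3)], rule assms)+

lemma pdp_diff:
  assumes "smooth_section W u" "smooth_section W v" "x \<in> W"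
  shows "pdp b m (\<lambda>y. u y - v y) x = pdp b m u x - pdp b m v x"
  unfolding pdp_def pd_def
  by (intro ext, simp only: minus_apply, rule frechet_derivative_diff)
    (rule smooth_on_differentiable[OF smooth_sectionD assms(3)], rule assms)+

lemma pdp_zero: "pdp b m (\<lambda>y. 0) x = 0"
  unfolding pdp_def pd_def by (intro ext) simp

lemma pdp_sum:
  assumes "open W" "\<And>i. i \<in> I \<Longrightarrow> smooth_section W (u i)" "x \<in> W"
  shows "pdp b m (\<lambda>y. \<Sum>i\<in>I. u i y) x = (\<Sum>i\<in>I. pdp b m (u i) x)"
  using assms(2)
proof (induction I rule: infinite_finite_induct)
  case (insert i I)
  have "pdp b m (\<lambda>y. u i y + (\<Sum>i\<in>I. u i y)) x = pdp b m (u i) x + pdp b m (\<lambda>y. \<Sum>i\<in>I. u i y) x"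
    by (rule pdp_add[OF _ _ assms(3)]) (use insert in \<open>auto intro: smooth_section_sum[OF assms(1)]\<close>)
  also have "pdp b m (\<lambda>y. \<Sum>i\<in>I. u i y) x = (\<Sum>i\<in>I. pdp b m (u i) x)"
    by (rule insert.IH) (simp add: insert.prems)
  finally show ?case by (simp only: sum.insert[OF insert.hyps])
qed (simp_all add: pdp_zero)

lemma pdp_pscale:
  assumes "smooth_on W c" "smooth_section W u" "x \<in> W"
  shows "pdp b m (\<lambda>y. pscale (c y) (u y)) x = pscale (pd b m c x) (u x) + pscale (c x) (pdp b m u x)"
  unfolding pdp_def pd_def pscale_def
  by (intro ext, simp only: plus_fun_apply, rule frechet_derivative_mult)
    (rule smooth_on_differentiable[OF assms(1,3)] smooth_on_differentiable[OF smooth_sectionD[OF assms(2)] assms(3)])+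

lemma pdp_coeffop:
  assumes "open W" "coeffop K" "smooth_section W u" "x \<in> W"
  shows "pdp b m (\<lambda>y. K (u y)) x = K (pdp b m u x)"
proof (intro ext)
  fix i j T
  obtain I c where I: "\<forall>v. K v i j T = (\<Sum>(i', j', T')\<in>I. c (i', j', T') * v i' j' T')"
    using assms(2) unfolding coeffop_def by meson
  have d: "(\<lambda>y. u y i' j' T') differentiable (at x)" for i' j' T'
    using smooth_on_differentiable[OF smooth_sectionD[OF assms(3)] assms(4)] .
  show "pdp b m (\<lambda>y. K (u y)) x i j T = K (pdp b m u x) i j T"
    unfolding pdp_def pd_def I[rule_format] split_def
    by (subst frechet_derivative_sum)
      (auto simp: frechet_derivative_mult[OF differentiable_const d] intro!: differentiable_mult differentiable_const d)
qed

lemma pdp_swap: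
  assumes "open W" "smooth_section W u" "x \<in> W"
  shows "pdp b m (pdp b l u) x = pdp b l (pdp b m u) x"
  unfolding pdp_def pd_def
  by (intro ext frechet_derivative_swap[OF assms(1) smooth_sectionD[OF assms(2)] assms(3)])

declare One_nat_def [simp del] add_2_eq_Suc [simp del] add_2_eq_Suc' [simp del]

section \<open>The operators \<open>d\<^sup>0\<^sup>'\<close>, \<open>d\<^sup>1\<^sup>'\<close> and the boundary frame\<close>

text \<open>The coefficient of the m-th partial derivative in \<nabla>_C with the index A raised;
  raising gives \<nabla>_{C1'} for A = 0 and minus \<nabla>_{C0'} for A = 1.\<close>

definition nabla_coef :: "nat \<Rightarrow> 2 \<Rightarrow> nat \<Rightarrow> complex" where
  "nabla_coef C A m = (let l = C div 2 in
     if even C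
     then (if A = 0 then (if m = 4*l+3 then - 1 else if m = 4*l+4 then - \<i> else 0)
                    else (if m = 4*l+1 then - 1 else if m = 4*l+2 then - \<i> else 0))
     else (if A = 0 then (if m = 4*l+1 then 1 else if m = 4*l+2 then - \<i> else 0)
                    else (if m = 4*l+3 then - 1 else if m = 4*l+4 then \<i> else 0)))"

lemma nabla_up_eq:
  assumes "C < 2*n+2"
  shows "nabla_up b C A f x = (\<Sum>m\<in>{1..4*n+4}. nabla_coef C A m * pd b m f x)"
proof -
  let ?l = "C div 2"
  have l: "?l \<le> n" using assms by linarith
  have two: "(\<Sum>m\<in>{1..4*n+4}. (if m = i then c else if m = i + 1 then d else 0) * pd b m f x) =
      c * pd b i f x + d * pd b (i + 1) f x" if "1 \<le> i" "i + 1 \<le> 4*n+4" for i c d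
  proof -
    have "(\<Sum>m\<in>{1..4*n+4}. (if m = i then c else if m = i + 1 then d else 0) * pd b m f x) =
        (\<Sum>m\<in>{i, i+1}. (if m = i then c else if m = i + 1 then d else 0) * pd b m f x)"
      by (rule sum.mono_neutral_right) (use that in auto)
    then show ?thesis by simp
  qed
  have a: "1 \<le> 4 * ?l + 1" "4 * ?l + 1 + 1 \<le> 4*n+4" "1 \<le> 4 * ?l + 3" "4 * ?l + 3 + 1 \<le> 4*n+4" using l by auto
  have s: "4 * ?l + 2 = 4 * ?l + 1 + 1" "4 * ?l + 4 = 4 * ?l + 3 + 1" by auto
  show ?thesis
    unfolding nabla_up_def nabla_def nabla_coef_def Let_def
    unfolding s
    by (cases "even C"; cases "A = 0") (simp_all only: if_True if_False two[OF a(1,2)] two[OF a(3,4)] one_neq_zero simp_thms, simp_all)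
qed

text \<open>The principal symbol of d^A at the covector dx_m.\<close>

definition Kop :: "nat \<Rightarrow> 2 \<Rightarrow> nat \<Rightarrow> pform \<Rightarrow> pform" where
  "Kop n A m v = (\<Sum>C<2*n+2. pscale (nabla_coef C A m) (wedge1 C v))"

lemma coeffop_Kop: "coeffop (Kop n A m)"
  unfolding Kop_def[abs_def] by (intro coeffop_sum coeffop_pscale coeffop_wedge1)

text \<open>Both operators are exterior multiplications by constant one-forms.\<close>

lemma Kop_anticommute: "Kop n A m (Kop n B l v) = - Kop n B l (Kop n A m v)"
proof -
  have "Kop n A m (Kop n B l v) = (\<Sum>C<2*n+2. \<Sum>C'<2*n+2. pscale (nabla_coef C A m * nabla_coef C' B l) (wedge1 C (wedge1 C' v)))"
    for A B m l
    unfolding Kop_def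
    by (simp only: coeffop_additive[OF coeffop_wedge1] coeffop_linear[OF coeffop_wedge1] pscale_sum pscale_simps)
  note eq = this
  have "Kop n A m (Kop n B l v) = (\<Sum>C'<2*n+2. \<Sum>C<2*n+2. pscale (nabla_coef C A m * nabla_coef C' B l) (wedge1 C (wedge1 C' v)))"
    unfolding eq by (rule sum.swap)
  also have "\<dots> = (\<Sum>C'<2*n+2. \<Sum>C<2*n+2. - pscale (nabla_coef C' B l * nabla_coef C A m) (wedge1 C' (wedge1 C v)))"
    by (intro sum.cong refl) (subst wedge1_wedge1, simp only: pscale_simps mult.commute)
  also have "\<dots> = - Kop n B l (Kop n A m v)"
    unfolding eq by (simp only: sum_negf)
  finally show ?thesis .
qed

lemma contr_Kop:
  assumes "B < 2*n+2"
  shows "contr B (Kop n A m v) = pscale (nabla_coef B A m) v - Kop n A m (contr B v)"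
proof -
  have "contr B (Kop n A m v) + Kop n A m (contr B v) =
      (\<Sum>C<2*n+2. pscale (nabla_coef C A m) (contr B (wedge1 C v) + wedge1 C (contr B v)))"
    unfolding Kop_def coeffop_additive[OF coeffop_contr] coeffop_linear[OF coeffop_contr] pscale_simps(1)
    by (rule sum.distrib[symmetric])
  also have "\<dots> = (\<Sum>C<2*n+2. if C = B then pscale (nabla_coef B A m) v else 0)"
  proof (intro sum.cong refl)
    show "pscale (nabla_coef C A m) (contr B (wedge1 C v) + wedge1 C (contr B v)) =
        (if C = B then pscale (nabla_coef B A m) v else 0)" for C
      unfolding contr_wedge1 by (cases "C = B") (simp_all add: pscale_simps)
  qed
  also have "\<dots> = pscale (nabla_coef B A m) v" using assms by (simp only: sum.delta finite_lessThan lessThan_iff if_True)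
  finally show ?thesis by (simp only: eq_diff_eq)
qed

definition dd :: "(nat \<Rightarrow> 'a::euclidean_space) \<Rightarrow> nat \<Rightarrow> 2 \<Rightarrow> 'a psection \<Rightarrow> 'a psection" where
  "dd b n A u x = (\<Sum>m\<in>{1..4*n+4}. Kop n A m (pdp b m u x))"

lemma smooth_section_dd: "open W \<Longrightarrow> smooth_section W u \<Longrightarrow> smooth_section W (dd b n A u)"
  unfolding dd_def[abs_def]
  by (intro smooth_section_sum smooth_section_coeffop[OF _ coeffop_Kop] smooth_section_pdp)

lemma dd_cong:
  assumes "open W" "x \<in> W" "\<And>y. y \<in> W \<Longrightarrow> u y = v y"
  shows "dd b n A u x = dd b n A v x"
  unfolding dd_def by (simp only: pdp_cong[OF assms])

lemma dd_add:
  assumes "smooth_section W u" "smooth_section W v" "x \<in> W"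
  shows "dd b n A (\<lambda>y. u y + v y) x = dd b n A u x + dd b n A v x"
  unfolding dd_def pdp_add[OF assms] coeffop_linear(1)[OF coeffop_Kop] by (rule sum.distrib)

lemma dd_diff:
  assumes "smooth_section W u" "smooth_section W v" "x \<in> W"
  shows "dd b n A (\<lambda>y. u y - v y) x = dd b n A u x - dd b n A v x"
  unfolding dd_def pdp_diff[OF assms] coeffop_additive[OF coeffop_Kop] by (rule sum_subtractf)

lemma dd_zero: "dd b n A (\<lambda>y. 0) x = 0"
  unfolding dd_def pdp_zero coeffop_additive[OF coeffop_Kop] by (rule sum.neutral_const)

lemma dd_pscale:
  assumes "smooth_on W c" "smooth_section W u" "x \<in> W"
  shows "dd b n A (\<lambda>y. pscale (c y) (u y)) x =
    (\<Sum>m\<in>{1..4*n+4}. pscale (pd b m c x) (Kop n A m (u x))) + pscale (c x) (dd b n A u x)"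
  unfolding dd_def pdp_pscale[OF assms] coeffop_linear[OF coeffop_Kop] pscale_sum by (rule sum.distrib)

lemma dd_coeffop:
  assumes "open W" "coeffop K" "smooth_section W u" "x \<in> W" "\<And>m v. K (Kop n A m v) = pscale s (Kop n A m (K v))" "s * s = 1"
  shows "dd b n A (\<lambda>y. K (u y)) x = pscale s (K (dd b n A u x))"
proof -
  have "Kop n A m (K v) = pscale s (K (Kop n A m v))" for m v
    using assms(6) by (simp add: assms(5) pscale_simps)
  then show ?thesis
    unfolding dd_def pdp_coeffop[OF assms(1-4)] coeffop_additive[OF assms(2)] pscale_sum by simp
qed

lemma dd_commute:
  assumes "open W" "coeffop K" "smooth_section W u" "x \<in> W" "\<And>m v. K (Kop n A m v) = Kop n A m (K v)"
  shows "dd b n A (\<lambda>y. K (u y)) x = K (dd b n A u x)"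
  using dd_coeffop[OF assms(1-4), where n = n and A = A and s = 1 and b = b] assms(5) by (simp add: pscale_simps)

lemma dd_Kop:
  assumes "open W" "smooth_section W u" "x \<in> W"
  shows "dd b n A (\<lambda>y. Kop n B l (u y)) x = - Kop n B l (dd b n A u x)"
proof -
  have "dd b n A (\<lambda>y. Kop n B l (u y)) x = pscale (- 1) (Kop n B l (dd b n A u x))"
    by (rule dd_coeffop[OF assms(1) coeffop_Kop assms(2,3)], subst Kop_anticommute) (simp_all only: pscale_simps, simp)
  then show ?thesis by (simp add: pscale_simps)
qed

lemma dd_pdp:
  assumes "open W" "smooth_section W u" "x \<in> W"
  shows "pdp b m (dd b n A u) x = dd b n A (pdp b m u) x"
proof -
  have "pdp b m (dd b n A u) x = (\<Sum>l\<in>{1..4*n+4}. pdp b m (\<lambda>y. Kop n A l (pdp b l u y)) x)"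
    unfolding dd_def[abs_def]
    by (rule pdp_sum[OF assms(1) _ assms(3)])
      (intro smooth_section_coeffop[OF _ coeffop_Kop] smooth_section_pdp assms)
  also have "\<dots> = (\<Sum>l\<in>{1..4*n+4}. Kop n A l (pdp b m (pdp b l u) x))"
    by (intro sum.cong refl pdp_coeffop[OF assms(1) coeffop_Kop _ assms(3)] smooth_section_pdp assms)
  also have "\<dots> = dd b n A (pdp b m u) x" unfolding dd_def pdp_swap[OF assms, of b m] ..
  finally show ?thesis .
qed

lemma dd_eq:
  assumes "open W" "smooth_section W u" "x \<in> W"
  shows "dd b n A (dd b n B u) x = (\<Sum>m\<in>{1..4*n+4}. \<Sum>l\<in>{1..4*n+4}. Kop n A m (Kop n B l (pdp b m (pdp b l u) x)))"
proof -
  have "dd b n A (dd b n B u) x = (\<Sum>l\<in>{1..4*n+4}. Kop n A l (dd b n B (pdp b l u) x))"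
    by (subst dd_def) (simp only: dd_pdp[OF assms])
  also have "\<dots> = (\<Sum>m\<in>{1..4*n+4}. Kop n A m (\<Sum>l\<in>{1..4*n+4}. Kop n B l (pdp b m (pdp b l u) x)))"
    unfolding dd_def pdp_swap[OF assms] ..
  also have "\<dots> = (\<Sum>m\<in>{1..4*n+4}. \<Sum>l\<in>{1..4*n+4}. Kop n A m (Kop n B l (pdp b m (pdp b l u) x)))"
    by (simp only: coeffop_additive[OF coeffop_Kop])
  finally show ?thesis .
qed

text \<open>Second partial derivatives commute while the symbols \<open>Kop\<close>
  anticommute.\<close>

lemma dd_anticommute:
  assumes "open W" "smooth_section W u" "x \<in> W"
  shows "dd b n A (dd b n B u) x = - dd b n B (dd b n A u) x"
proof -
  have "dd b n A (dd b n B u) x = (\<Sum>l\<in>{1..4*n+4}. \<Sum>m\<in>{1..4*n+4}. Kop n A m (Kop n B l (pdp b m (pdp b l u) x)))"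
    unfolding dd_eq[OF assms] by (rule sum.swap)
  also have "\<dots> = (\<Sum>l\<in>{1..4*n+4}. \<Sum>m\<in>{1..4*n+4}. - Kop n B l (Kop n A m (pdp b l (pdp b m u) x)))"
    by (intro sum.cong refl) (subst Kop_anticommute, subst pdp_swap[OF assms], rule refl)
  also have "\<dots> = - dd b n B (dd b n A u) x" unfolding dd_eq[OF assms] by (simp only: sum_negf)
  finally show ?thesis .
qed

lemma dd_dd_same:
  assumes "open W" "smooth_section W u" "x \<in> W"
  shows "dd b n A (dd b n A u) x = 0"
proof -
  have "v = - v \<Longrightarrow> v = 0" for v :: pform by (auto simp: fun_eq_iff)
  then show ?thesis using dd_anticommute[OF assms] by blast
qed

section \<open>Multiplication by \<Omega>^{A'} and the contractions dual to it\<close>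

locale cf_domain =
  fixes n :: nat and b :: "nat \<Rightarrow> 'a::euclidean_space" and U D :: "'a set" and \<rho> \<psi> :: "'a \<Rightarrow> real"
  assumes bij: "bij_betw b {1..4*n+4} Basis"
    and dom: "graph_domain (b (4*n+1)) U D \<rho> \<psi>"
begin

sublocale graph_domain "b (4*n+1)" U D \<rho> \<psi> by (rule dom)

abbreviation "M \<equiv> {1..4*n+4}"
abbreviation "e \<equiv> 4*n+1"
abbreviation "d \<equiv> dd b n"
abbreviation "K \<equiv> Kop n"

definition r :: "nat \<Rightarrow> 'a \<Rightarrow> complex" where "r m = pd b m (cfun \<rho>)"

lemma r_eq: "x \<in> U \<Longrightarrow> r m x = of_real (frechet_derivative \<rho> (at x) (b m))"
  unfolding r_def pd_def by (rule frechet_derivative_of_real[OF smooth_on_differentiable[OF smooth_\<rho>]])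

lemma smooth_cfun_\<rho>: "smooth_on U (cfun \<rho>)"
  by (intro smooth_on_of_real open_U smooth_\<rho>)

lemma smooth_r: "smooth_on U (r m)"
  unfolding r_def by (rule smooth_on_pd[OF smooth_cfun_\<rho>])

lemma r_e: "x \<in> U \<Longrightarrow> r e x = 1"
  by (simp add: r_eq \<rho>_e)

lemma pd_e_r:
  assumes "x \<in> U"
  shows "pd b e (r m) x = 0"
proof -
  have "pd b e (r m) x = frechet_derivative (\<lambda>y. complex_of_real (frechet_derivative \<rho> (at y) (b m))) (at x) (b e)"
    unfolding pd_def by (rule arg_cong[where f = "\<lambda>D. D (b e)"], rule frechet_derivative_cong_open[OF open_U assms r_eq])
  then show ?thesis
    using frechet_derivative_of_real[OF smooth_on_differentiable[OF smooth_on_frechet_derivative[OF smooth_\<rho>] assms], of "b m" "b e"]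
    by (simp add: \<rho>'_e[OF assms])
qed

lemma pd_r_swap: "x \<in> U \<Longrightarrow> pd b m (r l) x = pd b l (r m) x"
  unfolding r_def pd_def by (rule frechet_derivative_swap[OF open_U smooth_cfun_\<rho>])

text \<open>Exterior multiplication by \<Omega>^A = d^A \<rho>, equivalently the symbol of d^A at
  d\<rho>.\<close>

definition Om :: "2 \<Rightarrow> 'a \<Rightarrow> pform \<Rightarrow> pform" where
  "Om A x v = (\<Sum>m\<in>M. pscale (r m x) (K A m v))"

lemma coeffop_Om: "coeffop (Om A x)"
  unfolding Om_def[abs_def] by (intro coeffop_sum coeffop_pscale coeffop_Kop)

lemmas Om_simps = coeffop_linear[OF coeffop_Om] coeffop_additive[OF coeffop_Om]

lemma smooth_section_Om:
  "open W \<Longrightarrow> W \<subseteq> U \<Longrightarrow> smooth_section W u \<Longrightarrow> smooth_section W (\<lambda>x. Om A x (u x))"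
  unfolding Om_def
  by (intro smooth_section_sum smooth_section_pscale smooth_section_coeffop[OF _ coeffop_Kop])
    (auto intro: smooth_on_subset[OF _ smooth_r])

lemma Om_Kop: "Om A x (K B l v) = - K B l (Om A x v)"
  unfolding Om_def coeffop_additive[OF coeffop_Kop] coeffop_linear[OF coeffop_Kop]
  by (subst Kop_anticommute) (simp only: pscale_simps sum_negf)

lemma Om_anticommute: "Om A x (Om B x v) = - Om B x (Om A x v)"
  by (subst (2) Om_def) (simp only: Om_simps Om_Kop pscale_simps sum_negf Om_def[of B x "Om A x v"])

lemma Om_Om_same: "Om A x (Om A x v) = 0"
proof -
  have "v = - v \<Longrightarrow> v = 0" for v :: pform by (auto simp: fun_eq_iff)
  then show ?thesis using Om_anticommute by blast
qed

lemma d_\<rho>: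
  assumes "open W" "W \<subseteq> U" "smooth_section W u" "x \<in> W"
  shows "d A (\<lambda>y. pscale (cfun \<rho> y) (u y)) x = Om A x (u x) + pscale (cfun \<rho> x) (d A u x)"
  unfolding Om_def r_def using dd_pscale[OF smooth_on_subset[OF assms(2) smooth_cfun_\<rho>] assms(3,4)] .

text \<open>Exterior multiplication by the two-form d^A d^B \<rho>; the form \<E> of the statement
  is minus the case A = 0, B = 1.\<close>

definition E :: "2 \<Rightarrow> 2 \<Rightarrow> 'a \<Rightarrow> pform \<Rightarrow> pform" where
  "E A B x v = (\<Sum>m\<in>M. \<Sum>l\<in>M. pscale (pd b m (r l) x) (K A m (K B l v)))"

lemma coeffop_E: "coeffop (E A B x)"
  unfolding E_def[abs_def] by (intro coeffop_sum coeffop_pscale coeffop_comp[OF coeffop_Kop coeffop_Kop])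

text \<open>The Hessian of \<rho> is symmetric and the symbols \<open>K\<close> anticommute.\<close>

lemma E_anti:
  assumes "x \<in> U"
  shows "E A B x v = - E B A x v"
proof -
  have "E A B x v = (\<Sum>l\<in>M. \<Sum>m\<in>M. pscale (pd b m (r l) x) (K A m (K B l v)))"
    unfolding E_def by (rule sum.swap)
  also have "\<dots> = (\<Sum>l\<in>M. \<Sum>m\<in>M. - pscale (pd b l (r m) x) (K B l (K A m v)))"
    by (intro sum.cong refl) (subst Kop_anticommute, subst pd_r_swap[OF assms], simp only: pscale_simps)
  finally show ?thesis unfolding E_def by (simp only: sum_negf)
qed

lemma E_same: "x \<in> U \<Longrightarrow> E A A x v = 0"
proof -
  have "v = - v \<Longrightarrow> v = 0" for v :: pform by (auto simp: fun_eq_iff)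
  then show "x \<in> U \<Longrightarrow> E A A x v = 0" using E_anti by blast
qed

lemma d_Om:
  assumes "open W" "W \<subseteq> U" "smooth_section W u" "x \<in> W"
  shows "d A (\<lambda>y. Om B y (u y)) x = E A B x (u x) - Om B x (d A u x)"
proof -
  have sm: "smooth_section W (\<lambda>y. K B l (u y))" for l by (intro smooth_section_coeffop[OF _ coeffop_Kop] assms)
  have sr: "smooth_on W (r l)" for l by (rule smooth_on_subset[OF assms(2) smooth_r])
  have dl: "d A (\<lambda>y. pscale (r l y) (K B l (u y))) x =
      (\<Sum>m\<in>M. pscale (pd b m (r l) x) (K A m (K B l (u x)))) - pscale (r l x) (K B l (d A u x))" for l
    unfolding dd_pscale[OF sr sm assms(4)] dd_Kop[OF assms(1,3,4)] by (simp only: pscale_simps) simp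
  have "d A (\<lambda>y. \<Sum>l\<in>M. pscale (r l y) (K B l (u y))) x = (\<Sum>l\<in>M. d A (\<lambda>y. pscale (r l y) (K B l (u y))) x)"
    unfolding dd_def
    by (subst pdp_sum[OF assms(1) _ assms(4)], intro smooth_section_pscale assms(1) sr sm,
        simp only: coeffop_additive[OF coeffop_Kop], rule sum.swap)
  also have "\<dots> = (\<Sum>l\<in>M. \<Sum>m\<in>M. pscale (pd b m (r l) x) (K A m (K B l (u x)))) - Om B x (d A u x)"
    unfolding dl sum_subtractf Om_def ..
  also have "(\<Sum>l\<in>M. \<Sum>m\<in>M. pscale (pd b m (r l) x) (K A m (K B l (u x)))) = E A B x (u x)"
    unfolding E_def by (rule sum.swap)
  finally show ?thesis unfolding Om_def[of B] .
qed

text \<open>The coefficients of \<Omega>^B are first derivatives of \<rho>, and these are constant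
  along e.\<close>

lemma pdp_e_Om:
  assumes "open W" "W \<subseteq> U" "smooth_section W u" "x \<in> W"
  shows "pdp b e (\<lambda>y. Om B y (u y)) x = Om B x (pdp b e u x)"
proof -
  have sm: "smooth_section W (\<lambda>y. K B l (u y))" for l by (intro smooth_section_coeffop[OF _ coeffop_Kop] assms)
  have sr: "smooth_on W (r l)" for l by (rule smooth_on_subset[OF assms(2) smooth_r])
  have "pdp b e (\<lambda>y. \<Sum>l\<in>M. pscale (r l y) (K B l (u y))) x = (\<Sum>l\<in>M. pdp b e (\<lambda>y. pscale (r l y) (K B l (u y))) x)"
    by (rule pdp_sum[OF assms(1) _ assms(4)]) (intro smooth_section_pscale assms(1) sr sm)
  also have "\<dots> = (\<Sum>l\<in>M. pscale (r l x) (K B l (pdp b e u x)))"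
    using assms(2,4)
    by (intro sum.cong refl) (simp only: pdp_pscale[OF sr sm assms(4)] pd_e_r[OF subsetD[OF assms(2,4)]] pdp_coeffop[OF assms(1) coeffop_Kop assms(3,4)] pscale_simps add_0_left)
  finally show ?thesis unfolding Om_def[of B] .
qed

lemma pd_cfun_\<rho>: "pd b m (cfun \<rho>) x = r m x" by (simp add: r_def)

text \<open>The determinant of the matrix N\<rho>. Since the derivative of \<rho> along e is 1 and
  all its derivatives are real, it is 1 plus a sum of squares; this is why the matrix is
  invertible.\<close>

definition dt :: "'a \<Rightarrow> complex" where
  "dt x = 1 + r (4*n+2) x * r (4*n+2) x + r (4*n+3) x * r (4*n+3) x + r (4*n+4) x * r (4*n+4) x"

lemma dt_neq_0: "x \<in> U \<Longrightarrow> dt x \<noteq> 0"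
proof -
  assume x: "x \<in> U"
  have "dt x = of_real (1 + (frechet_derivative \<rho> (at x) (b (4*n+2)))\<^sup>2 + (frechet_derivative \<rho> (at x) (b (4*n+3)))\<^sup>2 +
      (frechet_derivative \<rho> (at x) (b (4*n+4)))\<^sup>2)"
    by (simp add: dt_def r_eq[OF x] power2_eq_square)
  moreover have "1 + (frechet_derivative \<rho> (at x) (b (4*n+2)))\<^sup>2 + (frechet_derivative \<rho> (at x) (b (4*n+3)))\<^sup>2 +
      (frechet_derivative \<rho> (at x) (b (4*n+4)))\<^sup>2 > 0"
    by (intro add_pos_nonneg) auto
  ultimately show ?thesis by (metis of_real_eq_0_iff less_irrefl)
qed

lemma Nlow_eq:
  assumes "x \<in> U"
  shows "Nlow b n 0 0 (cfun \<rho>) x = 1 + \<i> * r (4*n+2) x" "Nlow b n 0 1 (cfun \<rho>) x = - r (4*n+3) x - \<i> * r (4*n+4) x"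
    "Nlow b n 1 0 (cfun \<rho>) x = r (4*n+3) x - \<i> * r (4*n+4) x" "Nlow b n 1 1 (cfun \<rho>) x = 1 - \<i> * r (4*n+2) x"
  using r_e[OF assms] by (simp_all add: Nlow_def nabla_def oidx_def Let_def pd_cfun_\<rho>)

definition invN :: "'a \<Rightarrow> complex^2^2" where
  "invN x = (\<chi> B C. inverse (dt x) * (if B = 0 then (if C = 0 then 1 - \<i> * r (4*n+2) x else r (4*n+3) x + \<i> * r (4*n+4) x)
      else (if C = 0 then - r (4*n+3) x + \<i> * r (4*n+4) x else 1 + \<i> * r (4*n+2) x)))"

lemma Ninv_eq:
  assumes "x \<in> U"
  shows "Ninv b n \<rho> x = invN x"
proof -
  let ?N = "(\<chi> B' C'. Nlow b n B' C' (cfun \<rho>) x)"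
  have i: "inverse (dt x) * dt x = 1" using dt_neq_0[OF assms] by simp
  have "(?N ** invN x) $ B $ C = mat 1 $ B $ C \<and> (invN x ** ?N) $ B $ C = mat 1 $ B $ C" for B C
    using exhaust_01[of B] exhaust_01[of C] i
    by (auto simp: matrix_matrix_mult_def sum_01 invN_def Nlow_eq[OF assms] mat_def dt_def algebra_simps)
  then have P: "?N ** invN x = mat 1 \<and> invN x ** ?N = mat 1" by (simp add: vec_eq_iff)
  \<comment> \<open>\<open>matrix_inv\<close> is a choice among two-sided inverses, so identifying
    it takes uniqueness.\<close>
  have uniq: "B = invN x" if "?N ** B = mat 1 \<and> B ** ?N = mat 1" for B
  proof -
    have "B = B ** (?N ** invN x)" unfolding conjunct1[OF P] matrix_mul_rid ..
    also have "\<dots> = (B ** ?N) ** invN x" by (rule matrix_mul_assoc)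
    also have "\<dots> = invN x" unfolding conjunct2[OF that] matrix_mul_lid ..
    finally show ?thesis .
  qed
  show ?thesis unfolding Ninv_def matrix_inv_def by (rule some_equality) (rule P, rule uniq)
qed

lemma smooth_Ninv: "smooth_on U (\<lambda>x. Ninv b n \<rho> x $ B $ C)"
proof -
  have "smooth_on U (\<lambda>x. inverse (dt x))"
    using dt_neq_0 unfolding dt_def
    by (intro smooth_on_inverse smooth_on_add smooth_on_mult smooth_on_const smooth_r open_U) auto
  then have "smooth_on U (\<lambda>x. invN x $ B $ C)"
    unfolding invN_def
    by (cases "B = 0"; cases "C = 0"; simp;
        intro smooth_on_mult smooth_on_add smooth_on_diff smooth_on_uminus smooth_on_const smooth_r open_U)
  then show ?thesis by (rule smooth_on_cong[OF open_U, rotated]) (simp add: Ninv_eq)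
qed

lemma Nup_eq: "Nup b n B A f x = (\<Sum>m\<in>M. nabla_coef (2*n + oidx B) A m * pd b m f x)"
  unfolding Nup_def by (rule nabla_up_eq) (simp add: oidx_def)

lemma Nup_Nlow: "Nup b n B A f x = (if A = 0 then Nlow b n B 1 f x else - Nlow b n B 0 f x)"
  by (simp add: Nup_def Nlow_def nabla_up_def)

lemma Rcoef_eq: "Rcoef b n \<rho> A B x = (if A = 0 then Ninv b n \<rho> x $ 1 $ B else - Ninv b n \<rho> x $ 0 $ B)"
  using exhaust_01[of A] by (auto simp: Rcoef_def eps_def sum_01)

lemma smooth_Rcoef: "smooth_on U (Rcoef b n \<rho> A B)"
proof -
  have "Rcoef b n \<rho> A B = (\<lambda>x. if A = 0 then Ninv b n \<rho> x $ 1 $ B else - Ninv b n \<rho> x $ 0 $ B)"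
    by (rule ext) (rule Rcoef_eq)
  then show ?thesis using smooth_Ninv smooth_on_uminus[OF open_U smooth_Ninv] by (cases "A = 0") auto
qed

text \<open>Lowering by \<epsilon> in R undoes the raising of the second index: R inverts the matrix
  of the N_B^C \<rho>. This is the duality between \<open>J\<close> and \<open>Om\<close>.\<close>

lemma Rcoef_Nup:
  assumes "x \<in> U"
  shows "(\<Sum>B\<in>UNIV. Rcoef b n \<rho> A B x * Nup b n B C (cfun \<rho>) x) = (if A = C then 1 else 0)"
proof -
  have i: "inverse (dt x) * dt x = 1" using dt_neq_0[OF assms] by simp
  show ?thesis using exhaust_01[of A] exhaust_01[of C] i
    by (auto simp: sum_01 Rcoef_eq Nup_Nlow Nlow_eq[OF assms] Ninv_eq[OF assms] invN_def dt_def algebra_simps)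
qed

text \<open>Contraction with the vector that pairs to \<delta> with \<Omega>^{0'}, \<Omega>^{1'} and
  to 0 with \<omega>^0, ..., \<omega>^{2n-1}: it combines only the two vectors dual to \<omega>^{2n}
  and \<omega>^{2n+1}.\<close>

definition J :: "2 \<Rightarrow> 'a \<Rightarrow> pform \<Rightarrow> pform" where
  "J A x v = (\<Sum>B\<in>UNIV. pscale (Rcoef b n \<rho> A B x) (contr (2*n + oidx B) v))"

lemma coeffop_J: "coeffop (J A x)"
  unfolding J_def[abs_def] by (intro coeffop_sum coeffop_pscale coeffop_contr)

lemmas J_simps = coeffop_linear[OF coeffop_J] coeffop_additive[OF coeffop_J]

lemma smooth_section_J:
  "open W \<Longrightarrow> W \<subseteq> U \<Longrightarrow> smooth_section W u \<Longrightarrow> smooth_section W (\<lambda>x. J A x (u x))"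
  unfolding J_def
  by (intro smooth_section_sum smooth_section_pscale smooth_section_coeffop[OF _ coeffop_contr])
    (auto intro: smooth_on_subset[OF _ smooth_Rcoef])

lemma J_anticommute: "J A x (J B x v) = - J B x (J A x v)"
proof -
  have c: "contr C (J B x v) = - J B x (contr C v)" for C B v
    unfolding J_def coeffop_additive[OF coeffop_contr] coeffop_linear[OF coeffop_contr]
    by (subst contr_contr) (simp only: pscale_simps sum_negf)
  show ?thesis
    by (subst J_def) (simp only: c pscale_simps sum_negf J_simps J_def[of A x v])
qed

lemma J_J_same: "J A x (J A x v) = 0"
proof -
  have "v = - v \<Longrightarrow> v = 0" for v :: pform by (auto simp: fun_eq_iff)
  then show ?thesis using J_anticommute by blast
qed

lemma contr_Om: "contr (2*n + oidx B) (Om A x v) = pscale (Nup b n B A (cfun \<rho>) x) v - Om A x (contr (2*n + oidx B) v)"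
proof -
  have lt: "2*n + oidx B < 2*n+2" by (simp add: oidx_def)
  show ?thesis
    unfolding Om_def coeffop_additive[OF coeffop_contr] coeffop_linear[OF coeffop_contr] contr_Kop[OF lt] Nup_eq
    by (simp only: pscale_simps sum_subtractf pscale_sum_left pd_cfun_\<rho> mult.commute)
qed

lemma J_Om: "x \<in> U \<Longrightarrow> J A x (Om C x v) = (if A = C then v else 0) - Om C x (J A x v)"
proof -
  assume x: "x \<in> U"
  have "J A x (Om C x v) = pscale (\<Sum>B\<in>UNIV. Rcoef b n \<rho> A B x * Nup b n B C (cfun \<rho>) x) v - Om C x (J A x v)"
    by (simp only: J_def contr_Om pscale_simps sum_subtractf pscale_sum_left Om_simps)
  then show ?thesis unfolding Rcoef_Nup[OF x] by (auto simp only: pscale_simps split: if_splits)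
qed

lemma car: "x \<in> U \<Longrightarrow> car (Om 0 x) (Om 1 x) (J 0 x) (J 1 x)"
  by (unfold_locales)
    (simp_all only: Om_simps J_simps Om_Om_same J_J_same J_Om refl if_True if_False zero_neq_one one_neq_zero
      Om_anticommute[of 1 _ 0] J_anticommute[of 0 _ 1] diff_0)

definition p :: "'a \<Rightarrow> pform \<Rightarrow> pform" where
  "p x = car.p (Om 0 x) (Om 1 x) (J 0 x) (J 1 x)"

lemma p_eq: "x \<in> U \<Longrightarrow> p x v = J 1 x (J 0 x (Om 0 x (Om 1 x v)))"
  unfolding p_def by (rule car.p_def[OF car])

lemma coeffop_p: "x \<in> U \<Longrightarrow> coeffop (p x)"
proof -
  assume "x \<in> U"
  then have "p x = (\<lambda>v. J 1 x (J 0 x (Om 0 x (Om 1 x v))))" using p_eq by blast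
  then show "coeffop (p x)"
    using coeffop_comp[OF coeffop_J coeffop_comp[OF coeffop_J coeffop_comp[OF coeffop_Om coeffop_Om]]] by simp
qed

lemma smooth_section_p:
  assumes "open W" "W \<subseteq> U" "smooth_section W u"
  shows "smooth_section W (\<lambda>x. p x (u x))"
proof (rule smooth_section_cong[OF assms(1)])
  show "smooth_section W (\<lambda>x. J 1 x (J 0 x (Om 0 x (Om 1 x (u x)))))"
    by (intro smooth_section_J smooth_section_Om assms)
qed (use assms(2) p_eq in auto)

end

section \<open>Constant coefficient operators and their adjoints\<close>

primrec pdl :: "(nat \<Rightarrow> 'a::euclidean_space) \<Rightarrow> nat list \<Rightarrow> 'a psection \<Rightarrow> 'a psection" where
  "pdl b [] u = u"
| "pdl b (m # r) u = pdp b m (pdl b r u)"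

primrec pds :: "(nat \<Rightarrow> 'a::euclidean_space) \<Rightarrow> nat list \<Rightarrow> ('a \<Rightarrow> complex) \<Rightarrow> 'a \<Rightarrow> complex" where
  "pds b [] f = f"
| "pds b (m # r) f = pd b m (pds b r f)"

lemma pdl_apply: "pdl b r u x i j T = pds b r (\<lambda>y. u y i j T) x"
proof (induction r arbitrary: x)
  case (Cons m r)
  then show ?case by (simp only: pdl.simps pds.simps pdp_def)
qed simp

lemma smooth_section_pdl: "smooth_section W u \<Longrightarrow> smooth_section W (pdl b r u)"
  by (induction r) (auto intro: smooth_section_pdp)

lemma smooth_on_pds: "smooth_on W f \<Longrightarrow> smooth_on W (pds b r f)"
  by (induction r) (auto intro: smooth_on_pd)

lemma test_on_pd: "test_on U f \<Longrightarrow> test_on U (pd b m f)"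
  unfolding pd_def[abs_def] by (rule test_on_frechet_derivative)

lemma test_on_pds: "test_on U f \<Longrightarrow> test_on U (pds b r f)"
  by (induction r) (auto intro: test_on_pd)

lemma pd_swap:
  "open W \<Longrightarrow> smooth_on W f \<Longrightarrow> x \<in> W \<Longrightarrow> pd b m (pd b l f) x = pd b l (pd b m f) x"
  unfolding pd_def by (rule frechet_derivative_swap)

lemma pd_cong:
  assumes "open W" "x \<in> W" "\<And>y. y \<in> W \<Longrightarrow> f y = g y"
  shows "pd b m f x = pd b m g x"
  unfolding pd_def by (rule arg_cong[where f = "\<lambda>D. D (b m)"], rule frechet_derivative_cong_open[OF assms])

lemma pds_pd:
  assumes "open W" "smooth_on W f" "x \<in> W"
  shows "pds b r (pd b m f) x = pd b m (pds b r f) x"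
  using assms(3)
proof (induction r arbitrary: x)
  case (Cons l r)
  have "pds b (l # r) (pd b m f) x = pd b l (pd b m (pds b r f)) x"
    unfolding pds.simps by (rule pd_cong[OF assms(1) Cons.prems Cons.IH])
  also have "\<dots> = pd b m (pds b (l # r) f) x"
    unfolding pds.simps by (rule pd_swap[OF assms(1) smooth_on_pds[OF assms(2)] Cons.prems])
  finally show ?case .
qed simp

lemma pds_cong:
  assumes "open W" "x \<in> W" "\<And>y. y \<in> W \<Longrightarrow> f y = g y"
  shows "pds b r f x = pds b r g x"
  using assms(2)
proof (induction r arbitrary: x)
  case (Cons m r)
  show ?case unfolding pds.simps by (rule pd_cong[OF assms(1) Cons.prems Cons.IH])
qed (simp add: assms(3))

lemma pdl_cong:
  assumes "open W" "x \<in> W" "\<And>y. y \<in> W \<Longrightarrow> u y = v y"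
  shows "pdl b r u x = pdl b r v x"
  by (intro ext, simp only: pdl_apply, rule pds_cong[OF assms(1,2)], simp only: assms(3))

lemma pdl_coeffop:
  assumes "open W" "coeffop K" "smooth_section W u" "x \<in> W"
  shows "pdl b r (\<lambda>y. K (u y)) x = K (pdl b r u x)"
  using assms(4)
proof (induction r arbitrary: x)
  case (Cons m r)
  have "pdl b (m # r) (\<lambda>y. K (u y)) x = pdp b m (\<lambda>y. K (pdl b r u y)) x"
    unfolding pdl.simps by (rule pdp_cong[OF assms(1) Cons.prems Cons.IH])
  also have "\<dots> = K (pdl b (m # r) u x)"
    unfolding pdl.simps by (rule pdp_coeffop[OF assms(1,2) smooth_section_pdl[OF assms(3)] Cons.prems])
  finally show ?case .
qed simp

lemma pds_cmult:
  assumes "open W" "smooth_on W f" "x \<in> W"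
  shows "pds b r (\<lambda>y. f y * c) x = pds b r f x * c"
  using assms(3)
proof (induction r arbitrary: x)
  case (Cons m r)
  have "pds b (m # r) (\<lambda>y. f y * c) x = pd b m (\<lambda>y. pds b r f y * c) x"
    unfolding pds.simps by (rule pd_cong[OF assms(1) Cons.prems Cons.IH])
  also have "\<dots> = pds b (m # r) f x * c"
    unfolding pds.simps pd_def
    by (subst frechet_derivative_mult) (auto intro: smooth_on_differentiable[OF smooth_on_pds[OF assms(2)] Cons.prems])
  finally show ?case .
qed simp

lemma pdl_tensor:
  assumes "open W" "smooth_on W f" "x \<in> W"
  shows "pdl b r (\<lambda>y. pscale (f y) c) x = pscale (pds b r f x) c"
  by (intro ext) (simp only: pdl_apply pscale_def pds_cmult[OF assms])

lemma integral_pds_transpose: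
  assumes "open U" "smooth_on U f" "test_on U g"
  shows "(LINT x|lborel. pds b r f x * g x) = (- 1) ^ length r * (LINT x|lborel. f x * pds b r g x)"
  using assms(3)
proof (induction r arbitrary: g)
  case (Cons m r)
  have sm: "smooth_on U (pds b r f)" by (rule smooth_on_pds[OF assms(2)])
  have t: "test_on U (\<lambda>x. pds b r f x * g x)" by (rule test_on_mult[OF assms(1) Cons.prems sm])
  have i1: "integrable lborel (\<lambda>x. pd b m (pds b r f) x * g x)"
    by (rule test_on_integrable[OF test_on_mult[OF assms(1) Cons.prems smooth_on_pd[OF sm]]])
  have i2: "integrable lborel (\<lambda>x. pds b r f x * pd b m g x)"
    by (rule test_on_integrable[OF test_on_mult[OF assms(1) test_on_pd[OF Cons.prems] sm]])
  have "pd b m (\<lambda>x. pds b r f x * g x) x = pd b m (pds b r f) x * g x + pds b r f x * pd b m g x" for x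
  proof (cases "x \<in> U")
    case True
    then show ?thesis unfolding pd_def
      by (intro frechet_derivative_mult smooth_on_differentiable[OF sm] smooth_on_differentiable[OF test_on_smooth[OF Cons.prems] UNIV_I])
  next
    case False
    then show ?thesis
      using test_on_eq_0[OF Cons.prems False] test_on_eq_0[OF test_on_pd[OF Cons.prems] False] test_on_eq_0[OF test_on_pd[OF t] False] by simp
  qed
  then have "(LINT x|lborel. pd b m (pds b r f) x * g x + pds b r f x * pd b m g x) = 0"
    using integral_frechet_derivative_test[OF test_on_subset[OF t], of "b m"] unfolding pd_def by simp
  then have "(LINT x|lborel. pd b m (pds b r f) x * g x) = - (LINT x|lborel. pds b r f x * pd b m g x)"
    using Bochner_Integration.integral_add[OF i1 i2] by (simp add: eq_neg_iff_add_eq_0)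
  also have "\<dots> = - ((- 1) ^ length r * (LINT x|lborel. f x * pds b r (pd b m g) x))"
    using Cons.IH[OF test_on_pd[OF Cons.prems]] by simp
  also have "\<dots> = (- 1) ^ length (m # r) * (LINT x|lborel. f x * pds b (m # r) g x)"
    using pds_pd[OF open_UNIV test_on_smooth[OF Cons.prems] UNIV_I] by simp
  finally show ?case by simp
qed simp

section \<open>Hermitian inner products on the spaces of forms\<close>

definition emon :: "nat \<times> nat \<times> nat set \<Rightarrow> pform" where
  "emon y = (\<lambda>i j T. if (i, j, T) = y then 1 else 0)"

lemma finite_pform_index: "finite (pform_index N s t)"
proof (rule finite_subset)
  show "pform_index N s t \<subseteq> {..s} \<times> {..s} \<times> Pow {..<N}" by (auto simp: pform_index_def)
qed auto

lemma pforms_expand: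
  assumes "v \<in> pforms N s t"
  shows "v = (\<Sum>(i, j, T)\<in>pform_index N s t. pscale (v i j T) (emon (i, j, T)))"
proof (intro ext)
  fix a c Q
  have "(\<Sum>(i, j, T)\<in>pform_index N s t. pscale (v i j T) (emon (i, j, T))) a c Q =
      (\<Sum>y\<in>pform_index N s t. if y = (a, c, Q) then v a c Q else 0)"
    unfolding sum_apply split_def by (intro sum.cong refl) (auto simp: pscale_def emon_def)
  also have "\<dots> = v a c Q" using assms by (auto simp: sum.delta finite_pform_index pforms_def)
  finally show "v a c Q = (\<Sum>(i, j, T)\<in>pform_index N s t. pscale (v i j T) (emon (i, j, T))) a c Q" by simp
qed

lemma pforms_expand':
  "v \<in> pforms N s t \<Longrightarrow> v = (\<Sum>y\<in>pform_index N s t. pscale (v (fst y) (fst (snd y)) (snd (snd y))) (emon y))"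
  using pforms_expand[of v N s t] by (simp add: split_def)

lemma pforms_zero: "0 \<in> pforms N s t" by (simp add: pforms_def)

lemma pforms_add: "u \<in> pforms N s t \<Longrightarrow> v \<in> pforms N s t \<Longrightarrow> u + v \<in> pforms N s t"
  unfolding pforms_def mem_Collect_eq plus_fun_apply by (metis add_0)

lemma pforms_pscale: "u \<in> pforms N s t \<Longrightarrow> pscale c u \<in> pforms N s t"
  unfolding pforms_def mem_Collect_eq pscale_def by (metis mult_zero_right)

lemma pforms_uminus: "u \<in> pforms N s t \<Longrightarrow> - u \<in> pforms N s t"
  using pforms_pscale[of u N s t "- 1"] by (simp add: pscale_simps)

lemma pforms_diff: "u \<in> pforms N s t \<Longrightarrow> v \<in> pforms N s t \<Longrightarrow> u - v \<in> pforms N s t"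
  using pforms_add[of u N s t "- v"] pforms_uminus by simp

lemma pforms_sum: "(\<And>i. i \<in> I \<Longrightarrow> u i \<in> pforms N s t) \<Longrightarrow> (\<Sum>i\<in>I. u i) \<in> pforms N s t"
  by (induction I rule: infinite_finite_induct) (simp_all add: pforms_zero pforms_add)

lemma emon_pforms: "y \<in> pform_index N s t \<Longrightarrow> emon y \<in> pforms N s t"
  by (auto simp: pforms_def emon_def split: if_splits)

locale hermitian =
  fixes N s :: nat and t :: int and h :: "pform \<Rightarrow> pform \<Rightarrow> complex"
  assumes h: "hermitian_inner (pforms N s t) h"
begin

abbreviation "V \<equiv> pforms N s t"
abbreviation "I \<equiv> pform_index N s t"

lemmas hh = h[unfolded hermitian_inner_def]

lemma h_add: "u \<in> V \<Longrightarrow> v \<in> V \<Longrightarrow> w \<in> V \<Longrightarrow> h (u + v) w = h u w + h v w"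
  by (rule hh[THEN conjunct1, rule_format])

lemma h_scale: "u \<in> V \<Longrightarrow> w \<in> V \<Longrightarrow> h (pscale c u) w = c * h u w"
  by (rule hh[THEN conjunct2, THEN conjunct1, rule_format])

lemma h_sym: "u \<in> V \<Longrightarrow> w \<in> V \<Longrightarrow> h w u = cnj (h u w)"
  by (rule hh[THEN conjunct2, THEN conjunct2, THEN conjunct1, rule_format])

lemma h_pos: "u \<in> V \<Longrightarrow> u \<noteq> 0 \<Longrightarrow> 0 < Re (h u u)"
  by (rule hh[THEN conjunct2, THEN conjunct2, THEN conjunct2, rule_format])

lemma h_zero: "w \<in> V \<Longrightarrow> h 0 w = 0" "w \<in> V \<Longrightarrow> h w 0 = 0"
proof -
  show 1: "w \<in> V \<Longrightarrow> h 0 w = 0" for w using h_scale[OF pforms_zero, of w 0] by (simp add: pscale_simps)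
  show "w \<in> V \<Longrightarrow> h w 0 = 0" using h_sym[OF pforms_zero, of w] 1 by simp
qed

lemma h_sum: "(\<And>i. i \<in> X \<Longrightarrow> u i \<in> V) \<Longrightarrow> w \<in> V \<Longrightarrow> h (\<Sum>i\<in>X. u i) w = (\<Sum>i\<in>X. h (u i) w)"
  by (induction X rule: infinite_finite_induct) (simp_all add: h_zero h_add pforms_sum)

lemma h_add_right: "u \<in> V \<Longrightarrow> v \<in> V \<Longrightarrow> w \<in> V \<Longrightarrow> h w (u + v) = h w u + h w v"
  using h_sym[OF pforms_add, of u v w] h_add[of u v w] h_sym[of u w] h_sym[of v w] by simp

lemma h_scale_right: "u \<in> V \<Longrightarrow> w \<in> V \<Longrightarrow> h w (pscale c u) = cnj c * h w u"
  using h_sym[OF pforms_pscale, of u w c] h_scale[of u w c] h_sym[of u w] by simp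

lemma h_sum_right: "(\<And>i. i \<in> X \<Longrightarrow> u i \<in> V) \<Longrightarrow> w \<in> V \<Longrightarrow> h w (\<Sum>i\<in>X. u i) = (\<Sum>i\<in>X. h w (u i))"
  by (induction X rule: infinite_finite_induct) (simp_all add: h_zero h_add_right pforms_sum)

lemma h_expand: "v \<in> V \<Longrightarrow> w \<in> V \<Longrightarrow> h v w = (\<Sum>(i, j, T)\<in>I. v i j T * h (emon (i, j, T)) w)"
proof -
  assume v: "v \<in> V" and w: "w \<in> V"
  have "h v w = h (\<Sum>(i, j, T)\<in>I. pscale (v i j T) (emon (i, j, T))) w" using pforms_expand[OF v] by simp
  also have "\<dots> = (\<Sum>(i, j, T)\<in>I. h (pscale (v i j T) (emon (i, j, T))) w)"
    unfolding split_def by (rule h_sum[OF _ w]) (auto intro!: pforms_pscale emon_pforms)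
  also have "\<dots> = (\<Sum>(i, j, T)\<in>I. v i j T * h (emon (i, j, T)) w)"
    unfolding split_def by (intro sum.cong refl h_scale w emon_pforms) auto
  finally show ?thesis .
qed

text \<open>Gram-Schmidt, one monomial at a time. Subtracting from \<open>emon x\<close> its
  orthogonal projection w onto the span of the earlier monomials leaves f, orthogonal to these and
  paired nontrivially with \<open>emon x\<close>; a multiple of f corrects the value at x without
  disturbing the others. The induction hypothesis supplies both w and the solution v0 for the
  earlier monomials.\<close>

lemma riesz_finite:
  assumes "finite X" "X \<subseteq> I"
  shows "\<exists>v\<in>V. (\<forall>i j T. v i j T \<noteq> 0 \<longrightarrow> (i, j, T) \<in> X) \<and> (\<forall>y\<in>X. h (emon y) v = c y)"
  using assms
proof (induction X arbitrary: c rule: finite_induct)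
  case empty
  then show ?case by (intro bexI[of _ 0]) (auto simp: pforms_zero)
next
  case (insert x X)
  have xI: "x \<in> I" and XI: "X \<subseteq> I" using insert by auto
  obtain w where w: "w \<in> V" "\<And>i j T. w i j T \<noteq> 0 \<Longrightarrow> (i, j, T) \<in> X" "\<And>y. y \<in> X \<Longrightarrow> h (emon y) w = h (emon y) (emon x)"
    using insert.IH[OF XI, of "\<lambda>y. h (emon y) (emon x)"] by blast
  obtain v0 where v0: "v0 \<in> V" "\<And>i j T. v0 i j T \<noteq> 0 \<Longrightarrow> (i, j, T) \<in> X" "\<And>y. y \<in> X \<Longrightarrow> h (emon y) v0 = c y"
    using insert.IH[OF XI, of c] by blast
  define f where "f = emon x - w"
  have f: "f \<in> V" unfolding f_def by (intro pforms_diff emon_pforms xI w)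
  have f0: "h (emon y) f = 0" if "y \<in> X" for y
  proof -
    have yV: "emon y \<in> V" using that XI emon_pforms by blast
    have "h (emon y) (f + w) = h (emon y) f + h (emon y) w" by (rule h_add_right[OF f w(1) yV])
    then show ?thesis using w(3)[OF that] by (simp add: f_def)
  qed
  have "f \<noteq> 0"
  proof
    assume "f = 0"
    then have "emon x = w" by (simp add: f_def)
    moreover obtain a c Q where "x = (a, c, Q)" by (cases x)
    ultimately have "w a c Q \<noteq> 0" "x = (a, c, Q)" by (auto simp: emon_def)
    then show False using w(2) insert.hyps by blast
  qed
  have "h w f = 0"
    unfolding h_expand[OF w(1) f]
  proof (intro sum.neutral ballI, clarify)
    fix a c Q
    show "w a c Q * h (emon (a, c, Q)) f = 0" using w(2)[of a c Q] f0[of "(a, c, Q)"] by (cases "w a c Q = 0") auto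
  qed
  then have "h (emon x) f = h f f"
    using h_add[OF f w(1) f] by (simp add: f_def)
  then have nz: "h (emon x) f \<noteq> 0" using h_pos[OF f \<open>f \<noteq> 0\<close>] by auto
  \<comment> \<open>The conjugate is needed because h is conjugate linear in its second
    argument.\<close>
  define t0 where "t0 = cnj ((c x - h (emon x) v0) / h (emon x) f)"
  define v where "v = v0 + pscale t0 f"
  have hv: "h (emon y) v = h (emon y) v0 + cnj t0 * h (emon y) f" if "y \<in> I" for y
    unfolding v_def using h_add_right[OF v0(1) pforms_pscale[OF f] emon_pforms[OF that]] h_scale_right[OF f emon_pforms[OF that]] by simp
  show ?case
  proof (intro bexI[of _ v] conjI allI impI ballI)
    show "v \<in> V" unfolding v_def by (intro pforms_add v0 pforms_pscale f)
    fix a c' Q assume "v a c' Q \<noteq> 0"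
    then have "v0 a c' Q \<noteq> 0 \<or> emon x a c' Q \<noteq> 0 \<or> w a c' Q \<noteq> 0" by (auto simp: v_def pscale_def f_def)
    then show "(a, c', Q) \<in> insert x X" using v0(2) w(2) by (auto simp: emon_def split: if_splits)
  next
    fix y assume "y \<in> insert x X"
    then consider "y = x" | "y \<in> X" by blast
    then show "h (emon y) v = c y"
    proof cases
      case 1
      then show ?thesis using hv[OF xI] nz by (simp add: t0_def)
    next
      case 2
      then have "y \<in> I" using XI by blast
      then show ?thesis using hv f0[OF 2] v0(3)[OF 2] by simp
    qed
  qed
qed

definition dual :: "nat \<times> nat \<times> nat set \<Rightarrow> pform" where
  "dual y = (SOME v. v \<in> V \<and> (\<forall>x\<in>I. h (emon x) v = (if x = y then 1 else 0)))"

lemma dual: "dual y \<in> V" "x \<in> I \<Longrightarrow> h (emon x) (dual y) = (if x = y then 1 else 0)"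
proof -
  have "\<exists>v. v \<in> V \<and> (\<forall>x\<in>I. h (emon x) v = (if x = y then 1 else 0))"
    using riesz_finite[OF finite_pform_index subset_refl, of "\<lambda>x. if x = y then 1 else 0"] by blast
  from someI_ex[OF this] show "dual y \<in> V" "x \<in> I \<Longrightarrow> h (emon x) (dual y) = (if x = y then 1 else 0)"
    unfolding dual_def[symmetric] by blast+
qed

lemma h_dual:
  assumes "w \<in> V" "(i, j, T) \<in> I"
  shows "h w (dual (i, j, T)) = w i j T"
proof -
  have "h w (dual (i, j, T)) = (\<Sum>(i', j', T')\<in>I. w i' j' T' * h (emon (i', j', T')) (dual (i, j, T)))"
    by (rule h_expand[OF assms(1) dual(1)])
  also have "\<dots> = (\<Sum>y\<in>I. if y = (i, j, T) then w i j T else 0)"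
  proof (intro sum.cong refl, clarify)
    fix a c Q assume "(a, c, Q) \<in> I"
    then show "w a c Q * h (emon (a, c, Q)) (dual (i, j, T)) = (if (a, c, Q) = (i, j, T) then w i j T else 0)"
      by (cases "(a, c, Q) = (i, j, T)") (simp_all only: dual(2), simp_all)
  qed
  finally show ?thesis using assms(2) by (simp add: sum.delta finite_pform_index)
qed

lemma smooth_h:
  assumes "open W" "w \<in> V" "\<And>x. \<psi> x \<in> V" "smooth_section W \<psi>"
  shows "smooth_on W (\<lambda>x. h w (\<psi> x))"
proof -
  have "(\<lambda>x. h w (\<psi> x)) = (\<lambda>x. cnj (\<Sum>(i, j, T)\<in>I. \<psi> x i j T * h (emon (i, j, T)) w))"
    using h_sym[OF assms(3) assms(2)] h_expand[OF assms(3) assms(2)] by simp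
  then show ?thesis unfolding split_def
    by (simp only:) (intro smooth_on_cnj smooth_on_sum smooth_on_mult smooth_on_const smooth_sectionD assms)
qed

end


section \<open>Green's formula for constant coefficient operators\<close>

locale cc_operator = A: hermitian N s t h + B: hermitian N' s' t' h'
  for N s t h N' s' t' h' +
  fixes b :: "nat \<Rightarrow> 'a::euclidean_space" and R :: "nat list set" and Kr :: "nat list \<Rightarrow> pform \<Rightarrow> pform"
  assumes finite_R: "finite R"
    and coeffop_Kr: "\<And>r. coeffop (Kr r)"
    and Kr_in: "\<And>r v. r \<in> R \<Longrightarrow> v \<in> pforms N s t \<Longrightarrow> Kr r v \<in> pforms N' s' t'"
begin

definition CC :: "'a psection \<Rightarrow> 'a psection" where
  "CC u x = (\<Sum>r\<in>R. Kr r (pdl b r u x))"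

text \<open>The integrand of Green's formula tested against a scalar f: f times the operator applied
  to u, minus u with the transposed derivatives moved onto f. All components of the target are kept
  together.\<close>

definition Qp :: "'a psection \<Rightarrow> ('a \<Rightarrow> complex) \<Rightarrow> 'a psection" where
  "Qp u f x = (\<Sum>r\<in>R. Kr r (pscale (f x) (pdl b r u x) - pscale ((- 1) ^ length r * pds b r f x) (u x)))"

lemma pdl_in:
  assumes "open W" "x \<in> W" "\<And>y. y \<in> W \<Longrightarrow> u y \<in> pforms N s t"
  shows "pdl b r u x \<in> pforms N s t"
proof -
  have "pds b r (\<lambda>y. u y i j T) x = 0" if "(i, j, T) \<notin> pform_index N s t" for i j T
  proof -
    have "pds b r (\<lambda>y. u y i j T) x = pds b r (\<lambda>y. 0) x"
      by (rule pds_cong[OF assms(1,2)]) (use assms(3) that in \<open>auto simp: pforms_def\<close>)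
    moreover have "pds b r (\<lambda>y. 0) = (\<lambda>y. 0)"
      by (induction r) (simp_all add: pd_def[abs_def])
    ultimately show ?thesis by simp
  qed
  then show ?thesis by (auto simp: pforms_def pdl_apply)
qed

lemma CC_in:
  assumes "open W" "x \<in> W" "\<And>y. y \<in> W \<Longrightarrow> u y \<in> pforms N s t"
  shows "CC u x \<in> pforms N' s' t'"
  unfolding CC_def by (intro pforms_sum Kr_in pdl_in[OF assms])

definition gr :: "nat list \<Rightarrow> nat \<times> nat \<times> nat set \<Rightarrow> 'a psection \<Rightarrow> 'a \<Rightarrow> complex" where
  "gr r y \<psi> x = h' (Kr r (emon y)) (\<psi> x)"

text \<open>Integration by parts prescribes the pairing of \<open>adj \<psi>\<close> with each
  monomial; the dual basis assembles these numbers into a vector, conjugated since h is conjugate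
  linear there.\<close>

definition adj :: "'a psection \<Rightarrow> 'a psection" where
  "adj \<psi> x = (\<Sum>y\<in>A.I. pscale (cnj (\<Sum>r\<in>R. (- 1) ^ length r * pds b r (gr r y \<psi>) x)) (A.dual y))"

lemma test_gr:
  assumes \<psi>: "\<psi> \<in> csections U (pforms N' s' t')" and r: "r \<in> R" and y: "y \<in> A.I"
  shows "test_on U (gr r y \<psi>)"
proof -
  obtain C where C: "compact C" "C \<subseteq> U" "\<And>x. x \<notin> C \<Longrightarrow> \<psi> x = 0" using \<psi> by (auto simp: csections_def)
  have e: "Kr r (emon y) \<in> pforms N' s' t'" by (intro Kr_in r emon_pforms y)
  have "smooth_on UNIV (gr r y \<psi>)"
    unfolding gr_def[abs_def]
    by (rule B.smooth_h[OF open_UNIV e]) (use \<psi> in \<open>auto simp: csections_def sections_def smooth_section_def\<close>)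
  moreover have "gr r y \<psi> x = 0" if "x \<notin> C" for x
    using C(3)[OF that] B.h_zero(2)[OF e] by (simp add: gr_def)
  ultimately show ?thesis using C unfolding test_on_def by blast
qed

lemma h_adj:
  assumes "w \<in> pforms N s t"
  shows "h w (adj \<psi> x) = (\<Sum>(i, j, T)\<in>A.I. w i j T * (\<Sum>r\<in>R. (- 1) ^ length r * pds b r (gr r (i, j, T) \<psi>) x))"
proof -
  have "h w (adj \<psi> x) = (\<Sum>y\<in>A.I. h w (pscale (cnj (\<Sum>r\<in>R. (- 1) ^ length r * pds b r (gr r y \<psi>) x)) (A.dual y)))"
    unfolding adj_def by (rule A.h_sum_right) (intro pforms_pscale A.dual assms)+
  also have "\<dots> = (\<Sum>y\<in>A.I. (\<Sum>r\<in>R. (- 1) ^ length r * pds b r (gr r y \<psi>) x) * h w (A.dual y))"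
    by (intro sum.cong refl) (simp only: A.h_scale_right[OF A.dual(1) assms] complex_cnj_cnj)
  also have "\<dots> = (\<Sum>(i, j, T)\<in>A.I. w i j T * (\<Sum>r\<in>R. (- 1) ^ length r * pds b r (gr r (i, j, T) \<psi>) x))"
    unfolding split_def by (intro sum.cong refl) (use A.h_dual[OF assms] in \<open>auto simp: mult.commute\<close>)
  finally show ?thesis .
qed

lemma adj_csections:
  assumes \<psi>: "\<psi> \<in> csections U (pforms N' s' t')"
  shows "adj \<psi> \<in> csections U (pforms N s t)"
proof -
  obtain C where C: "compact C" "C \<subseteq> U" "\<And>x. x \<notin> C \<Longrightarrow> \<psi> x = 0" using \<psi> by (auto simp: csections_def)
  have "\<psi> \<in> csections C (pforms N' s' t')" using \<psi> C by (auto simp: csections_def)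
  then have t: "test_on C (pds b r (gr r y \<psi>))" if "r \<in> R" "y \<in> A.I" for r y
    by (intro test_on_pds test_gr that)
  have "adj \<psi> x = 0" if "x \<notin> C" for x
    unfolding adj_def by (intro sum.neutral ballI) (simp add: test_on_eq_0[OF t that] pscale_simps)
  moreover have "adj \<psi> x \<in> pforms N s t" for x
    unfolding adj_def by (intro pforms_sum pforms_pscale A.dual)
  moreover have "smooth_section UNIV (adj \<psi>)"
    unfolding adj_def[abs_def]
    by (intro smooth_section_sum smooth_section_pscale smooth_on_cnj smooth_on_sum smooth_on_mult smooth_on_const open_UNIV
        test_on_smooth[OF t]) (auto simp: smooth_section_def smooth_on_const)
  ultimately show ?thesis using C unfolding csections_def sections_def smooth_section_def by blast
qed

lemma h_CC:
  assumes "open W" "x \<in> W" "\<And>y. y \<in> W \<Longrightarrow> u y \<in> pforms N s t" "\<psi> x \<in> pforms N' s' t'"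
  shows "h' (CC u x) (\<psi> x) = (\<Sum>(i, j, T)\<in>A.I. \<Sum>r\<in>R. pds b r (\<lambda>y. u y i j T) x * gr r (i, j, T) \<psi> x)"
proof -
  have "h' (CC u x) (\<psi> x) = (\<Sum>r\<in>R. h' (Kr r (pdl b r u x)) (\<psi> x))"
    unfolding CC_def by (rule B.h_sum[OF Kr_in[OF _ pdl_in[OF assms(1-3)]] assms(4)])
  also have "\<dots> = (\<Sum>r\<in>R. \<Sum>(i, j, T)\<in>A.I. pds b r (\<lambda>y. u y i j T) x * gr r (i, j, T) \<psi> x)"
  proof (intro sum.cong refl)
    fix r assume r: "r \<in> R"
    have "Kr r (pdl b r u x) = (\<Sum>y\<in>A.I. pscale (pdl b r u x (fst y) (fst (snd y)) (snd (snd y))) (Kr r (emon y)))"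
      using arg_cong[where f = "Kr r", OF pforms_expand'[OF pdl_in[OF assms(1-3)]]]
      by (simp only: coeffop_additive[OF coeffop_Kr] coeffop_linear[OF coeffop_Kr])
    then have "h' (Kr r (pdl b r u x)) (\<psi> x) = (\<Sum>y\<in>A.I. h' (pscale (pdl b r u x (fst y) (fst (snd y)) (snd (snd y))) (Kr r (emon y))) (\<psi> x))"
      by (simp only:) (rule B.h_sum[OF _ assms(4)], intro pforms_pscale Kr_in r emon_pforms)
    also have "\<dots> = (\<Sum>y\<in>A.I. pdl b r u x (fst y) (fst (snd y)) (snd (snd y)) * h' (Kr r (emon y)) (\<psi> x))"
      by (intro sum.cong refl B.h_scale assms(4) Kr_in r emon_pforms)
    finally show "h' (Kr r (pdl b r u x)) (\<psi> x) = (\<Sum>(i, j, T)\<in>A.I. pds b r (\<lambda>y. u y i j T) x * gr r (i, j, T) \<psi> x)"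
      by (simp only: split_def gr_def pdl_apply prod.collapse)
  qed
  also have "\<dots> = (\<Sum>(i, j, T)\<in>A.I. \<Sum>r\<in>R. pds b r (\<lambda>y. u y i j T) x * gr r (i, j, T) \<psi> x)"
    unfolding split_def by (rule sum.swap)
  finally show ?thesis .
qed

lemma adj_pairing:
  assumes u: "u \<in> csections UNIV (pforms N s t)" and \<psi>: "\<psi> \<in> csections UNIV (pforms N' s' t')"
  shows "(LINT x|lborel. h' (CC u x) (\<psi> x)) = (LINT x|lborel. h (u x) (adj \<psi> x))"
proof -
  have uV: "u x \<in> pforms N s t" and \<psi>V: "\<psi> x \<in> pforms N' s' t'" and us: "smooth_on UNIV (\<lambda>x. u x i j T)" for x i j T
    using u \<psi> by (auto simp: csections_def sections_def)
  have tg: "test_on UNIV (gr r y \<psi>)" if "r \<in> R" "y \<in> A.I" for r y by (rule test_gr[OF \<psi> that])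
  have i1: "integrable lborel (\<lambda>x. pds b r (\<lambda>y. u y i j T) x * gr r (i, j, T) \<psi> x)" if "r \<in> R" "(i, j, T) \<in> A.I" for r i j T
    by (rule test_on_integrable[OF test_on_mult[OF open_UNIV tg[OF that] smooth_on_pds[OF us]]])
  have i2: "integrable lborel (\<lambda>x. u x i j T * pds b r (gr r (i, j, T) \<psi>) x)" if "r \<in> R" "(i, j, T) \<in> A.I" for r i j T
    by (rule test_on_integrable[OF test_on_mult[OF open_UNIV test_on_pds[OF tg[OF that]] us]])
  have "(LINT x|lborel. h' (CC u x) (\<psi> x)) =
      (LINT x|lborel. (\<Sum>y\<in>A.I. \<Sum>r\<in>R. pds b r (\<lambda>z. u z (fst y) (fst (snd y)) (snd (snd y))) x * gr r y \<psi> x))"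
    by (intro arg_cong[where f = "integral\<^sup>L lborel"] ext, rule trans[OF h_CC[OF open_UNIV UNIV_I uV \<psi>V]]) (simp add: split_def)
  also have "\<dots> = (\<Sum>y\<in>A.I. \<Sum>r\<in>R. LINT x|lborel. pds b r (\<lambda>z. u z (fst y) (fst (snd y)) (snd (snd y))) x * gr r y \<psi> x)"
    using i1 by (subst Bochner_Integration.integral_sum; (intro Bochner_Integration.integrable_sum)?)
      (auto intro!: sum.cong Bochner_Integration.integral_sum)
  also have "\<dots> = (\<Sum>y\<in>A.I. \<Sum>r\<in>R. (- 1) ^ length r * (LINT x|lborel. u x (fst y) (fst (snd y)) (snd (snd y)) * pds b r (gr r y \<psi>) x))"
    by (intro sum.cong refl integral_pds_transpose[OF open_UNIV us tg])
  also have "\<dots> = (\<Sum>y\<in>A.I. \<Sum>r\<in>R. LINT x|lborel. (- 1) ^ length r * (u x (fst y) (fst (snd y)) (snd (snd y)) * pds b r (gr r y \<psi>) x))"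
    by simp
  also have "\<dots> = (LINT x|lborel. (\<Sum>y\<in>A.I. \<Sum>r\<in>R. (- 1) ^ length r * (u x (fst y) (fst (snd y)) (snd (snd y)) * pds b r (gr r y \<psi>) x)))"
    using i2 by (subst Bochner_Integration.integral_sum; (intro Bochner_Integration.integrable_sum)?)
      (auto intro!: sum.cong Bochner_Integration.integral_sum[symmetric])
  also have "\<dots> = (LINT x|lborel. h (u x) (adj \<psi> x))"
    by (intro arg_cong[where f = "integral\<^sup>L lborel"] ext)
      (simp only: h_adj[OF uV] split_def prod.collapse sum_distrib_left mult.left_commute)
  finally show ?thesis .
qed

text \<open>The difference v - w is itself an admissible u; tested against it, the hypothesis says
  that the continuous nonnegative function h (v - w) (v - w) has integral 0. This makes the definite
  description in \<open>CFadjoint\<close> meaningful.\<close>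

lemma adj_unique:
  assumes v: "v \<in> csections UNIV (pforms N s t)" and w: "w \<in> csections UNIV (pforms N s t)"
    and eq: "\<And>u. u \<in> csections UNIV (pforms N s t) \<Longrightarrow> (LINT x|lborel. h (u x) (v x)) = (LINT x|lborel. h (u x) (w x))"
  shows "v = w"
proof (rule ext, rule ccontr)
  fix x0 assume ne: "v x0 \<noteq> w x0"
  define z where "z x = v x - w x" for x
  have V: "v x \<in> pforms N s t" "w x \<in> pforms N s t" "smooth_on UNIV (\<lambda>x. v x i j T)" "smooth_on UNIV (\<lambda>x. w x i j T)" for x i j T
    using v w by (auto simp: csections_def sections_def)
  have zV: "z x \<in> pforms N s t" for x unfolding z_def by (intro pforms_diff V)
  have zs: "smooth_section UNIV z" unfolding z_def[abs_def]
    by (intro smooth_section_diff open_UNIV) (simp_all add: smooth_section_def V)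
  obtain C1 where C1: "compact C1" "\<And>x. x \<notin> C1 \<Longrightarrow> v x = 0" using v by (auto simp: csections_def)
  obtain C2 where C2: "compact C2" "\<And>x. x \<notin> C2 \<Longrightarrow> w x = 0" using w by (auto simp: csections_def)
  have z0: "z x = 0" if "x \<notin> C1 \<union> C2" for x using that C1 C2 by (simp add: z_def)
  have zc: "z \<in> csections UNIV (pforms N s t)"
    unfolding csections_def sections_def
    using zV zs z0 compact_Un[OF C1(1) C2(1)] by (auto simp: smooth_section_def)
  have th: "test_on UNIV (\<lambda>x. h (z x) (q x))" if q: "\<And>x. q x \<in> pforms N s t" "smooth_section UNIV q" for q
  proof -
    have "smooth_on UNIV (\<lambda>x. \<Sum>(i, j, T)\<in>A.I. z x i j T * h (emon (i, j, T)) (q x))"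
      unfolding split_def
      by (intro smooth_on_sum smooth_on_mult open_UNIV smooth_sectionD[OF zs] A.smooth_h q) (auto intro: emon_pforms)
    then have "smooth_on UNIV (\<lambda>x. h (z x) (q x))" using A.h_expand[OF zV q(1)] by simp
    moreover have "h (z x) (q x) = 0" if "x \<notin> C1 \<union> C2" for x using z0[OF that] A.h_zero(1)[OF q(1)] by simp
    ultimately show ?thesis using compact_Un[OF C1(1) C2(1)] unfolding test_on_def by blast
  qed
  have vs: "smooth_section UNIV v" "smooth_section UNIV w" by (simp_all add: smooth_section_def V)
  have hz: "h (z x) (z x) = h (z x) (v x) - h (z x) (w x)" for x
  proof -
    have "h (z x) (z x + w x) = h (z x) (z x) + h (z x) (w x)" by (rule A.h_add_right[OF zV V(2) zV])
    then show ?thesis by (simp add: z_def)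
  qed
  have "(LINT x|lborel. h (z x) (z x)) = (LINT x|lborel. h (z x) (v x)) - (LINT x|lborel. h (z x) (w x))"
    unfolding hz by (rule Bochner_Integration.integral_diff) (intro test_on_integrable[OF th] V vs)+
  then have int0: "(LINT x|lborel. h (z x) (z x)) = 0" using eq[OF zc] by simp
  have tz: "test_on UNIV (\<lambda>x. h (z x) (z x))" by (rule th[OF zV zs])
  have real: "h (z x) (z x) = of_real (Re (h (z x) (z x)))" for x
    using A.h_sym[OF zV zV, of x x] by (metis Reals_cnj_iff of_real_Re)
  have nn: "Re (h (z x) (z x)) \<ge> 0" for x
    using A.h_pos[OF zV, of x] A.h_zero(1)[OF pforms_zero] by (cases "z x = 0") (auto intro: less_imp_le)
  have "Re (LINT x|lborel. h (z x) (z x)) = (LINT x|lborel. Re (h (z x) (z x)))"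
    by (rule integral_Re[symmetric]) (rule test_on_integrable[OF tz])
  then have "(LINT x|lborel. Re (h (z x) (z x))) = 0" using int0 by simp
  moreover have "integrable lborel (\<lambda>x. Re (h (z x) (z x)))" by (rule integrable_Re[OF test_on_integrable[OF tz]])
  ultimately have ae: "AE x in lborel. Re (h (z x) (z x)) = 0"
    using integral_nonneg_eq_0_iff_AE[of lborel "\<lambda>x. Re (h (z x) (z x))"] nn by simp
  have cont: "continuous_on UNIV (\<lambda>x. Re (h (z x) (z x)))"
    by (intro smooth_on_continuous smooth_on_Re open_UNIV test_on_smooth[OF tz])
  define O' where "O' = (\<lambda>x. Re (h (z x) (z x))) -` (- {0})"
  have opn: "open O'" unfolding O'_def by (rule open_vimage[OF _ cont]) auto
  have "x0 \<in> O'" using A.h_pos[OF zV, of x0] ne by (auto simp: O'_def z_def)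
  moreover have "negligible O'"
  proof -
    have "AE x in lebesgue. x \<notin> O'" using AE_completion[OF ae] by eventually_elim (auto simp: O'_def)
    moreover have "O' \<in> sets lebesgue" using opn by (simp add: borel_open)
    ultimately show ?thesis by (simp only: negligible_iff_null_sets AE_iff_null_sets)
  qed
  ultimately show False using open_not_negligible[OF opn] by blast
qed

end

lemma pds_pds:
  assumes "open W" "smooth_on W f" "x \<in> W"
  shows "pds b r (pds b q f) x = pds b q (pds b r f) x"
  using assms(3)
proof (induction q arbitrary: x)
  case (Cons m q)
  have "pds b r (pds b (m # q) f) x = pd b m (pds b r (pds b q f)) x"
    unfolding pds.simps by (rule pds_pd[OF assms(1) smooth_on_pds[OF assms(2)] Cons.prems])
  also have "\<dots> = pd b m (pds b q (pds b r f)) x" by (rule pd_cong[OF assms(1) Cons.prems Cons.IH])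
  finally show ?case by simp
qed simp

lemma pds_sum_cmult:
  assumes "open W" "\<And>i. i \<in> X \<Longrightarrow> smooth_on W (f i)" "x \<in> W"
  shows "pds b r (\<lambda>y. \<Sum>i\<in>X. f i y * c i) x = (\<Sum>i\<in>X. pds b r (f i) x * c i)"
  using assms(3)
proof (induction r arbitrary: x)
  case (Cons m r)
  have "pds b (m # r) (\<lambda>y. \<Sum>i\<in>X. f i y * c i) x = pd b m (\<lambda>y. \<Sum>i\<in>X. pds b r (f i) y * c i) x"
    unfolding pds.simps by (rule pd_cong[OF assms(1) Cons.prems Cons.IH])
  also have "\<dots> = (\<Sum>i\<in>X. pds b (m # r) (f i) x * c i)"
  proof -
    have d: "pds b r (f i) differentiable (at x)" if "i \<in> X" for i
      by (rule smooth_on_differentiable[OF smooth_on_pds[OF assms(2)[OF that]] Cons.prems])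
    show ?thesis
      unfolding pds.simps pd_def
      by (subst frechet_derivative_sum)
        (auto simp: frechet_derivative_mult[OF d differentiable_const] intro!: differentiable_mult d differentiable_const sum.cong)
  qed
  finally show ?case .
qed simp

context cc_operator
begin

text \<open>Pairing with monomials replaces the vector valued \<psi> by scalar test
  functions.\<close>

definition chi :: "'a psection \<Rightarrow> nat \<times> nat \<times> nat set \<Rightarrow> 'a \<Rightarrow> complex" where
  "chi \<psi> y x = h' (emon y) (\<psi> x)"

lemma test_chi:
  assumes \<psi>: "\<psi> \<in> csections U (pforms N' s' t')" and y: "y \<in> B.I"
  shows "test_on U (chi \<psi> y)"
proof -
  obtain C where C: "compact C" "C \<subseteq> U" "\<And>x. x \<notin> C \<Longrightarrow> \<psi> x = 0" using \<psi> by (auto simp: csections_def)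
  have "smooth_on UNIV (chi \<psi> y)"
    unfolding chi_def[abs_def]
    by (rule B.smooth_h[OF open_UNIV emon_pforms[OF y]]) (use \<psi> in \<open>auto simp: csections_def sections_def smooth_section_def\<close>)
  moreover have "chi \<psi> y x = 0" if "x \<notin> C" for x
    using C(3)[OF that] B.h_zero(2)[OF emon_pforms[OF y]] by (simp add: chi_def)
  ultimately show ?thesis using C unfolding test_on_def by blast
qed

lemma h'_expand:
  "w \<in> pforms N' s' t' \<Longrightarrow> \<psi> x \<in> pforms N' s' t' \<Longrightarrow> h' w (\<psi> x) = (\<Sum>(i, j, T)\<in>B.I. w i j T * chi \<psi> (i, j, T) x)"
  unfolding chi_def by (rule B.h_expand)

text \<open>The functions \<open>gr\<close> are constant coefficient combinations of the
  \<open>chi\<close>, so in the adjoint term all derivatives fall on the \<open>chi\<close> and the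
  difference splits into components of \<open>Qp\<close>.\<close>

lemma pairing:
  assumes \<psi>: "\<psi> \<in> csections U (pforms N' s' t')"
    and W: "open W" "x \<in> W" "\<And>y. y \<in> W \<Longrightarrow> u y \<in> pforms N s t"
  shows "h' (CC u x) (\<psi> x) - h (u x) (adj \<psi> x) = (\<Sum>(i, j, T)\<in>B.I. Qp u (chi \<psi> (i, j, T)) x i j T)"
proof -
  have \<psi>V: "\<psi> x \<in> pforms N' s' t'" for x using \<psi> by (auto simp: csections_def sections_def)
  have sm: "smooth_on UNIV (chi \<psi> y)" if "y \<in> B.I" for y using test_on_smooth[OF test_chi[OF \<psi> that]] .
  have g: "pds b r (gr r y \<psi>) x = (\<Sum>z\<in>B.I. pds b r (chi \<psi> z) x * Kr r (emon y) (fst z) (fst (snd z)) (snd (snd z)))"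
    if r: "r \<in> R" and y: "y \<in> A.I" for r y
  proof -
    have "gr r y \<psi> = (\<lambda>x. \<Sum>z\<in>B.I. chi \<psi> z x * Kr r (emon y) (fst z) (fst (snd z)) (snd (snd z)))"
      unfolding gr_def using h'_expand[OF Kr_in[OF r emon_pforms[OF y]] \<psi>V] by (intro ext) (simp add: split_def mult.commute)
    then show ?thesis using pds_sum_cmult[OF open_UNIV sm UNIV_I] by simp
  qed
  have Kw: "Kr r w i j T = (\<Sum>y\<in>A.I. w (fst y) (fst (snd y)) (snd (snd y)) * Kr r (emon y) i j T)"
    if "w \<in> pforms N s t" for r w i j T
  proof -
    have "Kr r w = (\<Sum>y\<in>A.I. pscale (w (fst y) (fst (snd y)) (snd (snd y))) (Kr r (emon y)))"
      using arg_cong[where f = "Kr r", OF pforms_expand'[OF that]]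
      by (simp only: coeffop_additive[OF coeffop_Kr] coeffop_linear[OF coeffop_Kr])
    then show ?thesis by (simp add: sum_apply pscale_def)
  qed
  have "h (u x) (adj \<psi> x) = (\<Sum>y\<in>A.I. \<Sum>r\<in>R. \<Sum>z\<in>B.I. u x (fst y) (fst (snd y)) (snd (snd y)) *
      ((- 1) ^ length r * (pds b r (chi \<psi> z) x * Kr r (emon y) (fst z) (fst (snd z)) (snd (snd z)))))"
    unfolding h_adj[OF W(3)[OF W(2)]] split_def prod.collapse
    by (intro sum.cong refl) (simp add: g sum_distrib_left)
  also have "\<dots> = (\<Sum>z\<in>B.I. \<Sum>r\<in>R. \<Sum>y\<in>A.I. u x (fst y) (fst (snd y)) (snd (snd y)) *
      ((- 1) ^ length r * (pds b r (chi \<psi> z) x * Kr r (emon y) (fst z) (fst (snd z)) (snd (snd z)))))"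
    by (subst (2) sum.swap, subst sum.swap, rule sum.cong[OF refl], subst sum.swap) (rule refl)
  also have "\<dots> = (\<Sum>z\<in>B.I. \<Sum>r\<in>R. (- 1) ^ length r * pds b r (chi \<psi> z) x * Kr r (u x) (fst z) (fst (snd z)) (snd (snd z)))"
    by (intro sum.cong refl) (simp add: Kw[OF W(3)[OF W(2)]] sum_distrib_left mult_ac)
  finally have 2: "h (u x) (adj \<psi> x) = \<dots>" .
  have "h' (CC u x) (\<psi> x) = (\<Sum>(i, j, T)\<in>B.I. CC u x i j T * chi \<psi> (i, j, T) x)"
    by (rule h'_expand[OF CC_in[OF W] \<psi>V])
  then have 1: "h' (CC u x) (\<psi> x) = (\<Sum>z\<in>B.I. \<Sum>r\<in>R. chi \<psi> z x * Kr r (pdl b r u x) (fst z) (fst (snd z)) (snd (snd z)))"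
    by (simp add: split_def CC_def sum_apply sum_distrib_left mult.commute)
  have 3: "Qp u f x i j T = (\<Sum>r\<in>R. f x * Kr r (pdl b r u x) i j T - (- 1) ^ length r * pds b r f x * Kr r (u x) i j T)" for f i j T
    unfolding Qp_def by (simp add: sum_apply coeffop_additive[OF coeffop_Kr] coeffop_linear[OF coeffop_Kr] pscale_apply)
  show ?thesis unfolding 1 2 3 split_def by (simp add: sum_subtractf[symmetric])
qed

text \<open>With a test section of this shape f is the only nonzero \<open>chi\<close>, so that any
  single component of \<open>Qp\<close> can be isolated with any scalar test function.\<close>

lemma Qp_dual:
  assumes J: "(i, j, T) \<in> B.I" and z: "z \<in> B.I"
  shows "chi (\<lambda>x. pscale (cnj (f x)) (B.dual (i, j, T))) z x = (if z = (i, j, T) then f x else 0)"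
  unfolding chi_def B.h_scale_right[OF B.dual(1) emon_pforms[OF z]] B.dual(2)[OF z] by simp

lemma Qp_zero: "Qp u (\<lambda>x. 0) x = 0"
proof -
  have "pds b r (\<lambda>y. 0) = (\<lambda>y. 0)" for r by (induction r) (simp_all add: pd_def[abs_def])
  then show ?thesis by (simp add: Qp_def pscale_simps coeffop_additive[OF coeffop_Kr])
qed

lemma test_Qp:
  assumes "open U" "smooth_section U u" "test_on U f"
  shows "test_on U (\<lambda>x. Qp u f x i j T)"
proof -
  have "test_on U (\<lambda>x. \<Sum>r\<in>R. Kr r (pdl b r u x) i j T * f x - (- 1) ^ length r * (Kr r (u x) i j T * pds b r f x))"
    by (intro test_on_sum test_on_diff test_on_cmult test_on_mult assms(1,3) test_on_pds
        smooth_sectionD smooth_section_coeffop[OF assms(1) coeffop_Kr] smooth_section_pdl assms(2))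
  moreover have "(\<lambda>x. Qp u f x i j T) = (\<lambda>x. \<Sum>r\<in>R. Kr r (pdl b r u x) i j T * f x - (- 1) ^ length r * (Kr r (u x) i j T * pds b r f x))"
    unfolding Qp_def by (intro ext) (simp add: sum_apply coeffop_additive[OF coeffop_Kr] coeffop_linear[OF coeffop_Kr] pscale_apply mult_ac)
  ultimately show ?thesis by simp
qed

lemma Qp_in:
  assumes "open W" "x \<in> W" "\<And>y. y \<in> W \<Longrightarrow> u y \<in> pforms N s t"
  shows "Qp u f x \<in> pforms N' s' t'"
  unfolding Qp_def by (intro pforms_sum Kr_in pforms_diff pforms_pscale pdl_in[OF assms]) (use assms in auto)

end

section \<open>The k-Cauchy-Fueter operators\<close>

definition Sop :: "nat \<Rightarrow> nat \<Rightarrow> 2 \<Rightarrow> pform \<Rightarrow> pform" where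
  "Sop k j A = (if j < k then ds A else slow A)"

lemma coeffop_Sop: "coeffop (Sop k j A)"
  by (simp add: Sop_def coeffop_ds coeffop_slow)

lemma Sop_wedge1: "Sop k j A (wedge1 C v) = wedge1 C (Sop k j A v)"
  by (auto simp: Sop_def ds_def slow_def wedge1_def fun_eq_iff)

lemma Sop_contr: "Sop k j A (contr C v) = contr C (Sop k j A v)"
  by (auto simp: Sop_def ds_def slow_def contr_def fun_eq_iff)

lemma Sop_Sop:
  assumes "j < k \<longleftrightarrow> j' < k"
  shows "Sop k j A (Sop k j' B v) = Sop k j' B (Sop k j A v)"
  using assms exhaust_01[of A] exhaust_01[of B]
  by (auto simp: Sop_def ds_def slow_def fun_eq_iff algebra_simps)

lemma Sop_Kop: "Sop k j A (Kop n B m v) = Kop n B m (Sop k j A v)"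
  unfolding Kop_def coeffop_additive[OF coeffop_Sop] coeffop_linear[OF coeffop_Sop] Sop_wedge1 ..

lemma dd_Sop:
  "open W \<Longrightarrow> smooth_section W u \<Longrightarrow> x \<in> W \<Longrightarrow> dd b n B (\<lambda>y. Sop k j A (u y)) x = Sop k j A (dd b n B u x)"
  by (rule dd_commute[OF _ coeffop_Sop _ _ Sop_Kop])

lemma pformsD: "v \<in> pforms N s t \<Longrightarrow> v i j T \<noteq> 0 \<Longrightarrow> i + j = s \<and> T \<subseteq> {..<N} \<and> int (card T) = t"
  by (auto simp: pforms_def pform_index_def)

lemma wedge1_pforms:
  assumes "C < N" "v \<in> pforms N s t"
  shows "wedge1 C v \<in> pforms N s (t + 1)"
  unfolding pforms_def mem_Collect_eq
proof (intro allI impI)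
  fix i j T assume "wedge1 C v i j T \<noteq> 0"
  then have CT: "C \<in> T" and "v i j (T - {C}) \<noteq> 0" by (auto simp: wedge1_def split: if_splits)
  then have v: "i + j = s" "T - {C} \<subseteq> {..<N}" "int (card (T - {C})) = t" using pformsD[OF assms(2)] by blast+
  have "finite T" using finite_subset[OF v(2)] by simp
  then have "card T = Suc (card (T - {C}))" using CT by (rule card.remove)
  then have "int (card T) = t + 1" using v(3) by linarith
  moreover have "T \<subseteq> {..<N}" using v(2) assms(1) CT by auto
  ultimately show "(i, j, T) \<in> pform_index N s (t + 1)" using v(1) by (simp add: pform_index_def)
qed

lemma contr_pforms:
  assumes "v \<in> pforms N s t"
  shows "contr C v \<in> pforms N s (t - 1)"
  unfolding pforms_def mem_Collect_eq
proof (intro allI impI)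
  fix i j T assume "contr C v i j T \<noteq> 0"
  then have CT: "C \<notin> T" and "v i j (insert C T) \<noteq> 0" by (auto simp: contr_def split: if_splits)
  then have v: "i + j = s" "insert C T \<subseteq> {..<N}" "int (card (insert C T)) = t" using pformsD[OF assms] by blast+
  have T: "T \<subseteq> {..<N}" using v(2) by blast
  then have "finite T" using finite_subset by blast
  then have "card (insert C T) = Suc (card T)" using CT by (rule card_insert_disjoint)
  then have "int (card T) = t - 1" using v(3) by linarith
  then show "(i, j, T) \<in> pform_index N s (t - 1)" using v(1) T by (simp add: pform_index_def)
qed

lemma Kop_pforms: "v \<in> pforms (2*n+2) s t \<Longrightarrow> Kop n A m v \<in> pforms (2*n+2) s (t + 1)"
  unfolding Kop_def by (intro pforms_sum pforms_pscale wedge1_pforms) auto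

lemma Sop_pforms:
  assumes "v \<in> pforms N s t"
  shows "j < k \<Longrightarrow> s \<ge> 1 \<Longrightarrow> Sop k j A v \<in> pforms N (s - 1) t" "\<not> j < k \<Longrightarrow> Sop k j A v \<in> pforms N (s + 1) t"
  using assms by (auto simp: Sop_def ds_def slow_def pforms_def pform_index_def split: if_splits) (force+)?

definition Rset :: "nat \<Rightarrow> nat \<Rightarrow> nat \<Rightarrow> nat list set" where
  "Rset n k j = (if j = k then (\<lambda>(m, l). [m, l]) ` ({1..4*n+4} \<times> {1..4*n+4}) else (\<lambda>m. [m]) ` {1..4*n+4})"

definition Kr :: "nat \<Rightarrow> nat \<Rightarrow> nat \<Rightarrow> nat list \<Rightarrow> pform \<Rightarrow> pform" where
  "Kr n k j r v = (if j = k then Kop n 0 (r ! 0) (Kop n 1 (r ! 1) v) else (\<Sum>A\<in>UNIV. Sop k j A (Kop n A (r ! 0) v)))"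

definition ord :: "nat \<Rightarrow> nat \<Rightarrow> nat" where "ord k j = (if j = k then 2 else 1)"

lemma length_Rset: "r \<in> Rset n k j \<Longrightarrow> length r = ord k j"
  by (auto simp: Rset_def ord_def split: if_splits)

lemma finite_Rset: "finite (Rset n k j)" by (simp add: Rset_def)

lemma coeffop_Kr: "coeffop (Kr n k j r)"
proof (cases "j = k")
  case True
  then show ?thesis unfolding Kr_def[abs_def] by (simp add: coeffop_comp[OF coeffop_Kop coeffop_Kop])
next
  case False
  have "coeffop (\<lambda>v. \<Sum>A\<in>UNIV. Sop k j A (Kop n A (r ! 0) v))"
    by (rule coeffop_sum, rule coeffop_comp[OF coeffop_Sop coeffop_Kop])
  then show ?thesis unfolding Kr_def[abs_def] using False by simp
qed

text \<open>At j = k the two factors \<open>Kop\<close> account for the jump of \<open>tau\<close>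
  by 2, and the polynomial degree stays 0.\<close>

lemma Kr_CFspace: "v \<in> CFspace n k j \<Longrightarrow> Kr n k j r v \<in> CFspace n k (Suc j)"
proof -
  assume v: "v \<in> CFspace n k j"
  consider "j < k" | "j = k" | "j > k" by linarith
  then show ?thesis
  proof cases
    case 1
    then have "Kr n k j r v \<in> pforms (2*n+2) (sig k j - 1) (int (tau k j) + 1)"
      using v unfolding Kr_def CFspace_def
      by (simp, intro pforms_sum Sop_pforms(1) Kop_pforms) (auto simp: sig_def)
    moreover have "sig k j - 1 = sig k (Suc j)" "int (tau k j) + 1 = int (tau k (Suc j))" using 1 by (auto simp: sig_def tau_def)
    ultimately show ?thesis unfolding CFspace_def by simp
  next
    case 2
    then have "Kr n k j r v = Kop n 0 (r ! 0) (Kop n 1 (r ! 1) v)" by (simp add: Kr_def)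
    then have "Kr n k j r v \<in> pforms (2*n+2) (sig k j) (int (tau k j) + 1 + 1)"
      using v unfolding CFspace_def by (simp only:) (intro Kop_pforms)
    moreover have "sig k j = sig k (Suc j)" "int (tau k j) + 1 + 1 = int (tau k (Suc j))" using 2 by (auto simp: sig_def tau_def)
    ultimately show ?thesis unfolding CFspace_def by simp
  next
    case 3
    then have "Kr n k j r v \<in> pforms (2*n+2) (sig k j + 1) (int (tau k j) + 1)"
      using v unfolding Kr_def CFspace_def
      by (simp, intro pforms_sum Sop_pforms(2) Kop_pforms) auto
    moreover have "sig k j + 1 = sig k (Suc j)" "int (tau k j) + 1 = int (tau k (Suc j))" using 3 by (auto simp: sig_def tau_def)
    ultimately show ?thesis unfolding CFspace_def by simp
  qed
qed

definition DD :: "(nat \<Rightarrow> 'a::euclidean_space) \<Rightarrow> nat \<Rightarrow> nat \<Rightarrow> nat \<Rightarrow> 'a psection \<Rightarrow> 'a psection" where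
  "DD b n k j u x = (if j = k then dd b n 0 (dd b n 1 u) x else (\<Sum>A\<in>UNIV. Sop k j A (dd b n A u x)))"

lemma DD_eq:
  assumes "open W" "smooth_section W u" "x \<in> W"
  shows "DD b n k j u x = (\<Sum>r\<in>Rset n k j. Kr n k j r (pdl b r u x))"
proof (cases "j = k")
  case True
  have "inj_on (\<lambda>(m, l). [m, l]) ({1..4*n+4} \<times> {1..4*n+4})" by (auto simp: inj_on_def)
  then show ?thesis
    unfolding DD_def dd_eq[OF assms] Rset_def Kr_def using True
    by (simp add: sum.reindex sum.cartesian_product split_def)
next
  case False
  have "inj_on (\<lambda>m. [m]) {1..4*n+4}" by (auto simp: inj_on_def)
  moreover have "(\<Sum>A\<in>UNIV. Sop k j A (dd b n A u x)) = (\<Sum>m\<in>{1..4*n+4}. \<Sum>A\<in>UNIV. Sop k j A (Kop n A m (pdp b m u x)))"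
    unfolding dd_def coeffop_additive[OF coeffop_Sop] by (rule sum.swap)
  ultimately show ?thesis
    unfolding DD_def Rset_def Kr_def using False by (simp add: sum.reindex)
qed

lemma DD_cong:
  assumes "open W" "x \<in> W" "\<And>y. y \<in> W \<Longrightarrow> u y = v y"
  shows "DD b n k j u x = DD b n k j v x"
  unfolding DD_def using dd_cong[OF assms] dd_cong[OF assms(1,2) dd_cong[OF assms(1) _ assms(3)]] by simp

lemma smooth_section_DD: "open W \<Longrightarrow> smooth_section W u \<Longrightarrow> smooth_section W (DD b n k j u)"
  unfolding DD_def[abs_def]
  by (cases "j = k") (simp_all add: smooth_section_dd smooth_section_sum smooth_section_coeffop[OF _ coeffop_Sop])

text \<open>Away from k, commuting polynomial operators meet the anticommuting d^0 and d^1, so mixed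
  terms cancel in pairs. When the composition involves the second order operator, every term
  contains d^0 or d^1 twice.\<close>

lemma DD_DD:
  assumes W: "open W" "smooth_section W u" "x \<in> W"
  shows "DD b n k (Suc j) (DD b n k j u) x = 0"
proof -
  note sm = smooth_section_dd[OF W(1)]
  let ?d = "dd b n"
  have dsum: "?d B (\<lambda>y. \<Sum>A\<in>UNIV. Sop k j A (?d A v y)) x = (\<Sum>A\<in>UNIV. Sop k j A (?d B (?d A v) x))"
    if v: "smooth_section W v" and x: "x \<in> W" for B v x
    unfolding sum_01
    by (subst dd_add[OF _ _ x]) (simp_all add: dd_Sop[OF W(1) sm[OF v] x] smooth_section_coeffop[OF W(1) coeffop_Sop] sm[OF v])
  have anti: "?d 1 (?d 0 u) y = - ?d 0 (?d 1 u) y" if "y \<in> W" for y by (rule dd_anticommute[OF W(1,2) that])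
  have sq: "?d A (?d A v) y = 0" if "smooth_section W v" "y \<in> W" for A v y by (rule dd_dd_same[OF W(1) that])
  consider "j = k" | "Suc j = k" | "j \<noteq> k" "Suc j \<noteq> k" by blast
  then show ?thesis
  proof cases
    case 1
    have "?d 0 (?d 0 (?d 1 u)) x = 0" by (rule sq[OF sm[OF W(2)] W(3)])
    moreover have "?d 1 (?d 0 (?d 1 u)) x = 0"
    proof -
      have "?d 1 (?d 0 (?d 1 u)) x = - ?d 0 (?d 1 (?d 1 u)) x" by (rule dd_anticommute[OF W(1) sm[OF W(2)] W(3)])
      also have "?d 0 (?d 1 (?d 1 u)) x = ?d 0 (\<lambda>y. 0) x" by (rule dd_cong[OF W(1,3)]) (rule sq[OF W(2)])
      finally show ?thesis by (simp only: dd_zero minus_zero)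
    qed
    moreover have "DD b n k j u = ?d 0 (?d 1 u)" using 1 by (simp add: DD_def[abs_def])
    ultimately show ?thesis using 1 by (simp add: DD_def sum_01 coeffop_additive[OF coeffop_Sop])
  next
    case 2
    then have eq: "DD b n k j u = (\<lambda>y. \<Sum>A\<in>UNIV. Sop k j A (?d A u y))" by (auto simp: DD_def)
    have "DD b n k (Suc j) (DD b n k j u) x = ?d 0 (?d 1 (\<lambda>y. \<Sum>A\<in>UNIV. Sop k j A (?d A u y))) x"
      unfolding eq using 2 by (simp add: DD_def)
    also have "\<dots> = ?d 0 (\<lambda>y. - Sop k j 0 (?d 0 (?d 1 u) y)) x"
      by (rule dd_cong[OF W(1,3)], subst dsum[OF W(2)])
        (simp_all add: sum_01 anti sq[OF W(2)] coeffop_additive[OF coeffop_Sop])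
    also have "\<dots> = ?d 0 (\<lambda>y. 0 - Sop k j 0 (?d 0 (?d 1 u) y)) x" by simp
    also have "\<dots> = 0 - Sop k j 0 (?d 0 (?d 0 (?d 1 u)) x)"
      by (subst dd_diff[OF smooth_section_zero _ W(3)])
        (simp_all add: dd_zero dd_Sop[OF W(1) sm[OF sm[OF W(2)]] W(3)] smooth_section_coeffop[OF W(1) coeffop_Sop] sm W(2))
    also have "\<dots> = 0" by (simp add: sq[OF sm[OF W(2)] W(3)] coeffop_additive[OF coeffop_Sop])
    finally show ?thesis .
  next
    case 3
    then have eq: "DD b n k j u = (\<lambda>y. \<Sum>A\<in>UNIV. Sop k j A (?d A u y))" by (auto simp: DD_def)
    have jk: "Suc j < k \<longleftrightarrow> j < k" using 3 by linarith
    have "DD b n k (Suc j) (DD b n k j u) x = (\<Sum>B\<in>UNIV. \<Sum>A\<in>UNIV. Sop k (Suc j) B (Sop k j A (?d B (?d A u) x)))"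
      unfolding eq using 3 by (simp add: DD_def dsum[OF W(2,3)] coeffop_additive[OF coeffop_Sop])
    also have "Sop k (Suc j) = Sop k j" using jk by (simp add: Sop_def fun_eq_iff)
    also have "(\<Sum>B\<in>UNIV. \<Sum>A\<in>UNIV. Sop k j B (Sop k j A (?d B (?d A u) x))) = 0"
      using Sop_Sop[of j k j 0 1]
      by (simp add: sum_01 anti[OF W(3)] sq[OF W(2,3)] coeffop_additive[OF coeffop_Sop])
    finally show ?thesis .
  qed
qed

section \<open>Comparison with the operators of the statement\<close>

lemma wedge_omega: "wedge (omega C) \<alpha> T = (if finite T \<and> C \<in> T then osign C T * \<alpha> (T - {C}) else 0)"
proof (cases "finite T")
  case True
  have fs: "form_sign {C} (T - {C}) = osign C T"
  proof -
    have "{(p, q). p \<in> {C} \<and> q \<in> T - {C} \<and> q < p} = Pair C ` {q \<in> T. q < C}" by auto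
    then show ?thesis unfolding form_sign_def osign_def by (simp add: card_image inj_on_def)
  qed
  have "wedge (omega C) \<alpha> T = (\<Sum>P\<in>Pow T. if P = {C} then osign C T * \<alpha> (T - {C}) else 0)"
    unfolding wedge_def omega_def by (intro sum.cong refl) (auto simp: fs)
  then show ?thesis using True by (simp add: sum.delta)
qed (simp add: wedge_def)

text \<open>\<open>wedge\<close> discards coefficients at infinite index sets while
  \<open>wedge1\<close> keeps them; the assumption on u bridges the difference.\<close>

lemma plift_dform:
  assumes "open W" "x \<in> W" "\<And>y i j T. y \<in> W \<Longrightarrow> infinite T \<Longrightarrow> u y i j T = 0"
  shows "plift (dform b n A) u x = dd b n A u x"
proof (intro ext)
  fix i j T
  have inf0: "pd b m (\<lambda>y. u y i j T') x = 0" if "infinite T'" for m T'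
    using pd_cong[OF assms(1,2), of "\<lambda>y. u y i j T'" "\<lambda>y. 0" b m] assms(3) that by (simp add: pd_def)
  have "plift (dform b n A) u x i j T = (\<Sum>C<2*n+2. if C \<in> T then osign C T * nabla_up b C A (\<lambda>y. u y i j (T - {C})) x else 0)"
    unfolding plift_def dform_def sum_apply wedge_omega
  proof (intro sum.cong refl)
    fix C assume "C \<in> {..<2*n+2}"
    then show "(if finite T \<and> C \<in> T then osign C T * nabla_up b C A (\<lambda>y. u y i j (T - {C})) x else 0) =
        (if C \<in> T then osign C T * nabla_up b C A (\<lambda>y. u y i j (T - {C})) x else 0)"
      using inf0[of "T - {C}"] by (simp add: nabla_up_eq)
  qed
  also have "\<dots> = (\<Sum>C<2*n+2. \<Sum>m\<in>{1..4*n+4}. pscale (nabla_coef C A m) (wedge1 C (pdp b m u x)) i j T)"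
    by (intro sum.cong refl) (auto simp: nabla_up_eq wedge1_def pscale_def pdp_def sum_distrib_left mult_ac intro!: sum.cong)
  also have "\<dots> = dd b n A u x i j T"
    unfolding dd_def Kop_def sum_apply by (rule sum.swap)
  finally show "plift (dform b n A) u x i j T = dd b n A u x i j T" .
qed

lemma plift_dform_infinite: "infinite T \<Longrightarrow> plift (dform b n A) u x i j T = 0"
  unfolding plift_def dform_def sum_apply wedge_omega by simp

lemma pforms_infinite: "v \<in> pforms N s t \<Longrightarrow> infinite T \<Longrightarrow> v i j T = 0"
  unfolding pforms_def pform_index_def using finite_subset[of T "{..<N}"] by blast

lemma CFop_eq:
  assumes "open U" "u \<in> sections U (CFspace n k j)" "x \<in> U"
  shows "CFop b n k U j u x = DD b n k j u x"
proof -
  have inf: "u y i j' T = 0" if "y \<in> U" "infinite T" for y i j' T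
    using assms(2) that pforms_infinite unfolding sections_def CFspace_def by blast
  have d1: "plift (dform b n A) u y = dd b n A u y" if "y \<in> U" for A y
    by (rule plift_dform[OF assms(1) that inf])
  have "plift (dform b n 0) (plift (dform b n 1) u) x = dd b n 0 (plift (dform b n 1) u) x"
    by (rule plift_dform[OF assms(1,3) plift_dform_infinite])
  also have "\<dots> = dd b n 0 (dd b n 1 u) x" by (rule dd_cong[OF assms(1,3) d1])
  finally have d2: "plift (dform b n 0) (plift (dform b n 1) u) x = dd b n 0 (dd b n 1 u) x" .
  show ?thesis unfolding CFop_def DD_def Sop_def using assms(3) by (simp add: d1 d2)
qed

context cf_domain
begin

section \<open>Zero Cauchy data as a boundary condition\<close>

definition tsec :: "'a psection \<Rightarrow> bool" where
  "tsec F \<longleftrightarrow> (\<forall>i j T. test_on U (\<lambda>x. F x i j T))"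

definition IntD :: "'a psection \<Rightarrow> pform" where
  "IntD F = (\<lambda>i j T. LINT x:D|lborel. F x i j T)"

lemma tsecD: "tsec F \<Longrightarrow> test_on U (\<lambda>x. F x i j T)" by (simp add: tsec_def)

lemma tsec_smooth: "tsec F \<Longrightarrow> smooth_section W F"
  unfolding tsec_def smooth_section_def using test_on_smooth by blast

lemma tsec_eq_0: "tsec F \<Longrightarrow> x \<notin> U \<Longrightarrow> F x = 0"
  by (intro ext) (simp add: test_on_eq_0[OF tsecD])

lemma tsec_add: "tsec F \<Longrightarrow> tsec G \<Longrightarrow> tsec (\<lambda>x. F x + G x)"
  by (simp add: tsec_def test_on_add)

lemma tsec_diff: "tsec F \<Longrightarrow> tsec G \<Longrightarrow> tsec (\<lambda>x. F x - G x)"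
  by (simp add: tsec_def test_on_diff)

lemma tsec_sum: "(\<And>i. i \<in> I \<Longrightarrow> tsec (F i)) \<Longrightarrow> tsec (\<lambda>x. \<Sum>i\<in>I. F i x)"
  by (simp add: tsec_def sum_apply test_on_sum)

lemma tsec_pscale: "test_on U f \<Longrightarrow> smooth_section U u \<Longrightarrow> tsec (\<lambda>x. pscale (f x) (u x))"
  unfolding tsec_def pscale_def using test_on_mult[OF open_U] by (simp add: mult.commute smooth_section_def)

lemma tsec_pscale': "smooth_on U c \<Longrightarrow> tsec F \<Longrightarrow> tsec (\<lambda>x. pscale (c x) (F x))"
  unfolding tsec_def pscale_def using test_on_mult[OF open_U] by simp

lemma tsec_coeffop:
  assumes "coeffop L" "tsec F"
  shows "tsec (\<lambda>x. L (F x))"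
  unfolding tsec_def
proof (intro allI)
  fix i j T
  obtain I c where I: "\<forall>v. L v i j T = (\<Sum>(i', j', T')\<in>I. c (i', j', T') * v i' j' T')"
    using assms(1) unfolding coeffop_def by meson
  show "test_on U (\<lambda>x. L (F x) i j T)"
    unfolding I[rule_format] split_def by (intro test_on_sum test_on_cmult tsecD assms)
qed

lemma tsec_pdp: "tsec F \<Longrightarrow> tsec (pdp b m F)"
  unfolding tsec_def pdp_def by (simp add: test_on_pd)

lemma tsec_dd: "tsec F \<Longrightarrow> tsec (d A F)"
  unfolding dd_def[abs_def] by (intro tsec_sum tsec_coeffop[OF coeffop_Kop] tsec_pdp)

lemma tsec_Om: "tsec F \<Longrightarrow> tsec (\<lambda>x. Om A x (F x))"
  unfolding Om_def by (intro tsec_sum tsec_pscale' smooth_r tsec_coeffop[OF coeffop_Kop])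

lemma IntD_cong: "tsec F \<Longrightarrow> tsec G \<Longrightarrow> (\<And>x. x \<in> U \<Longrightarrow> F x = G x) \<Longrightarrow> IntD F = IntD G"
  by (rule arg_cong[where f = IntD]) (metis ext tsec_eq_0)

lemma IntD_add: "tsec F \<Longrightarrow> tsec G \<Longrightarrow> IntD (\<lambda>x. F x + G x) = IntD F + IntD G"
  unfolding IntD_def by (intro ext) (simp add: integral_D_add tsecD)

lemma IntD_diff: "tsec F \<Longrightarrow> tsec G \<Longrightarrow> IntD (\<lambda>x. F x - G x) = IntD F - IntD G"
  unfolding IntD_def by (intro ext) (simp add: integral_D_diff tsecD)

lemma IntD_sum: "(\<And>i. i \<in> I \<Longrightarrow> tsec (F i)) \<Longrightarrow> IntD (\<lambda>x. \<Sum>i\<in>I. F i x) = (\<Sum>i\<in>I. IntD (F i))"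
  unfolding IntD_def by (intro ext) (simp add: sum_apply integral_D_sum tsecD)

lemma IntD_coeffop:
  assumes "coeffop L" "tsec F"
  shows "IntD (\<lambda>x. L (F x)) = L (IntD F)"
proof (intro ext)
  fix i j T
  obtain I c where I: "\<forall>v. L v i j T = (\<Sum>(i', j', T')\<in>I. c (i', j', T') * v i' j' T')"
    using assms(1) unfolding coeffop_def by meson
  have "IntD (\<lambda>x. L (F x)) i j T = (LINT x:D|lborel. (\<Sum>y\<in>I. c (fst y, fst (snd y), snd (snd y)) * F x (fst y) (fst (snd y)) (snd (snd y))))"
    unfolding IntD_def I[rule_format] split_def ..
  also have "\<dots> = (\<Sum>y\<in>I. LINT x:D|lborel. c (fst y, fst (snd y), snd (snd y)) * F x (fst y) (fst (snd y)) (snd (snd y)))"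
    by (intro integral_D_sum test_on_cmult tsecD assms)
  also have "\<dots> = L (IntD F) i j T"
    unfolding IntD_def I[rule_format] split_def integral_D_cmult ..
  finally show "IntD (\<lambda>x. L (F x)) i j T = L (IntD F) i j T" .
qed

lemma IntD_pdp:
  assumes F: "tsec F"
  shows "IntD (pdp b m F) = IntD (pdp b e (\<lambda>y. pscale (r m y) (F y)))"
proof (intro ext)
  fix i j T
  have eq: "(\<lambda>y. of_real (frechet_derivative \<rho> (at y) (b m)) * F y i j T) = (\<lambda>y. r m y * F y i j T)"
    by (intro ext) (metis r_eq tsec_eq_0[OF F] mult_zero_right zero_fun_apply)
  show "IntD (pdp b m F) i j T = IntD (pdp b e (\<lambda>y. pscale (r m y) (F y))) i j T"
    unfolding IntD_def pdp_def pd_def pscale_def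
    using integral_D_derivative[OF tsecD[OF F], of i j T "b m"] unfolding eq .
qed

text \<open>Stokes without a boundary measure: each partial derivative becomes the derivative along
  e of F times a component of d\<rho>, and these factors add up to multiplication by
  \<Omega>^A.\<close>

lemma IntD_d:
  assumes F: "tsec F"
  shows "IntD (d A F) = IntD (pdp b e (\<lambda>y. Om A y (F y)))"
proof -
  have t: "tsec (\<lambda>y. pscale (r m y) (F y))" for m by (intro tsec_pscale' smooth_r F)
  have t': "tsec (\<lambda>y. K A m (pscale (r m y) (F y)))" for m by (intro tsec_coeffop[OF coeffop_Kop] t)
  have "IntD (d A F) = (\<Sum>m\<in>M. K A m (IntD (pdp b m F)))"
    unfolding dd_def[abs_def]
    by (simp only: IntD_sum[OF tsec_coeffop[OF coeffop_Kop tsec_pdp[OF F]]] IntD_coeffop[OF coeffop_Kop tsec_pdp[OF F]])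
  also have "\<dots> = (\<Sum>m\<in>M. IntD (\<lambda>x. K A m (pdp b e (\<lambda>y. pscale (r m y) (F y)) x)))"
    by (simp only: IntD_pdp[OF F] IntD_coeffop[OF coeffop_Kop tsec_pdp[OF t]])
  also have "\<dots> = IntD (\<lambda>x. \<Sum>m\<in>M. K A m (pdp b e (\<lambda>y. pscale (r m y) (F y)) x))"
    by (rule IntD_sum[symmetric]) (intro tsec_coeffop[OF coeffop_Kop] tsec_pdp t)
  also have "(\<lambda>x. \<Sum>m\<in>M. K A m (pdp b e (\<lambda>y. pscale (r m y) (F y)) x)) = pdp b e (\<lambda>y. Om A y (F y))"
  proof
    fix x
    have "pdp b e (\<lambda>y. Om A y (F y)) x = pdp b e (\<lambda>y. \<Sum>m\<in>M. K A m (pscale (r m y) (F y))) x"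
      unfolding Om_def coeffop_linear[OF coeffop_Kop] ..
    also have "\<dots> = (\<Sum>m\<in>M. pdp b e (\<lambda>y. K A m (pscale (r m y) (F y))) x)"
      by (rule pdp_sum[OF open_UNIV tsec_smooth[OF t'] UNIV_I])
    also have "\<dots> = (\<Sum>m\<in>M. K A m (pdp b e (\<lambda>y. pscale (r m y) (F y)) x))"
      by (intro sum.cong refl pdp_coeffop[OF open_UNIV coeffop_Kop tsec_smooth[OF t] UNIV_I])
    finally show "(\<Sum>m\<in>M. K A m (pdp b e (\<lambda>y. pscale (r m y) (F y)) x)) = pdp b e (\<lambda>y. Om A y (F y)) x" by simp
  qed
  finally show ?thesis .
qed

lemma IntD_vanish:
  assumes F: "tsec F" and "\<And>x. x \<in> S \<Longrightarrow> F x = 0"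
  shows "IntD (pdp b e F) = 0"
  unfolding IntD_def pdp_def pd_def
  by (intro ext) (simp add: integral_D_derivative_vanishing[OF tsecD[OF F]] assms(2))

lemma IntD_eq_on_S:
  assumes "tsec F" "tsec G" "\<And>x. x \<in> S \<Longrightarrow> F x = G x"
  shows "IntD (pdp b e F) = IntD (pdp b e G)"
proof -
  have "IntD (pdp b e (\<lambda>x. F x - G x)) = 0" by (rule IntD_vanish[OF tsec_diff[OF assms(1,2)]]) (simp add: assms(3))
  moreover have "pdp b e (\<lambda>x. F x - G x) = (\<lambda>x. pdp b e F x - pdp b e G x)"
    using pdp_diff[OF tsec_smooth[OF assms(1)] tsec_smooth[OF assms(2)] UNIV_I] by (intro ext) simp
  ultimately show ?thesis using IntD_diff[OF tsec_pdp tsec_pdp, OF assms(1,2)] by simp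
qed

lemma IntD_nondegenerate:
  assumes G: "smooth_section U G" and int: "\<And>f. test_on U f \<Longrightarrow> IntD (pdp b e (\<lambda>x. pscale (f x) (G x))) = 0"
    and x: "x \<in> S"
  shows "G x = 0"
proof (intro ext)
  fix i j T
  have "(LINT x:D|lborel. frechet_derivative (\<lambda>x. f x * G x i j T) (at x) (b e)) = 0" if "test_on U f" for f
    using fun_cong[OF fun_cong[OF fun_cong[OF int[OF that]]], of i j T] by (simp add: IntD_def pdp_def pd_def pscale_def)
  then show "G x i j T = 0 i j T"
    using integral_D_derivative_nondegenerate[OF smooth_sectionD[OF G] _ x] by simp
qed

lemma IntD_boundary_iff:
  assumes G: "smooth_section U G"
  shows "(\<forall>f. test_on U f \<longrightarrow> IntD (pdp b e (\<lambda>x. pscale (f x) (G x))) = 0) \<longleftrightarrow> (\<forall>x\<in>S. G x = 0)"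
proof (intro iffI ballI allI impI)
  show "G x = 0" if "\<forall>f. test_on U f \<longrightarrow> IntD (pdp b e (\<lambda>x. pscale (f x) (G x))) = 0" "x \<in> S" for x
    by (rule IntD_nondegenerate[OF G that(1)[rule_format] that(2)])
  show "IntD (pdp b e (\<lambda>x. pscale (f x) (G x))) = 0" if "\<forall>x\<in>S. G x = 0" "test_on U f" for f
    by (rule IntD_vanish[OF tsec_pscale[OF that(2) G]]) (simp add: that(1) pscale_simps)
qed

end

section \<open>Zero Cauchy data in terms of scalar test functions\<close>

locale cf_complex = cf_domain +
  fixes k :: nat and h :: "nat \<Rightarrow> pform \<Rightarrow> pform \<Rightarrow> complex"
  assumes herm: "\<And>j. j \<le> 2*n+1 \<Longrightarrow> hermitian_inner (CFspace n k j) (h j)"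
begin

lemma cc: "j \<le> 2*n \<Longrightarrow> cc_operator (2*n+2) (sig k j) (int (tau k j)) (h j) (2*n+2) (sig k (Suc j)) (int (tau k (Suc j))) (h (Suc j))
    (Rset n k j) (Kr n k j)"
  using herm[of j] herm[of "Suc j"] Kr_CFspace[of _ n k j]
  by (auto simp: cc_operator_def cc_operator_axioms_def hermitian_def CFspace_def finite_Rset coeffop_Kr)

abbreviation "Q j \<equiv> cc_operator.Qp b (Rset n k j) (Kr n k j)"
abbreviation "\<D> j \<equiv> DD b n k j"
abbreviation "\<Gamma> j \<equiv> sections U (CFspace n k j)"
abbreviation "\<J> j \<equiv> zero_Cauchy b n k h U D j"

lemma sections_smooth: "u \<in> sections W V \<Longrightarrow> smooth_section W u"
  and sections_in: "u \<in> sections W V \<Longrightarrow> x \<in> W \<Longrightarrow> u x \<in> V"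
  and sections_0: "u \<in> sections W V \<Longrightarrow> x \<notin> W \<Longrightarrow> u x = 0"
  by (auto simp: sections_def smooth_section_def)

lemma CFop_outside: "x \<notin> W \<Longrightarrow> CFop b n k W j u x = 0"
  by (simp add: CFop_def)

lemma CFop_CC:
  assumes "j \<le> 2*n" "open W" "u \<in> sections W (CFspace n k j)" "x \<in> W"
  shows "CFop b n k W j u x = cc_operator.CC b (Rset n k j) (Kr n k j) u x"
proof -
  interpret cc_operator "2*n+2" "sig k j" "int (tau k j)" "h j" "2*n+2" "sig k (Suc j)" "int (tau k (Suc j))" "h (Suc j)" b "Rset n k j" "Kr n k j"
    by (rule cc[OF assms(1)])
  show ?thesis
    unfolding CFop_eq[OF assms(2-4)] DD_eq[OF assms(2) sections_smooth[OF assms(3)] assms(4)] CC_def ..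
qed

lemma CFop_sections:
  assumes "j \<le> 2*n" "open W" "u \<in> sections W (CFspace n k j)"
  shows "CFop b n k W j u \<in> sections W (CFspace n k (Suc j))"
proof -
  interpret cc_operator "2*n+2" "sig k j" "int (tau k j)" "h j" "2*n+2" "sig k (Suc j)" "int (tau k (Suc j))" "h (Suc j)" b "Rset n k j" "Kr n k j"
    by (rule cc[OF assms(1)])
  have "CFop b n k W j u x \<in> CFspace n k (Suc j)" if "x \<in> W" for x
    unfolding CFop_CC[OF assms that] CFspace_def
    using CC_in[OF assms(2) that, of u] sections_in[OF assms(3)] by (simp add: CFspace_def)
  moreover have "smooth_section W (CFop b n k W j u)"
    by (rule smooth_section_cong[OF assms(2) _ smooth_section_DD[OF assms(2) sections_smooth[OF assms(3)]]])
      (rule CFop_eq[OF assms(2,3), symmetric])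
  ultimately show ?thesis by (simp add: sections_def CFop_outside smooth_section_def)
qed

lemma CFadjoint_eq:
  assumes j: "j \<le> 2*n" and \<eta>: "\<eta> \<in> csections UNIV (CFspace n k (Suc j))"
  shows "CFadjoint b n k h j \<eta> = cc_operator.adj (2*n+2) (sig k j) (int (tau k j)) (h j) (h (Suc j)) b (Rset n k j) (Kr n k j) \<eta>"
proof -
  interpret cc_operator "2*n+2" "sig k j" "int (tau k j)" "h j" "2*n+2" "sig k (Suc j)" "int (tau k (Suc j))" "h (Suc j)" b "Rset n k j" "Kr n k j"
    by (rule cc[OF j])
  note \<eta>' = \<eta>[unfolded CFspace_def]
  have ac: "adj \<eta> \<in> csections UNIV (CFspace n k j)" unfolding CFspace_def by (rule adj_csections[OF \<eta>'])
  have pr: "(LINT x|lborel. h (Suc j) (CFop b n k UNIV j u x) (\<eta> x)) = (LINT x|lborel. h j (u x) (adj \<eta> x))"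
    if u: "u \<in> csections UNIV (CFspace n k j)" for u
  proof -
    have "u \<in> sections UNIV (CFspace n k j)" using u by (simp add: csections_def)
    then have "CFop b n k UNIV j u = CC u" using CFop_CC[OF j open_UNIV _ UNIV_I] by blast
    then show ?thesis using adj_pairing[OF u[unfolded CFspace_def] \<eta>'] by simp
  qed
  show ?thesis
    unfolding CFadjoint_def
  proof (rule the_equality)
    fix v assume v: "v \<in> csections UNIV (CFspace n k j) \<and> (\<forall>u\<in>csections UNIV (CFspace n k j).
        (LINT x|lborel. h (Suc j) (CFop b n k UNIV j u x) (\<eta> x)) = (LINT x|lborel. h j (u x) (v x)))"
    show "v = adj \<eta>"
    proof (rule adj_unique)
      show "v \<in> csections UNIV (pforms (2*n+2) (sig k j) (int (tau k j)))" using v by (simp add: CFspace_def)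
      show "adj \<eta> \<in> csections UNIV (pforms (2*n+2) (sig k j) (int (tau k j)))" using ac by (simp add: CFspace_def)
      fix u :: "'a psection" assume "u \<in> csections UNIV (pforms (2*n+2) (sig k j) (int (tau k j)))"
      then have "u \<in> csections UNIV (CFspace n k j)" by (simp add: CFspace_def)
      then show "(LINT x|lborel. h j (u x) (v x)) = (LINT x|lborel. h j (u x) (adj \<eta> x))"
        using conjunct2[OF v, rule_format, of u] pr[of u] by simp
    qed
  qed (use ac pr in blast)
qed

text \<open>The Hermitian products disappear: by \<open>pairing\<close> the defect in the weak
  identity is a sum of components of \<open>IntD (Q j u f)\<close> over scalar f, and by duality
  each component can be tested separately.\<close>

lemma zero_Cauchy_iff:
  assumes j: "j \<le> 2*n"
  shows "u \<in> \<J> j \<longleftrightarrow> u \<in> \<Gamma> j \<and> (\<forall>f. test_on U f \<longrightarrow> IntD (Q j u f) = 0)"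
proof (cases "u \<in> \<Gamma> j")
  case u: True
  interpret cc_operator "2*n+2" "sig k j" "int (tau k j)" "h j" "2*n+2" "sig k (Suc j)" "int (tau k (Suc j))" "h (Suc j)" b "Rset n k j" "Kr n k j"
    by (rule cc[OF j])
  have uV: "u x \<in> pforms (2*n+2) (sig k j) (int (tau k j))" for x
    using sections_in[OF u] sections_0[OF u] pforms_zero by (cases "x \<in> U") (auto simp: CFspace_def)
  have DuV: "CFop b n k U j u x \<in> pforms (2*n+2) (sig k (Suc j)) (int (tau k (Suc j)))" for x
    using sections_in[OF CFop_sections[OF j open_U u]] CFop_outside pforms_zero by (cases "x \<in> U") (auto simp: CFspace_def)
  have us: "smooth_section U u" by (rule sections_smooth[OF u])
  have sub: "csections U V \<subseteq> csections UNIV V" for V by (auto simp: csections_def)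
  have tQ: "test_on U (\<lambda>x. Q j u f x i l T)" if "test_on U f" for f i l T by (rule test_Qp[OF open_U us that])
  have key: "(LINT x:D|lborel. h (Suc j) (CFop b n k U j u x) (\<eta> x)) - (LINT x:D|lborel. h j (u x) (CFadjoint b n k h j \<eta> x)) =
      (\<Sum>(i, l, T)\<in>B.I. IntD (Q j u (chi \<eta> (i, l, T))) i l T)" if \<eta>: "\<eta> \<in> csections U (CFspace n k (Suc j))" for \<eta>
  proof -
    note \<eta>' = \<eta>[unfolded CFspace_def]
    have \<eta>V: "\<eta> x \<in> pforms (2*n+2) (sig k (Suc j)) (int (tau k (Suc j)))" for x
      using \<eta>' by (auto simp: csections_def sections_def)
    have tc: "test_on U (chi \<eta> y)" if "y \<in> B.I" for y by (rule test_chi[OF \<eta>' that])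
    have adj: "CFadjoint b n k h j \<eta> = adj \<eta>" by (rule CFadjoint_eq[OF j]) (use \<eta> sub in blast)
    have "test_on U (\<lambda>x. \<Sum>y\<in>B.I. CFop b n k U j u x (fst y) (fst (snd y)) (snd (snd y)) * chi \<eta> y x)"
      by (intro test_on_sum test_on_mult open_U tc smooth_sectionD[OF sections_smooth[OF CFop_sections[OF j open_U u]]])
    moreover have "h (Suc j) (CFop b n k U j u x) (\<eta> x) = (\<Sum>y\<in>B.I. CFop b n k U j u x (fst y) (fst (snd y)) (snd (snd y)) * chi \<eta> y x)" for x
      using h'_expand[OF DuV \<eta>V] by (simp add: split_def)
    ultimately have t1: "test_on U (\<lambda>x. h (Suc j) (CFop b n k U j u x) (\<eta> x))" by simp
    have "test_on U (\<lambda>x. \<Sum>y\<in>A.I. u x (fst y) (fst (snd y)) (snd (snd y)) * (\<Sum>r\<in>Rset n k j. (- 1) ^ length r * pds b r (gr r y \<eta>) x))"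
      by (intro test_on_sum test_on_mult open_U test_on_cmult test_on_pds test_gr[OF \<eta>'] smooth_sectionD[OF us])
    moreover have "h j (u x) (adj \<eta> x) = (\<Sum>y\<in>A.I. u x (fst y) (fst (snd y)) (snd (snd y)) * (\<Sum>r\<in>Rset n k j. (- 1) ^ length r * pds b r (gr r y \<eta>) x))" for x
      using h_adj[OF uV] by (simp add: split_def)
    ultimately have t2: "test_on U (\<lambda>x. h j (u x) (adj \<eta> x))" by simp
    have "(LINT x:D|lborel. h (Suc j) (CFop b n k U j u x) (\<eta> x)) - (LINT x:D|lborel. h j (u x) (CFadjoint b n k h j \<eta> x)) =
        (LINT x:D|lborel. h (Suc j) (CFop b n k U j u x) (\<eta> x) - h j (u x) (adj \<eta> x))"
      unfolding adj by (rule integral_D_diff[OF t1 t2, symmetric])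
    also have "(\<lambda>x. h (Suc j) (CFop b n k U j u x) (\<eta> x) - h j (u x) (adj \<eta> x)) =
        (\<lambda>x. \<Sum>y\<in>B.I. Q j u (chi \<eta> y) x (fst y) (fst (snd y)) (snd (snd y)))"
    proof
      fix x
      show "h (Suc j) (CFop b n k U j u x) (\<eta> x) - h j (u x) (adj \<eta> x) =
        (\<Sum>y\<in>B.I. Q j u (chi \<eta> y) x (fst y) (fst (snd y)) (snd (snd y)))"
      proof (cases "x \<in> U")
        case True
        then show ?thesis using pairing[OF \<eta>' open_U True uV] by (simp add: CFop_CC[OF j open_U u True] split_def)
      next
        case False
        then show ?thesis
          using test_on_eq_0[OF t1 False] test_on_eq_0[OF t2 False] test_on_eq_0[OF tQ[OF tc] False]
          by (simp add: sum.neutral)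
      qed
    qed
    also have "(LINT x:D|lborel. (\<Sum>y\<in>B.I. Q j u (chi \<eta> y) x (fst y) (fst (snd y)) (snd (snd y)))) =
        (\<Sum>y\<in>B.I. LINT x:D|lborel. Q j u (chi \<eta> y) x (fst y) (fst (snd y)) (snd (snd y)))"
      by (intro integral_D_sum tQ tc)
    finally show ?thesis by (simp add: split_def IntD_def)
  qed
  show ?thesis
  proof
    assume uJ: "u \<in> \<J> j"
    show "u \<in> \<Gamma> j \<and> (\<forall>f. test_on U f \<longrightarrow> IntD (Q j u f) = 0)"
    proof (intro conjI u allI impI ext)
      fix f i l T assume f: "test_on U f"
      show "IntD (Q j u f) i l T = 0 i l T"
      proof (cases "(i, l, T) \<in> B.I")
        case False
        have "Q j u f x i l T = 0" for x
        proof (cases "x \<in> U")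
          case True
          have "Q j u f x \<in> pforms (2*n+2) (sig k (Suc j)) (int (tau k (Suc j)))"
            by (rule Qp_in[OF open_U True]) (rule uV)
          then show ?thesis using False by (auto simp: pforms_def)
        next
          case False
          then show ?thesis by (rule test_on_eq_0[OF tQ[OF f]])
        qed
        then show ?thesis by (simp add: IntD_def)
      next
        case True
        \<comment> \<open>By \<open>Qp_dual\<close> this test section has f as its only nonzero
          component \<open>chi\<close>, so the sum in \<open>key\<close> reduces to the one term
          wanted.\<close>
        define \<eta> where "\<eta> x = pscale (cnj (f x)) (B.dual (i, l, T))" for x
        obtain C where C: "compact C" "C \<subseteq> U" "\<And>x. x \<notin> C \<Longrightarrow> f x = 0" using f by (auto simp: test_on_def)
        have "\<eta> \<in> csections U (CFspace n k (Suc j))"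
          unfolding csections_def sections_def CFspace_def
        proof (intro CollectI conjI exI[of _ C] allI ballI impI)
          show "\<eta> x \<in> pforms (2*n+2) (sig k (Suc j)) (int (tau k (Suc j)))" for x
            unfolding \<eta>_def by (intro pforms_pscale B.dual)
          show "smooth_on UNIV (\<lambda>x. \<eta> x a c E)" for a c E
            unfolding \<eta>_def pscale_def by (intro smooth_on_mult smooth_on_cnj smooth_on_const test_on_smooth[OF f] open_UNIV)
        qed (use C in \<open>auto simp: \<eta>_def pscale_simps\<close>)
        then have "(\<Sum>(a, c, E)\<in>B.I. IntD (Q j u (chi \<eta> (a, c, E))) a c E) = 0"
          using key[of \<eta>] uJ by (simp add: zero_Cauchy_def)
        moreover have "IntD (Q j u (chi \<eta> y)) (fst y) (fst (snd y)) (snd (snd y)) =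
            (if y = (i, l, T) then IntD (Q j u f) i l T else 0)" if "y \<in> B.I" for y
        proof -
          have "chi \<eta> y = (if y = (i, l, T) then f else (\<lambda>x. 0))"
            using Qp_dual[OF True that] unfolding \<eta>_def[abs_def] by (intro ext) auto
          then show ?thesis by (auto simp: Qp_zero IntD_def)
        qed
        ultimately have "(\<Sum>y\<in>B.I. if y = (i, l, T) then IntD (Q j u f) i l T else 0) = 0"
          by (simp add: split_def)
        then show ?thesis using True by (simp add: sum.delta finite_pform_index)
      qed
    qed
  next
    assume *: "u \<in> \<Gamma> j \<and> (\<forall>f. test_on U f \<longrightarrow> IntD (Q j u f) = 0)"
    have "(LINT x:D|lborel. h (Suc j) (CFop b n k U j u x) (\<eta> x)) = (LINT x:D|lborel. h j (u x) (CFadjoint b n k h j \<eta> x))"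
      if \<eta>: "\<eta> \<in> csections U (CFspace n k (Suc j))" for \<eta>
    proof -
      have "(\<Sum>(i, l, T)\<in>B.I. IntD (Q j u (chi \<eta> (i, l, T))) i l T) = 0"
        by (rule sum.neutral) (use * test_chi[OF \<eta>[unfolded CFspace_def]] in auto)
      then show ?thesis using key[OF \<eta>] by simp
    qed
    then show "u \<in> \<J> j" using u by (simp add: zero_Cauchy_def)
  qed
qed (simp add: zero_Cauchy_def)

text \<open>Zero Cauchy data is a weak identity between \<open>u\<close> and test functions; since \<open>D\<^bsub>j+1\<^esub> D\<^bsub>j\<^esub> = 0\<close> also
  on the products of a test function with a constant, it passes from \<open>u\<close> to \<open>D\<^bsub>j\<^esub> u\<close>.\<close>

lemma zero_Cauchy_CFop:
  assumes j: "Suc j \<le> 2*n" and uJ: "u \<in> \<J> j"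
  shows "CFop b n k U j u \<in> \<J> (Suc j)"
proof -
  have j': "j \<le> 2*n" using j by simp
  interpret c1: cc_operator "2*n+2" "sig k j" "int (tau k j)" "h j" "2*n+2" "sig k (Suc j)" "int (tau k (Suc j))" "h (Suc j)" b "Rset n k j" "Kr n k j"
    by (rule cc[OF j'])
  interpret c2: cc_operator "2*n+2" "sig k (Suc j)" "int (tau k (Suc j))" "h (Suc j)" "2*n+2" "sig k (Suc (Suc j))" "int (tau k (Suc (Suc j)))" "h (Suc (Suc j))" b "Rset n k (Suc j)" "Kr n k (Suc j)"
    by (rule cc[OF j])
  have u: "u \<in> \<Gamma> j" and Q0: "\<And>f. test_on U f \<Longrightarrow> IntD (Q j u f) = 0" using uJ zero_Cauchy_iff[OF j'] by auto
  have us: "smooth_section U u" by (rule sections_smooth[OF u])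
  define v where "v = CFop b n k U j u"
  have v: "v \<in> \<Gamma> (Suc j)" unfolding v_def by (rule CFop_sections[OF j' open_U u])
  have vD: "v x = \<D> j u x" if "x \<in> U" for x unfolding v_def by (rule CFop_eq[OF open_U u that])
  have vC: "v x = c1.CC u x" if "x \<in> U" for x unfolding v_def by (rule CFop_CC[OF j' open_U u that])
  have CCv: "(\<Sum>r\<in>Rset n k (Suc j). Kr n k (Suc j) r (pdl b r v x)) = 0" if "x \<in> U" for x
  proof -
    have "(\<Sum>r\<in>Rset n k (Suc j). Kr n k (Suc j) r (pdl b r v x)) = \<D> (Suc j) v x"
      by (rule DD_eq[OF open_U sections_smooth[OF v] that, symmetric])
    also have "\<dots> = \<D> (Suc j) (\<D> j u) x" by (rule DD_cong[OF open_U that vD])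
    also have "\<dots> = 0" by (rule DD_DD[OF open_U us that])
    finally show ?thesis .
  qed
  let ?s = "(- 1) ^ ord k (Suc j) :: complex" and ?s' = "(- 1) ^ ord k j :: complex"
  have "IntD (Q (Suc j) v f) = 0" if f: "test_on U f" for f
  proof -
    have fs: "smooth_on UNIV f" by (rule test_on_smooth[OF f])
    have tq: "tsec (Q j u (pds b r f))" for r unfolding tsec_def using c1.test_Qp[OF open_U us test_on_pds[OF f]] by blast
    have tQ: "tsec (Q (Suc j) v f)" unfolding tsec_def using c2.test_Qp[OF open_U sections_smooth[OF v] f] by blast
    have sc: "coeffop (\<lambda>w. pscale (- ?s) (Kr n k (Suc j) r w))" for r by (intro coeffop_pscale coeffop_Kr)
    have "Q (Suc j) v f x = (\<Sum>r\<in>Rset n k (Suc j). pscale (- ?s) (Kr n k (Suc j) r (Q j u (pds b r f) x)))" if x: "x \<in> U" for x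
    proof -
      have c0: "(\<Sum>r\<in>Rset n k (Suc j). \<Sum>q\<in>Rset n k j. Kr n k (Suc j) r (Kr n k j q (pscale (pds b q (pds b r f) x) (u x)))) = 0"
      proof -
        \<comment> \<open>The value of u at x is frozen, so only f is differentiated when D_{j+1}
          D_j = 0 is applied to w.\<close>
        define w where "w y = pscale (f y) (u x)" for y
        have ws: "smooth_section UNIV w" unfolding w_def
          by (intro smooth_section_pscale open_UNIV fs) (simp add: smooth_section_def smooth_on_const)
        have Dw: "\<D> j w y = (\<Sum>q\<in>Rset n k j. Kr n k j q (pscale (pds b q f y) (u x)))" for y
          unfolding DD_eq[OF open_UNIV ws UNIV_I] w_def pdl_tensor[OF open_UNIV fs UNIV_I] ..
        have Dws: "smooth_section UNIV (\<D> j w)" by (rule smooth_section_DD[OF open_UNIV ws])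
        have "pdl b r (\<D> j w) x = (\<Sum>q\<in>Rset n k j. Kr n k j q (pscale (pds b q (pds b r f) x) (u x)))" for r
        proof -
          have s2: "smooth_section UNIV (pdl b q w)" for q by (rule smooth_section_pdl[OF ws])
          have "pdl b r (\<D> j w) x = pdl b r (\<lambda>y. \<Sum>q\<in>Rset n k j. Kr n k j q (pdl b q w y)) x"
            by (rule pdl_cong[OF open_UNIV UNIV_I]) (rule DD_eq[OF open_UNIV ws UNIV_I])
          also have "\<dots> = (\<Sum>q\<in>Rset n k j. Kr n k j q (pdl b r (pdl b q w) x))"
          proof -
            have "pdl b r (\<lambda>y. \<Sum>q\<in>X. Kr n k j q (pdl b q w y)) x = (\<Sum>q\<in>X. pdl b r (\<lambda>y. Kr n k j q (pdl b q w y)) x)" for X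
            proof (intro ext)
              fix i l T
              show "pdl b r (\<lambda>y. \<Sum>q\<in>X. Kr n k j q (pdl b q w y)) x i l T = (\<Sum>q\<in>X. pdl b r (\<lambda>y. Kr n k j q (pdl b q w y)) x) i l T"
                unfolding sum_apply pdl_apply[of b r]
                using pds_sum_cmult[where W = UNIV and X = X and b = b and r = r and x = x and c = "\<lambda>_. 1" and
                    f = "\<lambda>q y. Kr n k j q (pdl b q w y) i l T",
                    OF open_UNIV smooth_sectionD[OF smooth_section_coeffop[OF open_UNIV coeffop_Kr s2]] UNIV_I]
                by simp
            qed
            then show ?thesis by (simp only: pdl_coeffop[OF open_UNIV coeffop_Kr s2 UNIV_I])
          qed
          also have "\<dots> = (\<Sum>q\<in>Rset n k j. Kr n k j q (pscale (pds b q (pds b r f) x) (u x)))"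
          proof (intro sum.cong refl arg_cong[where f = "Kr n k j _"])
            fix q
            have "pdl b q w = (\<lambda>y. pscale (pds b q f y) (u x))"
              unfolding w_def by (intro ext[of "pdl b q (\<lambda>y. pscale (f y) (u x))"] pdl_tensor[OF open_UNIV fs UNIV_I])
            then show "pdl b r (pdl b q w) x = pscale (pds b q (pds b r f) x) (u x)"
              using pdl_tensor[OF open_UNIV smooth_on_pds[OF fs] UNIV_I, of b r b q "u x" x] pds_pds[OF open_UNIV fs UNIV_I, of b r q x] by simp
          qed
          finally show ?thesis .
        qed
        then have "\<D> (Suc j) (\<D> j w) x = (\<Sum>r\<in>Rset n k (Suc j). Kr n k (Suc j) r (\<Sum>q\<in>Rset n k j. Kr n k j q (pscale (pds b q (pds b r f) x) (u x))))"
          unfolding DD_eq[OF open_UNIV Dws UNIV_I] by simp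
        then show ?thesis using DD_DD[OF open_UNIV ws UNIV_I] by (simp add: coeffop_additive[OF coeffop_Kr])
      qed
      have q: "pscale g' (v x) = Q j u (pds b r f) x + (\<Sum>q\<in>Rset n k j. Kr n k j q (pscale (?s' * pds b q (pds b r f) x) (u x)))"
        if "g' = pds b r f x" for g' r
        unfolding c1.Qp_def vC[OF x] c1.CC_def that
        by (simp add: coeffop_additive[OF coeffop_Kr] coeffop_linear[OF coeffop_Kr] pscale_sum sum_subtractf length_Rset)
      have "Q (Suc j) v f x = (\<Sum>r\<in>Rset n k (Suc j). pscale (f x) (Kr n k (Suc j) r (pdl b r v x)) - pscale ?s (Kr n k (Suc j) r (pscale (pds b r f x) (v x))))"
        unfolding c2.Qp_def
        by (intro sum.cong refl) (simp add: coeffop_additive[OF coeffop_Kr] coeffop_linear[OF coeffop_Kr] length_Rset pscale_simps)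
      also have "\<dots> = pscale (f x) 0 - (\<Sum>r\<in>Rset n k (Suc j). pscale ?s (Kr n k (Suc j) r (pscale (pds b r f x) (v x))))"
        unfolding sum_subtractf pscale_sum[symmetric] CCv[OF x] ..
      also have "\<dots> = - (\<Sum>r\<in>Rset n k (Suc j). pscale ?s (Kr n k (Suc j) r (Q j u (pds b r f) x)))
          - pscale (?s * ?s') (\<Sum>r\<in>Rset n k (Suc j). \<Sum>q\<in>Rset n k j. Kr n k (Suc j) r (Kr n k j q (pscale (pds b q (pds b r f) x) (u x))))"
        by (simp add: q[OF refl] coeffop_additive[OF coeffop_Kr] coeffop_linear[OF coeffop_Kr] pscale_simps pscale_sum sum.distrib mult.assoc)
      finally show ?thesis unfolding c0 by (simp add: pscale_simps sum_negf)
    qed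
    then have "IntD (Q (Suc j) v f) = IntD (\<lambda>x. \<Sum>r\<in>Rset n k (Suc j). pscale (- ?s) (Kr n k (Suc j) r (Q j u (pds b r f) x)))"
      by (intro IntD_cong tQ tsec_sum tsec_coeffop[OF sc] tq)
    also have "\<dots> = (\<Sum>r\<in>Rset n k (Suc j). pscale (- ?s) (Kr n k (Suc j) r (IntD (Q j u (pds b r f)))))"
      by (simp only: IntD_sum[OF tsec_coeffop[OF sc tq]] IntD_coeffop[OF sc tq])
    also have "\<dots> = 0" by (simp add: Q0[OF test_on_pds[OF f]] coeffop_additive[OF coeffop_Kr] pscale_simps)
    finally show ?thesis .
  qed
  then show ?thesis using v zero_Cauchy_iff[OF j] unfolding v_def by blast
qed

end

section \<open>Tangential and normal derivatives along the boundary\<close>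

context cf_domain
begin

lemma derivative_proj:
  fixes g :: "'a \<Rightarrow> 'b::real_normed_vector"
  assumes x: "x \<in> U" and g: "g differentiable (at (proj x))"
  shows "frechet_derivative (\<lambda>y. g (proj y)) (at x) v =
    frechet_derivative g (at (proj x)) (v - frechet_derivative \<rho> (at x) v *\<^sub>R b e)"
proof -
  have dp: "(proj has_derivative (\<lambda>v. v - frechet_derivative \<rho> (at x) v *\<^sub>R b e)) (at x)"
    unfolding proj_def[abs_def]
    using smooth_on_has_derivative[OF smooth_\<rho> x] by (auto intro!: derivative_eq_intros)
  have "((\<lambda>y. g (proj y)) has_derivative (\<lambda>v. frechet_derivative g (at (proj x)) (v - frechet_derivative \<rho> (at x) v *\<^sub>R b e))) (at x)"
    using diff_chain_at[OF dp, of g "frechet_derivative g (at (proj x))"] g[unfolded frechet_derivative_works]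
    by (simp add: o_def)
  then show ?thesis by (rule frechet_derivative_eqI)
qed

text \<open>Near x the functions \<open>g \<circ> proj\<close> and \<open>h \<circ> proj\<close>
  coincide, and by the chain rule differentiating them in the direction v means differentiating g
  and h in the tangential part of v.\<close>

lemma derivative_tangential:
  fixes g h :: "'a \<Rightarrow> 'b::real_normed_vector"
  assumes x: "x \<in> S" and W: "open W" "x \<in> W" and gh: "smooth_on W g" "smooth_on W h" "\<And>y. y \<in> W \<inter> S \<Longrightarrow> g y = h y"
  shows "frechet_derivative g (at x) (v - frechet_derivative \<rho> (at x) v *\<^sub>R b e) =
    frechet_derivative h (at x) (v - frechet_derivative \<rho> (at x) v *\<^sub>R b e)"
proof -
  have xU: "x \<in> U" "x \<in> U0" using x S_subset_U S_subset_U0 by auto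
  have px: "proj x = x" by (rule proj_S[OF x])
  define V where "V = U0 \<inter> proj -` W"
  have c: "continuous_on U0 proj" using smooth_on_continuous[OF smooth_proj] continuous_on_subset U0_subset_U by blast
  have V: "open V" unfolding V_def by (rule continuous_open_preimage[OF c open_U0 W(1)])
  have xV: "x \<in> V" using xU px W(2) by (simp add: V_def)
  have "g (proj y) = h (proj y)" if "y \<in> V" for y using that gh(3) proj_in_S by (simp add: V_def)
  then have "frechet_derivative (\<lambda>y. g (proj y)) (at x) = frechet_derivative (\<lambda>y. h (proj y)) (at x)"
    by (rule frechet_derivative_cong_open[OF V xV])
  then show ?thesis
    using derivative_proj[OF xU(1), of g v] derivative_proj[OF xU(1), of h v]
      smooth_on_differentiable[OF gh(1) W(2)] smooth_on_differentiable[OF gh(2) W(2)] unfolding px by simp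
qed

text \<open>Comparison with the zero function kills the tangential part of the derivative and leaves
  the part along e.\<close>

lemma vanishing_derivative:
  assumes f: "smooth_on U f" "\<And>y. y \<in> S \<Longrightarrow> f y = 0" and x: "x \<in> S"
  shows "frechet_derivative f (at x) v = frechet_derivative \<rho> (at x) v *\<^sub>R frechet_derivative f (at x) (b e)"
proof -
  have xU: "x \<in> U" using x S_subset_U by blast
  have "frechet_derivative f (at x) (v - frechet_derivative \<rho> (at x) v *\<^sub>R b e) =
      frechet_derivative (\<lambda>y. 0) (at x) (v - frechet_derivative \<rho> (at x) v *\<^sub>R b e)"
    by (rule derivative_tangential[OF x open_U xU f(1) smooth_on_const]) (simp add: f(2))
  then show ?thesis
    using linear_frechet_derivative[OF smooth_on_differentiable[OF f(1) xU]] by (simp add: linear_diff linear_scale)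
qed

lemma pdp_vanishing:
  assumes z: "smooth_section U z" "\<And>y. y \<in> S \<Longrightarrow> z y = 0" and x: "x \<in> S"
  shows "pdp b m z x = pscale (r m x) (pdp b e z x)"
proof (intro ext)
  fix i j T
  have "x \<in> U" using x S_subset_U by blast
  then show "pdp b m z x i j T = pscale (r m x) (pdp b e z x) i j T"
    unfolding pdp_def pd_def pscale_def r_eq[OF \<open>x \<in> U\<close>]
    using vanishing_derivative[OF smooth_sectionD[OF z(1)] _ x, of i j T "b m"] z(2)
    by (simp add: scaleR_conv_of_real)
qed

lemma d_vanishing:
  assumes "smooth_section U z" "\<And>y. y \<in> S \<Longrightarrow> z y = 0" and "x \<in> S"
  shows "d A z x = Om A x (pdp b e z x)"
  unfolding dd_def Om_def
proof (intro sum.cong refl)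
  fix m
  have "pdp b m z x = pscale (r m x) (pdp b e z x)"
    by (rule pdp_vanishing[OF assms(1) _ assms(3)]) (rule assms(2))
  then show "K A m (pdp b m z x) = pscale (r m x) (K A m (pdp b e z x))"
    by (simp only: coeffop_linear(2)[OF coeffop_Kop])
qed

lemma Nup_Rcoef:
  assumes "x \<in> U"
  shows "(\<Sum>A\<in>UNIV. Nup b n B A (cfun \<rho>) x * Rcoef b n \<rho> A C x) = (if B = C then 1 else 0)"
proof -
  have i: "inverse (dt x) * dt x = 1" using dt_neq_0[OF assms] by simp
  show ?thesis using exhaust_01[of B] exhaust_01[of C] i
    by (auto simp: sum_01 Rcoef_eq Nup_Nlow Nlow_eq[OF assms] Ninv_eq[OF assms] invN_def dt_def algebra_simps)
qed

lemma contr_J: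
  assumes "x \<in> U"
  shows "contr (2*n + oidx B) v = (\<Sum>A\<in>UNIV. pscale (Nup b n B A (cfun \<rho>) x) (J A x v))"
proof -
  have "(\<Sum>A\<in>UNIV. pscale (Nup b n B A (cfun \<rho>) x) (J A x v)) =
      (\<Sum>C\<in>UNIV. pscale (\<Sum>A\<in>UNIV. Nup b n B A (cfun \<rho>) x * Rcoef b n \<rho> A C x) (contr (2*n + oidx C) v))"
    unfolding J_def by (simp only: pscale_sum pscale_simps pscale_sum_left, rule sum.swap)
  also have "\<dots> = contr (2*n + oidx B) v"
    unfolding Nup_Rcoef[OF assms] using exhaust_01[of B] by (auto simp: sum_01 pscale_simps)
  finally show ?thesis ..
qed

text \<open>Although the contractions \<open>J A x\<close> vary with x, their common kernel does
  not: it consists of the forms without \<omega>^{2n} and \<omega>^{2n+1}. Therefore the property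
  passes to derivatives.\<close>

definition tangent :: "pform \<Rightarrow> bool" where
  "tangent v \<longleftrightarrow> (\<forall>B. contr (2*n + oidx B) v = 0)"

lemma tangent_iff: "x \<in> U \<Longrightarrow> tangent v \<longleftrightarrow> J 0 x v = 0 \<and> J 1 x v = 0"
proof
  assume x: "x \<in> U"
  show "J 0 x v = 0 \<and> J 1 x v = 0" if "tangent v"
    using that by (simp add: J_def tangent_def pscale_simps)
  show "tangent v" if "J 0 x v = 0 \<and> J 1 x v = 0"
    using that by (simp add: tangent_def contr_J[OF x] sum_01 pscale_simps)
qed

lemma tangent_add: "tangent u \<Longrightarrow> tangent v \<Longrightarrow> tangent (u + v)"
  and tangent_zero: "tangent 0"
  and tangent_pscale: "tangent u \<Longrightarrow> tangent (pscale c u)"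
  by (simp_all add: tangent_def coeffop_linear[OF coeffop_contr] coeffop_additive[OF coeffop_contr] pscale_simps)

lemma tangent_pdp:
  assumes "open W" "smooth_section W z" "x \<in> W" "\<And>y. y \<in> W \<Longrightarrow> tangent (z y)"
  shows "tangent (pdp b m z x)"
  unfolding tangent_def
proof
  fix B
  have "contr (2*n + oidx B) (pdp b m z x) = pdp b m (\<lambda>y. contr (2*n + oidx B) (z y)) x"
    by (rule pdp_coeffop[OF assms(1) coeffop_contr assms(2,3), symmetric])
  also have "\<dots> = pdp b m (\<lambda>y. 0) x" by (rule pdp_cong[OF assms(1,3)]) (use assms(4) in \<open>simp add: tangent_def\<close>)
  finally show "contr (2*n + oidx B) (pdp b m z x) = 0" by (simp add: pdp_zero)
qed

lemma tangent_pforms: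
  assumes "v \<in> pforms (2*n+2) s t" "tangent v"
  shows "v \<in> pforms (2*n) s t"
  unfolding pforms_def mem_Collect_eq
proof (intro allI impI)
  fix i j T assume nz: "v i j T \<noteq> 0"
  have no: "2*n + oidx B \<notin> T" for B
  proof
    assume B: "2*n + oidx B \<in> T"
    have "contr (2*n + oidx B) v i j (T - {2*n + oidx B}) = 0" using assms(2) by (simp add: tangent_def)
    then show False using nz B by (simp add: contr_def insert_absorb osign_def)
  qed
  have "T \<subseteq> {..<2*n+2}" "i + j = s" "int (card T) = t" using pformsD[OF assms(1) nz] by auto
  moreover have "2*n \<notin> T" "2*n + 1 \<notin> T" using no[of 0] no[of 1] by (simp_all add: oidx_def)
  ultimately show "(i, j, T) \<in> pform_index (2*n) s t"
    by (auto simp: pform_index_def) (metis Suc_eq_plus1 add_2_eq_Suc' lessThan_iff less_SucE numeral_2_eq_2 subsetD)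
qed

lemma pforms_tangent:
  assumes "v \<in> pforms (2*n) s t"
  shows "tangent v"
  unfolding tangent_def
proof (intro allI ext)
  fix B i j T
  have "v i j (insert (2*n + oidx B) T) = 0" using pformsD[OF assms, of i j "insert (2*n + oidx B) T"] by auto
  then show "contr (2*n + oidx B) v i j T = 0 i j T" by (simp add: contr_def)
qed

lemma pforms_mono: "v \<in> pforms (2*n) s t \<Longrightarrow> v \<in> pforms (2*n+2) s t"
  unfolding pforms_def[of "2*n+2"] mem_Collect_eq pform_index_def using pformsD[of v "2*n" s t] by fastforce

lemma Om_pforms: "v \<in> pforms (2*n+2) s t \<Longrightarrow> Om A x v \<in> pforms (2*n+2) s (t + 1)"
  unfolding Om_def by (intro pforms_sum pforms_pscale Kop_pforms)

lemma J_pforms: "v \<in> pforms N s t \<Longrightarrow> J A x v \<in> pforms N s (t - 1)"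
  unfolding J_def by (intro pforms_sum pforms_pscale contr_pforms)

lemma pdp_pforms:
  assumes W: "open W" "x \<in> W" and z: "\<And>y. y \<in> W \<Longrightarrow> z y \<in> pforms N s t"
  shows "pdp b m z x \<in> pforms N s t"
  unfolding pforms_def mem_Collect_eq
proof (intro allI impI, rule ccontr)
  fix i j T assume nz: "pdp b m z x i j T \<noteq> 0" and out: "(i, j, T) \<notin> pform_index N s t"
  have "pd b m (\<lambda>y. z y i j T) x = pd b m (\<lambda>y. 0) x"
    unfolding pd_def
    by (rule arg_cong[where f = "\<lambda>D. D (b m)"], rule frechet_derivative_cong_open[OF W])
      (use z out in \<open>auto simp: pforms_def\<close>)
  then show False using nz by (simp add: pdp_def pd_def)
qed

lemma dd_pforms:
  assumes W: "open W" "x \<in> W" and z: "\<And>y. y \<in> W \<Longrightarrow> z y \<in> pforms (2*n+2) s t"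
  shows "d A z x \<in> pforms (2*n+2) s (t + 1)"
  unfolding dd_def by (intro pforms_sum Kop_pforms pdp_pforms[OF W]) (rule z)

lemma p_pforms: "x \<in> U \<Longrightarrow> v \<in> pforms (2*n+2) s t \<Longrightarrow> p x v \<in> pforms (2*n+2) s t"
proof -
  assume x: "x \<in> U" and v: "v \<in> pforms (2*n+2) s t"
  have "J 1 x (J 0 x (Om 0 x (Om 1 x v))) \<in> pforms (2*n+2) s (t + 1 + 1 - 1 - 1)"
    by (intro J_pforms Om_pforms v)
  then show ?thesis by (simp add: p_eq[OF x])
qed

lemma p_tangent: "x \<in> U \<Longrightarrow> tangent (p x v)"
  using car.J_p[OF car] by (simp add: tangent_iff p_def)

lemma p_id: "x \<in> U \<Longrightarrow> tangent v \<Longrightarrow> p x v = v"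
  using car.p_vacuum[OF car] by (simp add: tangent_iff p_def)

lemma p_additive: "x \<in> U \<Longrightarrow> p x (u + v) = p x u + p x v" "x \<in> U \<Longrightarrow> p x 0 = 0" "x \<in> U \<Longrightarrow> p x (- u) = - p x u"
   "x \<in> U \<Longrightarrow> p x (u - v) = p x u - p x v" "x \<in> U \<Longrightarrow> p x (pscale c u) = pscale c (p x u)"
  using coeffop_linear[OF coeffop_p] coeffop_additive[OF coeffop_p] by auto

lemma p_Om: "x \<in> U \<Longrightarrow> p x (Om A x v) = 0"
  using car.p_O[OF car, of x v] exhaust_01[of A] by (auto simp: p_def)

lemma Om_Om_eq_0_iff: "x \<in> U \<Longrightarrow> Om 0 x (Om 1 x v) = 0 \<longleftrightarrow> p x v = 0"
  unfolding p_def by (rule car.O0_O1_eq_0_iff[OF car])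

text \<open>The second Cauchy datum of the second order operator \<open>d\<^sup>0\<^sup>' d\<^sup>1\<^sup>'\<close>.\<close>

definition Gk :: "'a psection \<Rightarrow> 'a psection" where
  "Gk u x = Om 0 x (d 1 u x) + d 0 (\<lambda>y. Om 1 y (u y)) x - Om 0 x (Om 1 x (pdp b e u x))"

lemma smooth_section_Gk:
  "open W \<Longrightarrow> W \<subseteq> U \<Longrightarrow> smooth_section W u \<Longrightarrow> smooth_section W (Gk u)"
  unfolding Gk_def[abs_def]
  by (intro smooth_section_diff smooth_section_add smooth_section_Om smooth_section_dd smooth_section_pdp)

lemma Gk_cong:
  assumes "open W" "x \<in> W" "\<And>y. y \<in> W \<Longrightarrow> u y = v y"
  shows "Gk u x = Gk v x"
proof -
  have "d 0 (\<lambda>y. Om 1 y (u y)) x = d 0 (\<lambda>y. Om 1 y (v y)) x"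
    by (rule dd_cong[OF assms(1,2)]) (simp add: assms(3))
  then show ?thesis unfolding Gk_def by (simp only: dd_cong[OF assms] pdp_cong[OF assms])
qed

lemma Gk_zero: "Gk (\<lambda>y. 0) x = 0"
  by (simp add: Gk_def dd_zero pdp_zero Om_simps)

lemma Gk_add:
  assumes "open W" "W \<subseteq> U" "smooth_section W u" "smooth_section W v" "x \<in> W"
  shows "Gk (\<lambda>y. u y + v y) x = Gk u x + Gk v x"
  unfolding Gk_def
  by (simp only: Om_simps dd_add[OF assms(3-5)] pdp_add[OF assms(3-5)]
      dd_add[OF smooth_section_Om[OF assms(1-3)] smooth_section_Om[OF assms(1,2,4)] assms(5)]) simp

lemma Gk_pscale:
  assumes "open W" "W \<subseteq> U" "smooth_section W u" "x \<in> W"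
  shows "Gk (\<lambda>y. pscale c (u y)) x = pscale c (Gk u x)"
proof -
  have co: "coeffop (pscale c)" using coeffop_pscale[OF coeffop_id, of c] by simp
  have cm: "pscale c (K A m v) = K A m (pscale c v)" for A m v by (simp add: coeffop_linear[OF coeffop_Kop])
  show ?thesis unfolding Gk_def
    by (simp only: Om_simps dd_commute[OF assms(1) co _ assms(4) cm] smooth_section_Om[OF assms(1-3)] assms(3)
        pdp_coeffop[OF assms(1) co assms(3,4)] pscale_simps)
qed

text \<open>On S each of the three terms of \<open>Gk\<close> reduces to \<Omega>^0 \<Omega>^1 times
  the derivative of z along e, with signs +, + and -.\<close>

lemma Gk_vanishing:
  assumes z: "smooth_section U z" "\<And>y. y \<in> S \<Longrightarrow> z y = 0" and x: "x \<in> S"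
  shows "Gk z x = Om 0 x (Om 1 x (pdp b e z x))"
proof -
  have xU: "x \<in> U" using x S_subset_U by blast
  have "d 0 (\<lambda>y. Om 1 y (z y)) x = Om 0 x (pdp b e (\<lambda>y. Om 1 y (z y)) x)"
    by (rule d_vanishing[OF smooth_section_Om[OF open_U subset_refl z(1)] _ x]) (simp add: z(2) Om_simps)
  also have "pdp b e (\<lambda>y. Om 1 y (z y)) x = Om 1 x (pdp b e z x)"
    by (rule pdp_e_Om[OF open_U subset_refl z(1) xU])
  finally have "d 0 (\<lambda>y. Om 1 y (z y)) x = Om 0 x (Om 1 x (pdp b e z x))" .
  moreover have "d 1 z x = Om 1 x (pdp b e z x)" by (rule d_vanishing[OF z x])
  ultimately show ?thesis unfolding Gk_def by (simp only: add_diff_cancel_right')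
qed

text \<open>Without tangential part, \<Omega>^0 \<Omega>^1 v vanishes on an open set;
  differentiating this identity shows that both \<Omega>^0 and \<Omega>^1 annihilate
  \<open>Gk v\<close>, which is then a multiple of \<Omega>^0 \<Omega>^1.\<close>

lemma Gk_decomposition:
  assumes W: "open W" "W \<subseteq> U" "smooth_section W v" "x \<in> W" and pv: "\<And>y. y \<in> W \<Longrightarrow> p y (v y) = 0"
  shows "Gk v x = Om 0 x (Om 1 x (J 1 x (J 0 x (Gk v x))))"
proof -
  have xU: "x \<in> U" using W by blast
  have OO: "Om 0 y (Om 1 y (v y)) = 0" if "y \<in> W" for y using pv[OF that] Om_Om_eq_0_iff that W(2) by blast
  have s1: "smooth_section W (\<lambda>y. Om 1 y (v y))" by (rule smooth_section_Om[OF W(1-3)])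
  have z: "d A (\<lambda>y. Om 0 y (Om 1 y (v y))) x = 0" for A
    using dd_cong[OF W(1,4) OO, where b = b and n = n and A = A] by (simp add: dd_zero)
  have a: "Om 0 x (d 0 (\<lambda>y. Om 1 y (v y)) x) = 0"
    using d_Om[OF W(1,2) s1 W(4), of 0 0] z[of 0] E_same[OF xU] by simp
  have "d 0 (\<lambda>y. Om 1 y (Om 1 y (v y))) x = 0" by (simp add: Om_Om_same dd_zero)
  then have "E 0 1 x (Om 1 x (v x)) = Om 1 x (d 0 (\<lambda>y. Om 1 y (v y)) x)"
    using d_Om[OF W(1,2) s1 W(4), of 0 1] by simp
  moreover have "E 1 0 x (Om 1 x (v x)) = Om 0 x (d 1 (\<lambda>y. Om 1 y (v y)) x)"
    using d_Om[OF W(1,2) s1 W(4), of 1 0] z[of 1] by simp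
  moreover have "d 1 (\<lambda>y. Om 1 y (v y)) x = - Om 1 x (d 1 v x)"
    using d_Om[OF W(1-4), of 1 1] E_same[OF xU] by simp
  \<comment> \<open>The two expressions for E 0 1 and E 1 0 applied to \<Omega>^1 v differ by a
    sign; the third fact rewrites one of them through d^1 v.\<close>
  ultimately have c: "Om 1 x (d 0 (\<lambda>y. Om 1 y (v y)) x) = Om 0 x (Om 1 x (d 1 v x))"
    using E_anti[OF xU, of 0 1] by (simp add: Om_simps)
  have "Om 0 x (Gk v x) = 0" unfolding Gk_def by (simp add: Om_simps Om_Om_same a)
  moreover have "Om 1 x (Gk v x) = 0"
    unfolding Gk_def by (simp add: Om_simps c) (simp add: Om_anticommute[of 1 x 0] Om_Om_same Om_simps)
  ultimately show ?thesis using car.eq_O0_O1[OF car[OF xU]] by blast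
qed

lemma IntDe_add:
  assumes "tsec F" "tsec G"
  shows "IntD (pdp b e F) + IntD (pdp b e G) = IntD (pdp b e (\<lambda>x. F x + G x))"
proof -
  have "pdp b e (\<lambda>x. F x + G x) = (\<lambda>x. pdp b e F x + pdp b e G x)"
    by (rule ext) (rule pdp_add[OF tsec_smooth[OF assms(1)] tsec_smooth[OF assms(2)] UNIV_I])
  then show ?thesis using IntD_add[OF tsec_pdp[OF assms(1)] tsec_pdp[OF assms(2)]] by simp
qed

lemma IntDe_diff:
  assumes "tsec F" "tsec G"
  shows "IntD (pdp b e F) - IntD (pdp b e G) = IntD (pdp b e (\<lambda>x. F x - G x))"
proof -
  have "pdp b e (\<lambda>x. F x - G x) = (\<lambda>x. pdp b e F x - pdp b e G x)"
    by (rule ext) (rule pdp_diff[OF tsec_smooth[OF assms(1)] tsec_smooth[OF assms(2)] UNIV_I])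
  then show ?thesis using IntD_diff[OF tsec_pdp[OF assms(1)] tsec_pdp[OF assms(2)]] by simp
qed

end

section \<open>Boundary conditions of the first and the second order operators\<close>

context cf_complex
begin

definition sym :: "nat \<Rightarrow> 'a \<Rightarrow> pform \<Rightarrow> pform" where
  "sym j x v = (\<Sum>A\<in>UNIV. Sop k j A (Om A x v))"

lemma coeffop_sym: "coeffop (sym j x)"
  unfolding sym_def[abs_def] by (rule coeffop_sum, rule coeffop_comp[OF coeffop_Sop coeffop_Om])

lemma smooth_section_sym: "open W \<Longrightarrow> W \<subseteq> U \<Longrightarrow> smooth_section W u \<Longrightarrow> smooth_section W (\<lambda>x. sym j x (u x))"
  unfolding sym_def by (intro smooth_section_sum smooth_section_coeffop[OF _ coeffop_Sop] smooth_section_Om)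

text \<open>At order one the transposition sign turns the Green integrand into D_j (f u), so one
  application of Stokes produces the symbol.\<close>

lemma IntD_Q_first:
  assumes jk: "j \<noteq> k" and j: "j \<le> 2*n" and us: "smooth_section U u" and f: "test_on U f"
  shows "IntD (Q j u f) = IntD (pdp b e (\<lambda>y. pscale (f y) (sym j y (u y))))"
proof -
  interpret cc_operator "2*n+2" "sig k j" "int (tau k j)" "h j" "2*n+2" "sig k (Suc j)" "int (tau k (Suc j))" "h (Suc j)" b "Rset n k j" "Kr n k j"
    by (rule cc[OF j])
  define F where "F y = pscale (f y) (u y)" for y
  have tF: "tsec F" unfolding F_def by (rule tsec_pscale[OF f us])
  have tD: "tsec (\<D> j F)"
    unfolding DD_def[abs_def] using jk by (simp, intro tsec_sum tsec_coeffop[OF coeffop_Sop] tsec_dd tF)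
  have tQ: "tsec (Q j u f)" unfolding tsec_def using test_Qp[OF open_U us f] by blast
  have "Q j u f x = \<D> j F x" if x: "x \<in> U" for x
    unfolding DD_eq[OF open_UNIV tsec_smooth[OF tF] UNIV_I] Qp_def
  proof (intro sum.cong refl arg_cong[where f = "Kr n k j _"])
    fix r assume "r \<in> Rset n k j"
    then obtain m where r: "r = [m]" using jk by (auto simp: Rset_def)
    show "pscale (f x) (pdl b r u x) - pscale ((- 1) ^ length r * pds b r f x) (u x) = pdl b r F x"
      unfolding r F_def using pdp_pscale[OF test_on_smooth[OF f] us x, of b m] by (simp add: pscale_simps)
  qed
  then have "IntD (Q j u f) = IntD (\<D> j F)" by (intro IntD_cong tQ tD)
  also have "\<dots> = IntD (\<lambda>x. \<Sum>A\<in>UNIV. Sop k j A (d A F x))"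
    using jk by (simp add: DD_def[abs_def])
  also have "\<dots> = (\<Sum>A\<in>UNIV. Sop k j A (IntD (pdp b e (\<lambda>y. Om A y (F y)))))"
    by (simp only: IntD_sum[OF tsec_coeffop[OF coeffop_Sop tsec_dd[OF tF]]] IntD_coeffop[OF coeffop_Sop tsec_dd[OF tF]] IntD_d[OF tF])
  also have "\<dots> = (\<Sum>A\<in>UNIV. IntD (pdp b e (\<lambda>y. Sop k j A (Om A y (F y)))))"
  proof (intro sum.cong refl)
    fix A
    have "pdp b e (\<lambda>y. Sop k j A (Om A y (F y))) = (\<lambda>x. Sop k j A (pdp b e (\<lambda>y. Om A y (F y)) x))"
      by (rule ext) (rule pdp_coeffop[OF open_UNIV coeffop_Sop tsec_smooth[OF tsec_Om[OF tF]] UNIV_I])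
    then show "Sop k j A (IntD (pdp b e (\<lambda>y. Om A y (F y)))) = IntD (pdp b e (\<lambda>y. Sop k j A (Om A y (F y))))"
      by (simp add: IntD_coeffop[OF coeffop_Sop tsec_pdp[OF tsec_Om[OF tF]]])
  qed
  also have "\<dots> = IntD (pdp b e (\<lambda>y. Sop k j 0 (Om 0 y (F y)) + Sop k j 1 (Om 1 y (F y))))"
    unfolding sum_01 by (rule IntDe_add) (intro tsec_coeffop[OF coeffop_Sop] tsec_Om tF)+
  also have "(\<lambda>y. Sop k j 0 (Om 0 y (F y)) + Sop k j 1 (Om 1 y (F y))) = (\<lambda>y. pscale (f y) (sym j y (u y)))"
    unfolding F_def sym_def sum_01 by (simp only: Om_simps coeffop_linear[OF coeffop_Sop] pscale_simps)
  finally show ?thesis .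
qed

lemma zero_Cauchy_first:
  assumes "j \<noteq> k" "j \<le> 2*n"
  shows "u \<in> \<J> j \<longleftrightarrow> u \<in> \<Gamma> j \<and> (\<forall>x\<in>S. sym j x (u x) = 0)"
proof (cases "u \<in> \<Gamma> j")
  case True
  note us = sections_smooth[OF True]
  show ?thesis
    unfolding zero_Cauchy_iff[OF assms(2)] IntD_boundary_iff[OF smooth_section_sym[OF open_U subset_refl us], symmetric]
    using IntD_Q_first[OF assms us] by simp
qed (simp add: zero_Cauchy_iff[OF assms(2)])

text \<open>The Green integrand is exact, namely d^0 (f d^1 u) + d^1 w, where w collects the terms
  in which d^0 falls on f. Stokes then leaves derivatives of f in all directions inside \<Omega>^1
  w; they are removed by a second application of Stokes.\<close>

lemma IntD_Q_second:
  assumes k: "k \<le> 2*n" and us: "smooth_section U u" and f: "test_on U f"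
  shows "IntD (Q k u f) = IntD (pdp b e (\<lambda>y. pscale (f y) (Gk u y) - pscale (pd b e f y) (Om 0 y (Om 1 y (u y)))))"
proof -
  interpret cc_operator "2*n+2" "sig k k" "int (tau k k)" "h k" "2*n+2" "sig k (Suc k)" "int (tau k (Suc k))" "h (Suc k)" b "Rset n k k" "Kr n k k"
    by (rule cc[OF k])
  define F where "F y = pscale (f y) (d 1 u y)" for y
  define w where "w y = (\<Sum>m\<in>M. pscale (pd b m f y) (K 0 m (u y)))" for y
  define G where "G y = pscale (f y) (Om 1 y (u y))" for y
  have fU: "smooth_on U f" by (rule test_on_smooth[OF f])
  have su: "smooth_section U (\<lambda>y. Om 1 y (u y))" by (rule smooth_section_Om[OF open_U subset_refl us])
  have sK: "smooth_section U (\<lambda>y. K 0 m (u y))" for m by (rule smooth_section_coeffop[OF open_U coeffop_Kop us])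
  have tw1: "tsec (\<lambda>y. pscale (pd b m f y) (K 0 m (u y)))" for m by (rule tsec_pscale[OF test_on_pd[OF f] sK])
  have tF: "tsec F" unfolding F_def by (rule tsec_pscale[OF f smooth_section_dd[OF open_U us]])
  have tw: "tsec w" unfolding w_def by (intro tsec_sum tw1)
  have tG: "tsec G" unfolding G_def by (rule tsec_pscale[OF f su])
  have tQ: "tsec (Q k u f)" unfolding tsec_def using test_Qp[OF open_U us f] by blast
  have QeqU: "Q k u f x = d 0 F x + d 1 w x" if x: "x \<in> U" for x
  proof -
    have inj: "inj_on (\<lambda>(m, l). [m, l]) (M \<times> M)" by (auto simp: inj_on_def)
    have R: "Rset n k k = (\<lambda>(m, l). [m, l]) ` (M \<times> M)" by (simp add: Rset_def)
    have "Q k u f x = (\<Sum>m\<in>M. \<Sum>l\<in>M. K 0 m (K 1 l (pscale (f x) (pdp b m (pdp b l u) x) - pscale (pd b m (pd b l f) x) (u x))))"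
      unfolding Qp_def unfolding R sum.reindex[OF inj] sum.cartesian_product by (intro sum.cong refl) (auto simp: Kr_def)
    also have "\<dots> = pscale (f x) (d 0 (d 1 u) x) - (\<Sum>m\<in>M. \<Sum>l\<in>M. pscale (pd b m (pd b l f) x) (K 0 m (K 1 l (u x))))"
      unfolding dd_eq[OF open_U us x]
      by (simp only: coeffop_additive[OF coeffop_Kop] coeffop_linear[OF coeffop_Kop] sum_subtractf pscale_sum)
    finally have q: "Q k u f x = \<dots>" .
    have F: "d 0 F x = (\<Sum>m\<in>M. pscale (pd b m f x) (K 0 m (d 1 u x))) + pscale (f x) (d 0 (d 1 u) x)"
      unfolding F_def by (rule dd_pscale[OF fU smooth_section_dd[OF open_U us] x])
    have "pdp b l w x = (\<Sum>m\<in>M. pscale (pd b l (pd b m f) x) (K 0 m (u x)) + pscale (pd b m f x) (K 0 m (pdp b l u x)))" for l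
      unfolding w_def
      by (subst pdp_sum[OF open_U tsec_smooth[OF tw1] x])
        (intro sum.cong refl, simp only: pdp_pscale[OF smooth_on_pd[OF fU] sK x] pdp_coeffop[OF open_U coeffop_Kop us x])
    then have d1: "d 1 w x = (\<Sum>l\<in>M. \<Sum>m\<in>M. pscale (pd b l (pd b m f) x) (K 1 l (K 0 m (u x)))) +
        (\<Sum>l\<in>M. \<Sum>m\<in>M. pscale (pd b m f x) (K 1 l (K 0 m (pdp b l u x))))"
      unfolding dd_def by (simp only: coeffop_additive[OF coeffop_Kop] coeffop_linear[OF coeffop_Kop] sum.distrib)
    have s1: "(\<Sum>l\<in>M. \<Sum>m\<in>M. pscale (pd b l (pd b m f) x) (K 1 l (K 0 m (u x)))) =
        (\<Sum>m\<in>M. \<Sum>l\<in>M. - pscale (pd b m (pd b l f) x) (K 0 m (K 1 l (u x))))"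
      by (subst sum.swap, intro sum.cong refl) (subst Kop_anticommute, subst pd_swap[OF open_U fU x], simp only: pscale_simps)
    have s2: "(\<Sum>l\<in>M. \<Sum>m\<in>M. pscale (pd b m f x) (K 1 l (K 0 m (pdp b l u x)))) =
        - (\<Sum>m\<in>M. pscale (pd b m f x) (K 0 m (d 1 u x)))"
      unfolding dd_def coeffop_additive[OF coeffop_Kop] pscale_sum sum_negf[symmetric]
      by (subst sum.swap, intro sum.cong refl) (subst Kop_anticommute, simp only: pscale_simps)
    show ?thesis unfolding q F d1 s1 s2 by (simp add: sum_negf)
  qed
  \<comment> \<open>By the Leibniz rule the derivatives of f in \<Omega>^1 w are those of the exact
    term d^0 G, up to a multiple of f itself.\<close>
  have W: "Om 1 y (w y) = pscale (f y) (d 0 (\<lambda>y. Om 1 y (u y)) y) - d 0 G y" for y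
  proof (cases "y \<in> U")
    case True
    have "d 0 G y = (\<Sum>m\<in>M. pscale (pd b m f y) (K 0 m (Om 1 y (u y)))) + pscale (f y) (d 0 (\<lambda>y. Om 1 y (u y)) y)"
      unfolding G_def by (rule dd_pscale[OF fU su True])
    moreover have "Om 1 y (w y) = - (\<Sum>m\<in>M. pscale (pd b m f y) (K 0 m (Om 1 y (u y))))"
      unfolding w_def by (simp only: Om_simps Om_Kop pscale_simps sum_negf)
    ultimately show ?thesis by simp
  next
    case False
    then show ?thesis using tsec_eq_0[OF tw False] tsec_eq_0[OF tsec_dd[OF tG] False] test_on_eq_0[OF f False]
      by (simp add: Om_simps pscale_simps)
  qed
  have t1: "tsec (\<lambda>y. pscale (f y) (d 0 (\<lambda>y. Om 1 y (u y)) y))"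
    by (rule tsec_pscale[OF f smooth_section_dd[OF open_U su]])
  have t2: "tsec (\<lambda>y. Om 0 y (F y))" by (rule tsec_Om[OF tF])
  have t3: "tsec (\<lambda>y. Om 0 y (pdp b e G y))" by (rule tsec_Om[OF tsec_pdp[OF tG]])
  have "IntD (Q k u f) = IntD (\<lambda>x. d 0 F x + d 1 w x)"
    by (rule IntD_cong[OF tQ tsec_add[OF tsec_dd[OF tF] tsec_dd[OF tw]] QeqU])
  also have "\<dots> = IntD (pdp b e (\<lambda>y. Om 0 y (F y))) + IntD (pdp b e (\<lambda>y. Om 1 y (w y)))"
    unfolding IntD_add[OF tsec_dd[OF tF] tsec_dd[OF tw]] IntD_d[OF tF] IntD_d[OF tw] ..
  also have "IntD (pdp b e (\<lambda>y. Om 1 y (w y))) = IntD (pdp b e (\<lambda>y. pscale (f y) (d 0 (\<lambda>y. Om 1 y (u y)) y))) - IntD (pdp b e (d 0 G))"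
    unfolding W by (rule IntDe_diff[OF t1 tsec_dd[OF tG], symmetric])
  \<comment> \<open>The derivative along e of d^0 G is again exact, so Stokes applies once more; of
    f only its value and its derivative along e remain.\<close>
  also have "pdp b e (d 0 G) = d 0 (pdp b e G)"
    by (rule ext) (rule dd_pdp[OF open_UNIV tsec_smooth[OF tG] UNIV_I])
  also have "IntD (d 0 (pdp b e G)) = IntD (pdp b e (\<lambda>y. Om 0 y (pdp b e G y)))"
    by (rule IntD_d[OF tsec_pdp[OF tG]])
  also have "IntD (pdp b e (\<lambda>y. Om 0 y (F y))) + (IntD (pdp b e (\<lambda>y. pscale (f y) (d 0 (\<lambda>y. Om 1 y (u y)) y))) -
      IntD (pdp b e (\<lambda>y. Om 0 y (pdp b e G y)))) =
      IntD (pdp b e (\<lambda>y. Om 0 y (F y) + (pscale (f y) (d 0 (\<lambda>y. Om 1 y (u y)) y) - Om 0 y (pdp b e G y))))"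
    unfolding IntDe_diff[OF t1 t3] by (rule IntDe_add[OF t2 tsec_diff[OF t1 t3]])
  also have "(\<lambda>y. Om 0 y (F y) + (pscale (f y) (d 0 (\<lambda>y. Om 1 y (u y)) y) - Om 0 y (pdp b e G y))) =
      (\<lambda>y. pscale (f y) (Gk u y) - pscale (pd b e f y) (Om 0 y (Om 1 y (u y))))"
  proof
    fix y
    show "Om 0 y (F y) + (pscale (f y) (d 0 (\<lambda>y. Om 1 y (u y)) y) - Om 0 y (pdp b e G y)) =
      pscale (f y) (Gk u y) - pscale (pd b e f y) (Om 0 y (Om 1 y (u y)))"
    proof (cases "y \<in> U")
      case True
      have "pdp b e G y = pscale (pd b e f y) (Om 1 y (u y)) + pscale (f y) (Om 1 y (pdp b e u y))"
        unfolding G_def pdp_pscale[OF fU su True] pdp_e_Om[OF open_U subset_refl us True] ..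
      then show ?thesis unfolding F_def Gk_def by (simp add: Om_simps pscale_simps)
    next
      case False
      then show ?thesis unfolding F_def
        using test_on_eq_0[OF f False] test_on_eq_0[OF test_on_pd[OF f] False] tsec_eq_0[OF tsec_pdp[OF tG] False]
        by (simp add: Om_simps pscale_simps)
    qed
  qed
  finally show ?thesis .
qed

lemma zero_Cauchy_second:
  assumes k: "k \<le> 2*n"
  shows "u \<in> \<J> k \<longleftrightarrow> u \<in> \<Gamma> k \<and> (\<forall>x\<in>S. Om 0 x (Om 1 x (u x)) = 0 \<and> Gk u x = 0)"
proof (cases "u \<in> \<Gamma> k")
  case True
  note us = sections_smooth[OF True]
  have sG: "smooth_section U (Gk u)" by (rule smooth_section_Gk[OF open_U subset_refl us])
  have sO: "smooth_section U (\<lambda>y. Om 0 y (Om 1 y (u y)))" by (intro smooth_section_Om open_U subset_refl us)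
  have tt: "tsec (\<lambda>y. pscale (f y) (Gk u y) - pscale (pd b e f y) (Om 0 y (Om 1 y (u y))))" if "test_on U f" for f
    by (intro tsec_diff tsec_pscale that test_on_pd sG sO)
  have "(\<forall>f. test_on U f \<longrightarrow> IntD (Q k u f) = 0) \<longleftrightarrow> (\<forall>x\<in>S. Om 0 x (Om 1 x (u x)) = 0 \<and> Gk u x = 0)"
  proof
    assume *: "\<forall>x\<in>S. Om 0 x (Om 1 x (u x)) = 0 \<and> Gk u x = 0"
    show "\<forall>f. test_on U f \<longrightarrow> IntD (Q k u f) = 0"
    proof (intro allI impI)
      fix f assume f: "test_on U f"
      show "IntD (Q k u f) = 0"
        unfolding IntD_Q_second[OF k us f] by (rule IntD_vanish[OF tt[OF f]]) (use * in \<open>simp add: pscale_simps\<close>)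
    qed
  next
    assume *: "\<forall>f. test_on U f \<longrightarrow> IntD (Q k u f) = 0"
    have O: "Om 0 x (Om 1 x (u x)) = 0" if x: "x \<in> S" for x
    proof (rule IntD_nondegenerate[OF sO _ x])
      fix f assume f: "test_on U f"
      \<comment> \<open>On S the function g vanishes and has derivative f along e. The term with
        \<open>Gk\<close> drops out, and the condition on \<Omega>^0 \<Omega>^1 u is tested with an
        arbitrary f.\<close>
      define g where "g y = cfun \<rho> y * f y" for y
      have g: "test_on U g" unfolding g_def by (rule test_on_mult[OF open_U f smooth_cfun_\<rho>])
      have gS: "g y = 0" "pd b e g y = f y" if "y \<in> S" for y
      proof -
        have y: "y \<in> U" "\<rho> y = 0" using that by (auto simp: S_def)
        show "g y = 0" using y by (simp add: g_def)
        have "pd b e g y = pd b e (cfun \<rho>) y * f y + cfun \<rho> y * pd b e f y"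
          unfolding g_def pd_def
          by (rule frechet_derivative_mult) (rule smooth_on_differentiable[OF smooth_cfun_\<rho> y(1)] smooth_on_differentiable[OF test_on_smooth[OF f] UNIV_I])+
        then show "pd b e g y = f y" using y by (simp add: pd_cfun_\<rho> r_e)
      qed
      have t: "tsec (\<lambda>y. pscale (f y) (Om 0 y (Om 1 y (u y))))" by (rule tsec_pscale[OF f sO])
      have co: "coeffop (\<lambda>v. - v)" by (rule coeffop_uminus[OF coeffop_id])
      have 1: "IntD (pdp b e (\<lambda>y. pscale (g y) (Gk u y) - pscale (pd b e g y) (Om 0 y (Om 1 y (u y))))) = 0"
        using *[rule_format, OF g] unfolding IntD_Q_second[OF k us g] .
      have 2: "IntD (pdp b e (\<lambda>y. pscale (g y) (Gk u y) - pscale (pd b e g y) (Om 0 y (Om 1 y (u y))))) =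
          IntD (pdp b e (\<lambda>y. - pscale (f y) (Om 0 y (Om 1 y (u y)))))"
        by (rule IntD_eq_on_S[OF tt[OF g] tsec_coeffop[OF co t]]) (simp add: gS pscale_simps)
      have 3: "pdp b e (\<lambda>y. - pscale (f y) (Om 0 y (Om 1 y (u y)))) = (\<lambda>x. - pdp b e (\<lambda>y. pscale (f y) (Om 0 y (Om 1 y (u y)))) x)"
        by (rule ext) (rule pdp_coeffop[OF open_UNIV co tsec_smooth[OF t] UNIV_I])
      have 4: "IntD (\<lambda>x. - pdp b e (\<lambda>y. pscale (f y) (Om 0 y (Om 1 y (u y)))) x) = - IntD (pdp b e (\<lambda>y. pscale (f y) (Om 0 y (Om 1 y (u y)))))"
        by (rule IntD_coeffop[OF co tsec_pdp[OF t]])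
      show "IntD (pdp b e (\<lambda>y. pscale (f y) (Om 0 y (Om 1 y (u y))))) = 0"
        using 1 unfolding 2 3 4 neg_equal_0_iff_equal .
    qed
    have G: "Gk u x = 0" if x: "x \<in> S" for x
    proof (rule IntD_nondegenerate[OF sG _ x])
      fix f assume f: "test_on U f"
      have "0 = IntD (pdp b e (\<lambda>y. pscale (f y) (Gk u y) - pscale (pd b e f y) (Om 0 y (Om 1 y (u y)))))"
        using *[rule_format, OF f] unfolding IntD_Q_second[OF k us f] by simp
      also have "\<dots> = IntD (pdp b e (\<lambda>y. pscale (f y) (Gk u y)))"
        by (rule IntD_eq_on_S[OF tt[OF f] tsec_pscale[OF f sG]]) (simp add: O pscale_simps)
      finally show "IntD (pdp b e (\<lambda>y. pscale (f y) (Gk u y))) = 0" by simp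
    qed
    show "\<forall>x\<in>S. Om 0 x (Om 1 x (u x)) = 0 \<and> Gk u x = 0" using O G by blast
  qed
  then show ?thesis unfolding zero_Cauchy_iff[OF k] using True by simp
qed (simp add: zero_Cauchy_iff[OF k])

section \<open>Boundary traces\<close>

definition tr1 :: "'a psection \<Rightarrow> 'a psection" where
  "tr1 u x = (if x \<in> S then p x (u x) else 0)"

text \<open>The minus sign for j \<noteq> k is a normalisation: with it the second datum enters the
  first boundary component as + E_0 wedge F_2. For j = k the projection \<open>p y\<close> has to be
  taken around S, since e is transversal to S.\<close>

definition tr2 :: "nat \<Rightarrow> 'a psection \<Rightarrow> 'a psection" where
  "tr2 j u x = (if x \<in> S then
     (if j = k then J 1 x (J 0 x (Gk (\<lambda>y. u y - p y (u y)) x)) + pdp b e (\<lambda>y. p y (u y)) x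
      else - J 1 x (J 0 x (sym j x (u x)))) else 0)"

lemma Sop_Om: "Sop k j A (Om B x v) = Om B x (Sop k j A v)"
  unfolding Om_def coeffop_additive[OF coeffop_Sop] coeffop_linear[OF coeffop_Sop] Sop_Kop ..

lemma Sop_J: "Sop k j A (J B x v) = J B x (Sop k j A v)"
  unfolding J_def coeffop_additive[OF coeffop_Sop] coeffop_linear[OF coeffop_Sop] Sop_contr ..

text \<open>Below k the polynomial has positive degree k - j, so it is determined by its two partial
  derivatives; above k multiplication by s^{0'} is injective.\<close>

lemma Sop_injective:
  assumes v: "v \<in> pforms N (sig k j) t" and jk: "j \<noteq> k" and "Sop k j 0 v = 0" "Sop k j 1 v = 0"
  shows "v = 0"
proof (intro ext)
  fix a c T
  show "v a c T = 0 a c T"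
  proof (cases "j < k")
    case True
    show ?thesis
    proof (cases a)
      case (Suc a')
      have "Sop k j 0 v a' c T = 0" using assms(3) by simp
      then have "of_nat (a' + 1) * v (a' + 1) c T = 0" using True by (simp add: Sop_def ds_def)
      then have "v (a' + 1) c T = 0" by (metis mult_eq_0_iff of_nat_eq_0_iff add_is_0 one_neq_zero)
      then show ?thesis using Suc by (simp add: Suc_eq_plus1)
    next
      case 0
      show ?thesis
      proof (cases c)
        case (Suc c')
        have "Sop k j 1 v a c' T = 0" using assms(4) by simp
        then have "of_nat (c' + 1) * v a (c' + 1) T = 0" using True by (simp add: Sop_def ds_def)
        then have "v a (c' + 1) T = 0" by (metis mult_eq_0_iff of_nat_eq_0_iff add_is_0 one_neq_zero)
        then show ?thesis using Suc by (simp add: Suc_eq_plus1)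
      next
        case c: 0
        have "sig k j \<noteq> 0" using True by (simp add: sig_def)
        then show ?thesis using pformsD[OF v, of a c T] 0 c by auto
      qed
    qed
  next
    case False
    have "Sop k j 1 v (a + 1) c T = 0" using assms(4) by simp
    then show ?thesis using False by (simp add: Sop_def slow_def)
  qed
qed

lemma trace_eq_0_iff:
  assumes j: "j \<le> 2*n" and u: "u \<in> \<Gamma> j"
  shows "tr1 u = 0 \<and> tr2 j u = 0 \<longleftrightarrow> u \<in> \<J> j"
proof (cases "j = k")
  case False
  have "(p x (u x) = 0 \<and> - J 1 x (J 0 x (sym j x (u x))) = 0) \<longleftrightarrow> sym j x (u x) = 0" if x: "x \<in> S" for x
  proof -
    have xU: "x \<in> U" using x S_subset_U by blast
    have uV: "u x \<in> pforms (2*n+2) (sig k j) (int (tau k j))" using sections_in[OF u xU] by (simp add: CFspace_def)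
    have "Sop k j 0 (Om 0 x (u x)) + Sop k j 1 (Om 1 x (u x)) = 0 \<longleftrightarrow>
        Sop k j 0 (p x (u x)) = 0 \<and> Sop k j 1 (p x (u x)) = 0 \<and> J 1 x (J 0 x (Sop k j 0 (Om 0 x (u x)) + Sop k j 1 (Om 1 x (u x)))) = 0"
      unfolding p_def
      by (rule car.symbol_eq_0_iff[OF car[OF xU]]) (rule coeffop_linear(1)[OF coeffop_Sop] Sop_Om Sop_J)+
    moreover have "Sop k j 0 (p x (u x)) = 0 \<and> Sop k j 1 (p x (u x)) = 0 \<longleftrightarrow> p x (u x) = 0"
      using Sop_injective[OF p_pforms[OF xU uV] False] by (auto simp: coeffop_additive[OF coeffop_Sop])
    ultimately show ?thesis unfolding sym_def sum_01 by auto
  qed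
  then have "(\<forall>x\<in>S. p x (u x) = 0 \<and> - J 1 x (J 0 x (sym j x (u x))) = 0) \<longleftrightarrow> (\<forall>x\<in>S. sym j x (u x) = 0)" by simp
  moreover have "tr1 u = 0 \<and> tr2 j u = 0 \<longleftrightarrow> (\<forall>x\<in>S. p x (u x) = 0 \<and> - J 1 x (J 0 x (sym j x (u x))) = 0)"
    using False unfolding fun_eq_iff[of "tr1 u"] fun_eq_iff[of "tr2 j u"] tr1_def tr2_def by auto
  ultimately show ?thesis unfolding zero_Cauchy_first[OF False j] using u by blast
next
  case True
  note us = sections_smooth[OF u]
  define z where "z y = p y (u y)" for y
  define v where "v y = u y - z y" for y
  have zs: "smooth_section U z" unfolding z_def by (rule smooth_section_p[OF open_U subset_refl us])
  have vs: "smooth_section U v" unfolding v_def by (rule smooth_section_diff[OF open_U us zs])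
  have zt: "tangent (z y)" if "y \<in> U" for y unfolding z_def by (rule p_tangent[OF that])
  have pv: "p y (v y) = 0" if "y \<in> U" for y
    using p_id[OF that zt[OF that]] by (simp add: v_def p_additive[OF that]) (simp add: z_def)
  have eq: "tr1 u = 0 \<and> tr2 j u = 0 \<longleftrightarrow> (\<forall>x\<in>S. z x = 0 \<and> J 1 x (J 0 x (Gk v x)) + pdp b e z x = 0)"
    using True unfolding fun_eq_iff[of "tr1 u"] fun_eq_iff[of "tr2 j u"] tr1_def tr2_def v_def[abs_def] z_def[abs_def] by auto
  have OO: "Om 0 x (Om 1 x (u x)) = 0 \<longleftrightarrow> z x = 0" if "x \<in> S" for x
    using Om_Om_eq_0_iff that S_subset_U by (auto simp: z_def)
  \<comment> \<open>Once z vanishes on S, both parts of \<open>Gk u\<close> are \<Omega>^0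
    \<Omega>^1 applied to a tangential form, and on tangential forms this multiplication is
    injective.\<close>
  have "Gk u x = 0 \<longleftrightarrow> J 1 x (J 0 x (Gk v x)) + pdp b e z x = 0" if x: "x \<in> S" and zS: "\<forall>x\<in>S. z x = 0" for x
  proof -
    have xU: "x \<in> U" using x S_subset_U by blast
    let ?w = "J 1 x (J 0 x (Gk v x)) + pdp b e z x"
    have "Gk u x = Gk (\<lambda>y. v y + z y) x" by (rule Gk_cong[OF open_U xU]) (simp add: v_def)
    also have "\<dots> = Gk v x + Gk z x" by (rule Gk_add[OF open_U subset_refl vs zs xU])
    finally have 0: "Gk u x = Gk v x + Gk z x" .
    have 1: "Gk z x = Om 0 x (Om 1 x (pdp b e z x))" by (rule Gk_vanishing[OF zs _ x]) (use zS in blast)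
    have 2: "Gk v x = Om 0 x (Om 1 x (J 1 x (J 0 x (Gk v x))))" by (rule Gk_decomposition[OF open_U subset_refl vs xU pv])
    have "Gk u x = Om 0 x (Om 1 x ?w)" unfolding 0 1 Om_simps(1) using 2 by simp
    moreover have "tangent ?w"
      by (intro tangent_add tangent_pdp[OF open_U zs xU zt])
        (simp_all add: tangent_iff[OF xU] J_J_same J_anticommute[of 0 x 1] J_simps)
    ultimately show ?thesis using Om_Om_eq_0_iff[OF xU, of ?w] p_id[OF xU] by simp
  qed
  then have "(\<forall>x\<in>S. z x = 0 \<and> J 1 x (J 0 x (Gk v x)) + pdp b e z x = 0) \<longleftrightarrow>
      (\<forall>x\<in>S. Om 0 x (Om 1 x (u x)) = 0 \<and> Gk u x = 0)"
    using OO by (metis (no_types, lifting))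
  then show ?thesis unfolding eq using zero_Cauchy_second u j True by blast
qed

end

context cf_domain
begin

section \<open>Extension from the boundary\<close>

definition rad :: "'a \<Rightarrow> real" where
  "rad = (SOME g. smooth_on U g \<and> (\<forall>x\<in>U. g x > 0 \<and> ball x (g x) \<subseteq> U))"

lemma rad: "smooth_on U rad" "x \<in> U \<Longrightarrow> rad x > 0" "x \<in> U \<Longrightarrow> ball x (rad x) \<subseteq> U"
  using someI_ex[OF smooth_radius[OF open_U]] unfolding rad_def[symmetric] by blast+

text \<open>The square avoids the non-smooth absolute value. Where it is below 1, |\<rho> x| is
  smaller than a radius of a ball around x inside U, so \<open>proj x\<close> stays in U.\<close>

definition rel :: "'a \<Rightarrow> real" where "rel x = \<rho> x * inverse (rad x) * (\<rho> x * inverse (rad x))"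

text \<open>The constants make it 1 for \<open>rel\<close> up to 1/4 and 0 from 1/2 on, well inside
  the region \<open>rel\<close> < 1 where \<open>proj\<close> lands on S.\<close>

definition cutoff :: "'a \<Rightarrow> complex" where "cutoff x = of_real (step (2 - 4 * rel x))"

lemma smooth_rel: "smooth_on U rel"
  unfolding rel_def[abs_def] using rad(2)
  by (intro smooth_on_mult smooth_on_inverse smooth_\<rho> rad(1) open_U) force+

lemma smooth_cutoff_U: "smooth_on U cutoff"
  unfolding cutoff_def[abs_def]
  by (intro smooth_on_of_real smooth_on_step_compose smooth_on_diff smooth_on_mult smooth_on_const smooth_rel open_U)

definition U1 :: "'a set" where "U1 = {x \<in> U. rel x < 1 / 4}"

lemma open_rel: "open {x \<in> U. rel x < c}" "open {x \<in> U. rel x > c}"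
proof -
  have "open (U \<inter> rel -` {..<c})" "open (U \<inter> rel -` {c<..})"
    by (rule continuous_open_preimage[OF smooth_on_continuous[OF smooth_rel] open_U], simp)+
  moreover have "U \<inter> rel -` {..<c} = {x \<in> U. rel x < c}" "U \<inter> rel -` {c<..} = {x \<in> U. rel x > c}" by auto
  ultimately show "open {x \<in> U. rel x < c}" "open {x \<in> U. rel x > c}" by simp_all
qed

lemma rel_less_1:
  assumes "x \<in> U" "rel x < 1"
  shows "x \<in> U0"
proof -
  have "norm (b e) = 1" using e_unit by (simp add: norm_eq_sqrt_inner)
  moreover have "\<bar>\<rho> x * inverse (rad x)\<bar> < 1" using assms(2) abs_square_less_1[of "\<rho> x * inverse (rad x)"]
    by (simp add: rel_def power2_eq_square)
  then have "\<bar>\<rho> x\<bar> < rad x" using rad(2)[OF assms(1)] by (simp add: abs_mult divide_inverse[symmetric])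
  ultimately have "proj x \<in> ball x (rad x)" by (simp add: proj_def dist_norm)
  then show ?thesis using rad(3)[OF assms(1)] assms(1) by (auto simp: U0_def)
qed

lemma open_U1: "open U1" and U1_subset: "U1 \<subseteq> U" "U1 \<subseteq> U0" and S_U1: "S \<subseteq> U1"
proof -
  show "open U1" unfolding U1_def by (rule open_rel(1))
  show "U1 \<subseteq> U" by (auto simp: U1_def)
  show "U1 \<subseteq> U0"
  proof
    fix x assume "x \<in> U1"
    then have "x \<in> U" "rel x < 1" by (simp_all add: U1_def)
    then show "x \<in> U0" by (rule rel_less_1)
  qed
  show "S \<subseteq> U1" by (simp add: U1_def S_def rel_def subset_iff)
qed

definition cut :: "'a psection \<Rightarrow> 'a psection" where
  "cut z x = (if x \<in> U0 then pscale (cutoff x) (z x) else 0)"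

lemma cut_eq: "x \<in> U1 \<Longrightarrow> cut z x = z x"
  using U1_subset by (auto simp: cut_def cutoff_def U1_def step_eq_1 pscale_simps)

text \<open>The product is smooth on \<open>U0\<close>, and it vanishes on the open set where
  \<open>rel\<close> > 1/2. These two sets cover U because \<open>rel\<close> < 1 implies membership
  in \<open>U0\<close>.\<close>

lemma smooth_section_cut:
  assumes z: "smooth_section U0 z"
  shows "smooth_section U (cut z)"
proof (rule smooth_sectionI, rule smooth_on_local)
  fix i j T x assume x: "x \<in> U"
  have c0: "smooth_on U0 cutoff" by (rule smooth_on_subset[OF U0_subset_U smooth_cutoff_U])
  show "\<exists>V. open V \<and> x \<in> V \<and> smooth_on V (\<lambda>x. cut z x i j T)"
  proof (cases "rel x < 1")
    case True
    have "smooth_on U0 (\<lambda>x. cutoff x * z x i j T)" by (intro smooth_on_mult c0 smooth_sectionD z open_U0)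
    then have "smooth_on U0 (\<lambda>x. cut z x i j T)"
      by (rule smooth_on_cong[OF open_U0, rotated]) (simp add: cut_def pscale_def)
    then show ?thesis using rel_less_1[OF x True] open_U0 by blast
  next
    case False
    let ?V = "{x \<in> U. rel x > 1 / 2}"
    have "smooth_on ?V (\<lambda>x. cut z x i j T)"
      by (rule smooth_on_cong[OF open_rel(2) _ smooth_on_const[of _ 0]])
        (auto simp: cut_def cutoff_def step_eq_0 pscale_simps)
    moreover have "x \<in> ?V" using x False by simp
    ultimately show ?thesis using open_rel(2) by blast
  qed
qed

lemma smooth_along_proj:
  assumes f: "smooth_along S f"
  shows "smooth_on U0 (\<lambda>x. f (proj x))"
proof (rule smooth_on_local)
  fix x assume x: "x \<in> U0"
  then obtain g W where g: "open W" "proj x \<in> W" "smooth_on W g" "\<And>y. y \<in> W \<inter> S \<Longrightarrow> g y = f y"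
    using f[unfolded smooth_along_def local_extension_def, rule_format, OF proj_in_S[OF x]] by metis
  have c: "continuous_on U0 proj" using smooth_on_continuous[OF smooth_proj] continuous_on_subset U0_subset_U by blast
  define V where "V = U0 \<inter> proj -` W"
  have V: "open V" unfolding V_def by (rule continuous_open_preimage[OF c open_U0 g(1)])
  have "smooth_on V (\<lambda>x. g (proj x))"
    by (rule smooth_on_compose[OF g(1) V _ g(3) smooth_on_subset[OF _ smooth_proj]]) (use U0_subset_U in \<open>auto simp: V_def\<close>)
  then have "smooth_on V (\<lambda>x. f (proj x))"
    by (rule smooth_on_cong[OF V, rotated]) (use g(4) proj_in_S in \<open>auto simp: V_def\<close>)
  then show "\<exists>V. open V \<and> x \<in> V \<and> smooth_on V (\<lambda>x. f (proj x))" using V x g(2) by (auto simp: V_def)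
qed

lemma smooth_alongI:
  assumes "open W" "S \<subseteq> W" "smooth_on W g" "\<And>x. x \<in> S \<Longrightarrow> g x = f x"
  shows "smooth_along S f"
  unfolding smooth_along_def local_extension_def using assms by blast

lemma bsections_proj: "F \<in> bsections S V \<Longrightarrow> smooth_section U0 (\<lambda>x. F (proj x))"
  by (auto simp: bsections_def smooth_section_def intro: smooth_along_proj)

lemma bsections_in: "F \<in> bsections S V \<Longrightarrow> x \<in> S \<Longrightarrow> F x \<in> V"
  and bsections_0: "F \<in> bsections S V \<Longrightarrow> x \<notin> S \<Longrightarrow> F x = 0"
  by (auto simp: bsections_def)

lemma bsectionsI:
  assumes "smooth_section U z" "\<And>x. x \<in> S \<Longrightarrow> F x = z x" "\<And>x. x \<in> S \<Longrightarrow> F x \<in> V" "\<And>x. x \<notin> S \<Longrightarrow> F x = 0"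
  shows "F \<in> bsections S V"
  unfolding bsections_def using assms(2-)
  by (auto intro!: smooth_alongI[OF open_U S_subset_U smooth_sectionD[OF assms(1)]])

lemma pdp_e_proj:
  assumes "smooth_section U0 (\<lambda>x. F (proj x))" "x \<in> U0"
  shows "pdp b e (\<lambda>x. F (proj x)) x = 0"
  unfolding pdp_def pd_def
proof (intro ext)
  fix i j T
  show "frechet_derivative (\<lambda>y. F (proj y) i j T) (at x) (b e) = 0 i j T"
    using derivative_e_zero[OF open_U0 assms(2) smooth_on_differentiable[OF smooth_sectionD[OF assms(1)] assms(2)], of i j T]
      proj_shift U0_subset_U assms(2) by (simp add: subset_iff)
qed

end

text \<open>The representative \<open>\<Omega>\<^sup>0\<^sup>' \<and> Rop 0 v + \<Omega>\<^sup>1\<^sup>' \<and> Rop 1 v\<close> of the second boundary datum \<open>v\<close>; see \<open>Sop_Rop\<close>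
  and \<open>zext\<close>.  The division is by \<open>i > 0\<close> only.\<close>

definition Rop :: "nat \<Rightarrow> nat \<Rightarrow> 2 \<Rightarrow> pform \<Rightarrow> pform" where
  "Rop k j A v = (if j < k then (if A = 0 then 0 else (\<lambda>i l T. if i = 0 then 0 else - (v (i - 1) l T / of_nat i)))
    else (if A = 0 then (\<lambda>i l T. v (i + 1) l T) else (\<lambda>i l T. if i = 0 then v 0 (l + 1) T else 0)))"

lemma coeffop_Rop: "coeffop (Rop k j A)"
proof (rule coeffop_single)
  fix i l T
  consider "j < k" "A = 0" | "j < k" "A \<noteq> 0" | "\<not> j < k" "A = 0" | "\<not> j < k" "A \<noteq> 0" by blast
  then show "\<exists>c i' l' T'. \<forall>v. Rop k j A v i l T = c * v i' l' T'"
  proof cases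
    case 1
    then show ?thesis by (intro exI[of _ 0]) (simp add: Rop_def)
  next
    case 2
    then show ?thesis
      by (intro exI[of _ "if i = 0 then 0 else - 1 / of_nat i"] exI[of _ "i - 1"] exI[of _ l] exI[of _ T]) (simp add: Rop_def)
  next
    case 3
    then show ?thesis by (intro exI[of _ 1] exI[of _ "i + 1"] exI[of _ l] exI[of _ T]) (simp add: Rop_def)
  next
    case 4
    then show ?thesis by (intro exI[of _ "if i = 0 then 1 else 0"] exI[of _ 0] exI[of _ "l + 1"] exI[of _ T]) (simp add: Rop_def)
  qed
qed

lemma Rop_contr: "Rop k j A (contr C v) = contr C (Rop k j A v)"
  by (auto simp: Rop_def contr_def fun_eq_iff)

lemma Rop_pforms:
  assumes "j \<noteq> k" "v \<in> pforms N (sig k (j + 1)) t"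
  shows "Rop k j A v \<in> pforms N (sig k j) t"
  unfolding pforms_def mem_Collect_eq
proof (intro allI impI)
  fix i l T assume nz: "Rop k j A v i l T \<noteq> 0"
  show "(i, l, T) \<in> pform_index N (sig k j) t"
  proof (cases "j < k")
    case True
    then have "i \<noteq> 0" "v (i - 1) l T \<noteq> 0" using nz by (auto simp: Rop_def split: if_splits)
    then show ?thesis using pformsD[OF assms(2), of "i - 1" l T] True by (auto simp: pform_index_def sig_def)
  next
    case False
    then have "v (i + 1) l T \<noteq> 0 \<or> (i = 0 \<and> v 0 (l + 1) T \<noteq> 0)" using nz by (auto simp: Rop_def split: if_splits)
    then show ?thesis using pformsD[OF assms(2), of "i + 1" l T] pformsD[OF assms(2), of 0 "l + 1" T] False assms(1)
      by (auto simp: pform_index_def sig_def)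
  qed
qed

text \<open>Below k, \<open>Rop k j 1\<close> is minus the primitive in s^{0'} and
  \<open>Rop k j 0\<close> is 0. Above k, the pair divides v by the variables: v is s^{0'} times
  \<open>Rop k j 0 v\<close> plus s^{1'} times \<open>Rop k j 1 v\<close>.\<close>

lemma Sop_Rop:
  assumes "j \<noteq> k" "v \<in> pforms N (sig k (j + 1)) t"
  shows "Sop k j 0 (Rop k j 1 v) - Sop k j 1 (Rop k j 0 v) = - v"
proof (intro ext)
  fix i l T
  show "(Sop k j 0 (Rop k j 1 v) - Sop k j 1 (Rop k j 0 v)) i l T = (- v) i l T"
  proof (cases "j < k")
    case True
    have "(of_nat (i + 1) :: complex) \<noteq> 0" by (metis add_is_0 of_nat_eq_0_iff one_neq_zero)
    then show ?thesis using True by (simp add: Sop_def Rop_def ds_def)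
  next
    case False
    \<comment> \<open>The degree j - k is positive, so there is no constant term to divide.\<close>
    have "v 0 0 T = 0" using pformsD[OF assms(2), of 0 0 T] False assms(1) by (auto simp: sig_def)
    then show ?thesis using False by (cases i; cases l) (simp_all add: Sop_def Rop_def slow_def Suc_eq_plus1)
  qed
qed

context cf_complex
begin

lemma tangent_Rop: "tangent v \<Longrightarrow> tangent (Rop k j A v)"
  unfolding tangent_def Rop_contr[symmetric] by (simp add: coeffop_additive[OF coeffop_Rop])

lemma \<Gamma>I: "smooth_section U u \<Longrightarrow> (\<And>x. x \<in> U \<Longrightarrow> u x \<in> CFspace n k j) \<Longrightarrow> (\<And>x. x \<notin> U \<Longrightarrow> u x = 0) \<Longrightarrow> u \<in> \<Gamma> j"
  by (simp add: sections_def smooth_section_def)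

lemma \<Gamma>_closed: "u \<in> \<Gamma> j \<Longrightarrow> v \<in> \<Gamma> j \<Longrightarrow> u + v \<in> \<Gamma> j" "u \<in> \<Gamma> j \<Longrightarrow> v \<in> \<Gamma> j \<Longrightarrow> u - v \<in> \<Gamma> j" "u \<in> \<Gamma> j \<Longrightarrow> sscale c u \<in> \<Gamma> j"
proof -
  assume u: "u \<in> \<Gamma> j"
  show "sscale c u \<in> \<Gamma> j"
    by (rule \<Gamma>I) (use sections_smooth[OF u] sections_in[OF u] sections_0[OF u] in
        \<open>auto simp: sscale_def CFspace_def pforms_pscale pscale_simps smooth_section_pscale[OF open_U smooth_on_const]\<close>)
  assume v: "v \<in> \<Gamma> j"
  show "u + v \<in> \<Gamma> j"
    by (rule \<Gamma>I) (use sections_smooth[OF u] sections_in[OF u] sections_0[OF u] sections_smooth[OF v] sections_in[OF v] sections_0[OF v] in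
        \<open>auto simp: CFspace_def pforms_add plus_fun_def[of u v] smooth_section_add[OF open_U]\<close>)
  show "u - v \<in> \<Gamma> j"
    by (rule \<Gamma>I) (use sections_smooth[OF u] sections_in[OF u] sections_0[OF u] sections_smooth[OF v] sections_in[OF v] sections_0[OF v] in
        \<open>auto simp: CFspace_def pforms_diff fun_diff_def[of u v] smooth_section_diff[OF open_U]\<close>)
qed

lemma tr1_linear: "tr1 (u + v) = tr1 u + tr1 v" "tr1 (sscale c u) = sscale c (tr1 u)"
  using S_subset_U by (auto simp: tr1_def fun_eq_iff[of "tr1 (u + v)"] fun_eq_iff[of "tr1 (sscale c u)"] p_additive sscale_def pscale_simps subset_iff)

lemma tr2_add:
  assumes us: "smooth_section U u" and vs: "smooth_section U v"
  shows "tr2 j (u + v) = tr2 j u + tr2 j v"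
proof
  fix x
  show "tr2 j (u + v) x = (tr2 j u + tr2 j v) x"
  proof (cases "x \<in> S")
    case True
    then have x: "x \<in> U" using S_subset_U by blast
    let ?q = "\<lambda>u y. u y - p y (u y)"
    have sp: "smooth_section U (\<lambda>y. p y (u y))" if "smooth_section U u" for u by (rule smooth_section_p[OF open_U subset_refl that])
    have sq: "smooth_section U (?q u)" if "smooth_section U u" for u by (rule smooth_section_diff[OF open_U that sp[OF that]])
    have "Gk (?q (u + v)) x = Gk (\<lambda>y. ?q u y + ?q v y) x"
      by (rule Gk_cong[OF open_U x]) (simp add: p_additive)
    then have 1: "Gk (?q (u + v)) x = Gk (?q u) x + Gk (?q v) x" using Gk_add[OF open_U subset_refl sq[OF us] sq[OF vs] x] by simp
    have "pdp b e (\<lambda>y. p y ((u + v) y)) x = pdp b e (\<lambda>y. p y (u y) + p y (v y)) x"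
      by (rule pdp_cong[OF open_U x]) (simp add: p_additive)
    then have 2: "pdp b e (\<lambda>y. p y ((u + v) y)) x = pdp b e (\<lambda>y. p y (u y)) x + pdp b e (\<lambda>y. p y (v y)) x"
      using pdp_add[OF sp[OF us] sp[OF vs] x] by simp
    show ?thesis using True unfolding tr2_def 1 2 by (simp add: J_simps coeffop_linear[OF coeffop_sym])
  qed (simp add: tr2_def)
qed

lemma tr2_sscale:
  assumes us: "smooth_section U u"
  shows "tr2 j (sscale c u) = sscale c (tr2 j u)"
proof
  fix x
  show "tr2 j (sscale c u) x = sscale c (tr2 j u) x"
  proof (cases "x \<in> S")
    case True
    then have x: "x \<in> U" using S_subset_U by blast
    let ?q = "\<lambda>u y. u y - p y (u y)"
    have co: "coeffop (pscale c)" using coeffop_pscale[OF coeffop_id, of c] by simp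
    have sp: "smooth_section U (\<lambda>y. p y (u y))" by (rule smooth_section_p[OF open_U subset_refl us])
    have sq: "smooth_section U (?q u)" by (rule smooth_section_diff[OF open_U us sp])
    have "Gk (?q (sscale c u)) x = Gk (\<lambda>y. pscale c (?q u y)) x"
      by (rule Gk_cong[OF open_U x]) (simp add: p_additive sscale_def pscale_simps)
    then have 1: "Gk (?q (sscale c u)) x = pscale c (Gk (?q u) x)" using Gk_pscale[OF open_U subset_refl sq x] by simp
    have "pdp b e (\<lambda>y. p y (sscale c u y)) x = pdp b e (\<lambda>y. pscale c (p y (u y))) x"
      by (rule pdp_cong[OF open_U x]) (simp add: p_additive sscale_def)
    then have 2: "pdp b e (\<lambda>y. p y (sscale c u y)) x = pscale c (pdp b e (\<lambda>y. p y (u y)) x)"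
      using pdp_coeffop[OF open_U co sp x] by simp
    show ?thesis using True unfolding tr2_def sscale_def[of c "tr2 j u"] 1 2
      by (simp add: J_simps coeffop_linear[OF coeffop_sym] pscale_simps sscale_def)
  qed (simp add: tr2_def sscale_def pscale_simps)
qed

section \<open>The trace map and its right inverse\<close>

definition tr :: "nat \<Rightarrow> 'a psection \<Rightarrow> 'a psection \<times> 'a psection" where
  "tr j u = (tr1 u, tr2 j u)"

lemma tr_add: "u \<in> \<Gamma> j \<Longrightarrow> v \<in> \<Gamma> j \<Longrightarrow> tr i (u + v) = tr i u + tr i v"
  by (simp add: tr_def tr1_linear tr2_add sections_smooth)

lemma tr_sscale: "u \<in> \<Gamma> j \<Longrightarrow> tr i (sscale c u) = map_prod (sscale c) (sscale c) (tr i u)"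
  by (simp add: tr_def tr1_linear tr2_sscale sections_smooth)

lemma tr_diff: "u \<in> \<Gamma> j \<Longrightarrow> v \<in> \<Gamma> j \<Longrightarrow> tr i (u - v) = tr i u - tr i v"
  using tr_add[of "u - v" j v i] \<Gamma>_closed(2)[of u j v] by (simp add: algebra_simps)

lemma tr_eq_iff:
  assumes "j \<le> 2*n" "u \<in> \<Gamma> j" "v \<in> \<Gamma> j"
  shows "tr j u = tr j v \<longleftrightarrow> u - v \<in> \<J> j"
proof -
  have "tr j u = tr j v \<longleftrightarrow> tr j (u - v) = 0" using tr_diff[OF assms(2,3)] by simp
  also have "\<dots> \<longleftrightarrow> u - v \<in> \<J> j"
    using trace_eq_0_iff[OF assms(1) \<Gamma>_closed(2)[OF assms(2,3)]] by (simp add: tr_def zero_prod_def)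
  finally show ?thesis .
qed

lemma tr_in_bspace:
  assumes j: "j \<le> 2*n" and u: "u \<in> \<Gamma> j"
  shows "tr j u \<in> bspace_sections n k S j"
proof -
  note us = sections_smooth[OF u]
  have uV: "u x \<in> pforms (2*n+2) (sig k j) (int (tau k j))" if "x \<in> U" for x using sections_in[OF u that] by (simp add: CFspace_def)
  have sp: "smooth_section U (\<lambda>y. p y (u y))" by (rule smooth_section_p[OF open_U subset_refl us])
  have 1: "tr1 u \<in> bsections S (Bspace1 n k j)"
  proof (rule bsectionsI[OF sp])
    show "tr1 u x \<in> Bspace1 n k j" if "x \<in> S" for x
      using that S_subset_U tangent_pforms[OF p_pforms[OF _ uV] p_tangent] by (auto simp: tr1_def Bspace1_def)
  qed (auto simp: tr1_def)
  have 2: "tr2 j u \<in> bsections S (Bspace2 n k j)"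
  proof (cases "j = k")
    case True
    define v where "v y = u y - p y (u y)" for y
    have vs: "smooth_section U v" unfolding v_def by (rule smooth_section_diff[OF open_U us sp])
    have vV: "v x \<in> pforms (2*n+2) 0 (int k)" "p x (u x) \<in> pforms (2*n+2) 0 (int k)" if "x \<in> U" for x
      unfolding v_def using uV[OF that] p_pforms[OF that] True by (auto intro!: pforms_diff simp: sig_def tau_def)
    show ?thesis
    proof (rule bsectionsI)
      show "smooth_section U (\<lambda>x. J 1 x (J 0 x (Gk v x)) + pdp b e (\<lambda>y. p y (u y)) x)"
        by (intro smooth_section_add smooth_section_J smooth_section_Gk open_U subset_refl vs smooth_section_pdp sp)
      show eq: "tr2 j u x = J 1 x (J 0 x (Gk v x)) + pdp b e (\<lambda>y. p y (u y)) x" if "x \<in> S" for x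
        using that True by (simp add: tr2_def v_def[abs_def])
      fix x assume x: "x \<in> S"
      then have xU: "x \<in> U" using S_subset_U by blast
      have "Gk v x \<in> pforms (2*n+2) 0 (int k + 1 + 1)"
        unfolding Gk_def by (intro pforms_add pforms_diff Om_pforms dd_pforms[OF open_U xU] pdp_pforms[OF open_U xU] vV)
      then have "J 1 x (J 0 x (Gk v x)) \<in> pforms (2*n+2) 0 (int k + 1 + 1 - 1 - 1)" by (intro J_pforms)
      then have "J 1 x (J 0 x (Gk v x)) + pdp b e (\<lambda>y. p y (u y)) x \<in> pforms (2*n+2) 0 (int k)"
        by (intro pforms_add pdp_pforms[OF open_U xU] vV) simp_all
      moreover have "tangent (J 1 x (J 0 x (Gk v x)) + pdp b e (\<lambda>y. p y (u y)) x)"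
        by (intro tangent_add tangent_pdp[OF open_U sp xU p_tangent])
          (simp_all add: tangent_iff[OF xU] J_J_same J_anticommute[of 0 x 1] J_simps)
      ultimately show "tr2 j u x \<in> Bspace2 n k j" unfolding eq[OF x] using True by (simp add: Bspace2_def tangent_pforms)
    qed (simp add: tr2_def)
  next
    case False
    have co: "coeffop (\<lambda>v. - v)" by (rule coeffop_uminus[OF coeffop_id])
    show ?thesis
    proof (rule bsectionsI)
      show "smooth_section U (\<lambda>x. - J 1 x (J 0 x (sym j x (u x))))"
        by (intro smooth_section_coeffop[OF open_U co] smooth_section_J smooth_section_sym open_U subset_refl us)
      show eq: "tr2 j u x = - J 1 x (J 0 x (sym j x (u x)))" if "x \<in> S" for x using that False by (simp add: tr2_def)
      fix x assume x: "x \<in> S"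
      then have xU: "x \<in> U" using S_subset_U by blast
      have "sym j x (u x) \<in> pforms (2*n+2) (sig k (j + 1)) (int (tau k j) + 1)"
      proof (cases "j < k")
        case True
        then have "sig k j \<ge> 1" "sig k (j + 1) = sig k j - 1" by (auto simp: sig_def)
        then show ?thesis unfolding sym_def by (simp only:) (intro pforms_sum Sop_pforms(1) Om_pforms uV xU True)
      next
        case nl: False
        then have "sig k (j + 1) = sig k j + 1" using False by (auto simp: sig_def)
        then show ?thesis unfolding sym_def by (simp only:) (intro pforms_sum Sop_pforms(2) Om_pforms uV xU nl)
      qed
      then have "- J 1 x (J 0 x (sym j x (u x))) \<in> pforms (2*n+2) (sig k (j + 1)) (int (tau k j) + 1 - 1 - 1)"
        by (intro pforms_uminus J_pforms)
      moreover have "tangent (- J 1 x (J 0 x (sym j x (u x))))"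
        by (simp add: tangent_iff[OF xU] J_J_same J_anticommute[of 0 x 1] J_simps)
      ultimately show "tr2 j u x \<in> Bspace2 n k j" unfolding eq[OF x] using False by (simp add: Bspace2_def tangent_pforms)
    qed (simp add: tr2_def)
  qed
  show ?thesis using 1 2 by (simp add: tr_def bspace_sections_def)
qed

text \<open>At j = k the factor \<rho> places the second datum in the derivative along e without
  changing the values on S. At other j the datum is stored in the multiples of \<Omega>, which
  \<open>p\<close> does not see.\<close>

definition zext :: "nat \<Rightarrow> 'a psection \<times> 'a psection \<Rightarrow> 'a psection" where
  "zext j F x = (if j = k then fst F (proj x) + pscale (cfun \<rho> x) (snd F (proj x))
     else fst F (proj x) + (Om 0 x (Rop k j 0 (snd F (proj x))) + Om 1 x (Rop k j 1 (snd F (proj x)))))"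

definition Ext :: "nat \<Rightarrow> 'a psection \<times> 'a psection \<Rightarrow> 'a psection" where
  "Ext j F = cut (zext j F)"

lemma bspaceD:
  assumes "F \<in> bspace_sections n k S j"
  shows "smooth_section U0 (\<lambda>x. fst F (proj x))" "smooth_section U0 (\<lambda>x. snd F (proj x))"
    "x \<in> S \<Longrightarrow> fst F x \<in> pforms (2*n) (sig k j) (int (tau k j))"
    "x \<in> S \<Longrightarrow> j \<noteq> k \<Longrightarrow> snd F x \<in> pforms (2*n) (sig k (j + 1)) (int (tau k j) - 1)"
    "x \<in> S \<Longrightarrow> j = k \<Longrightarrow> snd F x \<in> pforms (2*n) 0 (int k)"
    "x \<in> S \<Longrightarrow> tangent (fst F x)" "x \<in> S \<Longrightarrow> tangent (snd F x)" "x \<notin> S \<Longrightarrow> fst F x = 0" "x \<notin> S \<Longrightarrow> snd F x = 0"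
proof -
  obtain F1 F2 where F: "F = (F1, F2)" "F1 \<in> bsections S (Bspace1 n k j)" "F2 \<in> bsections S (Bspace2 n k j)"
    using assms by (auto simp: bspace_sections_def)
  show "smooth_section U0 (\<lambda>x. fst F (proj x))" "smooth_section U0 (\<lambda>x. snd F (proj x))"
    using bsections_proj F by auto
  show 1: "x \<in> S \<Longrightarrow> fst F x \<in> pforms (2*n) (sig k j) (int (tau k j))"
    using bsections_in[OF F(2)] F(1) by (simp add: Bspace1_def)
  show 2: "x \<in> S \<Longrightarrow> j \<noteq> k \<Longrightarrow> snd F x \<in> pforms (2*n) (sig k (j + 1)) (int (tau k j) - 1)"
    using bsections_in[OF F(3)] F(1) by (simp add: Bspace2_def)
  show 3: "x \<in> S \<Longrightarrow> j = k \<Longrightarrow> snd F x \<in> pforms (2*n) 0 (int k)"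
    using bsections_in[OF F(3)] F(1) by (simp add: Bspace2_def)
  show "x \<in> S \<Longrightarrow> tangent (fst F x)" by (rule pforms_tangent[OF 1])
  show "x \<in> S \<Longrightarrow> tangent (snd F x)" using pforms_tangent[OF 2] pforms_tangent[OF 3] by blast
  show "x \<notin> S \<Longrightarrow> fst F x = 0" using bsections_0[OF F(2)] F(1) by (simp only: fst_conv)
  show "x \<notin> S \<Longrightarrow> snd F x = 0" using bsections_0[OF F(3)] F(1) by (simp only: snd_conv)
qed

lemma smooth_section_zext:
  assumes F: "F \<in> bspace_sections n k S j"
  shows "smooth_section U0 (zext j F)"
proof -
  note s = bspaceD(1,2)[OF F]
  have r0: "smooth_on U0 (cfun \<rho>)" by (rule smooth_on_subset[OF U0_subset_U smooth_cfun_\<rho>])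
  show ?thesis
  proof (cases "j = k")
    case True
    then show ?thesis unfolding zext_def[abs_def]
      by (simp, intro smooth_section_add smooth_section_pscale open_U0 r0 s)
  next
    case False
    then show ?thesis unfolding zext_def[abs_def]
      by (simp, intro smooth_section_add smooth_section_Om smooth_section_coeffop[OF open_U0 coeffop_Rop] open_U0 U0_subset_U s)
  qed
qed

lemma Ext_in:
  assumes F: "F \<in> bspace_sections n k S j"
  shows "Ext j F \<in> \<Gamma> j"
proof (rule \<Gamma>I)
  show "smooth_section U (Ext j F)" unfolding Ext_def by (rule smooth_section_cut[OF smooth_section_zext[OF F]])
  show "Ext j F x = 0" if "x \<notin> U" for x using that U0_subset_U by (auto simp: Ext_def cut_def)
  fix x assume "x \<in> U"
  show "Ext j F x \<in> CFspace n k j"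
  proof (cases "x \<in> U0")
    case True
    note pS = proj_in_S[OF True]
    have 1: "fst F (proj x) \<in> pforms (2*n+2) (sig k j) (int (tau k j))" by (rule pforms_mono[OF bspaceD(3)[OF F pS]])
    have "zext j F x \<in> pforms (2*n+2) (sig k j) (int (tau k j))"
    proof (cases "j = k")
      case j: True
      have "snd F (proj x) \<in> pforms (2*n+2) (sig k j) (int (tau k j))"
        using pforms_mono[OF bspaceD(5)[OF F pS j]] j by (simp add: sig_def tau_def)
      then have "fst F (proj x) + pscale (cfun \<rho> x) (snd F (proj x)) \<in> pforms (2*n+2) (sig k j) (int (tau k j))"
        by (rule pforms_add[OF 1 pforms_pscale])
      then show ?thesis using j by (simp only: zext_def if_True simp_thms)
    next
      case False
      have "Om A x (Rop k j A (snd F (proj x))) \<in> pforms (2*n+2) (sig k j) (int (tau k j) - 1 + 1)" for A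
        by (intro Om_pforms Rop_pforms False pforms_mono bspaceD(4)[OF F pS])
      then show ?thesis using False 1 unfolding zext_def by (simp, intro pforms_add) auto
    qed
    then show ?thesis unfolding Ext_def cut_def CFspace_def using True by (simp add: pforms_pscale)
  qed (simp add: Ext_def cut_def CFspace_def pforms_zero)
qed

lemma zext_tangent_k: "F \<in> bspace_sections n k S k \<Longrightarrow> x \<in> U0 \<Longrightarrow> tangent (zext k F x)"
  unfolding zext_def using bspaceD(6,7)[OF _ proj_in_S] by (simp add: tangent_add tangent_pscale)

lemma pdp_e_zext_k:
  assumes F: "F \<in> bspace_sections n k S k" and x: "x \<in> U0"
  shows "pdp b e (zext k F) x = snd F (proj x)"
proof -
  note s = bspaceD(1,2)[OF F]
  have xU: "x \<in> U" using x U0_subset_U by blast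
  have r0: "smooth_on U0 (cfun \<rho>)" by (rule smooth_on_subset[OF U0_subset_U smooth_cfun_\<rho>])
  have "pdp b e (zext k F) x = pdp b e (\<lambda>x. fst F (proj x) + pscale (cfun \<rho> x) (snd F (proj x))) x"
    by (simp add: zext_def[abs_def])
  then show ?thesis
    unfolding pdp_add[OF s(1) smooth_section_pscale[OF open_U0 r0 s(2)] x] pdp_pscale[OF r0 s(2) x]
      pdp_e_proj[OF s(1) x] pdp_e_proj[OF s(2) x] pd_cfun_\<rho> r_e[OF xU]
    by (simp add: pscale_simps)
qed

lemma tr_Ext:
  assumes F: "F \<in> bspace_sections n k S j"
  shows "tr j (Ext j F) = F"
proof -
  have E1: "Ext j F x = zext j F x" if "x \<in> U1" for x unfolding Ext_def by (rule cut_eq[OF that])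
  have 1: "tr1 (Ext j F) x = fst F x" for x
  proof (cases "x \<in> S")
    case True
    then have x: "x \<in> U1" "x \<in> U" using S_U1 U1_subset by auto
    have "p x (zext j F x) = fst F x"
      unfolding zext_def proj_S[OF True]
      using bspaceD(6,7)[OF F True] True by (simp add: p_additive[OF x(2)] p_Om[OF x(2)] p_id[OF x(2)] S_def pscale_simps)
    then show ?thesis using True E1[OF x(1)] by (simp add: tr1_def)
  qed (simp add: tr1_def bspaceD(8)[OF F])
  have 2: "tr2 j (Ext j F) x = snd F x" for x
  proof (cases "x \<in> S")
    case True
    then have x: "x \<in> U1" "x \<in> U" "x \<in> U0" using S_U1 U1_subset by auto
    show ?thesis
    proof (cases "j = k")
      case j: True
      have p1: "p y (Ext j F y) = zext j F y" if "y \<in> U1" for y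
      proof -
        have "y \<in> U" "y \<in> U0" using that U1_subset by auto
        then show ?thesis using E1[OF that] p_id[OF _ zext_tangent_k, of y F] F unfolding j by simp
      qed
      \<comment> \<open>The extension is tangential on a whole neighbourhood, so the argument of
        \<open>Gk\<close> vanishes near x and only the derivative along e contributes to the second
        trace.\<close>
      have "Gk (\<lambda>y. Ext j F y - p y (Ext j F y)) x = Gk (\<lambda>y. 0) x"
        by (rule Gk_cong[OF open_U1 x(1)]) (subst p1, assumption, simp only: E1 diff_self)
      then have g: "Gk (\<lambda>y. Ext j F y - p y (Ext j F y)) x = 0" by (simp add: Gk_zero)
      have "pdp b e (\<lambda>y. p y (Ext j F y)) x = pdp b e (zext j F) x"
        by (rule pdp_cong[OF open_U1 x(1)]) (rule p1)
      then have "pdp b e (\<lambda>y. p y (Ext j F y)) x = snd F x"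
        using pdp_e_zext_k[of F x] F x(3) proj_S[OF True] unfolding j by simp
      then show ?thesis using True j g by (simp add: tr2_def J_simps)
    next
      case False
      let ?a = "Rop k j 0 (snd F x)" and ?c = "Rop k j 1 (snd F x)" and ?f = "fst F x"
      have t: "tangent ?a" "tangent ?c" "tangent ?f" using bspaceD(6,7)[OF F True] tangent_Rop by auto
      have J0: "J A x ?a = 0" "J A x ?c = 0" "J A x ?f = 0" for A
        using t tangent_iff[OF x(2)] exhaust_01[of A] by auto
      have z: "zext j F x = ?f + (Om 0 x ?a + Om 1 x ?c)" using False by (simp add: zext_def proj_S[OF True])
      have SJ: "J A x (Sop k j B ?a) = 0" "J A x (Sop k j B ?c) = 0" "J A x (Sop k j B ?f) = 0" for A B
        unfolding Sop_J[symmetric] J0 by (simp_all add: coeffop_additive[OF coeffop_Sop])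
      have "J 1 x (J 0 x (sym j x (zext j F x))) = Sop k j 0 ?c - Sop k j 1 ?a"
        unfolding z sym_def sum_01
        by (simp add: Om_simps coeffop_linear[OF coeffop_Sop] coeffop_additive[OF coeffop_Sop] J_simps Sop_Om J_Om[OF x(2)] SJ Om_Om_same)
      also have "\<dots> = - snd F x" by (rule Sop_Rop[OF False bspaceD(4)[OF F True False]])
      finally show ?thesis using True False E1[OF x(1)] by (simp add: tr2_def)
    qed
  qed (simp add: tr2_def bspaceD(9)[OF F])
  show ?thesis unfolding tr_def using 1 2 by (metis ext prod.collapse)
qed

definition \<Psi> :: "nat \<Rightarrow> 'a psection set \<Rightarrow> 'a psection \<times> 'a psection" where
  "\<Psi> j C = tr j (SOME u. u \<in> C)"

lemma \<Psi>_class: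
  assumes "j \<le> 2*n" "u \<in> \<Gamma> j"
  shows "\<Psi> j (modrel (\<Gamma> j) (\<J> j) `` {u}) = tr j u"
proof -
  have "tr j (u - u) = 0" using tr_diff[OF assms(2,2)] by simp
  then have "u - u \<in> \<J> j" using tr_eq_iff[OF assms assms(2)] by simp
  then have "u \<in> modrel (\<Gamma> j) (\<J> j) `` {u}" using assms(2) by (simp add: modrel_def)
  then have "(SOME v. v \<in> modrel (\<Gamma> j) (\<J> j) `` {u}) \<in> modrel (\<Gamma> j) (\<J> j) `` {u}"
    by (rule someI[of "\<lambda>v. v \<in> modrel (\<Gamma> j) (\<J> j) `` {u}"])
  then have "(SOME v. v \<in> modrel (\<Gamma> j) (\<J> j) `` {u}) \<in> \<Gamma> j" "u - (SOME v. v \<in> modrel (\<Gamma> j) (\<J> j) `` {u}) \<in> \<J> j"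
    by (auto simp: modrel_def)
  then show ?thesis unfolding \<Psi>_def using tr_eq_iff[OF assms] by metis
qed

lemma quotient_iso:
  assumes j: "j \<le> 2*n"
  shows "quotient_linear_iso (\<Gamma> j) (\<J> j) (bspace_sections n k S j) (\<Psi> j)"
  unfolding quotient_linear_iso_def
proof (intro conjI ballI allI)
  show "\<Psi> j (modrel (\<Gamma> j) (\<J> j) `` {u + v}) = \<Psi> j (modrel (\<Gamma> j) (\<J> j) `` {u}) + \<Psi> j (modrel (\<Gamma> j) (\<J> j) `` {v})"
    if "u \<in> \<Gamma> j" "v \<in> \<Gamma> j" for u v
    using that by (simp add: \<Psi>_class[OF j] \<Gamma>_closed tr_add[OF that])
  show "\<Psi> j (modrel (\<Gamma> j) (\<J> j) `` {sscale c u}) = map_prod (sscale c) (sscale c) (\<Psi> j (modrel (\<Gamma> j) (\<J> j) `` {u}))"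
    if "u \<in> \<Gamma> j" for u c
    using that by (simp add: \<Psi>_class[OF j] \<Gamma>_closed tr_sscale[OF that])
  show "bij_betw (\<Psi> j) (\<Gamma> j // modrel (\<Gamma> j) (\<J> j)) (bspace_sections n k S j)"
    unfolding bij_betw_def
  proof
    show "inj_on (\<Psi> j) (\<Gamma> j // modrel (\<Gamma> j) (\<J> j))"
    proof (rule inj_onI)
      fix C C' assume "C \<in> \<Gamma> j // modrel (\<Gamma> j) (\<J> j)" "C' \<in> \<Gamma> j // modrel (\<Gamma> j) (\<J> j)" and eq: "\<Psi> j C = \<Psi> j C'"
      then obtain u v where u: "u \<in> \<Gamma> j" "C = modrel (\<Gamma> j) (\<J> j) `` {u}" and v: "v \<in> \<Gamma> j" "C' = modrel (\<Gamma> j) (\<J> j) `` {v}"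
        by (auto elim!: quotientE)
      have "tr j u = tr j v" using eq \<Psi>_class[OF j u(1)] \<Psi>_class[OF j v(1)] u(2) v(2) by simp
      then have "(u - w \<in> \<J> j) = (v - w \<in> \<J> j)" if "w \<in> \<Gamma> j" for w
        using tr_eq_iff[OF j u(1) that] tr_eq_iff[OF j v(1) that] by simp
      then show "C = C'" unfolding u v using u(1) v(1) by (auto simp: modrel_def)
    qed
    show "\<Psi> j ` (\<Gamma> j // modrel (\<Gamma> j) (\<J> j)) = bspace_sections n k S j"
    proof
      show "\<Psi> j ` (\<Gamma> j // modrel (\<Gamma> j) (\<J> j)) \<subseteq> bspace_sections n k S j"
        using \<Psi>_class[OF j] tr_in_bspace[OF j] by (auto elim!: quotientE)
      show "bspace_sections n k S j \<subseteq> \<Psi> j ` (\<Gamma> j // modrel (\<Gamma> j) (\<J> j))"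
      proof
        fix F assume F: "F \<in> bspace_sections n k S j"
        have "F = \<Psi> j (modrel (\<Gamma> j) (\<J> j) `` {Ext j F})" using \<Psi>_class[OF j Ext_in[OF F]] tr_Ext[OF F] by simp
        then show "F \<in> \<Psi> j ` (\<Gamma> j // modrel (\<Gamma> j) (\<J> j))" using Ext_in[OF F] by (auto intro: quotientI)
      qed
    qed
  qed
qed

section \<open>The induced boundary operators\<close>

definition bD :: "nat \<Rightarrow> 'a psection \<times> 'a psection \<Rightarrow> 'a psection \<times> 'a psection" where
  "bD j F = tr (Suc j) (CFop b n k U j (Ext j F))"

lemma CFop_diff:
  assumes u: "u \<in> \<Gamma> j" and v: "v \<in> \<Gamma> j"
  shows "CFop b n k U j (u - v) = CFop b n k U j u - CFop b n k U j v"
proof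
  fix x
  note s = sections_smooth[OF u] sections_smooth[OF v]
  show "CFop b n k U j (u - v) x = (CFop b n k U j u - CFop b n k U j v) x"
  proof (cases "x \<in> U")
    case True
    have uv: "u - v = (\<lambda>x. u x - v x)" by (simp add: fun_diff_def)
    have d1: "d A (\<lambda>x. u x - v x) y = d A u y - d A v y" if "y \<in> U" for A y by (rule dd_diff[OF s that])
    have "d 0 (d 1 (\<lambda>x. u x - v x)) x = d 0 (\<lambda>y. d 1 u y - d 1 v y) x" by (rule dd_cong[OF open_U True d1])
    also have "\<dots> = d 0 (d 1 u) x - d 0 (d 1 v) x"
      by (rule dd_diff[OF smooth_section_dd[OF open_U s(1)] smooth_section_dd[OF open_U s(2)] True])
    finally have d2: "d 0 (d 1 (\<lambda>x. u x - v x)) x = d 0 (d 1 u) x - d 0 (d 1 v) x" .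
    have "\<D> j (\<lambda>x. u x - v x) x = \<D> j u x - \<D> j v x"
      unfolding DD_def d2 d1[OF True] by (simp add: coeffop_additive[OF coeffop_Sop] sum_subtractf)
    then show ?thesis
      using CFop_eq[OF open_U \<Gamma>_closed(2)[OF u v] True] CFop_eq[OF open_U u True] CFop_eq[OF open_U v True] unfolding uv by simp
  qed (simp add: CFop_outside)
qed

text \<open>u and the extension of its trace have the same trace, so they differ by a section with
  zero Cauchy data; D_j maps such sections to sections with zero Cauchy data for D_{j+1}.\<close>

lemma bD_tr:
  assumes j: "Suc j \<le> 2*n" and u: "u \<in> \<Gamma> j"
  shows "bD j (tr j u) = tr (Suc j) (CFop b n k U j u)"
proof -
  have j': "j \<le> 2*n" using j by simp
  let ?v = "Ext j (tr j u)"
  have v: "?v \<in> \<Gamma> j" by (rule Ext_in[OF tr_in_bspace[OF j' u]])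
  have "tr j u = tr j ?v" by (rule tr_Ext[OF tr_in_bspace[OF j' u], symmetric])
  then have "u - ?v \<in> \<J> j" using tr_eq_iff[OF j' u v] by simp
  then have "CFop b n k U j u - CFop b n k U j ?v \<in> \<J> (Suc j)"
    using zero_Cauchy_CFop[OF j, of "u - ?v"] CFop_diff[OF u v] by simp
  then show ?thesis unfolding bD_def
    using tr_eq_iff[OF j CFop_sections[OF j' open_U u] CFop_sections[OF j' open_U v]] by simp
qed

lemma bD_bD:
  assumes j: "Suc (Suc j) \<le> 2*n" and F: "F \<in> bspace_sections n k S j"
  shows "bD (Suc j) (bD j F) = 0"
proof -
  have j': "j \<le> 2*n" "Suc j \<le> 2*n" using j by auto
  let ?u = "Ext j F"
  have u: "?u \<in> \<Gamma> j" by (rule Ext_in[OF F])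
  let ?v = "CFop b n k U j ?u"
  have v: "?v \<in> \<Gamma> (Suc j)" by (rule CFop_sections[OF j'(1) open_U u])
  let ?w = "CFop b n k U (Suc j) ?v"
  have w: "?w \<in> \<Gamma> (Suc (Suc j))" by (rule CFop_sections[OF j'(2) open_U v])
  have "?w x = 0" for x
  proof (cases "x \<in> U")
    case True
    have "?w x = \<D> (Suc j) ?v x" by (rule CFop_eq[OF open_U v True])
    also have "\<dots> = \<D> (Suc j) (\<D> j ?u) x" by (rule DD_cong[OF open_U True CFop_eq[OF open_U u]])
    also have "\<dots> = 0" by (rule DD_DD[OF open_U sections_smooth[OF u] True])
    finally show ?thesis .
  qed (simp add: CFop_outside)
  then have "?w = 0" by (simp only: fun_eq_iff[of ?w] zero_fun_def simp_thms)
  then have "?w - ?w = ?w" by simp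
  have "bD (Suc j) (bD j F) = tr (Suc (Suc j)) ?w" unfolding bD_def[of j] by (rule bD_tr[OF j v])
  also have "\<dots> = tr (Suc (Suc j)) (?w - ?w)" using \<open>?w - ?w = ?w\<close> by simp
  also have "\<dots> = 0" unfolding tr_diff[OF w w] by simp
  finally show ?thesis .
qed

end

context cf_domain
begin

section \<open>Tangential derivatives\<close>

text \<open>\<open>along\<close> evaluates on an unspecified extension; the hypothesis on X is the
  independence of that choice and lets any convenient g be used.\<close>

lemma alongI:
  assumes W: "open W" "x \<in> W" "smooth_on W g" "\<And>y. y \<in> W \<inter> S \<Longrightarrow> g y = f y"
    and X: "\<And>V h. open V \<Longrightarrow> x \<in> V \<Longrightarrow> smooth_on V h \<Longrightarrow> smooth_on V g \<Longrightarrow> (\<And>y. y \<in> V \<inter> S \<Longrightarrow> h y = g y) \<Longrightarrow> X h x = X g x"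
  shows "along S X f x = X g x"
proof -
  define h where "h = (SOME h. local_extension S x f h)"
  have "local_extension S x f g" unfolding local_extension_def using W by blast
  then have "local_extension S x f h" unfolding h_def by (rule someI[of "local_extension S x f"])
  then obtain V where V: "open V" "x \<in> V" "smooth_on V h" "\<And>y. y \<in> V \<inter> S \<Longrightarrow> h y = f y"
    unfolding local_extension_def by blast
  have "X h x = X g x"
  proof (rule X)
    show "open (V \<inter> W)" "x \<in> V \<inter> W" using V W by auto
    show "smooth_on (V \<inter> W) h" by (rule smooth_on_subset[OF _ V(3)]) blast
    show "smooth_on (V \<inter> W) g" by (rule smooth_on_subset[OF _ W(3)]) blast
    show "h y = g y" if "y \<in> (V \<inter> W) \<inter> S" for y using that V(4) W(4) by simp
  qed
  then show ?thesis unfolding along_def h_def .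
qed

lemma along_field:
  assumes x: "x \<in> S" and W: "open W" "x \<in> W" "smooth_on W g" "\<And>y. y \<in> W \<inter> S \<Longrightarrow> g y = f y"
    and Y: "frechet_derivative \<rho> (at x) (Y x) = 0"
  shows "along S (\<lambda>f x. frechet_derivative f (at x) (Y x)) f x = frechet_derivative g (at x) (Y x)"
proof (rule alongI[OF W])
  fix V h assume "open V" "x \<in> V" "smooth_on V h" "smooth_on V g" "\<And>y. y \<in> V \<inter> S \<Longrightarrow> h y = g y"
  from derivative_tangential[OF x this, of "Y x"] show "frechet_derivative h (at x) (Y x) = frechet_derivative g (at x) (Y x)"
    by (simp add: Y)
qed

text \<open>Two extensions have partial derivatives differing by r m times one common number; the
  condition on c, tangentiality of the complex field, cancels these differences.\<close>

lemma along_complex_field: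
  assumes x: "x \<in> S" and W: "open W" "x \<in> W" "smooth_on W g" "\<And>y. y \<in> W \<inter> S \<Longrightarrow> g y = f y"
    and X: "\<And>f. X f x = (\<Sum>m\<in>M. c m * pd b m f x)" "(\<Sum>m\<in>M. c m * r m x) = 0"
  shows "along S X f x = X g x"
proof (rule alongI[OF W])
  fix V h assume V: "open V" "x \<in> V" "smooth_on V h" "smooth_on V g" "\<And>y. y \<in> V \<inter> S \<Longrightarrow> h y = g y"
  have xU: "x \<in> U" using x S_subset_U by blast
  have 1: "pd b m h x - pd b m g x = r m x * (pd b e h x - pd b e g x)" for m
  proof -
    have l: "frechet_derivative f (at x) (v - t *\<^sub>R w) = frechet_derivative f (at x) v - of_real t * frechet_derivative f (at x) w"
      if "smooth_on V f" for f :: "'a \<Rightarrow> complex" and v w t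
      using linear_frechet_derivative[OF smooth_on_differentiable[OF that V(2)]]
      by (simp add: linear_diff linear_scale scaleR_conv_of_real)
    from derivative_tangential[OF x V, of "b m"] show ?thesis
      unfolding l[OF V(3)] l[OF V(4)] pd_def r_eq[OF xU] by (simp add: algebra_simps)
  qed
  have "(\<Sum>m\<in>M. c m * (pd b m h x - pd b m g x)) = (\<Sum>m\<in>M. c m * r m x) * (pd b e h x - pd b e g x)"
    unfolding sum_distrib_right mult.assoc by (rule sum.cong[OF refl], subst 1, rule refl)
  then show "X h x = X g x" unfolding X by (simp only: right_diff_distrib sum_subtractf mult_zero_left diff_zero right_minus_eq)
qed

lemma Om_wedge1: "Om A x v = (\<Sum>C<2*n+2. pscale (nabla_up b C A (cfun \<rho>) x) (wedge1 C v))"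
proof -
  have "Om A x v = (\<Sum>C<2*n+2. \<Sum>m\<in>M. pscale (nabla_coef C A m * r m x) (wedge1 C v))"
    unfolding Om_def Kop_def pscale_sum pscale_simps by (subst sum.swap) (simp only: mult.commute)
  also have "\<dots> = (\<Sum>C<2*n+2. pscale (nabla_up b C A (cfun \<rho>) x) (wedge1 C v))"
    by (intro sum.cong refl) (simp only: nabla_up_eq lessThan_iff pd_cfun_\<rho> pscale_sum_left)
  finally show ?thesis .
qed

lemma dd_wedge1: "d A u x = (\<Sum>C<2*n+2. wedge1 C (\<Sum>m\<in>M. pscale (nabla_coef C A m) (pdp b m u x)))"
  unfolding dd_def Kop_def coeffop_additive[OF coeffop_wedge1] coeffop_linear[OF coeffop_wedge1] by (rule sum.swap)

lemma sum_frame: "(\<Sum>C<2*n+2. f C) = (\<Sum>C<2*n. f C) + (\<Sum>B\<in>UNIV. f (2*n + oidx B))"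
  for f :: "nat \<Rightarrow> 'v::comm_monoid_add"
proof -
  have "2*n+2 = Suc (Suc (2*n))" by simp
  then show ?thesis by (simp only: sum.lessThan_Suc sum_01 oidx_def) (simp add: add.assoc One_nat_def)
qed

lemma ncoef_eq: "ncoef b n \<rho> C B x = (\<Sum>A\<in>UNIV. Rcoef b n \<rho> A B x * nabla_up b C A (cfun \<rho>) x)"
  by (simp add: ncoef_def sum_01 Rcoef_eq nabla_up_def)

text \<open>The combination of \<Omega>^{0'}, \<Omega>^{1'} with coefficients R equals
  \<omega>^{2n+o(B)} plus the sum of n_{CB} \<omega>^C over C < 2n. As \<open>p\<close> kills
  multiples of \<Omega>, it replaces the normal covector by minus that sum; this is the origin of
  the coefficients n in Z.\<close>

lemma p_wedge1_normal:
  assumes x: "x \<in> U"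
  shows "p x (wedge1 (2*n + oidx B) v) = - (\<Sum>C<2*n. pscale (ncoef b n \<rho> C B x) (p x (wedge1 C v)))"
proof -
  have "(\<Sum>A\<in>UNIV. pscale (Rcoef b n \<rho> A B x) (Om A x v)) = (\<Sum>C<2*n+2. pscale (ncoef b n \<rho> C B x) (wedge1 C v))"
    unfolding Om_wedge1 pscale_sum by (subst sum.swap) (simp only: pscale_simps pscale_sum_left[symmetric] ncoef_eq)
  also have "\<dots> = (\<Sum>C<2*n. pscale (ncoef b n \<rho> C B x) (wedge1 C v)) + wedge1 (2*n + oidx B) v"
  proof -
    have q: "ncoef b n \<rho> (2*n + oidx B') B x = (if B' = B then 1 else 0)" for B'
      using Nup_Rcoef[OF x, of B' B] by (simp only: ncoef_eq Nup_def mult.commute)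
    have "(\<Sum>B'\<in>UNIV. pscale (ncoef b n \<rho> (2*n + oidx B') B x) (wedge1 (2*n + oidx B') v)) = wedge1 (2*n + oidx B) v"
      unfolding q using exhaust_01[of B] by (auto simp: sum_01 pscale_simps)
    then show ?thesis unfolding sum_frame by simp
  qed
  finally have "p x (\<Sum>A\<in>UNIV. pscale (Rcoef b n \<rho> A B x) (Om A x v)) =
      p x ((\<Sum>C<2*n. pscale (ncoef b n \<rho> C B x) (wedge1 C v)) + wedge1 (2*n + oidx B) v)" by (rule arg_cong)
  then have "0 = (\<Sum>C<2*n. pscale (ncoef b n \<rho> C B x) (p x (wedge1 C v))) + p x (wedge1 (2*n + oidx B) v)"
    unfolding p_additive(1)[OF x] coeffop_additive(4)[OF coeffop_p[OF x]] p_additive(5)[OF x] p_Om[OF x] pscale_simps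
    by simp
  then show ?thesis by (simp only: eq_neg_iff_add_eq_0 add.commute)
qed

lemma tangent_wedge1:
  assumes "C < 2*n" "tangent v"
  shows "tangent (wedge1 C v)"
  unfolding tangent_def
proof
  fix B
  have "2*n + oidx B \<noteq> C" using assms(1) by simp
  then show "contr (2*n + oidx B) (wedge1 C v) = 0"
    using contr_wedge1[of "2*n + oidx B" C v] assms(2) by (simp add: tangent_def coeffop_additive[OF coeffop_wedge1])
qed

lemma tangent_sum: "(\<And>i. i \<in> I \<Longrightarrow> tangent (f i)) \<Longrightarrow> tangent (\<Sum>i\<in>I. f i)"
  by (induction I rule: infinite_finite_induct) (simp_all add: tangent_zero tangent_add)

lemma tangent_coef: "tangent v \<longleftrightarrow> (\<forall>B i j T. 2*n + oidx B \<in> T \<longrightarrow> v i j T = 0)"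
proof
  assume t: "tangent v"
  show "\<forall>B i j T. 2*n + oidx B \<in> T \<longrightarrow> v i j T = 0"
  proof (intro allI impI)
    fix B i j T assume B: "2*n + oidx B \<in> T"
    have "contr (2*n + oidx B) v i j (T - {2*n + oidx B}) = 0" using t by (simp add: tangent_def)
    then show "v i j T = 0" using B by (simp add: contr_def insert_absorb osign_def)
  qed
next
  assume *: "\<forall>B i j T. 2*n + oidx B \<in> T \<longrightarrow> v i j T = 0"
  show "tangent v"
    unfolding tangent_def by (intro allI ext) (simp add: contr_def *[rule_format, OF insertI1])
qed

definition zcoef :: "nat \<Rightarrow> 2 \<Rightarrow> 'a \<Rightarrow> nat \<Rightarrow> complex" where
  "zcoef C A x m = nabla_coef C A m - (\<Sum>B\<in>UNIV. ncoef b n \<rho> C B x * nabla_coef (2*n + oidx B) A m)"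

lemma Zfield_eq:
  assumes "C < 2*n"
  shows "Zfield b n \<rho> C A f x = (\<Sum>m\<in>M. zcoef C A x m * pd b m f x)"
proof -
  have C: "C < 2*n+2" using assms by simp
  have "(\<Sum>B\<in>UNIV. ncoef b n \<rho> C B x * (\<Sum>m\<in>M. nabla_coef (2*n + oidx B) A m * pd b m f x)) =
      (\<Sum>m\<in>M. (\<Sum>B\<in>UNIV. ncoef b n \<rho> C B x * nabla_coef (2*n + oidx B) A m) * pd b m f x)"
    unfolding sum_distrib_left sum_distrib_right by (subst sum.swap) (simp only: mult.assoc)
  then show ?thesis
    unfolding Zfield_def Nup_eq nabla_up_eq[OF C] zcoef_def by (simp only: left_diff_distrib sum_subtractf)
qed

lemma Zfield_tangential:
  assumes "C < 2*n" "x \<in> U"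
  shows "(\<Sum>m\<in>M. zcoef C A x m * r m x) = 0"
proof -
  have "(\<Sum>B\<in>UNIV. ncoef b n \<rho> C B x * Nup b n B A (cfun \<rho>) x) =
      (\<Sum>D\<in>UNIV. nabla_up b C D (cfun \<rho>) x * (\<Sum>B\<in>UNIV. Rcoef b n \<rho> D B x * Nup b n B A (cfun \<rho>) x))"
    unfolding ncoef_eq sum_distrib_left sum_distrib_right by (subst sum.swap) (simp only: mult_ac)
  also have "\<dots> = nabla_up b C A (cfun \<rho>) x"
    unfolding Rcoef_Nup[OF assms(2)] using exhaust_01[of A] by (auto simp: sum_01)
  finally have "Zfield b n \<rho> C A (cfun \<rho>) x = 0" by (simp add: Zfield_def)
  then show ?thesis unfolding Zfield_eq[OF assms(1)] pd_cfun_\<rho> .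
qed

text \<open>The components of d^A f along \<omega>^{2n} and \<omega>^{2n+1} are moved by
  \<open>p_wedge1_normal\<close> to the tangential covectors, where they turn \<nabla>_C into
  Z_C.\<close>

lemma p_d_tangent:
  assumes W: "open W" "x \<in> W" "W \<subseteq> U" and f: "smooth_section W f" "\<And>y. y \<in> W \<Longrightarrow> tangent (f y)"
  shows "p x (d A f x) = (\<Sum>C<2*n. wedge1 C (\<lambda>i j T. Zfield b n \<rho> C A (\<lambda>y. f y i j T) x))"
proof -
  have x: "x \<in> U" using W by blast
  define g where "g C = (\<Sum>m\<in>M. pscale (nabla_coef C A m) (pdp b m f x))" for C
  have tg: "tangent (g C)" for C
    unfolding g_def by (intro tangent_sum tangent_pscale tangent_pdp[OF W(1) f(1) W(2) f(2)])
  have pw: "p x (wedge1 C (g C')) = wedge1 C (g C')" if "C < 2*n" for C C'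
    by (rule p_id[OF x tangent_wedge1[OF that tg]])
  have "p x (d A f x) = (\<Sum>C<2*n. p x (wedge1 C (g C))) + (\<Sum>B\<in>UNIV. p x (wedge1 (2*n + oidx B) (g (2*n + oidx B))))"
    unfolding dd_wedge1 g_def[symmetric] sum_frame p_additive(1)[OF x] coeffop_additive(4)[OF coeffop_p[OF x]] ..
  also have "(\<Sum>B\<in>UNIV. p x (wedge1 (2*n + oidx B) (g (2*n + oidx B)))) =
      - (\<Sum>B\<in>UNIV. \<Sum>C<2*n. pscale (ncoef b n \<rho> C B x) (wedge1 C (g (2*n + oidx B))))"
    unfolding p_wedge1_normal[OF x] sum_negf
    by (intro arg_cong[where f = uminus] sum.cong refl arg_cong[where f = "pscale _"] pw) simp
  also have "(\<Sum>B\<in>UNIV. \<Sum>C<2*n. pscale (ncoef b n \<rho> C B x) (wedge1 C (g (2*n + oidx B)))) =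
      (\<Sum>C<2*n. wedge1 C (\<Sum>B\<in>UNIV. pscale (ncoef b n \<rho> C B x) (g (2*n + oidx B))))"
    unfolding coeffop_additive(4)[OF coeffop_wedge1] coeffop_linear(2)[OF coeffop_wedge1] by (rule sum.swap)
  also have "(\<Sum>C<2*n. p x (wedge1 C (g C))) = (\<Sum>C<2*n. wedge1 C (g C))" by (intro sum.cong refl pw) simp
  finally have 1: "p x (d A f x) = (\<Sum>C<2*n. wedge1 C (g C - (\<Sum>B\<in>UNIV. pscale (ncoef b n \<rho> C B x) (g (2*n + oidx B)))))"
    by (simp only: coeffop_additive(3)[OF coeffop_wedge1] sum_subtractf add_uminus_conv_diff)
  have gij: "g C i j T = nabla_up b C A (\<lambda>y. f y i j T) x" if "C < 2*n+2" for C i j T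
    unfolding nabla_up_eq[OF that] g_def by (simp add: sum_apply pscale_apply pdp_def)
  have 2: "g C - (\<Sum>B\<in>UNIV. pscale (ncoef b n \<rho> C B x) (g (2*n + oidx B))) = (\<lambda>i j T. Zfield b n \<rho> C A (\<lambda>y. f y i j T) x)"
    if "C < 2*n" for C
  proof -
    have "2*n + oidx B < 2*n+2" for B by (simp add: oidx_def)
    then show ?thesis unfolding Zfield_def Nup_def
      using that by (intro ext) (simp add: sum_apply pscale_apply gij)
  qed
  show ?thesis unfolding 1 by (intro sum.cong refl arg_cong[where f = "wedge1 _"] 2) simp
qed

lemma plift_bdform:
  assumes x: "x \<in> S" and W: "open W" "x \<in> W" "W \<subseteq> U"
    and f: "smooth_section W f" "\<And>y. y \<in> W \<Longrightarrow> f y \<in> pforms (2*n) s t"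
    and F: "\<And>y. y \<in> W \<inter> S \<Longrightarrow> f y = F y"
  shows "plift (bdform b n \<rho> S A) F x = p x (d A f x)"
proof (intro ext)
  fix i j T
  have xU: "x \<in> U" using W by blast
  have pd: "p x (d A f x) = (\<Sum>C<2*n. wedge1 C (\<lambda>i j T. Zfield b n \<rho> C A (\<lambda>y. f y i j T) x))"
    by (rule p_d_tangent[OF W f(1)]) (rule pforms_tangent[OF f(2)])
  have a: "along S (Zfield b n \<rho> C A) (\<lambda>y. F y i j T) x = Zfield b n \<rho> C A (\<lambda>y. f y i j T) x" if "C < 2*n" for C T
    by (rule along_complex_field[where X = "Zfield b n \<rho> C A" and g = "\<lambda>y. f y i j T" and c = "zcoef C A x",
          OF x W(1,2) smooth_sectionD[OF f(1)] _ Zfield_eq[OF that] Zfield_tangential[OF that xU]])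
      (simp only: F)
  have "p x (d A f x) \<in> pforms (2*n+2) s (t + 1)"
    by (rule p_pforms[OF xU dd_pforms[OF W(1,2)]]) (rule pforms_mono[OF f(2)])
  then have inf: "infinite T \<Longrightarrow> p x (d A f x) i j T = 0" by (rule pforms_infinite)
  show "plift (bdform b n \<rho> S A) F x i j T = p x (d A f x) i j T"
  proof (cases "finite T")
    case True
    then show ?thesis
      unfolding plift_def bdform_def pd
      by (simp add: sum_apply wedge_omega wedge1_def a)
  next
    case False
    then show ?thesis by (simp add: inf plift_def bdform_def sum_apply wedge_omega)
  qed
qed

end

section \<open>Exterior products\<close>

lemma form_sign_insert:
  assumes "finite P" "finite Q" "C \<notin> P"
  shows "form_sign (insert C P) Q = osign C Q * form_sign P Q"
proof -
  let ?X = "{(p, q). p \<in> P \<and> q \<in> Q \<and> q < p}" and ?Y = "(\<lambda>q. (C, q)) ` {q \<in> Q. q < C}"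
  have eq: "{(p, q). p \<in> insert C P \<and> q \<in> Q \<and> q < p} = ?X \<union> ?Y" by auto
  have fin: "finite ?X" by (rule finite_subset[of _ "P \<times> Q"]) (use assms in auto)
  have "card (?X \<union> ?Y) = card ?X + card ?Y"
    by (rule card_Un_disjoint[OF fin]) (use assms in auto)
  moreover have "card ?Y = card {q \<in> Q. q < C}" by (rule card_image) (simp add: inj_on_def)
  ultimately show ?thesis unfolding form_sign_def osign_def eq by (simp add: power_add mult.commute)
qed

lemma osign_Un:
  assumes "finite P" "finite Q" "P \<inter> Q = {}"
  shows "osign C (P \<union> Q) = osign C P * osign C Q"
proof -
  have "{q \<in> P \<union> Q. q < C} = {q \<in> P. q < C} \<union> {q \<in> Q. q < C}" by auto
  moreover have "card ({q \<in> P. q < C} \<union> {q \<in> Q. q < C}) = card {q \<in> P. q < C} + card {q \<in> Q. q < C}"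
    by (rule card_Un_disjoint) (use assms in auto)
  ultimately show ?thesis unfolding osign_def by (simp add: power_add)
qed

text \<open>Associativity for a one-form factor. It shows that \<open>Kop\<close>, \<open>Om\<close>
  and \<open>E\<close> are exterior multiplications by their values on \<open>unit_pform\<close>,
  which links them to the forms of the statement. A form is handled as the coefficient
  \<open>w 0 0\<close> of a \<open>pform\<close>.\<close>

lemma pwedge_wedge1: "pwedge (wedge1 C w 0 0) v = wedge1 C (pwedge (w 0 0) v)"
proof (intro ext)
  fix i j T
  show "pwedge (wedge1 C w 0 0) v i j T = wedge1 C (pwedge (w 0 0) v) i j T"
  proof (cases "finite T \<and> C \<in> T")
    case False
    have "wedge \<alpha> \<beta> T' = 0" if "infinite T'" for \<alpha> \<beta> T' using that by (simp add: wedge_def)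
    then show ?thesis using False
      by (cases "finite T") (auto simp: pwedge_def wedge1_def wedge_def intro!: sum.neutral)
  next
    case True
    let ?R = "T - {C}"
    \<comment> \<open>Only index sets P containing C contribute, and those correspond to subsets of
      T without C.\<close>
    have PT: "Pow T = Pow ?R \<union> insert C ` Pow ?R" using True Pow_insert[of C ?R] by (simp add: insert_absorb)
    have inj: "inj_on (insert C) (Pow ?R)" by (auto simp: inj_on_def)
    have fR: "finite (Pow ?R)" using True by simp
    have "wedge (wedge1 C w 0 0) (v i j) T =
        (\<Sum>P\<in>Pow ?R. form_sign P (T - P) * wedge1 C w 0 0 P * v i j (T - P)) +
        (\<Sum>P\<in>insert C ` Pow ?R. form_sign P (T - P) * wedge1 C w 0 0 P * v i j (T - P))"
      unfolding wedge_def PT by (rule sum.union_disjoint) (use fR in auto)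
    also have "(\<Sum>P\<in>Pow ?R. form_sign P (T - P) * wedge1 C w 0 0 P * v i j (T - P)) = 0"
      by (rule sum.neutral) (auto simp: wedge1_def)
    also have "(\<Sum>P\<in>insert C ` Pow ?R. form_sign P (T - P) * wedge1 C w 0 0 P * v i j (T - P)) =
        (\<Sum>P\<in>Pow ?R. osign C T * (form_sign P (?R - P) * w 0 0 P * v i j (?R - P)))"
      unfolding sum.reindex[OF inj] o_def
    proof (rule sum.cong[OF refl])
      fix P assume "P \<in> Pow ?R"
      then have P: "P \<subseteq> ?R" "C \<notin> P" "finite P" "finite (?R - P)" using True finite_subset by auto
      have s1: "T - insert C P = ?R - P" by blast
      have s2: "insert C P - {C} = P" using P(2) by blast
      have "T = insert C (P \<union> (?R - P))" using P(1) True by blast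
      then have "osign C T = osign C (P \<union> (?R - P))" by (metis osign_insert less_irrefl)
      also have "\<dots> = osign C P * osign C (?R - P)" by (rule osign_Un) (use P in auto)
      finally have o: "osign C T = osign C P * osign C (?R - P)" .
      have o2: "osign C (insert C P) = osign C P" by (simp add: osign_insert)
      show "form_sign (insert C P) (T - insert C P) * wedge1 C w 0 0 (insert C P) * v i j (T - insert C P) =
          osign C T * (form_sign P (?R - P) * w 0 0 P * v i j (?R - P))"
        unfolding s1 o form_sign_insert[OF P(3,4,2)] by (simp add: wedge1_def s2 o2 mult_ac)
    qed
    finally show ?thesis using True by (simp add: pwedge_def wedge1_def wedge_def[of "w 0 0"] sum_distrib_left)
  qed
qed

lemma pwedge_linear:
  "pwedge ((u + w) 0 0) v = pwedge (u 0 0) v + pwedge (w 0 0) v"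
  "pwedge (pscale c w 0 0) v = pscale c (pwedge (w 0 0) v)"
  by (auto simp: pwedge_def wedge_def pscale_def fun_eq_iff sum.distrib[symmetric] sum_distrib_left algebra_simps)

lemmas pwedge_additive = additive_simps[of "\<lambda>w. pwedge (w 0 0) v" for v, OF pwedge_linear(1)]

lemma pwedge_Kop: "pwedge (Kop n A m w 0 0) v = Kop n A m (pwedge (w 0 0) v)"
  unfolding Kop_def pwedge_additive pwedge_linear pwedge_wedge1 ..

definition of_form :: "form \<Rightarrow> pform" where
  "of_form \<alpha> = (\<lambda>i j T. if i = 0 \<and> j = 0 then \<alpha> T else 0)"

definition unit_pform :: pform where
  "unit_pform = of_form (\<lambda>T. if T = {} then 1 else 0)"

lemma of_form_00: "of_form \<alpha> 0 0 = \<alpha>" by (simp add: of_form_def)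

lemma of_form_pforms: "\<alpha> \<in> forms N t \<Longrightarrow> of_form \<alpha> \<in> pforms N 0 t"
  by (auto simp: of_form_def forms_def pforms_def pform_index_def split: if_splits)

lemma pforms_of_form:
  assumes "w \<in> pforms N 0 t"
  shows "w 0 0 \<in> forms N t" "of_form (w 0 0) = w"
proof -
  show "w 0 0 \<in> forms N t" using pformsD[OF assms, of 0 0] by (auto simp: forms_def)
  show "of_form (w 0 0) = w"
    using pformsD[OF assms] by (intro ext) (auto simp: of_form_def)
qed

lemma unit_pforms: "unit_pform \<in> pforms N 0 0"
  by (auto simp: unit_pform_def of_form_def pforms_def pform_index_def split: if_splits)

lemma pforms_00: "w \<in> pforms N 0 0 \<Longrightarrow> w = pscale (w 0 0 {}) unit_pform"
proof (intro ext)
  fix i j T assume w: "w \<in> pforms N 0 0"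
  have "w i j T \<noteq> 0 \<Longrightarrow> i = 0 \<and> j = 0 \<and> T = {}" using pformsD[OF w, of i j T] finite_subset[of T "{..<N}"] by auto
  then show "w i j T = pscale (w 0 0 {}) unit_pform i j T" by (auto simp: pscale_def unit_pform_def of_form_def)
qed

lemma pwedge_unit:
  assumes "\<And>i j T. infinite T \<Longrightarrow> v i j T = 0"
  shows "pwedge (unit_pform 0 0) v = v"
proof (intro ext)
  fix i j T
  show "pwedge (unit_pform 0 0) v i j T = v i j T"
  proof (cases "finite T")
    case True
    have "(\<Sum>P\<in>Pow T. form_sign P (T - P) * (if P = {} then 1 else 0) * v i j (T - P)) =
        (\<Sum>P\<in>Pow T. if P = {} then v i j T else 0)"
      by (rule sum.cong[OF refl]) (simp add: form_sign_def)
    also have "\<dots> = v i j T" using True by (subst sum.delta) auto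
    finally show ?thesis by (simp add: pwedge_def wedge_def unit_pform_def of_form_def)
  next
    case False
    then show ?thesis using assms by (simp add: pwedge_def wedge_def)
  qed
qed

context cf_domain
begin

lemma pwedge_Om: "pwedge (Om A x w 0 0) v = Om A x (pwedge (w 0 0) v)"
  unfolding Om_def pwedge_additive pwedge_linear pwedge_Kop ..

lemma pwedge_E: "pwedge (E A B x w 0 0) v = E A B x (pwedge (w 0 0) v)"
  unfolding E_def pwedge_additive pwedge_linear pwedge_Kop ..

lemma E_pforms: "v \<in> pforms (2*n+2) s t \<Longrightarrow> E A B x v \<in> pforms (2*n+2) s (t + 1 + 1)"
  unfolding E_def by (intro pforms_sum pforms_pscale Kop_pforms)

lemma d_unit: "d A (\<lambda>y. unit_pform) x = 0"
proof -
  have "pdp b m (\<lambda>y. unit_pform) x = 0" for m by (simp add: pdp_def pd_def fun_eq_iff)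
  then show ?thesis unfolding dd_def by (simp add: coeffop_additive[OF coeffop_Kop])
qed

lemma smooth_section_unit: "smooth_section W (\<lambda>y. unit_pform)"
  by (simp add: smooth_section_def smooth_on_const)

lemma plift_zero_form:
  assumes x: "x \<in> U"
  shows "plift (dform b n A) (\<lambda>y. pscale (cfun \<rho> y) unit_pform) x = Om A x unit_pform"
proof -
  have "plift (dform b n A) (\<lambda>y. pscale (cfun \<rho> y) unit_pform) x = d A (\<lambda>y. pscale (cfun \<rho> y) unit_pform) x"
    by (rule plift_dform[OF open_U x]) (auto simp: pscale_def unit_pform_def of_form_def)
  then show ?thesis using d_\<rho>[OF open_U subset_refl smooth_section_unit x] by (simp add: d_unit pscale_simps)
qed

lemma zero_form_eq: "zero_form \<rho> = (\<lambda>y. pscale (cfun \<rho> y) unit_pform 0 0)"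
  by (auto simp: zero_form_def pscale_def unit_pform_def of_form_def fun_eq_iff)

lemma Omega_eq: "x \<in> U \<Longrightarrow> Omega b n \<rho> A x = Om A x unit_pform 0 0"
  unfolding Omega_def zero_form_eq using plift_zero_form[of x A] by (metis plift_def)

lemma Eform_eq:
  assumes x: "x \<in> U"
  shows "Eform b n \<rho> x = (- E 0 1 x unit_pform) 0 0"
proof -
  let ?z = "plift (dform b n 1) (\<lambda>y. pscale (cfun \<rho> y) unit_pform)"
  have "plift (dform b n 0) ?z x = d 0 ?z x"
    by (rule plift_dform[OF open_U x]) (rule plift_dform_infinite)
  also have "\<dots> = d 0 (\<lambda>y. Om 1 y unit_pform) x" by (rule dd_cong[OF open_U x plift_zero_form])
  also have "\<dots> = E 0 1 x unit_pform"
    unfolding d_Om[OF open_U subset_refl smooth_section_unit x] by (simp add: d_unit Om_simps)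
  finally have "plift (dform b n 0) ?z x 0 0 = E 0 1 x unit_pform 0 0" by simp
  then show ?thesis unfolding Eform_def zero_form_eq by (simp add: plift_def)
qed

lemma wedge_Omega:
  assumes "x \<in> U" "\<alpha> \<in> forms N t"
  shows "wedge (Omega b n \<rho> A x) \<alpha> = Om A x (of_form \<alpha>) 0 0"
proof -
  have "wedge (Omega b n \<rho> A x) \<alpha> = pwedge (Om A x unit_pform 0 0) (of_form \<alpha>) 0 0"
    unfolding Omega_eq[OF assms(1)] by (simp add: pwedge_def of_form_00)
  also have "pwedge (Om A x unit_pform 0 0) (of_form \<alpha>) = Om A x (of_form \<alpha>)"
    unfolding pwedge_Om by (subst pwedge_unit) (auto intro: pforms_infinite[OF of_form_pforms[OF assms(2)]])
  finally show ?thesis .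
qed

lemma wedge_Omega_Omega: "x \<in> U \<Longrightarrow> wedge (Omega b n \<rho> 0 x) (Omega b n \<rho> 1 x) = Om 0 x (Om 1 x unit_pform) 0 0"
proof -
  assume x: "x \<in> U"
  have 1: "Om 1 x unit_pform \<in> pforms (2*n+2) 0 (0 + 1)" by (rule Om_pforms[OF unit_pforms])
  show ?thesis
    unfolding Omega_eq[OF x, of 1] wedge_Omega[OF x pforms_of_form(1)[OF 1]] pforms_of_form(2)[OF 1] ..
qed

text \<open>Existence in the definite description is the anticommutation splitting of \<E>;
  uniqueness holds because \<open>p\<close> fixes forms in \<omega>^0, ..., \<omega>^{2n-1} and
  kills every multiple of \<Omega>.\<close>

lemma Ezero_eq:
  assumes x: "x \<in> U"
  shows "Ezero b n \<rho> x = p x (- E 0 1 x unit_pform) 0 0"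
proof -
  define w where "w = - E 0 1 x unit_pform"
  have Ew: "Eform b n \<rho> x = w 0 0" unfolding w_def by (rule Eform_eq[OF x])
  have wV: "w \<in> pforms (2*n+2) 0 2" using pforms_uminus[OF E_pforms[OF unit_pforms]] by (simp add: w_def)
  have tV: "p x v \<in> pforms (2*n) 0 t" if "v \<in> pforms (2*n+2) 0 t" for v t
    by (rule tangent_pforms[OF p_pforms[OF x that] p_tangent[OF x]])
  have JV: "J A x w \<in> pforms (2*n+2) 0 1" for A using J_pforms[OF wV, of A x] by simp
  have JJV: "J 1 x (J 0 x w) \<in> pforms (2*n+2) 0 0" using J_pforms[OF JV[of 0], of 1 x] by simp
  define c where "c = J 1 x (J 0 x w) 0 0 {}"
  have "Ezero b n \<rho> x = p x w 0 0"
    unfolding Ezero_def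
  proof (rule the_equality)
    have "w = p x w + Om 0 x (p x (J 0 x w)) + Om 1 x (p x (J 1 x w)) + Om 0 x (Om 1 x (J 1 x (J 0 x w)))"
      unfolding p_def by (rule car.decomposition[OF car[OF x]])
    also have "J 1 x (J 0 x w) = pscale c unit_pform" unfolding c_def by (rule pforms_00[OF JJV])
    finally have dec: "w = p x w + Om 0 x (p x (J 0 x w)) + Om 1 x (p x (J 1 x w)) + pscale c (Om 0 x (Om 1 x unit_pform))"
      by (simp only: Om_simps)
    have om: "wedge (Omega b n \<rho> A x) (p x (J A x w) 0 0) = Om A x (p x (J A x w)) 0 0" for A
      unfolding wedge_Omega[OF x pforms_of_form(1)[OF tV[OF JV]]] pforms_of_form(2)[OF tV[OF JV]] ..
    have "Eform b n \<rho> x = p x w 0 0 + (\<Sum>A\<in>UNIV. wedge (Omega b n \<rho> A x) (p x (J A x w) 0 0))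
        + (\<lambda>T. c * wedge (Omega b n \<rho> 0 x) (Omega b n \<rho> 1 x) T)"
      unfolding Ew om wedge_Omega_Omega[OF x] sum_01
      by (subst dec, rule ext) (simp add: pscale_apply)
    moreover have "p x (J A x w) 0 0 \<in> forms (2*n) 1" for A by (rule pforms_of_form(1)[OF tV[OF JV]])
    ultimately show "p x w 0 0 \<in> forms (2*n) 2 \<and> (\<exists>e' :: 2 \<Rightarrow> form. \<exists>c. (\<forall>A'. e' A' \<in> forms (2*n) 1) \<and>
        Eform b n \<rho> x = p x w 0 0 + (\<Sum>A'\<in>UNIV. wedge (Omega b n \<rho> A' x) (e' A'))
          + (\<lambda>T. c * wedge (Omega b n \<rho> 0 x) (Omega b n \<rho> 1 x) T))"
      using pforms_of_form(1)[OF tV[OF wV]]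
      by (intro conjI exI[of _ "\<lambda>A. p x (J A x w) 0 0"] exI[of _ c] allI) auto
  next
    fix e0 :: form
    assume "e0 \<in> forms (2*n) 2 \<and> (\<exists>e' :: 2 \<Rightarrow> form. \<exists>c. (\<forall>A'. e' A' \<in> forms (2*n) 1) \<and>
        Eform b n \<rho> x = e0 + (\<Sum>A'\<in>UNIV. wedge (Omega b n \<rho> A' x) (e' A'))
          + (\<lambda>T. c * wedge (Omega b n \<rho> 0 x) (Omega b n \<rho> 1 x) T))"
    then obtain e' c where e0: "e0 \<in> forms (2*n) 2" and e': "\<And>A. e' A \<in> forms (2*n) 1"
      and eq: "Eform b n \<rho> x = e0 + (\<Sum>A'\<in>UNIV. wedge (Omega b n \<rho> A' x) (e' A'))
          + (\<lambda>T. c * wedge (Omega b n \<rho> 0 x) (Omega b n \<rho> 1 x) T)" by blast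
    let ?v = "of_form e0 + (Om 0 x (of_form (e' 0)) + Om 1 x (of_form (e' 1))) + pscale c (Om 0 x (Om 1 x unit_pform))"
    have tm: "of_form e0 \<in> pforms (2*n+2) 0 2" "of_form (e' A) \<in> pforms (2*n+2) 0 1" for A
      by (rule pforms_mono[OF of_form_pforms[OF e0]], rule pforms_mono[OF of_form_pforms[OF e']])
    have o2: "Om A x (of_form (e' B)) \<in> pforms (2*n+2) 0 2" for A B using Om_pforms[OF tm(2)] by simp
    have "Om 0 x (Om 1 x unit_pform) \<in> pforms (2*n+2) 0 2" using Om_pforms[OF Om_pforms[OF unit_pforms], of 0 x 1 x] by simp
    then have v: "?v \<in> pforms (2*n+2) 0 2" by (intro pforms_add pforms_pscale tm o2)
    have "w 0 0 = ?v 0 0"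
      using eq unfolding Ew wedge_Omega[OF x e'] wedge_Omega_Omega[OF x] sum_01
      by (simp add: of_form_00 pscale_apply fun_eq_iff)
    then have "w = ?v" using pforms_of_form(2)[OF wV] pforms_of_form(2)[OF v] by simp
    then have "p x w = p x (of_form e0)" by (simp add: p_additive[OF x] p_Om[OF x] pscale_simps)
    also have "\<dots> = of_form e0" by (rule p_id[OF x pforms_tangent[OF of_form_pforms[OF e0]]])
    finally show "e0 = p x w 0 0" by (simp add: of_form_00)
  qed
  then show ?thesis by (simp add: w_def)
qed

lemma tangent_pwedge:
  assumes "tangent w" "tangent v"
  shows "tangent (pwedge (w 0 0) v)"
  unfolding tangent_coef
proof (intro allI impI)
  fix B i j T assume B: "2*n + oidx B \<in> T"
  have "w 0 0 P * v i j (T - P) = 0" for P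
    using assms B unfolding tangent_coef by (cases "2*n + oidx B \<in> P") auto
  then show "pwedge (w 0 0) v i j T = 0"
    by (simp only: pwedge_def wedge_def mult.assoc mult_zero_right sum.neutral_const)
qed

text \<open>\<open>E 0 1 x\<close> is multiplication by minus \<E>. Splitting that form, all parts
  containing some \<Omega> are killed by \<open>p\<close>, and its tangential part is minus
  E_0.\<close>

lemma p_E:
  assumes x: "x \<in> U" and t: "tangent v" and v: "v \<in> pforms N s q"
  shows "p x (E 0 1 x v) = - pwedge (Ezero b n \<rho> x) v"
proof -
  define w where "w = E 0 1 x unit_pform"
  have "E 0 1 x v = E 0 1 x (pwedge (unit_pform 0 0) v)" by (subst pwedge_unit) (auto intro: pforms_infinite[OF v])
  then have 1: "E 0 1 x v = pwedge (w 0 0) v" by (simp only: pwedge_E w_def)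
  have dec: "w = p x w + Om 0 x (p x (J 0 x w)) + Om 1 x (p x (J 1 x w)) + Om 0 x (Om 1 x (J 1 x (J 0 x w)))"
    unfolding p_def by (rule car.decomposition[OF car[OF x]])
  have "pwedge (w 0 0) v = pwedge (p x w 0 0) v + Om 0 x (pwedge (p x (J 0 x w) 0 0) v) +
      Om 1 x (pwedge (p x (J 1 x w) 0 0) v) + Om 0 x (Om 1 x (pwedge (J 1 x (J 0 x w) 0 0) v))"
    by (subst dec) (simp only: pwedge_linear pwedge_Om)
  then have "p x (E 0 1 x v) = p x (pwedge (p x w 0 0) v)" unfolding 1 by (simp add: p_additive[OF x] p_Om[OF x])
  also have "\<dots> = pwedge (p x w 0 0) v" by (rule p_id[OF x tangent_pwedge[OF p_tangent[OF x] t]])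
  also have "p x w = - p x (- w)" by (simp add: p_additive[OF x])
  finally show ?thesis unfolding Ezero_eq[OF x] w_def pwedge_additive .
qed

end

section \<open>The boundary operators\<close>

lemma pwedge_add_right: "pwedge \<alpha> (u + v) = pwedge \<alpha> u + pwedge \<alpha> v"
  by (simp add: pwedge_def wedge_def fun_eq_iff sum.distrib[symmetric] algebra_simps)

context cf_domain
begin

text \<open>Contracting d^1 f with a normal vector leaves only the normal derivatives, because f is
  tangential. They combine to R_{1'C'} N_{C'}^{1'} f, which is T^{1'0'} f since f has no derivative
  along e at x.\<close>

lemma p_J_d:
  assumes x: "x \<in> S" and W: "open W" "x \<in> W" "W \<subseteq> U"
    and f: "smooth_section W f" "\<And>y. y \<in> W \<Longrightarrow> f y \<in> pforms (2*n) s t" "pdp b e f x = 0"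
    and F: "\<And>y. y \<in> W \<inter> S \<Longrightarrow> f y = F y"
  shows "p x (J 1 x (d 1 f x)) = boundary_T10 b n \<rho> S F x"
proof -
  have xU: "x \<in> U" using W by blast
  have tp: "tangent (pdp b m f x)" for m by (rule tangent_pdp[OF W(1) f(1) W(2)]) (rule pforms_tangent[OF f(2)])
  have c: "contr (2*n + oidx B) (d 1 f x) = (\<Sum>m\<in>M. pscale (nabla_coef (2*n + oidx B) 1 m) (pdp b m f x))" for B
  proof -
    have lt: "2*n + oidx B < 2*n+2" by (simp add: oidx_def)
    have z: "contr (2*n + oidx B) (pdp b m f x) = 0" for m using tp by (simp add: tangent_def)
    show ?thesis
      unfolding dd_def coeffop_additive[OF coeffop_contr] contr_Kop[OF lt] z coeffop_additive[OF coeffop_Kop] by simp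
  qed
  have "tangent (J 1 x (d 1 f x))"
    unfolding J_def c by (intro tangent_sum tangent_pscale tp)
  then have 1: "p x (J 1 x (d 1 f x)) = J 1 x (d 1 f x)" by (rule p_id[OF xU])
  have T: "Tfield b n \<rho> 1 1 h x = (\<Sum>C\<in>UNIV. Rcoef b n \<rho> 1 C x * Nup b n C 1 h x) - pd b e h x" for h
    by (simp add: Tfield_def)
  define q where "q m = (\<Sum>C\<in>UNIV. Rcoef b n \<rho> 1 C x * nabla_coef (2*n + oidx C) 1 m) - (if m = e then 1 else 0)" for m
  have Tq: "Tfield b n \<rho> 1 1 h x = (\<Sum>m\<in>M. q m * pd b m h x)" for h
  proof -
    have "(\<Sum>C\<in>UNIV. Rcoef b n \<rho> 1 C x * Nup b n C 1 h x) =
        (\<Sum>m\<in>M. (\<Sum>C\<in>UNIV. Rcoef b n \<rho> 1 C x * nabla_coef (2*n + oidx C) 1 m) * pd b m h x)"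
      unfolding Nup_eq sum_distrib_left sum_distrib_right by (subst sum.swap) (simp only: mult.assoc)
    moreover have "(\<Sum>m\<in>M. (if m = e then 1 else 0) * pd b m h x) = pd b e h x"
    proof -
      have "(\<Sum>m\<in>M. (if m = e then 1 else 0) * pd b m h x) = (\<Sum>m\<in>M. if m = e then pd b m h x else 0)"
        by (rule sum.cong) auto
      also have "\<dots> = pd b e h x" by (subst sum.delta) auto
      finally show ?thesis .
    qed
    ultimately show ?thesis unfolding T q_def by (simp only: left_diff_distrib sum_subtractf)
  qed
  have "Tfield b n \<rho> 1 1 (cfun \<rho>) x = 0" unfolding T Rcoef_Nup[OF xU] pd_cfun_\<rho> r_e[OF xU] by simp
  then have q0: "(\<Sum>m\<in>M. q m * r m x) = 0" unfolding Tq pd_cfun_\<rho> .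
  show ?thesis
  proof (intro ext)
    fix i j T'
    have "boundary_T10 b n \<rho> S F x i j T' = Tfield b n \<rho> 1 1 (\<lambda>y. f y i j T') x"
      unfolding boundary_T10_def
      by (rule along_complex_field[where X = "Tfield b n \<rho> 1 1" and g = "\<lambda>y. f y i j T'" and c = q,
            OF x W(1,2) smooth_sectionD[OF f(1)] _ Tq q0])
        (simp only: F)
    moreover have "pd b e (\<lambda>y. f y i j T') x = 0" using fun_cong[OF fun_cong[OF fun_cong[OF f(3)]], of i j T'] by (simp add: pdp_def)
    moreover have "J 1 x (d 1 f x) i j T' = (\<Sum>C\<in>UNIV. Rcoef b n \<rho> 1 C x * Nup b n C 1 (\<lambda>y. f y i j T') x)"
      unfolding J_def c Nup_eq by (simp add: sum_apply pscale_apply pdp_def)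
    ultimately show "p x (J 1 x (d 1 f x)) i j T' = boundary_T10 b n \<rho> S F x i j T'" unfolding 1 T by simp
  qed
qed

text \<open>Splitting d^1 f before applying d^0, a part \<Omega>^B v contributes only through d^0
  \<Omega>^B, because the remaining term is again a multiple of \<Omega>. As d^0 \<Omega>^0 = 0,
  just the \<Omega>^1 part survives, and it is the T^{1'0'} term.\<close>

lemma p_d_d:
  assumes x: "x \<in> S" and W: "open W" "x \<in> W" "W \<subseteq> U"
    and f: "smooth_section W f" "\<And>y. y \<in> W \<Longrightarrow> f y \<in> pforms (2*n) s t" "pdp b e f x = 0"
    and F: "\<And>y. y \<in> W \<inter> S \<Longrightarrow> f y = F y"
  shows "p x (d 0 (d 1 f) x) =
    plift (bdform b n \<rho> S 0) (plift (bdform b n \<rho> S 1) F) x - pwedge (Ezero b n \<rho> x) (boundary_T10 b n \<rho> S F x)"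
proof -
  have xU: "x \<in> U" using W by blast
  define w where "w y = p y (d 1 f y)" for y
  define t0 where "t0 y = p y (J 0 y (d 1 f y))" for y
  define t1 where "t1 y = p y (J 1 y (d 1 f y))" for y
  define t2 where "t2 y = Om 1 y (J 1 y (J 0 y (d 1 f y)))" for y
  have sd: "smooth_section W (d 1 f)" by (rule smooth_section_dd[OF W(1) f(1)])
  have sw: "smooth_section W w" unfolding w_def by (rule smooth_section_p[OF W(1,3) sd])
  have s0: "smooth_section W t0" unfolding t0_def by (intro smooth_section_p smooth_section_J W sd)
  have s1: "smooth_section W t1" unfolding t1_def by (intro smooth_section_p smooth_section_J W sd)
  have s2: "smooth_section W t2" unfolding t2_def by (intro smooth_section_Om smooth_section_J W sd)
  note so = smooth_section_Om[OF W(1,3)]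
  have dV: "d 1 f y \<in> pforms (2*n+2) s (t + 1)" if "y \<in> W" for y
    by (rule dd_pforms[OF W(1) that]) (rule pforms_mono[OF f(2)])
  have wV: "w y \<in> pforms (2*n) s (t + 1)" if "y \<in> W" for y
    unfolding w_def using that W(3) by (intro tangent_pforms p_pforms p_tangent dV) auto
  have "plift (bdform b n \<rho> S 1) F y = w y" if "y \<in> W \<inter> S" for y
    unfolding w_def by (rule plift_bdform[OF _ W(1) _ W(3) f(1,2) F]) (use that in auto)
  then have bd: "plift (bdform b n \<rho> S 0) (plift (bdform b n \<rho> S 1) F) x = p x (d 0 w x)"
    by (intro plift_bdform[OF x W sw wV]) auto
  have "d 1 f y = w y + Om 0 y (t0 y) + Om 1 y (t1 y) + Om 0 y (t2 y)" if "y \<in> W" for y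
    unfolding w_def t0_def t1_def t2_def p_def
    by (rule car.decomposition[OF car]) (use that W(3) in blast)
  then have "d 0 (d 1 f) x = d 0 (\<lambda>y. w y + Om 0 y (t0 y) + Om 1 y (t1 y) + Om 0 y (t2 y)) x"
    by (rule dd_cong[OF W(1,2)])
  also have "\<dots> = d 0 w x + d 0 (\<lambda>y. Om 0 y (t0 y)) x + d 0 (\<lambda>y. Om 1 y (t1 y)) x + d 0 (\<lambda>y. Om 0 y (t2 y)) x"
    by (simp only: dd_add[OF _ _ W(2)] smooth_section_add[OF W(1)] sw so[OF s0] so[OF s1] so[OF s2])
  finally have 1: "p x (d 0 (d 1 f) x) = p x (d 0 w x) + p x (E 0 1 x (t1 x))"
    unfolding d_Om[OF W(1,3) s0 W(2)] d_Om[OF W(1,3) s1 W(2)] d_Om[OF W(1,3) s2 W(2)] E_same[OF xU]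
    by (simp add: p_additive[OF xU] p_Om[OF xU])
  have 2: "p x (E 0 1 x (t1 x)) = - pwedge (Ezero b n \<rho> x) (t1 x)"
    unfolding t1_def by (rule p_E[OF xU p_tangent[OF xU] p_pforms[OF xU J_pforms[OF dV[OF W(2)]]]])
  have 3: "t1 x = boundary_T10 b n \<rho> S F x"
    unfolding t1_def by (rule p_J_d[OF x W f F])
  show ?thesis unfolding 1 2 unfolding 3 bd by (simp only: add_uminus_conv_diff)
qed

end

context cf_complex
begin

lemma Sop_E: "Sop k j A (E B C x v) = E B C x (Sop k j A v)"
  unfolding E_def coeffop_additive[OF coeffop_Sop] coeffop_linear[OF coeffop_Sop] Sop_Kop ..

lemma Sop_p: "x \<in> U \<Longrightarrow> Sop k j A (p x v) = p x (Sop k j A v)"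
  by (simp only: p_eq Sop_J Sop_Om)

lemma Ext_eq: "x \<in> U1 \<Longrightarrow> Ext j F x = zext j F x"
  unfolding Ext_def by (rule cut_eq)

lemma CFop_Ext:
  assumes "F \<in> bspace_sections n k S j" "x \<in> U1"
  shows "CFop b n k U j (Ext j F) x = \<D> j (zext j F) x"
proof -
  have "x \<in> U" using assms(2) U1_subset by blast
  then have "CFop b n k U j (Ext j F) x = \<D> j (Ext j F) x" by (rule CFop_eq[OF open_U Ext_in[OF assms(1)]])
  also have "\<dots> = \<D> j (zext j F) x" by (rule DD_cong[OF open_U1 assms(2) Ext_eq])
  finally show ?thesis .
qed

lemma fst_bD:
  assumes "F \<in> bspace_sections n k S j" "x \<in> S"
  shows "fst (bD j F) x = p x (\<D> j (zext j F) x)"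
proof -
  have x1: "x \<in> U1" using assms(2) S_U1 by blast
  show ?thesis using assms(2) by (simp add: bD_def tr_def tr1_def CFop_Ext[OF assms(1) x1])
qed

text \<open>The tangential part of d^A applied to the extension sees the stored second datum only
  through d^A \<Omega>^B. For j \<noteq> k antisymmetry in A and B leaves E 0 1 applied to the
  combination evaluated in \<open>Sop_Rop\<close>; for j = k, d^1 of \<rho> F_2 brings \<Omega>^1
  F_2, and d^0 then gives E 0 1.\<close>

lemma bD_formula:
  assumes F: "(F1, F2) \<in> bspace_sections n k S j" and x: "x \<in> S"
  shows "fst (bD j (F1, F2)) x =
    (if j = k then plift (bdform b n \<rho> S 0) (plift (bdform b n \<rho> S 1) F1) x - pwedge (Ezero b n \<rho> x) (boundary_T10 b n \<rho> S F1 x + F2 x)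
     else (\<Sum>A\<in>UNIV. Sop k j A (plift (bdform b n \<rho> S A) F1 x)) + pwedge (Ezero b n \<rho> x) (F2 x))"
proof -
  have xU: "x \<in> U" and x0: "x \<in> U0" using x S_subset_U S_subset_U0 by auto
  have px: "proj x = x" by (rule proj_S[OF x])
  define f where "f y = F1 (proj y)" for y
  define g where "g y = F2 (proj y)" for y
  have sf: "smooth_section U0 f" and sg: "smooth_section U0 g"
    using bspaceD(1,2)[OF F] by (simp_all only: f_def[abs_def] g_def[abs_def] fst_conv snd_conv)
  have fV: "f y \<in> pforms (2*n) (sig k j) (int (tau k j))" if "y \<in> U0" for y
    using bspaceD(3)[OF F proj_in_S[OF that]] by (simp only: f_def fst_conv)
  have F1: "f y = F1 y" if "y \<in> U0 \<inter> S" for y using that by (simp add: f_def proj_S)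
  have gx: "g x = F2 x" by (simp add: g_def px)
  note W = open_U0 x0 U0_subset_U
  note so = smooth_section_Om[OF open_U0 U0_subset_U]
  show ?thesis
  proof (cases "j = k")
    case True
    have r0: "smooth_on U0 (cfun \<rho>)" by (rule smooth_on_subset[OF U0_subset_U smooth_cfun_\<rho>])
    have rx: "cfun \<rho> x = 0" using x by (simp add: S_def)
    have gV: "F2 x \<in> pforms (2*n) 0 (int k)" using bspaceD(5)[OF F x True] by simp
    have sdg: "smooth_section U0 (d 1 g)" by (rule smooth_section_dd[OF open_U0 sg])
    have srg: "smooth_section U0 (\<lambda>y. pscale (cfun \<rho> y) (g y))" by (rule smooth_section_pscale[OF open_U0 r0 sg])
    have e0: "pdp b e f x = 0" using pdp_e_proj[OF bspaceD(1)[OF F] x0] by (simp only: f_def[abs_def] fst_conv)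
    have z: "zext j (F1, F2) = (\<lambda>y. f y + pscale (cfun \<rho> y) (g y))"
      using True by (simp add: zext_def[abs_def] f_def g_def)
    have "d 1 (zext j (F1, F2)) y = d 1 f y + (Om 1 y (g y) + pscale (cfun \<rho> y) (d 1 g y))" if "y \<in> U0" for y
      unfolding z dd_add[OF sf srg that] d_\<rho>[OF open_U0 U0_subset_U sg that] ..
    then have "d 0 (d 1 (zext j (F1, F2))) x = d 0 (\<lambda>y. d 1 f y + (Om 1 y (g y) + pscale (cfun \<rho> y) (d 1 g y))) x"
      by (rule dd_cong[OF open_U0 x0])
    also have "\<dots> = d 0 (d 1 f) x + (d 0 (\<lambda>y. Om 1 y (g y)) x + d 0 (\<lambda>y. pscale (cfun \<rho> y) (d 1 g y)) x)"
      by (simp only: dd_add[OF _ _ x0] smooth_section_add[OF open_U0] smooth_section_dd[OF open_U0 sf] so[OF sg]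
          smooth_section_pscale[OF open_U0 r0 sdg])
    finally have "p x (d 0 (d 1 (zext j (F1, F2))) x) = p x (d 0 (d 1 f) x) + p x (E 0 1 x (F2 x))"
      unfolding d_Om[OF open_U0 U0_subset_U sg x0] d_\<rho>[OF open_U0 U0_subset_U sdg x0] rx gx
      by (simp add: p_additive[OF xU] p_Om[OF xU] pscale_simps)
    moreover have "p x (d 0 (d 1 f) x) = plift (bdform b n \<rho> S 0) (plift (bdform b n \<rho> S 1) F1) x
        - pwedge (Ezero b n \<rho> x) (boundary_T10 b n \<rho> S F1 x)"
      by (rule p_d_d[OF x W sf fV e0 F1])
    moreover have "p x (E 0 1 x (F2 x)) = - pwedge (Ezero b n \<rho> x) (F2 x)"
      by (rule p_E[OF xU pforms_tangent[OF gV] gV])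
    moreover have "fst (bD j (F1, F2)) x = p x (d 0 (d 1 (zext j (F1, F2))) x)"
      unfolding fst_bD[OF F x] DD_def using True by simp
    ultimately show ?thesis using True by (simp add: pwedge_add_right diff_diff_eq)
  next
    case False
    define a where "a B y = Rop k j B (g y)" for B y
    have gV: "F2 x \<in> pforms (2*n) (sig k (j + 1)) (int (tau k j) - 1)" using bspaceD(4)[OF F x False] by simp
    have sa: "smooth_section U0 (a B)" for B
      unfolding a_def by (rule smooth_section_coeffop[OF open_U0 coeffop_Rop sg])
    have z: "zext j (F1, F2) = (\<lambda>y. f y + (Om 0 y (a 0 y) + Om 1 y (a 1 y)))"
      using False by (simp add: zext_def[abs_def] f_def g_def a_def)
    have dz: "p x (d A (zext j (F1, F2)) x) = p x (d A f x) + (p x (E A 0 x (a 0 x)) + p x (E A 1 x (a 1 x)))" for A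
    proof -
      have "d A (zext j (F1, F2)) x = d A f x + (d A (\<lambda>y. Om 0 y (a 0 y)) x + d A (\<lambda>y. Om 1 y (a 1 y)) x)"
        unfolding z by (simp only: dd_add[OF _ _ x0] smooth_section_add[OF open_U0] sf so[OF sa])
      then show ?thesis
        unfolding d_Om[OF open_U0 U0_subset_U sa x0] by (simp add: p_additive[OF xU] p_Om[OF xU])
    qed
    have bd: "plift (bdform b n \<rho> S A) F1 x = p x (d A f x)" for A by (rule plift_bdform[OF x W sf fV F1])
    have 1: "fst (bD j (F1, F2)) x = (\<Sum>A\<in>UNIV. Sop k j A (p x (d A (zext j (F1, F2)) x)))"
      using False by (simp add: fst_bD[OF F x] DD_def coeffop_additive(4)[OF coeffop_p[OF xU]] Sop_p[OF xU])
    have 2: "(\<Sum>A\<in>UNIV. Sop k j A (p x (d A (zext j (F1, F2)) x))) = (\<Sum>A\<in>UNIV. Sop k j A (plift (bdform b n \<rho> S A) F1 x)) +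
        p x (E 0 1 x (Sop k j 0 (a 1 x) - Sop k j 1 (a 0 x)))"
      unfolding dz bd sum_01 E_anti[OF xU, of 1 0] E_same[OF xU]
      by (simp add: coeffop_linear[OF coeffop_Sop] coeffop_additive[OF coeffop_Sop] coeffop_additive[OF coeffop_E]
          p_additive[OF xU] Sop_p[OF xU] Sop_E)
    have 3: "Sop k j 0 (a 1 x) - Sop k j 1 (a 0 x) = - F2 x"
      unfolding a_def gx by (rule Sop_Rop[OF False gV])
    have 4: "p x (E 0 1 x (- F2 x)) = pwedge (Ezero b n \<rho> x) (F2 x)"
      by (simp add: coeffop_additive[OF coeffop_E] p_additive[OF xU] p_E[OF xU pforms_tangent[OF gV] gV])
    show ?thesis unfolding 1 2 3 4 using False by simp
  qed
qed

end

context cf_domain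
begin

section \<open>Differential operators along the boundary\<close>

lemma smooth_along_iff: "smooth_along S f \<longleftrightarrow> smooth_on U0 (\<lambda>x. f (proj x))"
proof
  show "smooth_along S f" if "smooth_on U0 (\<lambda>x. f (proj x))"
    by (rule smooth_alongI[OF open_U0 S_subset_U0 that]) (simp add: proj_S)
qed (rule smooth_along_proj)

lemma scalar_diffops_smooth:
  assumes "P \<in> scalar_diffops \<rho> S"
  shows "smooth_along S f \<Longrightarrow> smooth_along S (P f)"
  using assms
proof (induction arbitrary: f rule: scalar_diffops.induct)
  case (mult c)
  then show ?case unfolding smooth_along_iff by (intro smooth_on_mult open_U0)
next
  case (field X)
  define g where "g x = f (proj x)" for x
  have g: "smooth_on U0 g" using field(3) unfolding smooth_along_iff g_def .
  have X: "smooth_on U0 (\<lambda>x. X (proj x))" using field(1) unfolding smooth_along_iff .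
  have 1: "along S (\<lambda>f x. frechet_derivative f (at x) (X x)) f (proj x) =
      (\<Sum>i\<in>Basis. (X (proj x) \<bullet> i) *\<^sub>R frechet_derivative g (at (proj x)) i)" if x: "x \<in> U0" for x
  proof -
    have y: "proj x \<in> S" "proj x \<in> U0" using proj_in_S[OF x] S_subset_U0 by auto
    have "along S (\<lambda>f x. frechet_derivative f (at x) (X x)) f (proj x) = frechet_derivative g (at (proj x)) (X (proj x))"
      by (rule along_field[where Y = X, OF y(1) open_U0 y(2) g _ field(2)[OF y(1)]]) (simp add: g_def proj_S)
    then show ?thesis unfolding has_derivative_Basis_sum[OF smooth_on_differentiable[OF g y(2)], of "X (proj x)"] .
  qed
  have "smooth_on U0 (\<lambda>x. frechet_derivative g (at (proj x)) i)" for i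
    by (rule smooth_on_compose[OF open_U0 open_U0 _ smooth_on_frechet_derivative[OF g] smooth_on_subset[OF U0_subset_U smooth_proj]])
      (use proj_in_S S_subset_U0 in blast)
  then have "smooth_on U0 (\<lambda>x. \<Sum>i\<in>Basis. (X (proj x) \<bullet> i) *\<^sub>R frechet_derivative g (at (proj x)) i)"
    by (intro smooth_on_sum smooth_on_scaleR open_U0 smooth_on_bounded_linear[OF bounded_linear_inner_left] X)
  then show ?case unfolding smooth_along_iff
    by (rule smooth_on_cong[OF open_U0, rotated]) (rule 1[symmetric])
next
  case (add P Q)
  have "smooth_along S (P f)" "smooth_along S (Q f)" using add by auto
  then show ?case unfolding smooth_along_iff by (intro smooth_on_add open_U0)
next
  case (comp P Q)
  then show ?case by simp
qed

definition tfield :: "nat \<Rightarrow> 'a \<Rightarrow> 'a" where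
  "tfield m x = b m - frechet_derivative \<rho> (at x) (b m) *\<^sub>R b e"

lemma tfield_diffop: "along S (\<lambda>f x. frechet_derivative f (at x) (tfield m x)) \<in> scalar_diffops \<rho> S"
  and tfield_tangential: "x \<in> S \<Longrightarrow> frechet_derivative \<rho> (at x) (tfield m x) = 0"
proof -
  have "smooth_on U (tfield m)"
    unfolding tfield_def[abs_def]
    by (intro smooth_on_diff smooth_on_const smooth_on_scaleR smooth_on_frechet_derivative smooth_\<rho> open_U)
  then have "smooth_along S (tfield m)" by (rule smooth_alongI[OF open_U S_subset_U]) simp
  moreover show t: "frechet_derivative \<rho> (at x) (tfield m x) = 0" if "x \<in> S" for x
  proof -
    have x: "x \<in> U" using that S_subset_U by blast
    show ?thesis
      using linear_frechet_derivative[OF smooth_on_differentiable[OF smooth_\<rho> x]] \<rho>_e[OF x]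
      by (simp add: tfield_def linear_diff linear_scale)
  qed
  ultimately show "along S (\<lambda>f x. frechet_derivative f (at x) (tfield m x)) \<in> scalar_diffops \<rho> S"
    by (intro scalar_diffops.field)
qed

text \<open>\<open>f \<circ> proj\<close> is constant along e, so only the tangential part of b m
  acts; since d\<rho> is constant along e, this part is the same at x and at
  \<open>proj x\<close>.\<close>

lemma pd_proj:
  assumes f: "smooth_along S f" and x: "x \<in> U0"
  shows "pd b m (\<lambda>y. f (proj y)) x = along S (\<lambda>f x. frechet_derivative f (at x) (tfield m x)) f (proj x)"
proof -
  define g where "g y = f (proj y)" for y
  have g: "smooth_on U0 g" using smooth_along_proj[OF f] unfolding g_def .
  have xU: "x \<in> U" using x U0_subset_U by blast
  have y: "proj x \<in> S" "proj x \<in> U0" using proj_in_S[OF x] S_subset_U0 by auto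
  have "along S (\<lambda>f x. frechet_derivative f (at x) (tfield m x)) f (proj x) = frechet_derivative g (at (proj x)) (tfield m (proj x))"
    by (rule along_field[where Y = "tfield m", OF y(1) open_U0 y(2) g _ tfield_tangential[OF y(1)]]) (simp add: g_def proj_S)
  also have "tfield m (proj x) = b m - frechet_derivative \<rho> (at x) (b m) *\<^sub>R b e"
  proof -
    have px: "proj x = x + (- \<rho> x) *\<^sub>R b e" by (simp add: proj_def)
    have pU: "x + (- \<rho> x) *\<^sub>R b e \<in> U" using y(2) U0_subset_U px by auto
    show ?thesis unfolding tfield_def px \<rho>'_shift[OF xU pU] ..
  qed
  also have "frechet_derivative g (at (proj x)) \<dots> = frechet_derivative (\<lambda>y. g (proj y)) (at x) (b m)"
    by (rule derivative_proj[OF xU smooth_on_differentiable[OF g y(2)], symmetric])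
  also have "frechet_derivative (\<lambda>y. g (proj y)) (at x) = frechet_derivative (\<lambda>y. f (proj y)) (at x)"
    by (rule frechet_derivative_cong_open[OF open_U0 x]) (simp add: g_def proj_S[OF proj_in_S])
  finally show ?thesis unfolding pd_def ..
qed

end

context cf_complex
begin

definition index1 :: "nat \<Rightarrow> (nat \<times> nat \<times> nat set) set" where
  "index1 j = pform_index (2*n) (sig k j) (int (tau k j))"

definition index2 :: "nat \<Rightarrow> (nat \<times> nat \<times> nat set) set" where
  "index2 j = (if j = k then pform_index (2*n) 0 (int k) else pform_index (2*n) (sig k (j + 1)) (int (tau k j) - 1))"

fun coef :: "(nat \<times> nat \<times> nat set) + (nat \<times> nat \<times> nat set) \<Rightarrow> 'a psection \<times> 'a psection \<Rightarrow> 'a \<Rightarrow> complex" where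
  "coef (Inl (i, l, T)) F = (\<lambda>y. fst F y i l T)"
| "coef (Inr (i, l, T)) F = (\<lambda>y. snd F y i l T)"

lemma smooth_along_coef: "F \<in> bspace_sections n k S j \<Longrightarrow> smooth_along S (coef q F)"
  by (cases "(q, F)" rule: coef.cases) (auto simp: bspace_sections_def bsections_def)

text \<open>Boundary data enter only through their extensions \<open>F \<circ> proj\<close>, on which \<open>\<partial>\<^sub>m\<close> acts as the tangential
  field \<open>tfield m\<close>; hence the class is closed under \<open>\<partial>\<^sub>m\<close>.\<close>

inductive ldo :: "nat \<Rightarrow> ('a psection \<times> 'a psection \<Rightarrow> 'a \<Rightarrow> complex) \<Rightarrow> bool" for j where
  base: "smooth_on U0 c \<Longrightarrow> P \<in> scalar_diffops \<rho> S \<Longrightarrow> q \<in> Inl ` index1 j \<union> Inr ` index2 j \<Longrightarrow>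
    ldo j (\<lambda>F x. c x * P (coef q F) (proj x))"
| zero: "ldo j (\<lambda>F x. 0)"
| add: "ldo j L \<Longrightarrow> ldo j L' \<Longrightarrow> ldo j (\<lambda>F x. L F x + L' F x)"
| agree: "ldo j L \<Longrightarrow> (\<And>F x. F \<in> bspace_sections n k S j \<Longrightarrow> x \<in> U0 \<Longrightarrow> L' F x = L F x) \<Longrightarrow> ldo j L'"

lemma smooth_coef_base:
  assumes "P \<in> scalar_diffops \<rho> S" "F \<in> bspace_sections n k S j"
  shows "smooth_on U0 (\<lambda>x. P (coef q F) (proj x))"
  by (rule smooth_along_proj[OF scalar_diffops_smooth[OF assms(1) smooth_along_coef[OF assms(2)]]])

lemma ldo_smooth:
  assumes "ldo j L" "F \<in> bspace_sections n k S j"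
  shows "smooth_on U0 (L F)"
  using assms(1)
proof induction
  case (base c P q)
  show ?case by (rule smooth_on_mult[OF open_U0 base(1) smooth_coef_base[OF base(2) assms(2)]])
next
  case zero
  show ?case by (rule smooth_on_const)
next
  case (add L L')
  show ?case by (rule smooth_on_add[OF open_U0 add.IH])
next
  case (agree L L')
  show ?case by (rule smooth_on_cong[OF open_U0 _ agree.IH]) (rule agree.hyps(2)[OF assms(2), symmetric])
qed

lemma ldo_mult:
  assumes "ldo j L" "smooth_on U0 a"
  shows "ldo j (\<lambda>F x. a x * L F x)"
  using assms(1)
proof induction
  case (base c P q)
  have "ldo j (\<lambda>F x. (a x * c x) * P (coef q F) (proj x))"
    by (rule ldo.base[OF smooth_on_mult[OF open_U0 assms(2) base(1)] base(2,3)])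
  then show ?case by (simp only: mult.assoc)
next
  case zero
  show ?case by (simp add: ldo.zero)
next
  case (add L L')
  then show ?case by (simp add: distrib_left ldo.add)
next
  case (agree L L')
  show ?case by (rule ldo.agree[OF agree.IH]) (simp add: agree.hyps(2))
qed

lemma ldo_pd:
  assumes "ldo j L"
  shows "ldo j (\<lambda>F. pd b m (L F))"
  using assms
proof induction
  case (base c P q)
  let ?X = "along S (\<lambda>f x. frechet_derivative f (at x) (tfield m x))"
  \<comment> \<open>By the Leibniz rule: a derivative falling on the boundary factor becomes
    composition with a tangential field, which stays among the scalar operators.\<close>
  have "ldo j (\<lambda>F x. pd b m c x * P (coef q F) (proj x) + c x * (?X \<circ> P) (coef q F) (proj x))"
    by (intro ldo.add ldo.base smooth_on_pd base scalar_diffops.comp tfield_diffop)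
  then show ?case
  proof (rule ldo.agree)
    fix F x assume F: "F \<in> bspace_sections n k S j" and x: "x \<in> U0"
    have "pd b m (\<lambda>x. c x * P (coef q F) (proj x)) x =
        pd b m c x * P (coef q F) (proj x) + c x * pd b m (\<lambda>x. P (coef q F) (proj x)) x"
      unfolding pd_def
      by (rule frechet_derivative_mult)
        (rule smooth_on_differentiable[OF base(1) x] smooth_on_differentiable[OF smooth_coef_base[OF base(2) F] x])+
    then show "pd b m (\<lambda>x. c x * P (coef q F) (proj x)) x =
        pd b m c x * P (coef q F) (proj x) + c x * (?X \<circ> P) (coef q F) (proj x)"
      using pd_proj[OF scalar_diffops_smooth[OF base(2) smooth_along_coef[OF F]] x] by simp
  qed
next
  case zero
  show ?case by (rule ldo.agree[OF ldo.zero]) (simp add: pd_def)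
next
  case (add L L')
  show ?case
  proof (rule ldo.agree[OF ldo.add[OF add.IH]])
    fix F x assume F: "F \<in> bspace_sections n k S j" and x: "x \<in> U0"
    show "pd b m (\<lambda>x. L F x + L' F x) x = pd b m (L F) x + pd b m (L' F) x"
      unfolding pd_def
      by (rule frechet_derivative_add)
        (rule smooth_on_differentiable[OF ldo_smooth[OF add.hyps(1) F] x] smooth_on_differentiable[OF ldo_smooth[OF add.hyps(2) F] x])+
  qed
next
  case (agree L L')
  show ?case
  proof (rule ldo.agree[OF agree.IH])
    fix F x assume F: "F \<in> bspace_sections n k S j" and x: "x \<in> U0"
    show "pd b m (L' F) x = pd b m (L F) x"
      unfolding pd_def
      by (rule arg_cong[where f = "\<lambda>D. D (b m)"], rule frechet_derivative_cong_open[OF open_U0 x]) (rule agree.hyps(2)[OF F])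
  qed
qed

lemma finite_index: "finite (index1 j)" "finite (index2 j)"
  by (simp_all add: index1_def index2_def finite_pform_index)

text \<open>On S the projection is the identity, so the coefficient c becomes a multiplication by a
  function smooth along S; entries without a contribution receive the zero operator.\<close>

lemma ldo_on_S:
  assumes "ldo j L"
  shows "\<exists>M1 M2. range M1 \<subseteq> scalar_diffops \<rho> S \<and> range M2 \<subseteq> scalar_diffops \<rho> S \<and>
    (\<forall>F\<in>bspace_sections n k S j. \<forall>x\<in>S. L F x =
      (\<Sum>q\<in>index1 j. M1 q (coef (Inl q) F) x) + (\<Sum>q\<in>index2 j. M2 q (coef (Inr q) F) x))"
  using assms
proof induction
  case (base c P q)
  have c: "smooth_along S c" by (rule smooth_alongI[OF open_U0 S_subset_U0 base(1)]) simp
  define C where "C = (\<lambda>f x. c x * f x) \<circ> P"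
  define Z where "Z = (\<lambda>(f :: 'a \<Rightarrow> complex) (x :: 'a). 0 * f x)"
  have C: "C \<in> scalar_diffops \<rho> S" unfolding C_def by (intro scalar_diffops.comp scalar_diffops.mult c base)
  have Z: "Z \<in> scalar_diffops \<rho> S"
    unfolding Z_def by (rule scalar_diffops.mult) (rule smooth_alongI[OF open_U S_subset_U smooth_on_const], rule refl)
  from base(3) show ?case
  proof
    assume "q \<in> Inl ` index1 j"
    then obtain i where i: "q = Inl i" "i \<in> index1 j" by blast
    have "(\<Sum>q'\<in>index1 j. (if q' = i then C else Z) (coef (Inl q') F) x) = C (coef q F) x" for F x
    proof -
      have "(\<Sum>q'\<in>index1 j. (if q' = i then C else Z) (coef (Inl q') F) x) = (\<Sum>q'\<in>index1 j. if q' = i then C (coef q F) x else 0)"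
        by (rule sum.cong) (auto simp: Z_def i)
      then show ?thesis using i(2) finite_index(1)[of j] by simp
    qed
    then show ?case using C Z
      by (intro exI[of _ "\<lambda>q'. if q' = i then C else Z"] exI[of _ "\<lambda>q'. Z"] conjI ballI)
        (auto simp: Z_def C_def proj_S)
  next
    assume "q \<in> Inr ` index2 j"
    then obtain i where i: "q = Inr i" "i \<in> index2 j" by blast
    have "(\<Sum>q'\<in>index2 j. (if q' = i then C else Z) (coef (Inr q') F) x) = C (coef q F) x" for F x
    proof -
      have "(\<Sum>q'\<in>index2 j. (if q' = i then C else Z) (coef (Inr q') F) x) = (\<Sum>q'\<in>index2 j. if q' = i then C (coef q F) x else 0)"
        by (rule sum.cong) (auto simp: Z_def i)
      then show ?thesis using i(2) finite_index(2)[of j] by simp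
    qed
    then show ?case using C Z
      by (intro exI[of _ "\<lambda>q'. Z"] exI[of _ "\<lambda>q'. if q' = i then C else Z"] conjI ballI)
        (auto simp: Z_def C_def proj_S)
  qed
next
  case zero
  have Z: "(\<lambda>f x. 0 * f x) \<in> scalar_diffops \<rho> S"
    by (rule scalar_diffops.mult) (rule smooth_alongI[OF open_U S_subset_U smooth_on_const], rule refl)
  then show ?case
    by (intro exI[of _ "\<lambda>q f x. 0 * f x"] conjI ballI) auto
next
  case (add L L')
  from add.IH(1) obtain M1 M2 where M: "range M1 \<subseteq> scalar_diffops \<rho> S" "range M2 \<subseteq> scalar_diffops \<rho> S"
    and L: "\<forall>F\<in>bspace_sections n k S j. \<forall>x\<in>S. L F x =
      (\<Sum>q\<in>index1 j. M1 q (coef (Inl q) F) x) + (\<Sum>q\<in>index2 j. M2 q (coef (Inr q) F) x)"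
    by (elim exE conjE) (rule that)
  from add.IH(2) obtain M1' M2' where M': "range M1' \<subseteq> scalar_diffops \<rho> S" "range M2' \<subseteq> scalar_diffops \<rho> S"
    and L': "\<forall>F\<in>bspace_sections n k S j. \<forall>x\<in>S. L' F x =
      (\<Sum>q\<in>index1 j. M1' q (coef (Inl q) F) x) + (\<Sum>q\<in>index2 j. M2' q (coef (Inr q) F) x)"
    by (elim exE conjE) (rule that)
  have "range (\<lambda>q f x. M1 q f x + M1' q f x) \<subseteq> scalar_diffops \<rho> S" "range (\<lambda>q f x. M2 q f x + M2' q f x) \<subseteq> scalar_diffops \<rho> S"
    using M M' by (auto intro!: scalar_diffops.add)
  then show ?case
    by (intro exI[of _ "\<lambda>q f x. M1 q f x + M1' q f x"] exI[of _ "\<lambda>q f x. M2 q f x + M2' q f x"] conjI ballI)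
      (simp_all add: L L' sum.distrib)
next
  case (agree L L')
  have "\<forall>F\<in>bspace_sections n k S j. \<forall>x\<in>S. L' F x = L F x" using agree.hyps(2) S_subset_U0 by blast
  then show ?case using agree.IH by simp
qed

lemma diffop_component_ldo:
  assumes L: "ldo j L" and eq: "\<And>F x. F \<in> bspace_sections n k S j \<Longrightarrow> x \<in> S \<Longrightarrow> L' F x = L F x"
  shows "diffop_component \<rho> S (index1 j) (index2 j) (bspace_sections n k S j) L'"
proof -
  obtain M1 M2 where M: "range M1 \<subseteq> scalar_diffops \<rho> S" "range M2 \<subseteq> scalar_diffops \<rho> S"
    and LM: "\<forall>F\<in>bspace_sections n k S j. \<forall>x\<in>S. L F x =
      (\<Sum>q\<in>index1 j. M1 q (coef (Inl q) F) x) + (\<Sum>q\<in>index2 j. M2 q (coef (Inr q) F) x)"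
    using ldo_on_S[OF L] by (elim exE conjE) (rule that)
  have s1: "(\<Sum>q\<in>I. M1 q (coef (Inl q) (F1, F2)) x) = (\<Sum>(i, l, T)\<in>I. M1 (i, l, T) (\<lambda>y. F1 y i l T) x)" for I F1 F2 x
    by (rule sum.cong[OF refl]) auto
  have s2: "(\<Sum>q\<in>I. M2 q (coef (Inr q) (F1, F2)) x) = (\<Sum>(i, l, T)\<in>I. M2 (i, l, T) (\<lambda>y. F2 y i l T) x)" for I F1 F2 x
    by (rule sum.cong[OF refl]) auto
  show ?thesis
    unfolding diffop_component_def
    by (intro exI[of _ M1] exI[of _ M2] conjI M allI impI ballI) (simp only: eq LM[rule_format] s1 s2)
qed

definition lds :: "nat \<Rightarrow> ('a psection \<times> 'a psection \<Rightarrow> 'a psection) \<Rightarrow> bool" where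
  "lds j u \<longleftrightarrow> (\<forall>i l T. ldo j (\<lambda>F x. u F x i l T))"

lemma lds_cong:
  assumes "lds j u" "\<And>F x. F \<in> bspace_sections n k S j \<Longrightarrow> x \<in> U0 \<Longrightarrow> v F x = u F x"
  shows "lds j v"
  unfolding lds_def
proof (intro allI)
  fix i l T
  have "ldo j (\<lambda>F x. u F x i l T)" using assms(1) by (simp add: lds_def)
  then show "ldo j (\<lambda>F x. v F x i l T)" by (rule ldo.agree) (simp add: assms(2))
qed

lemma lds_zero: "lds j (\<lambda>F x. 0)"
  unfolding lds_def using ldo.zero by simp

lemma lds_add: "lds j u \<Longrightarrow> lds j v \<Longrightarrow> lds j (\<lambda>F x. u F x + v F x)"
  unfolding lds_def using ldo.add by simp

lemma lds_sum: "(\<And>i. i \<in> I \<Longrightarrow> lds j (u i)) \<Longrightarrow> lds j (\<lambda>F x. \<Sum>i\<in>I. u i F x)"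
  by (induction I rule: infinite_finite_induct) (simp_all add: lds_zero lds_add)

lemma lds_pscale: "smooth_on U0 c \<Longrightarrow> lds j u \<Longrightarrow> lds j (\<lambda>F x. pscale (c x) (u F x))"
  unfolding lds_def using ldo_mult by (simp add: pscale_apply)

lemma ldo_sum: "(\<And>i. i \<in> I \<Longrightarrow> ldo j (L i)) \<Longrightarrow> ldo j (\<lambda>F x. \<Sum>i\<in>I. L i F x)"
  by (induction I rule: infinite_finite_induct) (simp_all add: ldo.zero ldo.add)

lemma lds_coeffop:
  assumes "coeffop L" "lds j u"
  shows "lds j (\<lambda>F x. L (u F x))"
  unfolding lds_def
proof (intro allI)
  fix i l T
  obtain I c where I: "\<forall>v. L v i l T = (\<Sum>(i', l', T')\<in>I. c (i', l', T') * v i' l' T')"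
    using assms(1) unfolding coeffop_def by meson
  show "ldo j (\<lambda>F x. L (u F x) i l T)"
    unfolding I[rule_format] split_def
    using assms(2) unfolding lds_def by (intro ldo_sum ldo_mult smooth_on_const) blast
qed

lemma lds_diff: "lds j u \<Longrightarrow> lds j v \<Longrightarrow> lds j (\<lambda>F x. u F x - v F x)"
  using lds_add[of j u "\<lambda>F x. - v F x"] lds_coeffop[OF coeffop_uminus[OF coeffop_id], of j v] by simp

lemma lds_pdp: "lds j u \<Longrightarrow> lds j (\<lambda>F. pdp b m (u F))"
  unfolding lds_def pdp_def by (intro allI ldo_pd) blast

lemma lds_dd: "lds j u \<Longrightarrow> lds j (\<lambda>F. d A (u F))"
  unfolding dd_def[abs_def] by (intro lds_sum lds_coeffop[OF coeffop_Kop] lds_pdp)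

lemma lds_Om: "lds j u \<Longrightarrow> lds j (\<lambda>F x. Om A x (u F x))"
  unfolding Om_def by (intro lds_sum lds_pscale lds_coeffop[OF coeffop_Kop] smooth_on_subset[OF U0_subset_U smooth_r])

lemma lds_J: "lds j u \<Longrightarrow> lds j (\<lambda>F x. J A x (u F x))"
  unfolding J_def by (intro lds_sum lds_pscale lds_coeffop[OF coeffop_contr] smooth_on_subset[OF U0_subset_U smooth_Rcoef])

lemma lds_p:
  assumes "lds j u"
  shows "lds j (\<lambda>F x. p x (u F x))"
proof (rule lds_cong)
  show "lds j (\<lambda>F x. J 1 x (J 0 x (Om 0 x (Om 1 x (u F x)))))" by (intro lds_J lds_Om assms)
qed (rule p_eq, use U0_subset_U in blast)

lemma lds_sym: "lds j u \<Longrightarrow> lds j (\<lambda>F x. sym i x (u F x))"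
  unfolding sym_def by (intro lds_sum lds_coeffop[OF coeffop_Sop] lds_Om)

lemma lds_Gk: "lds j u \<Longrightarrow> lds j (\<lambda>F. Gk (u F))"
  unfolding Gk_def[abs_def] by (intro lds_diff lds_add lds_Om lds_dd lds_pdp)

lemma lds_DD: "lds j u \<Longrightarrow> lds j (\<lambda>F. \<D> i (u F))"
  unfolding DD_def[abs_def] by (cases "i = k") (simp_all add: lds_dd lds_sum lds_coeffop[OF coeffop_Sop])

lemma ldo_coef:
  assumes "q \<in> Inl ` index1 j \<union> Inr ` index2 j"
  shows "ldo j (\<lambda>F x. coef q F (proj x))"
proof -
  have i: "(\<lambda>f x. 1 * f x) \<in> scalar_diffops \<rho> S"
    by (rule scalar_diffops.mult) (rule smooth_alongI[OF open_U S_subset_U smooth_on_const], rule refl)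
  have "ldo j (\<lambda>F x. 1 * (\<lambda>f x. 1 * f x) (coef q F) (proj x))" by (rule ldo.base[OF smooth_on_const i assms])
  then show ?thesis by simp
qed

text \<open>Coefficients outside the finite index set vanish for boundary sections and are
  represented by the zero operator.\<close>

lemma lds_fst: "lds j (\<lambda>F x. fst F (proj x))"
  unfolding lds_def
proof (intro allI)
  fix i l T
  show "ldo j (\<lambda>F x. fst F (proj x) i l T)"
  proof (cases "(i, l, T) \<in> index1 j")
    case True
    then show ?thesis using ldo_coef[of "Inl (i, l, T)" j] by simp
  next
    case False
    show ?thesis
    proof (rule ldo.agree[OF ldo.zero])
      fix F x assume F: "F \<in> bspace_sections n k S j" and "x \<in> U0"
      then show "fst F (proj x) i l T = 0"
        using bspaceD(3)[OF F proj_in_S] False by (auto simp: pforms_def index1_def)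
    qed
  qed
qed

lemma lds_snd: "lds j (\<lambda>F x. snd F (proj x))"
  unfolding lds_def
proof (intro allI)
  fix i l T
  show "ldo j (\<lambda>F x. snd F (proj x) i l T)"
  proof (cases "(i, l, T) \<in> index2 j")
    case True
    then show ?thesis using ldo_coef[of "Inr (i, l, T)" j] by simp
  next
    case False
    show ?thesis
    proof (rule ldo.agree[OF ldo.zero])
      fix F x assume F: "F \<in> bspace_sections n k S j" and "x \<in> U0"
      then show "snd F (proj x) i l T = 0"
        using bspaceD(4)[OF F proj_in_S] bspaceD(5)[OF F proj_in_S] False
        by (cases "j = k") (auto simp: pforms_def index2_def)
    qed
  qed
qed

lemma lds_zext: "lds j (zext j)"
proof -
  have r0: "smooth_on U0 (cfun \<rho>)" by (rule smooth_on_subset[OF U0_subset_U smooth_cfun_\<rho>])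
  show ?thesis
    unfolding zext_def[abs_def]
    by (cases "j = k") (simp_all add: lds_add lds_pscale[OF r0] lds_Om lds_coeffop[OF coeffop_Rop] lds_fst lds_snd)
qed

lemma snd_bD:
  assumes F: "F \<in> bspace_sections n k S j" and x: "x \<in> S"
  shows "snd (bD j F) x = (let z = \<D> j (zext j F) in
    if Suc j = k then J 1 x (J 0 x (Gk (\<lambda>y. z y - p y (z y)) x)) + pdp b e (\<lambda>y. p y (z y)) x
    else - J 1 x (J 0 x (sym (Suc j) x (z x))))"
proof -
  have x1: "x \<in> U1" using x S_U1 by blast
  let ?v = "CFop b n k U j (Ext j F)" and ?z = "\<D> j (zext j F)"
  have v: "?v y = ?z y" if "y \<in> U1" for y by (rule CFop_Ext[OF F that])
  have "Gk (\<lambda>y. ?v y - p y (?v y)) x = Gk (\<lambda>y. ?z y - p y (?z y)) x"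
    by (rule Gk_cong[OF open_U1 x1]) (simp only: v)
  moreover have "pdp b e (\<lambda>y. p y (?v y)) x = pdp b e (\<lambda>y. p y (?z y)) x"
    by (rule pdp_cong[OF open_U1 x1]) (simp only: v)
  ultimately show ?thesis using x v[OF x1] by (simp add: bD_def tr_def tr2_def Let_def)
qed

text \<open>Extension, D_j and both traces are built from partial derivatives, multiplications by
  smooth functions and coefficient operators, all of which preserve \<open>lds\<close>.\<close>

lemma boundary_diffop_bD:
  assumes j: "Suc j \<le> 2*n"
  shows "boundary_diffop n k \<rho> S j (bD j)"
proof -
  have z: "lds j (\<lambda>F. \<D> j (zext j F))" by (rule lds_DD[OF lds_zext])
  have 1: "lds j (\<lambda>F x. p x (\<D> j (zext j F) x))" by (rule lds_p[OF z])
  have 2: "lds j (\<lambda>F x. let z = \<D> j (zext j F) in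
    if Suc j = k then J 1 x (J 0 x (Gk (\<lambda>y. z y - p y (z y)) x)) + pdp b e (\<lambda>y. p y (z y)) x
    else - J 1 x (J 0 x (sym (Suc j) x (z x))))"
  proof (cases "Suc j = k")
    case True
    have "lds j (\<lambda>F x. J 1 x (J 0 x (Gk (\<lambda>y. \<D> j (zext j F) y - p y (\<D> j (zext j F) y)) x)) + pdp b e (\<lambda>y. p y (\<D> j (zext j F) y)) x)"
      by (intro lds_add lds_J lds_Gk lds_diff lds_pdp lds_p z)
    then show ?thesis using True by (simp add: Let_def)
  next
    case False
    have "lds j (\<lambda>F x. - J 1 x (J 0 x (sym (Suc j) x (\<D> j (zext j F) x))))"
      by (intro lds_coeffop[OF coeffop_uminus[OF coeffop_id]] lds_J lds_sym z)
    then show ?thesis using False by (simp add: Let_def)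
  qed
  have "bD j ` bspace_sections n k S j \<subseteq> bspace_sections n k S (Suc j)"
  proof
    fix G assume "G \<in> bD j ` bspace_sections n k S j"
    then obtain F where F: "F \<in> bspace_sections n k S j" "G = bD j F" by blast
    have "CFop b n k U j (Ext j F) \<in> \<Gamma> (Suc j)" by (rule CFop_sections[OF _ open_U Ext_in[OF F(1)]]) (use j in simp)
    then show "G \<in> bspace_sections n k S (Suc j)" unfolding F(2) bD_def by (rule tr_in_bspace[OF j])
  qed
  moreover have "diffop_component \<rho> S (index1 j) (index2 j) (bspace_sections n k S j) (\<lambda>F x. fst (bD j F) x i l T)" for i l T
    by (rule diffop_component_ldo[OF 1[unfolded lds_def, rule_format, of i l T]]) (simp only: fst_bD)
  moreover have "diffop_component \<rho> S (index1 j) (index2 j) (bspace_sections n k S j) (\<lambda>F x. snd (bD j F) x i l T)" for i l T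
    by (rule diffop_component_ldo[OF 2[unfolded lds_def, rule_format, of i l T]]) (simp only: snd_bD)
  ultimately show ?thesis unfolding boundary_diffop_def Let_def index1_def[symmetric] index2_def[symmetric] by blast
qed

end

theorem theorem1p1:
  fixes n k :: nat
    and b :: "nat \<Rightarrow> 'a::euclidean_space"
    and U D S :: "'a set"
    and \<rho> \<phi> :: "'a \<Rightarrow> real"
    and h :: "nat \<Rightarrow> pform \<Rightarrow> pform \<Rightarrow> complex"
  assumes "n \<ge> 1"
    and "bij_betw b {1..4*n+4} Basis"
    and "open U" and "0 \<in> U"
    and "\<And>x. x \<in> U \<Longrightarrow> \<rho> x = x \<bullet> b (4*n+1) - \<phi> (drop_re b n x)"
    and "smooth_on U (\<lambda>x. \<phi> (drop_re b n x))"
    and "(\<lambda>x. \<phi> (drop_re b n x)) \<in> O[at 0](\<lambda>x. norm (drop_re b n x) ^ 2)"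
    and "\<And>j. j \<le> 2*n+1 \<Longrightarrow> hermitian_inner (CFspace n k j) (h j)"
    and "D = {x. \<rho> x > 0}" and "S = frontier D \<inter> U"
  shows "\<exists>\<Psi> \<D>.
    (\<forall>j\<le>2*n-1. quotient_linear_iso (sections U (CFspace n k j)) (zero_Cauchy b n k h U D j)
                   (bspace_sections n k S j) (\<Psi> j)) \<and>
    (\<forall>j\<le>2*n-2. boundary_diffop n k \<rho> S j (\<D> j)) \<and>
    (\<forall>j\<le>2*n-2. \<forall>u\<in>sections U (CFspace n k j).
        CFop b n k U j u \<in> sections U (CFspace n k (Suc j)) \<and>
        \<Psi> (Suc j) (modrel (sections U (CFspace n k (Suc j))) (zero_Cauchy b n k h U D (Suc j))
                     `` {CFop b n k U j u}) =
        \<D> j (\<Psi> j (modrel (sections U (CFspace n k j)) (zero_Cauchy b n k h U D j) `` {u}))) \<and>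
    (\<forall>j. Suc j \<le> 2*n-2 \<longrightarrow> (\<forall>F\<in>bspace_sections n k S j. \<D> (Suc j) (\<D> j F) = 0)) \<and>
    (\<forall>j\<le>2*n-2. \<forall>F\<^sub>1 F\<^sub>2. (F\<^sub>1, F\<^sub>2) \<in> bspace_sections n k S j \<longrightarrow> (\<forall>x\<in>S.
        fst (\<D> j (F\<^sub>1, F\<^sub>2)) x =
          (if j < k then
             (\<Sum>A'\<in>UNIV. ds A' (plift (bdform b n \<rho> S A') F\<^sub>1 x)) + pwedge (Ezero b n \<rho> x) (F\<^sub>2 x)
           else if j = k then
             plift (bdform b n \<rho> S 0) (plift (bdform b n \<rho> S 1) F\<^sub>1) x
               - pwedge (Ezero b n \<rho> x) (boundary_T10 b n \<rho> S F\<^sub>1 x + F\<^sub>2 x)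
           else
             (\<Sum>A'\<in>UNIV. slow A' (plift (bdform b n \<rho> S A') F\<^sub>1 x)) + pwedge (Ezero b n \<rho> x) (F\<^sub>2 x))))"
proof -
  let ?e = "b (4*n+1)"
  have "?e \<in> Basis" using bij_betw_apply[OF assms(2), of "4*n+1"] by simp
  then have e: "?e \<bullet> ?e = 1" by (simp add: inner_same_Basis)
  have inv: "drop_re b n (x + t *\<^sub>R ?e) = drop_re b n x" for x t
    by (simp add: drop_re_def inner_add_left e scaleR_add_left)
  \<comment> \<open>The function \<open>\<psi>\<close> of the locale is \<phi> after discarding the
    coordinate x_{4n+1}, hence it is invariant along e.\<close>
  have "graph_domain ?e U D \<rho> (\<lambda>x. \<phi> (drop_re b n x))"
    by (unfold_locales; (rule assms(3) e assms(6) assms(9) | simp only: inv assms(5)))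
  then interpret cf_domain n b U D \<rho> "\<lambda>x. \<phi> (drop_re b n x)" by (rule cf_domain.intro[OF assms(2)])
  interpret cf_complex n b U D \<rho> "\<lambda>x. \<phi> (drop_re b n x)" k h by unfold_locales (rule assms(8))
  have S: "S = graph_domain.S U \<rho>" unfolding assms(10) by (rule S_eq_frontier[symmetric])
  \<comment> \<open>Subtraction of naturals is truncated; with n \<ge> 1 the bound on j leaves room
    for the successor degree.\<close>
  have j2: "Suc j \<le> 2*n" if "j \<le> 2*n-2" for j using that assms(1) by linarith
  show ?thesis
    unfolding S
  proof (intro exI[of _ \<Psi>] exI[of _ bD] conjI allI impI ballI)
    show "quotient_linear_iso (sections U (CFspace n k j)) (zero_Cauchy b n k h U D j)
        (bspace_sections n k (graph_domain.S U \<rho>) j) (\<Psi> j)" if "j \<le> 2*n-1" for j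
      by (rule quotient_iso) (use that in linarith)
    show "boundary_diffop n k \<rho> (graph_domain.S U \<rho>) j (bD j)" if "j \<le> 2*n-2" for j
      by (rule boundary_diffop_bD[OF j2[OF that]])
    show C: "CFop b n k U j u \<in> sections U (CFspace n k (Suc j))"
      if "j \<le> 2*n-2" "u \<in> sections U (CFspace n k j)" for j u
      by (rule CFop_sections[OF _ assms(3) that(2)]) (use j2[OF that(1)] in simp)
    show "\<Psi> (Suc j) (modrel (sections U (CFspace n k (Suc j))) (zero_Cauchy b n k h U D (Suc j)) `` {CFop b n k U j u}) =
        bD j (\<Psi> j (modrel (sections U (CFspace n k j)) (zero_Cauchy b n k h U D j) `` {u}))"
      if j: "j \<le> 2*n-2" and u: "u \<in> sections U (CFspace n k j)" for j u
      unfolding \<Psi>_class[OF j2[OF j] C[OF j u]] \<Psi>_class[OF Suc_leD[OF j2[OF j]] u]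
      by (rule bD_tr[OF j2[OF j] u, symmetric])
    show "bD (Suc j) (bD j F) = 0" if "Suc j \<le> 2*n-2" "F \<in> bspace_sections n k (graph_domain.S U \<rho>) j" for j F
      by (rule bD_bD[OF j2[OF that(1)] that(2)])
    show "fst (bD j (F1, F2)) x =
        (if j < k then
           (\<Sum>A'\<in>UNIV. ds A' (plift (bdform b n \<rho> (graph_domain.S U \<rho>) A') F1 x)) + pwedge (Ezero b n \<rho> x) (F2 x)
         else if j = k then
           plift (bdform b n \<rho> (graph_domain.S U \<rho>) 0) (plift (bdform b n \<rho> (graph_domain.S U \<rho>) 1) F1) x
             - pwedge (Ezero b n \<rho> x) (boundary_T10 b n \<rho> (graph_domain.S U \<rho>) F1 x + F2 x)
         else
           (\<Sum>A'\<in>UNIV. slow A' (plift (bdform b n \<rho> (graph_domain.S U \<rho>) A') F1 x)) + pwedge (Ezero b n \<rho> x) (F2 x))"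
      if "(F1, F2) \<in> bspace_sections n k (graph_domain.S U \<rho>) j" "x \<in> graph_domain.S U \<rho>" for j F1 F2 x
      unfolding bD_formula[OF that] by (simp add: Sop_def)
  qed
qed

end
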